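(* Let $1<p<\infty$. Suppose $\{u_n\}_{n\in\mathbb{N}}\subset W^{1,p}(\Omega_{\gamma})\cap L^p_{w}(\partial\Omega_{\gamma})$ is a sequence such that $\|u_n\|_{L^p_{w}(\partial\Omega_{\gamma})}=1$ for all $n$, and \[ \lim_{n\to\infty}\|u_n\|_{W^{1,p}(\Omega_{\gamma})}^p=\lambda_p, \] where \[ \lambda_p:=\inf\Big\{\int_{\Omega_{\gamma}}\big(|\nabla u|^p+|u|^p\big)\,dx \;:\; u\in W^{1,p}(\Omega_{\gamma})\cap L^p_{w}(\partial\Omega_{\gamma}),\ \|u\|_{L^p_{w}(\partial\Omega_{\gamma})}=1\Big\}. \] (a) Then there exists a subsequence $\{u_{n_j}\}_{j\in\mathbb{N}}$ that converges strongly in $W^{1,p}(\Omega_{\gamma})$ to a function $u\in W^{1,p}(\Omega_{\gamma})\cap L^p_{w}(\partial\Omega_{\gamma})$ with $\|u\|_{L^p_{w}(\partial\Omega_{\gamma})}=1$, and \[ \lambda_p=\int_{\Omega_{\gamma}}|\nabla u|^p\,dx+\int_{\Omega_{\gamma}}|u|^p\,dx. \] (b) Moreover, $(\lambda_p,u)$ is an eigenpair of the weighted Schrödinger–Steklov $p$-eigenvalue problem \[ -\mathrm{div}(|\nabla u|^{p-2}\nabla u)+|u|^{p-2}u=0 \text{ in } \Omega_{\gamma},\qquad |\nabla u|^{p-2}\nabla u\cdot\nu=\lambda\, w\,|u|^{p-2}u \text{ on } \partial\Omega_{\gamma}, \] i.e. $\int_{\Omega_{\gamma}}|\nabla u|^{p-2}\nabla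 u\cdot\nabla v\,dx+\int_{\Omega_{\gamma}}|u|^{p-2}uv\,dx=\lambda_p\int_{\partial\Omega_{\gamma}}|u|^{p-2}uv\,w\,ds$ for every $v\in W^{1,p}(\Omega_{\gamma})$; and every eigenfunction of this problem associated with $\lambda_p$ is a scalar multiple of a function $u\in W^{1,p}(\Omega_{\gamma})$ with $\|u\|_{L^p_{w}(\partial\Omega_{\gamma})}=1$ at which the infimum $\lambda_p$ is attained (such as the limit functions obtained in (a)).
   Context: Let $\gamma:[0,1]\to[0,\infty)$ be continuous, increasing and differentiable with $\gamma(0)=0$, $\gamma(1)=1$, $\gamma'$ increasing on $(0,1)$ and $\lim_{t\to0^+}\gamma'(t)=0$. With $x'=(x_1,\dots,x_{n-1})$, the outward cuspidal domain is $\Omega_{\gamma}=\{(x',x_n)\in\mathbb{R}^{n-1}\times\mathbb{R}: |x'|<\gamma(x_n),\,0<x_n\le1\}\cup B^n((0,2),\sqrt2)\subset\mathbb{R}^n$, $n\ge2$. The weight $w:\partial\Omega_{\gamma}\to\mathbb{R}$ is $w(x)=\gamma(x_n)$ if $|x'|=\gamma(x_n)<1$, and $w(x)=1$ if $|x'|=\gamma(x_n)\ge1$. $W^{1,p}(\Omega_{\gamma})$ has norm $\|u\|_{W^{1,p}}=(\int_{\Omega_{\gamma}}|\nabla u|^p\,dx+\int_{\Omega_{\gamma}}|u|^p\,dx)^{1/p}$, and $L^p_w(\partial\Omega_{\gamma})$ has norm $\|u\|_{L^p_w(\partial\Omega_{\gamma})}=(\int_{\partial\Omega_{\gamma}}|u|^p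 w\,ds)^{1/p}$, where $ds$ is the $(n-1)$-dimensional surface measure and $\nu$ the unit outward normal. The trace embedding $W^{1,p}(\Omega_{\gamma})\hookrightarrow L^p_w(\partial\Omega_{\gamma})$ is compact. *)

theory Defs
  imports "HOL-Analysis.Analysis"
begin

text \<open>Points of R^n are vectors of type real^'n; a distinguished index k plays the
role of the last coordinate x_n, the remaining coordinates form x'.\<close>

definition xprime_norm :: "'n::finite \<Rightarrow> real^'n \<Rightarrow> real" where
  "xprime_norm k x = sqrt (\<Sum>i\<in>UNIV - {k}. (x $ i)^2)"

definition cusp_center :: "'n::finite \<Rightarrow> real^'n" where
  "cusp_center k = (\<chi> i. if i = k then 2 else 0)"

definition cusp_domain :: "'n::finite \<Rightarrow> (real \<Rightarrow> real) \<Rightarrow> (real^'n) set" where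
  "cusp_domain k \<gamma> =
     {x. xprime_norm k x < \<gamma> (x $ k) \<and> 0 < x $ k \<and> x $ k \<le> 1}
     \<union> ball (cusp_center k) (sqrt 2)"

definition cusp_weight :: "'n::finite \<Rightarrow> (real \<Rightarrow> real) \<Rightarrow> real^'n \<Rightarrow> real" where
  "cusp_weight k \<gamma> x =
     (if 0 \<le> x $ k \<and> x $ k \<le> 1 \<and> xprime_norm k x = \<gamma> (x $ k) \<and> \<gamma> (x $ k) < 1
      then \<gamma> (x $ k) else 1)"

definition hausdorff_pre :: "real \<Rightarrow> real \<Rightarrow> 'a::metric_space set \<Rightarrow> ennreal" where
  "hausdorff_pre s \<delta> A =
     Inf {(\<Sum>i. ennreal (unit_ball_vol s * (diameter (C i) / 2) powr s)) | C.
            A \<subseteq> (\<Union>i. C i) \<and> (\<forall>i. bounded (C i) \<and> diameter (C i) \<le> \<delta>)}"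

definition hausdorff :: "real \<Rightarrow> 'a::metric_space set \<Rightarrow> ennreal" where
  "hausdorff s A = (SUP \<delta>\<in>{0<..}. hausdorff_pre s \<delta> A)"

definition boundary_measure :: "'n::finite \<Rightarrow> (real \<Rightarrow> real) \<Rightarrow> (real^'n) measure" where
  "boundary_measure k \<gamma> =
     measure_of (frontier (cusp_domain k \<gamma>))
       {B \<inter> frontier (cusp_domain k \<gamma>) | B. B \<in> sets borel}
       (hausdorff (real CARD('n) - 1))"

coinductive smooth_fun :: "(real^'n::finite \<Rightarrow> real) \<Rightarrow> bool" where
  "\<phi> differentiable_on UNIV \<Longrightarrow> continuous_on UNIV \<phi> \<Longrightarrow>
   (\<forall>i. smooth_fun (\<lambda>x. frechet_derivative \<phi> (at x) (axis i 1))) \<Longrightarrow> smooth_fun \<phi>"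

definition test_fun :: "(real^'n::finite) set \<Rightarrow> (real^'n \<Rightarrow> real) \<Rightarrow> bool" where
  "test_fun \<Omega> \<phi> \<longleftrightarrow> smooth_fun \<phi> \<and> compact (closure {x. \<phi> x \<noteq> 0})
      \<and> closure {x. \<phi> x \<noteq> 0} \<subseteq> \<Omega>"

definition loc_integrable :: "(real^'n::finite) set \<Rightarrow> (real^'n \<Rightarrow> real) \<Rightarrow> bool" where
  "loc_integrable \<Omega> f \<longleftrightarrow> f \<in> borel_measurable (lebesgue_on \<Omega>) \<and>
      (\<forall>K. compact K \<and> K \<subseteq> \<Omega> \<longrightarrow> integrable (lebesgue_on K) f)"

definition weak_grad :: "(real^'n::finite) set \<Rightarrow> (real^'n \<Rightarrow> real) \<Rightarrow> (real^'n \<Rightarrow> real^'n) \<Rightarrow> bool" where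
  "weak_grad \<Omega> u g \<longleftrightarrow> loc_integrable \<Omega> u \<and> (\<forall>i. loc_integrable \<Omega> (\<lambda>x. g x $ i)) \<and>
     (\<forall>\<phi> i. test_fun \<Omega> \<phi> \<longrightarrow>
        integral\<^sup>L (lebesgue_on \<Omega>) (\<lambda>x. u x * frechet_derivative \<phi> (at x) (axis i 1))
        = - integral\<^sup>L (lebesgue_on \<Omega>) (\<lambda>x. g x $ i * \<phi> x))"

definition wgrad :: "(real^'n::finite) set \<Rightarrow> (real^'n \<Rightarrow> real) \<Rightarrow> real^'n \<Rightarrow> real^'n" where
  "wgrad \<Omega> u = (SOME g. weak_grad \<Omega> u g)"

definition Lp_fun :: "real \<Rightarrow> 'a measure \<Rightarrow> ('a \<Rightarrow> real) \<Rightarrow> bool" where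
  "Lp_fun p M f \<longleftrightarrow> f \<in> borel_measurable M \<and> integrable M (\<lambda>x. \<bar>f x\<bar> powr p)"

definition W1p :: "real \<Rightarrow> (real^'n::finite) set \<Rightarrow> (real^'n \<Rightarrow> real) \<Rightarrow> bool" where
  "W1p p \<Omega> u \<longleftrightarrow> Lp_fun p (lebesgue_on \<Omega>) u \<and>
     (\<exists>g. weak_grad \<Omega> u g \<and> Lp_fun p (lebesgue_on \<Omega>) (\<lambda>x. norm (g x)))"

definition energy :: "real \<Rightarrow> (real^'n::finite) set \<Rightarrow> (real^'n \<Rightarrow> real) \<Rightarrow> real" where
  "energy p \<Omega> u = integral\<^sup>L (lebesgue_on \<Omega>) (\<lambda>x. norm (wgrad \<Omega> u x) powr p)
                 + integral\<^sup>L (lebesgue_on \<Omega>) (\<lambda>x. \<bar>u x\<bar> powr p)"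

definition W1p_norm :: "real \<Rightarrow> (real^'n::finite) set \<Rightarrow> (real^'n \<Rightarrow> real) \<Rightarrow> real" where
  "W1p_norm p \<Omega> u = energy p \<Omega> u powr (1 / p)"

definition bdry_int :: "'n::finite \<Rightarrow> (real \<Rightarrow> real) \<Rightarrow> real \<Rightarrow> (real^'n \<Rightarrow> real) \<Rightarrow> ennreal" where
  "bdry_int k \<gamma> p T = (\<integral>\<^sup>+ x. ennreal (\<bar>T x\<bar> powr p * cusp_weight k \<gamma> x) \<partial>boundary_measure k \<gamma>)"

definition is_trace :: "'n::finite \<Rightarrow> (real \<Rightarrow> real) \<Rightarrow> real \<Rightarrow> (real^'n \<Rightarrow> real) \<Rightarrow> (real^'n \<Rightarrow> real) \<Rightarrow> bool" where
  "is_trace k \<gamma> p u T \<longleftrightarrow>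
     T \<in> borel_measurable (boundary_measure k \<gamma>) \<and> bdry_int k \<gamma> p T < \<infinity> \<and>
     (\<exists>v :: nat \<Rightarrow> real^'n \<Rightarrow> real.
        (\<forall>j. W1p p (cusp_domain k \<gamma>) (v j) \<and> continuous_on (closure (cusp_domain k \<gamma>)) (v j)) \<and>
        (\<lambda>j. energy p (cusp_domain k \<gamma>) (\<lambda>x. v j x - u x)) \<longlonglongrightarrow> 0 \<and>
        (\<lambda>j. bdry_int k \<gamma> p (\<lambda>x. v j x - T x)) \<longlonglongrightarrow> 0)"

definition trace :: "'n::finite \<Rightarrow> (real \<Rightarrow> real) \<Rightarrow> real \<Rightarrow> (real^'n \<Rightarrow> real) \<Rightarrow> real^'n \<Rightarrow> real" where
  "trace k \<gamma> p u = (SOME T. is_trace k \<gamma> p u T)"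

definition W1p_Lpw :: "'n::finite \<Rightarrow> (real \<Rightarrow> real) \<Rightarrow> real \<Rightarrow> (real^'n \<Rightarrow> real) \<Rightarrow> bool" where
  "W1p_Lpw k \<gamma> p u \<longleftrightarrow> W1p p (cusp_domain k \<gamma>) u \<and> (\<exists>T. is_trace k \<gamma> p u T)"

definition Lpw_norm :: "'n::finite \<Rightarrow> (real \<Rightarrow> real) \<Rightarrow> real \<Rightarrow> (real^'n \<Rightarrow> real) \<Rightarrow> real" where
  "Lpw_norm k \<gamma> p u = enn2real (bdry_int k \<gamma> p (trace k \<gamma> p u)) powr (1 / p)"

definition lambda_p :: "'n::finite \<Rightarrow> (real \<Rightarrow> real) \<Rightarrow> real \<Rightarrow> real" where
  "lambda_p k \<gamma> p = Inf {energy p (cusp_domain k \<gamma>) u | u.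
                            W1p_Lpw k \<gamma> p u \<and> Lpw_norm k \<gamma> p u = 1}"

definition is_eigenpair :: "'n::finite \<Rightarrow> (real \<Rightarrow> real) \<Rightarrow> real \<Rightarrow> real \<Rightarrow> (real^'n \<Rightarrow> real) \<Rightarrow> bool" where
  "is_eigenpair k \<gamma> p lam u \<longleftrightarrow>
     W1p_Lpw k \<gamma> p u \<and> \<not> (AE x in lebesgue_on (cusp_domain k \<gamma>). u x = 0) \<and>
     (\<forall>v. W1p p (cusp_domain k \<gamma>) v \<longrightarrow>
        integral\<^sup>L (lebesgue_on (cusp_domain k \<gamma>))
          (\<lambda>x. norm (wgrad (cusp_domain k \<gamma>) u x) powr (p - 2) *
               (wgrad (cusp_domain k \<gamma>) u x \<bullet> wgrad (cusp_domain k \<gamma>) v x))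
        + integral\<^sup>L (lebesgue_on (cusp_domain k \<gamma>)) (\<lambda>x. \<bar>u x\<bar> powr (p - 2) * u x * v x)
        = lam * integral\<^sup>L (boundary_measure k \<gamma>)
              (\<lambda>x. \<bar>trace k \<gamma> p u x\<bar> powr (p - 2) * trace k \<gamma> p u x * trace k \<gamma> p v x
                   * cusp_weight k \<gamma> x))"

end

theory Submission
  imports Defs "HOL-Complex_Analysis.Great_Picard" "HOL-Library.Diagonal_Subsequence"
begin

text \<open>
  The cusp is strictly star-shaped about the centre of its ball, so dilating and mollifying gives approximation of
  Sobolev functions by C1 functions and a Rellich theorem. The surface integral of |v|^p against the weight is
  bounded by the volume integral of |v|^p over thin layers obtained by translating the domain in a coordinate
  direction, the weight being dominated by the corresponding coordinate of x - c; the divergence theorem along lines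
  and Young's inequality turn this into a trace inequality with an arbitrarily small constant in front of the
  gradient, whence traces are compact. Along a minimizing sequence the traces of a subsequence converge, midpoints are
  almost admissible, and uniform convexity makes the subsequence a Cauchy sequence in the Sobolev norm. The Euler-Lagrange
  equation is the first variation of the nonnegative functional E(u) - lambda N(u), where E is the energy and N the
  p-th power of the weighted boundary norm, and testing it with an eigenfunction itself shows that its normalization
  is a minimizer.
\<close>

text \<open>Boundary integrals are only ever bounded from above, since the surface measure is
  accessible through \<open>hausdorff\<close> alone, and near the tip the surface has no uniform
  Lipschitz charts. What makes the volume bound possible is that on the lateral surface the weight
  is |x'| itself. Some signed horizontal axis e has (x - c) . e at least |x'| divided by the square
  root of the dimension, and (x - c) . e is the factor that vanishes on the hyperplane where the
  lines of direction e are cut off. The weight thus degenerates at the tip just fast enough, for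
  every p and every sharpness of the cusp. The small constant in front of the gradient matters
  because the gradients of a minimizing sequence are at first only bounded, while the functions
  themselves already converge in L^p along a subsequence. As \<open>wgrad\<close> and
  \<open>trace\<close> are picked by SOME, a gradient and a boundary function are carried explicitly
  (\<open>W1p_pair\<close>, \<open>tr\<close>), with a.e. uniqueness proved before returning to the
  chosen ones. L^p quantities are kept as p-th powers of norms, so a weighted convexity inequality
  replaces Minkowski's.\<close>

section \<open>Pointwise inequalities for p-th powers of norms\<close>

lemma powr_add_le_weighted:
 fixes a b p :: real
 assumes "a \<ge> 0" "b \<ge> 0" "0 < t" "t < 1" "1 \<le> p"
 shows "(a + b) powr p \<le> (1 - t) powr (1 - p) * a powr p + t powr (1 - p) * b powr p"
proof -
 have ge1: "1 \<le> x powr (1 - p)" if "0 < x" "x < 1" for x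
  using powr_mono2'[of "1 - p" x 1] that assms by simp
 show ?thesis
 proof (cases "a = 0 \<or> b = 0")
  case True
  then show ?thesis
  proof
   assume "a = 0"
   then show ?thesis using mult_right_mono[OF ge1[of t], of "b powr p"] assms by simp
  next
   assume "b = 0"
   then show ?thesis using mult_right_mono[OF ge1[of "1 - t"], of "a powr p"] assms by simp
  qed
 next
  case False
  then have ab: "a > 0" "b > 0" using assms by auto
  have *: "x * (c / x) powr p = x powr (1 - p) * c powr p" if "x > 0" "c > 0" for x c :: real
  proof -
   have "x powr (1 - p) = x * x powr (-p)"
    using that powr_add[of x 1 "-p"] by simp
   then show ?thesis using that by (simp add: powr_divide powr_minus field_simps)
  qed
  \<comment> \<open>The sum a + b is the convex combination of a / (1 - t) and b / t with weights 1
    - t and t, so convexity of \<open>powr\<close> gives the two factors.\<close>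
  have "((1 - t) *\<^sub>R (a / (1 - t)) + t *\<^sub>R (b / t)) powr p
    \<le> (1 - t) * (a / (1 - t)) powr p + t * (b / t) powr p"
   by (rule convex_onD[OF powr_convex[OF assms(5)]]) (use ab assms in auto)
  also have "(1 - t) *\<^sub>R (a / (1 - t)) + t *\<^sub>R (b / t) = a + b"
   using assms by simp
  finally show ?thesis using * ab assms by simp
 qed
qed

text \<open>Stands in for Minkowski's inequality: as t tends to 0 the factor of
  \<open>norm a powr p\<close> tends to 1, and the large factor of \<open>norm b powr p\<close> is
  harmless when b is small.\<close>

lemma norm_add_powr_le_weighted:
 fixes a b :: "'b::real_normed_vector"
 assumes "0 < t" "t < 1" "1 \<le> p"
 shows "norm (a + b) powr p \<le> (1 - t) powr (1 - p) * norm a powr p + t powr (1 - p) * norm b powr p"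
proof -
 have "norm (a + b) powr p \<le> (norm a + norm b) powr p"
  by (rule powr_mono2) (use assms norm_triangle_ineq in auto)
 also have "\<dots> \<le> (1 - t) powr (1 - p) * norm a powr p + t powr (1 - p) * norm b powr p"
  by (rule powr_add_le_weighted) (use assms in auto)
 finally show ?thesis .
qed

lemma norm_add_powr_le:
 fixes a b :: "'b::real_normed_vector"
 assumes "1 \<le> p"
 shows "norm (a + b) powr p \<le> 2 powr (p - 1) * (norm a powr p + norm b powr p)"
proof -
 have "(1 / 2 :: real) powr (1 - p) = 2 powr (p - 1)"
  using powr_minus_divide[of 2 "1-p"] by (simp add: powr_divide)
 then show ?thesis
  using norm_add_powr_le_weighted[of "1/2" p a b] assms by (simp add: algebra_simps)
qed

lemma norm_midpoint_powr_le:
 fixes a b :: "'b::real_normed_vector"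
 assumes "1 \<le> p"
 shows "norm ((1/2) *\<^sub>R (a + b)) powr p \<le> (norm a powr p + norm b powr p) / 2"
proof -
 have "norm ((1/2) *\<^sub>R (a + b)) powr p = (1/2) powr p * norm (a + b) powr p"
  by (simp add: powr_divide)
 also have "\<dots> \<le> (1/2) powr p * (2 powr (p - 1) * (norm a powr p + norm b powr p))"
  by (intro mult_left_mono norm_add_powr_le assms) auto
 also have "\<dots> = (norm a powr p + norm b powr p) / 2"
  by (simp add: powr_divide powr_diff)
 finally show ?thesis .
qed

lemma powr_MVT:
 fixes s t p :: real
 assumes "0 \<le> s" "s < t" "1 < p"
 obtains \<xi> where "s < \<xi>" "\<xi> < t" "t powr p - s powr p = (t - s) * (p * \<xi> powr (p - 1))"
proof -
 have "\<exists>l z. s < z \<and> z < t \<and> ((\<lambda>t. t powr p) has_real_derivative l) (at z) \<and> t powr p - s powr p = (t - s) * l"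
 proof (rule MVT[OF assms(2)])
  show "continuous_on {s..t} (\<lambda>t. t powr p)"
   using assms by (intro continuous_on_powr' continuous_intros) auto
  show "(\<lambda>t. t powr p) differentiable (at x)" if "s < x" "x < t" for x
   using has_real_derivative_powr[of x p] that assms real_differentiable_def by fastforce
 qed
 then obtain l z where z: "s < z" "z < t" "((\<lambda>t. t powr p) has_real_derivative l) (at z)"
  "t powr p - s powr p = (t - s) * l" by blast
 have "l = p * z powr (p - 1)"
  using DERIV_unique[OF z(3) has_real_derivative_powr[of z p]] z(1) assms(1) by simp
 then show ?thesis using that z by blast
qed

text \<open>Convexity in the form used for Jensen's inequality: with m the mean of t, integration
  removes the linear term.\<close>

lemma powr_tangent_le:
 fixes t m p :: real
 assumes "0 \<le> t" "0 \<le> m" "1 < p"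
 shows "m powr p + p * m powr (p - 1) * (t - m) \<le> t powr p"
proof (rule linorder_cases[of t m])
 assume "t < m"
 then obtain z where z: "t < z" "z < m" "m powr p - t powr p = (m - t) * (p * z powr (p - 1))"
  using powr_MVT[of t m p] assms by auto
 have "z powr (p - 1) \<le> m powr (p - 1)" using z assms by (intro powr_mono2) auto
 then have "(m - t) * (p * z powr (p - 1)) \<le> (m - t) * (p * m powr (p - 1))"
  using \<open>t < m\<close> assms by (intro mult_left_mono) auto
 then show ?thesis using z(3) by (simp add: algebra_simps)
next
 assume "m < t"
 then obtain z where z: "m < z" "z < t" "t powr p - m powr p = (t - m) * (p * z powr (p - 1))"
  using powr_MVT[of m t p] assms by auto
 have "m powr (p - 1) \<le> z powr (p - 1)" using z assms by (intro powr_mono2) auto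
 then have "(t - m) * (p * m powr (p - 1)) \<le> (t - m) * (p * z powr (p - 1))"
  using \<open>m < t\<close> assms by (intro mult_left_mono) auto
 then show ?thesis using z(3) by (simp add: algebra_simps)
qed simp

lemma powr_midpoint_less:
 fixes s t p :: real
 assumes "0 \<le> s" "s < t" "1 < p"
 shows "((s + t) / 2) powr p < (s powr p + t powr p) / 2"
proof -
 define m where "m = (s + t) / 2"
 have m: "s < m" "m < t" "0 \<le> m" using assms by (auto simp: m_def)
 obtain x where x: "s < x" "x < m" "m powr p - s powr p = (m - s) * (p * x powr (p - 1))"
  using powr_MVT[of s m p] assms m by auto
 obtain y where y: "m < y" "y < t" "t powr p - m powr p = (t - m) * (p * y powr (p - 1))"
  using powr_MVT[of m t p] assms m by auto
 have "x powr (p - 1) < y powr (p - 1)" using x y assms by (intro powr_less_mono2) auto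
 then have "(m - s) * (p * x powr (p - 1)) < (m - s) * (p * y powr (p - 1))"
  using m assms by simp
 moreover have ms: "m - s = t - m" by (simp add: m_def field_simps)
 ultimately have "m powr p - s powr p < t powr p - m powr p" using x(3) y(3) unfolding ms by simp
 then show ?thesis unfolding m_def[symmetric] by simp
qed

text \<open>Strictness has two sources. For equal norms, equality in the triangle inequality would
  force equal vectors, an inner product fact; for different norms, \<open>powr p\<close> is strictly
  convex on the nonnegative reals.\<close>

lemma norm_midpoint_powr_less:
 fixes a b :: "'b::real_inner"
 assumes "1 < p" "a \<noteq> b"
 shows "norm ((1/2) *\<^sub>R (a + b)) powr p < (norm a powr p + norm b powr p) / 2"
proof (cases "norm a = norm b")
 case True
 have "norm (a + b) \<noteq> norm a + norm b"
 proof
  assume "norm (a + b) = norm a + norm b"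
  then have "norm a *\<^sub>R b = norm b *\<^sub>R a" by (simp add: norm_triangle_eq)
  then show False using True assms by (cases "norm b = 0") auto
 qed
 then have "norm (a + b) < 2 * norm a" using True norm_triangle_ineq[of a b] by simp
 then have "norm ((1/2) *\<^sub>R (a + b)) < norm a" by simp
 then have "norm ((1/2) *\<^sub>R (a + b)) powr p < norm a powr p"
  using assms by (intro powr_less_mono2) auto
 then show ?thesis using True by simp
next
 case False
 have "norm ((1/2) *\<^sub>R (a + b)) powr p \<le> ((norm a + norm b) / 2) powr p"
  using norm_triangle_ineq[of a b] assms by (intro powr_mono2) auto
 also have "\<dots> < (norm a powr p + norm b powr p) / 2"
  using powr_midpoint_less[of "norm a" "norm b" p] powr_midpoint_less[of "norm b" "norm a" p] False assms
  by (cases "norm a < norm b") (auto simp: add.commute)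
 finally show ?thesis .
qed

text \<open>A form of uniform convexity that survives integration against any measure.\<close>

lemma norm_powr_uniform_convexity:
 fixes p E :: real
 assumes "1 < p" "0 < E"
 obtains C where "0 \<le> C" "\<And>a b::'b::euclidean_space. norm (a - b) powr p \<le>
   E * (norm a powr p + norm b powr p) +
   C * ((norm a powr p + norm b powr p) / 2 - norm ((1/2) *\<^sub>R (a + b)) powr p)"
proof -
 define f :: "'b \<times> 'b \<Rightarrow> real" where
  "f = (\<lambda>(a, b). (norm a powr p + norm b powr p) / 2 - norm ((1/2) *\<^sub>R (a + b)) powr p)"
 define g :: "'b \<times> 'b \<Rightarrow> real" where "g = (\<lambda>(a, b). norm (a - b) powr p)"
 define h :: "'b \<times> 'b \<Rightarrow> real" where "h = (\<lambda>(a, b). max (norm a) (norm b))"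
 \<comment> \<open>By homogeneity it suffices to treat pairs whose larger norm is 1. On the compact
   set S, where the difference is not small, the midpoint defect f has a positive minimum; off S the
   term with E is enough.\<close>
 define S where "S = (cball 0 1 \<times> cball 0 1) \<inter> {x. h x = 1 \<and> g x \<ge> E}"
 have cont: "continuous_on UNIV f" "continuous_on UNIV g" "continuous_on UNIV h"
  unfolding f_def g_def h_def case_prod_beta using assms
  by (intro continuous_intros continuous_on_powr'; force)+
 have "compact S" unfolding S_def Collect_conj_eq
  by (intro compact_Int_closed compact_Times compact_cball closed_Int closed_Collect_eq
     closed_Collect_le cont continuous_on_const)
 have fpos: "f x > 0" if "x \<in> S" for x
  using that assms norm_midpoint_powr_less[of p "fst x" "snd x"]
  by (cases "fst x = snd x") (auto simp: S_def f_def g_def case_prod_beta)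
 have f0: "f x \<ge> 0" for x
  using norm_midpoint_powr_le[of p "fst x" "snd x"] assms by (simp add: f_def case_prod_beta)
 obtain d where d: "d > 0" "\<And>x. x \<in> S \<Longrightarrow> d \<le> f x"
 proof (cases "S = {}")
  case False
  then obtain x where "x \<in> S" "\<And>y. y \<in> S \<Longrightarrow> f x \<le> f y"
   using continuous_attains_inf[OF \<open>compact S\<close> _ continuous_on_subset[OF cont(1)]] by auto
  then show ?thesis using that fpos by blast
 qed (use that[of 1] in auto)
 \<comment> \<open>On normalized pairs the left-hand side is at most 2^p, and d bounds f from below
   on S.\<close>
 define C where "C = 2 powr p / d"
 have C0: "C \<ge> 0" using d by (simp add: C_def)
 have unit: "g (a, b) \<le> E * (norm a powr p + norm b powr p) + C * f (a, b)" if h: "h (a, b) = 1" for a b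
 proof (cases "g (a, b) \<ge> E")
  case True
  have ab: "norm a \<le> 1" "norm b \<le> 1" using h by (auto simp: h_def)
  then have "(a, b) \<in> S" using True h by (auto simp: S_def)
  have "g (a, b) \<le> 2 powr p" using ab norm_triangle_ineq4[of a b] assms
   by (auto simp: g_def intro!: powr_mono2)
  also have "\<dots> = C * d" using d by (simp add: C_def)
  also have "\<dots> \<le> C * f (a, b)" using d(2)[OF \<open>(a,b) \<in> S\<close>] C0 by (rule mult_left_mono)
  finally show ?thesis using assms by (simp add: add_increasing)
 next
  case False
  have "norm a powr p + norm b powr p \<ge> 1" using h by (auto simp: h_def max_def split: if_splits)
  then have "E \<le> E * (norm a powr p + norm b powr p)" using assms by simp
  then show ?thesis using False mult_nonneg_nonneg[OF C0 f0[of "(a,b)"]] by linarith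
 qed
 show ?thesis
 proof (rule that[OF C0])
  fix a b :: 'b
  show "norm (a - b) powr p \<le> E * (norm a powr p + norm b powr p) +
   C * ((norm a powr p + norm b powr p) / 2 - norm ((1/2) *\<^sub>R (a + b)) powr p)"
  proof (cases "a = 0 \<and> b = 0")
   case False
   define r where "r = max (norm a) (norm b)"
   have r: "r > 0" using False by (auto simp: r_def max_def)
   define a' b' where "a' = (1/r) *\<^sub>R a" and "b' = (1/r) *\<^sub>R b"
   have h1: "h (a', b') = 1" using r
    by (auto simp: h_def a'_def b'_def r_def max_def divide_simps split: if_splits)
   have sc: "norm (r *\<^sub>R x) powr p = r powr p * norm x powr p" for x :: 'b
    using r by (simp add: powr_mult)
   have ab: "a = r *\<^sub>R a'" "b = r *\<^sub>R b'" using r by (auto simp: a'_def b'_def)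
   have e1: "norm (a - b) powr p = r powr p * norm (a' - b') powr p"
    unfolding ab scaleR_diff_right[symmetric] by (rule sc)
   have e2: "norm ((1/2) *\<^sub>R (a + b)) powr p = r powr p * norm ((1/2) *\<^sub>R (a' + b')) powr p"
    using sc[of "(1/2) *\<^sub>R (a' + b')"] by (simp add: ab algebra_simps)
   have e3: "norm a powr p = r powr p * norm a' powr p" "norm b powr p = r powr p * norm b' powr p"
    by (simp_all only: ab sc)
   have "r powr p * g (a', b') \<le> r powr p * (E * (norm a' powr p + norm b' powr p) + C * f (a', b'))"
    by (intro mult_left_mono unit h1) auto
   then show ?thesis unfolding e1 e2 e3 by (simp add: f_def g_def algebra_simps)
  qed (use assms in auto)
 qed
qed

text \<open>At the origin the formula is the zero map because \<open>x \<bullet> h\<close> vanishes,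
  whatever \<open>powr (p - 2)\<close> returns there; this is the true derivative since p > 1 makes
  the p-th power of the norm small to first order.\<close>

lemma has_derivative_norm_powr:
 fixes x :: "'b::real_inner"
 assumes "1 < p"
 shows "((\<lambda>x. norm x powr p) has_derivative (\<lambda>h. p * norm x powr (p - 2) * (x \<bullet> h))) (at x)"
proof (cases "x = 0")
 case True
 have "((\<lambda>h::'b. norm h powr (p - 1)) \<longlongrightarrow> 0) (at 0)"
 proof -
  have "continuous (at 0) (\<lambda>h::'b. norm h powr (p - 1))"
   using continuous_on_powr'[of UNIV "norm" "\<lambda>_. p - 1"] assms
   by (auto simp: continuous_on_eq_continuous_at intro: continuous_intros)
  then show ?thesis using assms by (simp add: isCont_def)
 qed
 then have "((\<lambda>h::'b. norm h powr p / norm h) \<longlongrightarrow> 0) (at 0)"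
  by (rule Lim_transform_eventually) (auto simp: eventually_at_filter powr_diff)
 then show ?thesis using True assms
  by (simp add: has_derivative_at)
next
 case False
 have "((\<lambda>x. norm x powr p) has_derivative
   (\<lambda>h. norm x powr p * (0 * ln (norm x) + inner (sgn x) h * p / norm x))) (at x)"
  by (rule has_derivative_eq_rhs[OF has_derivative_powr[OF has_derivative_norm[OF False] has_derivative_const]])
    (use False in \<open>auto simp: inner_commute\<close>)
 moreover have "norm x powr p * (0 * ln (norm x) + inner (sgn x) h * p / norm x) = p * norm x powr (p - 2) * (x \<bullet> h)" for h
  using False by (simp add: sgn_div_norm powr_diff power2_eq_square powr_numeral field_simps)
 ultimately show ?thesis by simp
qed

lemma has_real_derivative_norm_powr_line:
 fixes a b :: "'b::real_inner"
 assumes "1 < p"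
 shows "((\<lambda>t. norm (a + t *\<^sub>R b) powr p) has_real_derivative
      p * norm (a + t *\<^sub>R b) powr (p - 2) * ((a + t *\<^sub>R b) \<bullet> b)) (at t)"
proof -
 have "((\<lambda>t. a + t *\<^sub>R b) has_derivative (\<lambda>h. h *\<^sub>R b)) (at t)"
  by (auto intro!: derivative_eq_intros)
 from has_derivative_compose[OF this has_derivative_norm_powr[OF assms]]
 show ?thesis by (auto simp: has_field_derivative_def elim!: has_derivative_eq_rhs)
qed

lemma norm_powr_inner_le:
 fixes x h :: "'b::real_inner"
 shows "\<bar>norm x powr (p - 2) * (x \<bullet> h)\<bar> \<le> norm x powr (p - 1) * norm h"
proof (cases "x = 0")
 case False
 have "\<bar>norm x powr (p - 2) * (x \<bullet> h)\<bar> = norm x powr (p - 2) * \<bar>x \<bullet> h\<bar>" by (simp add: abs_mult)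
 also have "\<dots> \<le> norm x powr (p - 2) * (norm x * norm h)"
  by (intro mult_left_mono Cauchy_Schwarz_ineq2) auto
 also have "\<dots> = norm x powr (p - 1) * norm h"
  using False powr_add[of "norm x" "p - 2" 1] by simp
 finally show ?thesis .
qed simp

text \<open>Gives a dominating function, independent of t, for the difference quotients when an L^p
  integral is differentiated along a line.\<close>

lemma norm_powr_line_diff_le:
 fixes a b :: "'b::real_inner"
 assumes "1 < p" "\<bar>t\<bar> \<le> 1"
 shows "\<bar>norm (a + t *\<^sub>R b) powr p - norm a powr p\<bar> \<le> \<bar>t\<bar> * (p * (norm a + norm b) powr p)"
proof -
 have bd: "norm (p * norm (a + x *\<^sub>R b) powr (p - 2) * ((a + x *\<^sub>R b) \<bullet> b)) \<le> p * (norm a + norm b) powr p"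
  if x: "x \<in> {-1..1}" for x
 proof -
  let ?s = "norm a + norm b"
  have "norm (a + x *\<^sub>R b) \<le> norm a + \<bar>x\<bar> * norm b" using norm_triangle_ineq[of a "x *\<^sub>R b"] by simp
  also have "\<dots> \<le> ?s" using x mult_right_mono[of "\<bar>x\<bar>" 1 "norm b"] by auto
  finally have n: "norm (a + x *\<^sub>R b) \<le> ?s" .
  have "\<bar>norm (a + x *\<^sub>R b) powr (p - 2) * ((a + x *\<^sub>R b) \<bullet> b)\<bar> \<le> norm (a + x *\<^sub>R b) powr (p - 1) * norm b"
   by (rule norm_powr_inner_le)
  also have "\<dots> \<le> ?s powr (p - 1) * ?s"
   using n assms by (intro mult_mono powr_mono2) auto
  also have "\<dots> = ?s powr p"
   using powr_add[of ?s "p - 1" 1] by (cases "?s = 0") (auto simp: add_nonneg_eq_0_iff)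
  finally show ?thesis using assms by (simp add: abs_mult mult.assoc mult_left_mono)
 qed
 have "norm (norm (a + t *\<^sub>R b) powr p - norm (a + 0 *\<^sub>R b) powr p) \<le> p * (norm a + norm b) powr p * norm (t - 0)"
  by (rule field_differentiable_bound[of "{-1..1}" "\<lambda>t. norm (a + t *\<^sub>R b) powr p"])
    (use bd assms in \<open>auto intro!: DERIV_subset[OF has_real_derivative_norm_powr_line]\<close>)
 then show ?thesis by (simp add: mult.commute)
qed

section \<open>Spaces of p-integrable functions\<close>

definition Lp_vec :: "real \<Rightarrow> 'a measure \<Rightarrow> ('a \<Rightarrow> 'b::euclidean_space) \<Rightarrow> bool" where
 "Lp_vec p M f \<longleftrightarrow> f \<in> borel_measurable M \<and> integrable M (\<lambda>x. norm (f x) powr p)"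

text \<open>The p-th power of the L^p norm. Energies and boundary integrals are of this form, and it
  satisfies a triangle inequality up to the factor \<open>2 powr (p - 1)\<close>.\<close>

definition Lp_int :: "real \<Rightarrow> 'a measure \<Rightarrow> ('a \<Rightarrow> 'b::euclidean_space) \<Rightarrow> real" where
 "Lp_int p M f = (\<integral>x. norm (f x) powr p \<partial>M)"

lemma Lp_fun_eq: "Lp_fun p M f \<longleftrightarrow> Lp_vec p M f"
 by (simp add: Lp_fun_def Lp_vec_def)

lemma Lp_vec_measurable: "Lp_vec p M f \<Longrightarrow> f \<in> borel_measurable M"
 and Lp_vec_integrable: "Lp_vec p M f \<Longrightarrow> integrable M (\<lambda>x. norm (f x) powr p)"
 by (auto simp: Lp_vec_def)

lemma Lp_int_nonneg [simp]: "0 \<le> Lp_int p M f"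
 by (simp add: Lp_int_def)

lemma Lp_vec_scaleR:
 assumes "Lp_vec p M f"
 shows "Lp_vec p M (\<lambda>x. c *\<^sub>R f x)"
 using assms by (auto simp: Lp_vec_def powr_mult)

lemma Lp_int_scaleR: "Lp_int p M (\<lambda>x. c *\<^sub>R f x) = \<bar>c\<bar> powr p * Lp_int p M f"
 by (simp add: Lp_int_def powr_mult)

lemma Lp_vec_add:
 assumes "1 \<le> p" "Lp_vec p M f" "Lp_vec p M g"
 shows "Lp_vec p M (\<lambda>x. f x + g x)"
proof -
 note [measurable] = Lp_vec_measurable[OF assms(2)] Lp_vec_measurable[OF assms(3)]
 have "integrable M (\<lambda>x. 2 powr (p - 1) * (norm (f x) powr p + norm (g x) powr p))"
  using assms by (auto simp: Lp_vec_def)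
 then have "integrable M (\<lambda>x. norm (f x + g x) powr p)"
  by (rule Bochner_Integration.integrable_bound) (auto intro!: AE_I2 order_trans[OF norm_add_powr_le] assms)
 then show ?thesis by (simp add: Lp_vec_def)
qed

lemma Lp_vec_uminus: "Lp_vec p M f \<Longrightarrow> Lp_vec p M (\<lambda>x. - f x)"
 by (auto simp: Lp_vec_def)

lemma Lp_vec_diff: "1 \<le> p \<Longrightarrow> Lp_vec p M f \<Longrightarrow> Lp_vec p M g \<Longrightarrow> Lp_vec p M (\<lambda>x. f x - g x)"
 using Lp_vec_add[of p M f "\<lambda>x. - g x"] Lp_vec_uminus[of p M g] by simp

lemma Lp_vec_cong_AE:
 assumes "Lp_vec p M f" "g \<in> borel_measurable M" "AE x in M. f x = g x"
 shows "Lp_vec p M g"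
proof -
 have "integrable M (\<lambda>x. norm (f x) powr p) = integrable M (\<lambda>x. norm (g x) powr p)"
  by (rule integrable_cong_AE) (use assms in \<open>auto simp: Lp_vec_def\<close>)
 then show ?thesis using assms by (simp add: Lp_vec_def)
qed

lemma Lp_int_cong_AE:
 assumes "f \<in> borel_measurable M" "g \<in> borel_measurable M" "AE x in M. f x = g x"
 shows "Lp_int p M f = Lp_int p M g"
 unfolding Lp_int_def by (rule integral_cong_AE) (use assms in auto)

lemma Lp_int_add_le:
 assumes "1 \<le> p" "Lp_vec p M f" "Lp_vec p M g"
 shows "Lp_int p M (\<lambda>x. f x + g x) \<le> 2 powr (p - 1) * (Lp_int p M f + Lp_int p M g)"
proof -
 have "Lp_int p M (\<lambda>x. f x + g x) \<le> (\<integral>x. 2 powr (p - 1) * (norm (f x) powr p + norm (g x) powr p) \<partial>M)"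
  unfolding Lp_int_def
  by (rule integral_mono) (use assms Lp_vec_add[OF assms] in \<open>auto simp: Lp_vec_def intro!: norm_add_powr_le\<close>)
 also have "\<dots> = 2 powr (p - 1) * (Lp_int p M f + Lp_int p M g)"
  using assms by (simp add: Lp_int_def Lp_vec_def)
 finally show ?thesis .
qed

lemma Lp_int_minus_commute: "Lp_int p M (\<lambda>x. f x - g x) = Lp_int p M (\<lambda>x. g x - f x)"
 by (simp add: Lp_int_def norm_minus_commute)

lemma Lp_int_uminus: "Lp_int p M (\<lambda>x. - f x) = Lp_int p M f"
 by (simp add: Lp_int_def)

lemma Lp_int_diff_le:
 assumes "1 \<le> p" "Lp_vec p M f" "Lp_vec p M g"
 shows "Lp_int p M (\<lambda>x. f x - g x) \<le> 2 powr (p - 1) * (Lp_int p M f + Lp_int p M g)"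
 using Lp_int_add_le[OF assms(1,2) Lp_vec_uminus[OF assms(3)]] by (simp add: Lp_int_uminus)

lemma Lp_int_triangle:
 assumes "1 \<le> p" "Lp_vec p M f" "Lp_vec p M g" "Lp_vec p M h"
 shows "Lp_int p M (\<lambda>x. f x - h x) \<le> 2 powr (p - 1) * (Lp_int p M (\<lambda>x. f x - g x) + Lp_int p M (\<lambda>x. g x - h x))"
 using Lp_int_add_le[OF assms(1) Lp_vec_diff[OF assms(1,2,3)] Lp_vec_diff[OF assms(1,3,4)]] by simp

lemma Lp_int_add_le_weighted:
 assumes "1 \<le> p" "Lp_vec p M f" "Lp_vec p M g" "0 < t" "t < 1"
 shows "Lp_int p M (\<lambda>x. f x + g x) \<le> (1 - t) powr (1 - p) * Lp_int p M f + t powr (1 - p) * Lp_int p M g"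
proof -
 have "Lp_int p M (\<lambda>x. f x + g x) \<le> (\<integral>x. (1 - t) powr (1 - p) * norm (f x) powr p + t powr (1 - p) * norm (g x) powr p \<partial>M)"
  unfolding Lp_int_def
  by (rule integral_mono) (use assms Lp_vec_add[OF assms(1-3)] in \<open>auto simp: Lp_vec_def intro!: norm_add_powr_le_weighted\<close>)
 also have "\<dots> = (1 - t) powr (1 - p) * Lp_int p M f + t powr (1 - p) * Lp_int p M g"
  using assms by (simp add: Lp_int_def Lp_vec_def)
 finally show ?thesis .
qed

text \<open>The order of choices matters: first t is taken so small that the factor of the limit a
  leaves the product below c, and only then n so large that B absorbs the fixed, possibly huge,
  factor \<open>t powr (1 - p)\<close>.\<close>

lemma weighted_bound_tendsto:
 assumes "1 \<le> p" "(A :: nat \<Rightarrow> real) \<longlonglongrightarrow> a" "B \<longlonglongrightarrow> 0"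
  and le: "\<And>t n. 0 < t \<Longrightarrow> t < 1 \<Longrightarrow> C n \<le> (1 - t) powr (1 - p) * A n + t powr (1 - p) * B n"
  and "a < c"
 shows "\<forall>\<^sub>F n in sequentially. C n < c"
proof -
 have "((\<lambda>t. (1 - t) powr (1 - p) * a) \<longlongrightarrow> (1 - 0) powr (1 - p) * a) (at_right (0::real))"
  by (intro tendsto_intros) auto
 then have "\<forall>\<^sub>F t in at_right 0. (1 - t) powr (1 - p) * a < c"
  using \<open>a < c\<close> by (intro order_tendstoD(2)) auto
 moreover have "\<forall>\<^sub>F t in at_right 0. (0::real) < t \<and> t < 1"
  by (auto simp: eventually_at_right_field intro: exI[of _ 1])
 ultimately obtain t where th: "(1 - t) powr (1 - p) * a < c" "0 < t" "t < 1"
  by (metis (mono_tags, lifting) eventually_conj_iff eventually_happens' trivial_limit_at_right_real)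
 have "(\<lambda>n. (1 - t) powr (1 - p) * A n + t powr (1 - p) * B n) \<longlonglongrightarrow> (1 - t) powr (1 - p) * a + t powr (1 - p) * 0"
  by (intro tendsto_intros assms)
 then have "\<forall>\<^sub>F n in sequentially. (1 - t) powr (1 - p) * A n + t powr (1 - p) * B n < c"
  using th(1) by (intro order_tendstoD(2)) auto
 then show ?thesis by (rule eventually_mono) (use le[OF th(2,3)] in \<open>auto intro: le_less_trans\<close>)
qed

text \<open>Continuity of the norm without the reverse triangle inequality: the weighted bound is
  applied to f n = g + (f n - g) for the upper half, and to g = f n + (g - f n) for the lower
  half.\<close>

lemma Lp_int_tendsto:
 assumes p: "1 \<le> p" and f: "\<And>n. Lp_vec p M (f n)" and g: "Lp_vec p M g"
  and lim: "(\<lambda>n. Lp_int p M (\<lambda>x. f n x - g x)) \<longlonglongrightarrow> 0"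
 shows "(\<lambda>n. Lp_int p M (f n)) \<longlonglongrightarrow> Lp_int p M g"
proof (rule order_tendstoI)
 fix c assume "Lp_int p M g < c"
 show "\<forall>\<^sub>F n in sequentially. Lp_int p M (f n) < c"
 proof (rule weighted_bound_tendsto[OF p tendsto_const lim])
  fix t n assume "(0::real) < t" "t < 1"
  then show "Lp_int p M (f n) \<le> (1 - t) powr (1 - p) * Lp_int p M g + t powr (1 - p) * Lp_int p M (\<lambda>x. f n x - g x)"
   using Lp_int_add_le_weighted[OF p g Lp_vec_diff[OF p f g], of t n] by simp
 qed fact
next
 fix c assume c: "c < Lp_int p M g"
 show "\<forall>\<^sub>F n in sequentially. c < Lp_int p M (f n)"
 proof (cases "c < 0")
  case True
  then show ?thesis by (auto intro!: always_eventually less_le_trans[OF True])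
 next
  case False
  have "((\<lambda>t. (1 - t) powr (1 - p) * c) \<longlongrightarrow> (1 - 0) powr (1 - p) * c) (at_right (0::real))"
   by (intro tendsto_intros) auto
  then have "\<forall>\<^sub>F t in at_right 0. (1 - t) powr (1 - p) * c < Lp_int p M g"
   using c by (intro order_tendstoD(2)) auto
  moreover have "\<forall>\<^sub>F t in at_right 0. (0::real) < t \<and> t < 1"
   by (auto simp: eventually_at_right_field intro: exI[of _ 1])
  ultimately obtain t where th: "(1 - t) powr (1 - p) * c < Lp_int p M g" "0 < t" "t < 1"
   by (metis (mono_tags, lifting) eventually_conj_iff eventually_happens' trivial_limit_at_right_real)
  have "(\<lambda>n. t powr (1 - p) * Lp_int p M (\<lambda>x. f n x - g x)) \<longlonglongrightarrow> t powr (1 - p) * 0"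
   by (intro tendsto_intros lim)
  then have "\<forall>\<^sub>F n in sequentially. t powr (1 - p) * Lp_int p M (\<lambda>x. f n x - g x) < Lp_int p M g - (1 - t) powr (1 - p) * c"
   using th(1) by (intro order_tendstoD(2)) auto
  then show ?thesis
  proof (rule eventually_mono)
   fix n assume n: "t powr (1 - p) * Lp_int p M (\<lambda>x. f n x - g x) < Lp_int p M g - (1 - t) powr (1 - p) * c"
   have "Lp_int p M g \<le> (1 - t) powr (1 - p) * Lp_int p M (f n) + t powr (1 - p) * Lp_int p M (\<lambda>x. g x - f n x)"
    using Lp_int_add_le_weighted[OF p f[of n] Lp_vec_diff[OF p g f[of n]] th(2,3)] by simp
   then have "(1 - t) powr (1 - p) * c < (1 - t) powr (1 - p) * Lp_int p M (f n)"
    using n by (simp add: Lp_int_minus_commute[of p M g])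
   then show "c < Lp_int p M (f n)" using th by simp
  qed
 qed
qed

lemma Lp_Cauchy_fast_AE_convergent:
 fixes f :: "nat \<Rightarrow> 'a \<Rightarrow> 'b::euclidean_space"
 assumes p: "1 < p" and f: "\<And>n. Lp_vec p M (f n)"
  and fast: "\<And>k. Lp_int p M (\<lambda>x. f (Suc k) x - f k x) \<le> (2 powr (-p) / 2) ^ k"
 shows "AE x in M. convergent (\<lambda>k. f k x)"
proof -
 \<comment> \<open>The weight leaves integrals of at most 2^-k, so the sum of all h k is finite
   almost everywhere. At such a point the increments are at most B^(1/p) 2^-k, a summable
   bound.\<close>
 define h where "h k x = (2 powr p)^k * norm (f (Suc k) x - f k x) powr p" for k x
 have hi: "integrable M (h k)" for k
  unfolding h_def using Lp_vec_diff[OF _ f f, of "Suc k" k] p by (auto simp: Lp_vec_def)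
 have h0: "0 \<le> h k x" for k x by (simp add: h_def)
 have "(\<integral>x. h k x \<partial>M) \<le> (1/2)^k" for k
 proof -
  have "(\<integral>x. h k x \<partial>M) = (2 powr p)^k * Lp_int p M (\<lambda>x. f (Suc k) x - f k x)"
   by (simp add: h_def Lp_int_def)
  also have "\<dots> \<le> (2 powr p)^k * (2 powr (-p) / 2) ^ k" by (intro mult_left_mono fast) auto
  also have "\<dots> = (1/2)^k" by (simp add: power_mult_distrib[symmetric] powr_minus)
  finally show ?thesis .
 qed
 then have "(\<integral>\<^sup>+x. ennreal (h k x) \<partial>M) \<le> ennreal ((1/2)^k)" for k
  by (subst nn_integral_eq_integral[OF hi]) (auto simp: h0 intro!: ennreal_leI)
 then have "(\<Sum>k. \<integral>\<^sup>+x. ennreal (h k x) \<partial>M) \<le> (\<Sum>k. ennreal ((1/2)^k))"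
  by (intro suminf_le) auto
 also have "(\<Sum>k. ennreal ((1/2)^k)) < \<infinity>"
  by (subst suminf_ennreal2) (auto simp: summable_geometric)
 finally have "(\<integral>\<^sup>+x. (\<Sum>k. ennreal (h k x)) \<partial>M) \<noteq> \<infinity>"
  by (subst nn_integral_suminf) (use hi in auto)
 then have "AE x in M. (\<Sum>k. ennreal (h k x)) \<noteq> \<infinity>"
  by (intro nn_integral_PInf_AE) (use hi in auto)
 then show ?thesis
 proof (rule AE_mp, intro AE_I2 impI)
  fix x assume fin: "(\<Sum>k. ennreal (h k x)) \<noteq> \<infinity>"
  define B where "B = enn2real (\<Sum>k. ennreal (h k x))"
  have hB: "h k x \<le> B" for k
  proof -
   have "ennreal (h k x) \<le> (\<Sum>k. ennreal (h k x))"
    using sum_le_suminf[of "\<lambda>k. ennreal (h k x)" "{k}"] by auto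
   also have "\<dots> = ennreal B" unfolding B_def using fin by (simp add: less_top)
   finally show ?thesis by (simp add: B_def)
  qed
  have B0: "B \<ge> 0" by (simp add: B_def)
  have nb: "norm (f (Suc k) x - f k x) \<le> B powr (1/p) * (1/2)^k" for k
  proof -
   have "norm (f (Suc k) x - f k x) powr p \<le> B / (2 powr p)^k"
    using hB[of k] by (simp add: h_def field_simps)
   then have "(norm (f (Suc k) x - f k x) powr p) powr (1/p) \<le> (B / (2 powr p)^k) powr (1/p)"
    using p by (intro powr_mono2) auto
   also have "\<dots> = B powr (1/p) * (1/2)^k"
    using p B0 by (simp add: powr_divide powr_realpow[symmetric] powr_powr field_simps)
   finally show ?thesis using p by (simp add: powr_powr)
  qed
  have "summable (\<lambda>k. f (Suc k) x - f k x)"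
   by (rule summable_comparison_test'[OF summable_mult[OF summable_geometric]]) (use nb in auto)
  then have "(\<lambda>n. f 0 x + (\<Sum>k<n. f (Suc k) x - f k x)) \<longlonglongrightarrow> f 0 x + (\<Sum>k. f (Suc k) x - f k x)"
   by (intro tendsto_add tendsto_const summable_LIMSEQ)
  then show "convergent (\<lambda>k. f k x)"
   using sum_lessThan_telescope[of "\<lambda>k. f k x"] by (auto simp: convergent_def)
 qed
qed

text \<open>The Riesz-Fischer argument: a rapidly Cauchy subsequence converges almost everywhere,
  and Fatou's lemma turns the Cauchy property of the whole sequence into convergence to that
  pointwise limit.\<close>

lemma Lp_complete:
 fixes f :: "nat \<Rightarrow> 'a \<Rightarrow> 'b::euclidean_space"
 assumes p: "1 < p" and f: "\<And>n. Lp_vec p M (f n)"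
  and Cau: "\<And>e. 0 < e \<Longrightarrow> \<exists>N. \<forall>m\<ge>N. \<forall>n\<ge>N. Lp_int p M (\<lambda>x. f m x - f n x) < e"
 obtains g where "Lp_vec p M g" "(\<lambda>n. Lp_int p M (\<lambda>x. f n x - g x)) \<longlonglongrightarrow> 0"
proof -
 note [measurable] = Lp_vec_measurable[OF f]
 define e where "e k = (2 powr (-p) / 2) ^ k" for k :: nat
 have e0: "e k > 0" for k by (simp add: e_def)
 from Cau[OF e0] obtain N where N: "\<And>k m n. m \<ge> N k \<Longrightarrow> n \<ge> N k \<Longrightarrow> Lp_int p M (\<lambda>x. f m x - f n x) < e k"
  by metis
 define r where "r = rec_nat (N 0) (\<lambda>k rk. max (Suc rk) (N (Suc k)))"
 have r0: "r 0 = N 0" and rS: "r (Suc k) = max (Suc (r k)) (N (Suc k))" for k by (simp_all add: r_def)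
 have rmono: "strict_mono r" by (rule strict_monoI_Suc) (simp add: rS)
 have rN: "r k \<ge> N k" for k by (cases k) (auto simp: r0 rS)
 have "AE x in M. convergent (\<lambda>k. f (r k) x)"
 proof (rule Lp_Cauchy_fast_AE_convergent[OF p])
  fix k
  have "r (Suc k) \<ge> N k" using rN[of k] by (simp add: rS)
  then show "Lp_int p M (\<lambda>x. f (r (Suc k)) x - f (r k) x) \<le> (2 powr (-p) / 2) ^ k"
   using N[of k "r (Suc k)" "r k"] rN[of k] by (simp add: e_def)
 qed (rule f)
 define g where "g x = lim (\<lambda>k. f (r k) x)" for x
 have gm[measurable]: "g \<in> borel_measurable M" unfolding g_def by measurable
 have AE: "AE x in M. (\<lambda>k. f (r k) x) \<longlonglongrightarrow> g x"
  using \<open>AE x in M. convergent (\<lambda>k. f (r k) x)\<close> by eventually_elim (simp add: g_def convergent_LIMSEQ_iff)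
 \<comment> \<open>Fatou along the a.e. convergent subsequence with n held fixed; it bounds the
   distance from f n to the limit without yet knowing that the limit is p-integrable.\<close>
 have key: "(\<integral>\<^sup>+x. ennreal (norm (f n x - g x) powr p) \<partial>M) \<le> ennreal E"
  if n: "\<And>m. m \<ge> n0 \<Longrightarrow> Lp_int p M (\<lambda>x. f n x - f m x) \<le> E" for n n0 E
 proof -
  have "(\<integral>\<^sup>+x. ennreal (norm (f n x - g x) powr p) \<partial>M) \<le> (\<integral>\<^sup>+x. liminf (\<lambda>k. ennreal (norm (f n x - f (r k) x) powr p)) \<partial>M)"
  proof (rule nn_integral_mono_AE, use AE in eventually_elim)
   case (elim x)
   have "(\<lambda>k. ennreal (norm (f n x - f (r k) x) powr p)) \<longlonglongrightarrow> ennreal (norm (f n x - g x) powr p)"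
    by (intro tendsto_ennrealI tendsto_powr' tendsto_norm tendsto_diff tendsto_const elim) (use p in auto)
   then show ?case by (simp only: lim_imp_Liminf[OF sequentially_bot] order_refl)
  qed
  also have "\<dots> \<le> liminf (\<lambda>k. \<integral>\<^sup>+x. ennreal (norm (f n x - f (r k) x) powr p) \<partial>M)"
   by (rule nn_integral_liminf) auto
  also have "\<dots> \<le> ennreal E"
  proof (rule Liminf_le)
   show "\<forall>\<^sub>F k in sequentially. (\<integral>\<^sup>+x. ennreal (norm (f n x - f (r k) x) powr p) \<partial>M) \<le> ennreal E"
    using eventually_ge_at_top[of n0]
   proof eventually_elim
    case (elim k)
    then have "r k \<ge> n0" using seq_suble[OF rmono, of k] by simp
    then have "Lp_int p M (\<lambda>x. f n x - f (r k) x) \<le> E" by (rule n)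
    moreover have "integrable M (\<lambda>x. norm (f n x - f (r k) x) powr p)"
     using Lp_vec_diff[OF _ f f] p by (auto simp: Lp_vec_def)
    ultimately show ?case by (subst nn_integral_eq_integral) (auto simp: Lp_int_def intro!: ennreal_leI)
   qed
  qed simp
  finally show ?thesis .
 qed
 have key2: "Lp_vec p M (\<lambda>x. f n x - g x)" "Lp_int p M (\<lambda>x. f n x - g x) \<le> E"
  if n: "\<And>m. m \<ge> n0 \<Longrightarrow> Lp_int p M (\<lambda>x. f n x - f m x) \<le> E" for n n0 E
 proof -
  have e: "0 \<le> E" using n[of n0] Lp_int_nonneg order_trans by blast
  have k: "(\<integral>\<^sup>+x. ennreal (norm (f n x - g x) powr p) \<partial>M) \<le> ennreal E"
   by (rule key[OF n])
  have i: "integrable M (\<lambda>x. norm (f n x - g x) powr p)"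
   by (rule integrableI_bounded) (use le_less_trans[OF k ennreal_less_top] in auto)
  then show "Lp_vec p M (\<lambda>x. f n x - g x)" by (simp add: Lp_vec_def)
  show "Lp_int p M (\<lambda>x. f n x - g x) \<le> E"
   using k nn_integral_eq_integral[OF i] e by (simp add: Lp_int_def)
 qed
 show ?thesis
 proof (rule that)
  have "Lp_vec p M (\<lambda>x. f (N 0) x - g x)"
   using N[of 0 "N 0"] by (intro key2(1)[of "N 0" _ "e 0"] less_imp_le) simp
  then have "Lp_vec p M (\<lambda>x. f (N 0) x - (f (N 0) x - g x))"
   by (rule Lp_vec_diff[OF less_imp_le[OF p] f])
  then show "Lp_vec p M g" by simp
  show "(\<lambda>n. Lp_int p M (\<lambda>x. f n x - g x)) \<longlonglongrightarrow> 0"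
  proof (rule LIMSEQ_I)
   fix E :: real assume "0 < E"
   then obtain K where K: "\<And>m n. m \<ge> K \<Longrightarrow> n \<ge> K \<Longrightarrow> Lp_int p M (\<lambda>x. f m x - f n x) < E/2"
    using Cau[of "E/2"] by auto
   have "norm (Lp_int p M (\<lambda>x. f n x - g x) - 0) < E" if "n \<ge> K" for n
   proof -
    have "Lp_int p M (\<lambda>x. f n x - g x) \<le> E / 2"
     by (rule key2(2)[of K]) (use K[of n] that in \<open>auto intro: less_imp_le\<close>)
    then show ?thesis using \<open>0 < E\<close> by simp
   qed
   then show "\<exists>no. \<forall>n\<ge>no. norm (Lp_int p M (\<lambda>x. f n x - g x) - 0) < E" by blast
  qed
 qed
qed

lemma Lp_vec_const_bounded:
 assumes "finite_measure M" "f \<in> borel_measurable M" "\<And>x. x \<in> space M \<Longrightarrow> norm (f x) \<le> B" "0 \<le> p"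
 shows "Lp_vec p M f"
proof -
 interpret finite_measure M by fact
 have "integrable M (\<lambda>x. norm (f x) powr p)"
  by (rule integrable_const_bound[of _ "B powr p"]) (use assms in \<open>auto intro!: AE_I2 powr_mono2\<close>)
 then show ?thesis using assms by (simp add: Lp_vec_def)
qed

text \<open>If t exceeds e, then t = t^(1-p) t^p and the first factor is at most e^(1-p). On a
  finite measure space this compares L^1 with L^p, in place of Hoelder's inequality.\<close>

lemma le_add_powr:
 fixes t e p :: real
 assumes "0 \<le> t" "0 < e" "1 \<le> p"
 shows "t \<le> e + e powr (1 - p) * t powr p"
proof (cases "t \<le> e")
 case False
 then have t: "t > 0" using assms by auto
 have "t = t powr (1 - p) * t powr p" using t by (simp add: powr_add[symmetric])
 also have "\<dots> \<le> e powr (1 - p) * t powr p"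
  using False assms by (intro mult_right_mono powr_mono2') auto
 finally show ?thesis using assms by simp
qed (use assms in \<open>simp add: add_increasing2\<close>)

lemma Lp_vec_imp_integrable:
 assumes "finite_measure M" "1 \<le> p" "Lp_vec p M f"
 shows "integrable M f"
proof -
 interpret finite_measure M by fact
 have "integrable M (\<lambda>x. 1 + 1 powr (1 - p) * norm (f x) powr p)"
  using assms by (auto simp: Lp_vec_def)
 then show ?thesis
  by (rule Bochner_Integration.integrable_bound)
    (use assms le_add_powr[of _ 1 p] in \<open>auto simp: Lp_vec_def intro!: AE_I2 order_trans[OF le_add_powr[of _ 1 p]]\<close>)
qed

text \<open>Convergence in L^1 is what the defining identity of the weak gradient needs in order to
  pass to a limit, because test functions and their derivatives are bounded.\<close>

lemma Lp_tendsto_imp_L1: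
 assumes M: "finite_measure M" and p: "1 \<le> p" and f: "\<And>n. Lp_vec p M (f n)" and g: "Lp_vec p M g"
  and lim: "(\<lambda>n. Lp_int p M (\<lambda>x. f n x - g x)) \<longlonglongrightarrow> 0"
 shows "(\<lambda>n. \<integral>x. norm (f n x - g x) \<partial>M) \<longlonglongrightarrow> 0"
proof (rule LIMSEQ_I)
 interpret finite_measure M by fact
 fix E :: real assume "0 < E"
 define m where "m = measure M (space M)"
 have m: "0 \<le> m" by (simp add: m_def)
 define e where "e = E / (2 * (m + 1))"
 have e0: "e > 0" "e * (m + 1) = E / 2"
  using \<open>0 < E\<close> m by (simp_all add: e_def field_simps)
 have "e * m \<le> e * (m + 1)" using e0 by simp
 then have e: "e > 0" "e * measure M (space M) < E"
  using e0 \<open>0 < E\<close> unfolding m_def[symmetric] by linarith+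
 have "(\<lambda>n. e * measure M (space M) + e powr (1 - p) * Lp_int p M (\<lambda>x. f n x - g x)) \<longlonglongrightarrow> e * measure M (space M) + e powr (1 - p) * 0"
  by (intro tendsto_intros lim)
 then have "\<forall>\<^sub>F n in sequentially. e * measure M (space M) + e powr (1 - p) * Lp_int p M (\<lambda>x. f n x - g x) < E"
  using e by (intro order_tendstoD(2)) auto
 then obtain N where N: "\<And>n. n \<ge> N \<Longrightarrow> e * measure M (space M) + e powr (1 - p) * Lp_int p M (\<lambda>x. f n x - g x) < E"
  by (auto simp: eventually_sequentially)
 show "\<exists>no. \<forall>n\<ge>no. norm ((\<integral>x. norm (f n x - g x) \<partial>M) - 0) < E"
 proof (intro exI allI impI)
  fix n assume "n \<ge> N"
  have d: "Lp_vec p M (\<lambda>x. f n x - g x)" by (intro Lp_vec_diff p f g)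
  have "(\<integral>x. norm (f n x - g x) \<partial>M) \<le> (\<integral>x. e + e powr (1 - p) * norm (f n x - g x) powr p \<partial>M)"
   by (rule integral_mono) (use d Lp_vec_imp_integrable[OF M p d] e p in \<open>auto simp: Lp_vec_def intro!: le_add_powr\<close>)
  also have "\<dots> = e * measure M (space M) + e powr (1 - p) * Lp_int p M (\<lambda>x. f n x - g x)"
   using d by (simp add: Lp_vec_def Lp_int_def)
  finally show "norm ((\<integral>x. norm (f n x - g x) \<partial>M) - 0) < E"
   using N[OF \<open>n \<ge> N\<close>] by simp
 qed
qed

text \<open>The pointwise inequality is linear in p-th powers, so it can be integrated as it stands;
  hence C depends on p, e and the value space, but neither on the measure nor on the
  functions.\<close>

lemma Lp_int_uniform_convexity:
 fixes p e :: real
 assumes "1 < p" "0 < e"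
 obtains C where "0 \<le> C" "\<And>(M::'a measure) f g::'a \<Rightarrow> 'b::euclidean_space. Lp_vec p M f \<Longrightarrow> Lp_vec p M g \<Longrightarrow>
   Lp_int p M (\<lambda>x. f x - g x) \<le> e * (Lp_int p M f + Lp_int p M g) +
   C * ((Lp_int p M f + Lp_int p M g) / 2 - Lp_int p M (\<lambda>x. (1/2) *\<^sub>R (f x + g x)))"
proof -
 obtain C where C: "0 \<le> C" "\<And>a b::'b. norm (a - b) powr p \<le>
   e * (norm a powr p + norm b powr p) +
   C * ((norm a powr p + norm b powr p) / 2 - norm ((1/2) *\<^sub>R (a + b)) powr p)"
  using norm_powr_uniform_convexity[OF assms] by metis
 show ?thesis
 proof (rule that[OF C(1)])
  fix M :: "'a measure" and f g :: "'a \<Rightarrow> 'b"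
  assume f: "Lp_vec p M f" and g: "Lp_vec p M g"
  have h: "Lp_vec p M (\<lambda>x. (1/2) *\<^sub>R (f x + g x))" "Lp_vec p M (\<lambda>x. f x - g x)"
   using f g assms by (auto intro!: Lp_vec_scaleR Lp_vec_add Lp_vec_diff)
  note i = Lp_vec_integrable[OF f] Lp_vec_integrable[OF g] Lp_vec_integrable[OF h(1)] Lp_vec_integrable[OF h(2)]
  have "Lp_int p M (\<lambda>x. f x - g x) \<le> (\<integral>x. e * (norm (f x) powr p + norm (g x) powr p) +
    C * ((norm (f x) powr p + norm (g x) powr p) / 2 - norm ((1/2) *\<^sub>R (f x + g x)) powr p) \<partial>M)"
   unfolding Lp_int_def using i by (intro integral_mono C(2)) (auto simp del: norm_scaleR)
  also have "\<dots> = e * (Lp_int p M f + Lp_int p M g) +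
   C * ((Lp_int p M f + Lp_int p M g) / 2 - Lp_int p M (\<lambda>x. (1/2) *\<^sub>R (f x + g x)))"
   using i by (simp add: Lp_int_def del: norm_scaleR)
  finally show "Lp_int p M (\<lambda>x. f x - g x) \<le> \<dots>" .
 qed
qed

text \<open>Differentiation under the integral sign: along any sequence tending to 0 the quotients
  are eventually dominated by a multiple of the sum of the two p-th powers.\<close>

lemma Lp_int_has_derivative_line:
 assumes p: "1 < p" and f: "Lp_vec p M f" and g: "Lp_vec p M g"
 shows "((\<lambda>t. Lp_int p M (\<lambda>x. f x + t *\<^sub>R g x)) has_real_derivative
      p * (\<integral>x. norm (f x) powr (p - 2) * (f x \<bullet> g x) \<partial>M)) (at 0)"
proof -
 note [measurable] = Lp_vec_measurable[OF f] Lp_vec_measurable[OF g]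
 have L: "Lp_vec p M (\<lambda>x. f x + t *\<^sub>R g x)" for t
  using p by (intro Lp_vec_add Lp_vec_scaleR f g) auto
 define q where "q t x = (norm (f x + t *\<^sub>R g x) powr p - norm (f x) powr p) / t" for t x
 have "((\<lambda>t. \<integral>x. q t x \<partial>M) \<longlongrightarrow> (\<integral>x. p * (norm (f x) powr (p - 2) * (f x \<bullet> g x)) \<partial>M)) (at 0)"
  unfolding tendsto_at_iff_sequentially
 proof (intro allI impI)
  fix X :: "nat \<Rightarrow> real" assume X: "\<forall>i. X i \<in> UNIV - {0}" "X \<longlonglongrightarrow> 0"
  then obtain N where N: "\<And>n. n \<ge> N \<Longrightarrow> norm (X n) < 1" using LIMSEQ_D[OF X(2), of 1] by auto
  have "(\<lambda>i. \<integral>x. q (X (i + N)) x \<partial>M) \<longlonglongrightarrow> (\<integral>x. p * (norm (f x) powr (p - 2) * (f x \<bullet> g x)) \<partial>M)"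
  proof (rule integral_dominated_convergence)
   show "integrable M (\<lambda>x. p * (2 powr (p - 1) * (norm (f x) powr p + norm (g x) powr p)))"
    using f g by (auto simp: Lp_vec_def)
   show "AE x in M. (\<lambda>i. q (X (i + N)) x) \<longlonglongrightarrow> p * (norm (f x) powr (p - 2) * (f x \<bullet> g x))"
   proof (rule AE_I2)
    fix x
    have "((\<lambda>t. q t x) \<longlongrightarrow> p * (norm (f x) powr (p - 2) * (f x \<bullet> g x))) (at 0)"
     using has_real_derivative_norm_powr_line[OF p, of "f x" "g x" 0]
     by (simp add: DERIV_def q_def mult.assoc)
    then show "(\<lambda>i. q (X (i + N)) x) \<longlonglongrightarrow> p * (norm (f x) powr (p - 2) * (f x \<bullet> g x))"
     unfolding tendsto_at_iff_sequentially comp_def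
     using X LIMSEQ_ignore_initial_segment[OF X(2), of N] by auto
   qed
   show "AE x in M. norm (q (X (i + N)) x) \<le> p * (2 powr (p - 1) * (norm (f x) powr p + norm (g x) powr p))" for i
   proof (rule AE_I2)
    fix x
    have X1: "\<bar>X (i + N)\<bar> \<le> 1" "X (i + N) \<noteq> 0" using N[of "i + N"] X(1) by auto
    have "\<bar>norm (f x + X (i + N) *\<^sub>R g x) powr p - norm (f x) powr p\<bar> \<le> \<bar>X (i + N)\<bar> * (p * (norm (f x) + norm (g x)) powr p)"
     by (rule norm_powr_line_diff_le[OF p X1(1)])
    then have "norm (q (X (i + N)) x) \<le> p * (norm (f x) + norm (g x)) powr p"
     using X1 by (simp add: q_def field_simps)
    also have "\<dots> \<le> p * (2 powr (p - 1) * (norm (f x) powr p + norm (g x) powr p))"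
     using norm_add_powr_le[of p "norm (f x)" "norm (g x)"] p by simp
    finally show "norm (q (X (i + N)) x) \<le> \<dots>" .
   qed
  qed (auto simp: q_def)
  then show "((\<lambda>t. \<integral>x. q t x \<partial>M) \<circ> X) \<longlonglongrightarrow> (\<integral>x. p * (norm (f x) powr (p - 2) * (f x \<bullet> g x)) \<partial>M)"
   unfolding comp_def by (rule LIMSEQ_offset)
 qed
 moreover have "(\<integral>x. q t x \<partial>M) = (Lp_int p M (\<lambda>x. f x + t *\<^sub>R g x) - Lp_int p M f) / t" for t
  unfolding q_def Lp_int_def
  using Lp_vec_integrable[OF L[of t]] Lp_vec_integrable[OF f] by simp
 ultimately show ?thesis by (simp add: DERIV_def)
qed

section \<open>Smooth functions, bump functions and test functions\<close>

abbreviation pd :: "'n::finite \<Rightarrow> (real^'n \<Rightarrow> real) \<Rightarrow> real^'n \<Rightarrow> real" where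
 "pd i f \<equiv> (\<lambda>x. frechet_derivative f (at x) (axis i 1))"

lemma smooth_funD:
 assumes "smooth_fun f"
 shows "f differentiable (at x)" "continuous_on UNIV f" "smooth_fun (pd i f)"
  "(f has_derivative frechet_derivative f (at x)) (at x)"
proof -
 show "f differentiable (at x)"
  using assms by (cases rule: smooth_fun.cases) (auto simp: differentiable_on_def)
 then show "(f has_derivative frechet_derivative f (at x)) (at x)"
  by (simp add: frechet_derivative_works)
 show "continuous_on UNIV f" "smooth_fun (pd i f)"
  using assms by (cases rule: smooth_fun.cases; simp)+
qed

lemma smooth_fun_const: "smooth_fun (\<lambda>x::real^'n::finite. c)"
proof -
 have "smooth_fun f" if "\<exists>c. f = (\<lambda>x::real^'n. c)" for f
  using that
 proof (coinduction arbitrary: f rule: smooth_fun.coinduct)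
  case smooth_fun
  then show ?case by (force simp: frechet_derivative_const)
 qed
 then show ?thesis by blast
qed

text \<open>The coinduction requires a class closed under partial derivatives. Single products are
  not closed, but finite sums of products are, by the Leibniz rule; hence the list of pairs.\<close>

lemma smooth_fun_sum_mult:
 fixes ps :: "((real^'n::finite \<Rightarrow> real) \<times> (real^'n \<Rightarrow> real)) list"
 assumes "\<forall>(f, g) \<in> set ps. smooth_fun f \<and> smooth_fun g"
 shows "smooth_fun (\<lambda>x. \<Sum>(f, g)\<leftarrow>ps. f x * g x)"
 using assms
proof (coinduction arbitrary: ps rule: smooth_fun.coinduct)
 case smooth_fun
 define F where "F ps = (\<lambda>x::real^'n. \<Sum>(f, g)\<leftarrow>ps. f x * g x)"
  for ps :: "((real^'n \<Rightarrow> real) \<times> (real^'n \<Rightarrow> real)) list"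
 define N where "N i ps = concat (map (\<lambda>(f, g). [(pd i f, g), (f, pd i g)]) ps)"
  for i and ps :: "((real^'n \<Rightarrow> real) \<times> (real^'n \<Rightarrow> real)) list"
 have D: "F qs differentiable (at x) \<and> pd i (F qs) x = F (N i qs) x"
  if "\<forall>(f, g) \<in> set qs. smooth_fun f \<and> smooth_fun g" for qs x i
  using that
 proof (induction qs)
  case Nil
  then show ?case by (simp add: F_def N_def frechet_derivative_const)
 next
  case (Cons q qs)
  obtain f g where q: "q = (f, g)" by force
  have f: "smooth_fun f" "smooth_fun g" using Cons.prems q by auto
  have IH: "F qs differentiable (at x)" "pd i (F qs) x = F (N i qs) x"
   using Cons by auto
  have "((\<lambda>x. f x * g x + F qs x) has_derivative
   (\<lambda>h. (f x * frechet_derivative g (at x) h + frechet_derivative f (at x) h * g x) + frechet_derivative (F qs) (at x) h)) (at x)"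
   by (intro has_derivative_add has_derivative_mult smooth_funD(4) f IH(1)[unfolded frechet_derivative_works])
  moreover have "F (q # qs) = (\<lambda>x. f x * g x + F qs x)" by (simp add: F_def q)
  ultimately have d: "(F (q # qs) has_derivative
   (\<lambda>h. (f x * frechet_derivative g (at x) h + frechet_derivative f (at x) h * g x) + frechet_derivative (F qs) (at x) h)) (at x)"
   by simp
  show ?case
   using d IH(2) frechet_derivative_at[OF d, symmetric]
   by (auto simp: differentiable_def F_def N_def q)
 qed
 have sm: "\<forall>(f, g) \<in> set (N i ps). smooth_fun f \<and> smooth_fun g" for i
  using smooth_fun by (auto simp: N_def intro: smooth_funD(3))
 have diff: "F ps differentiable_on UNIV"
  using D[OF smooth_fun] by (auto simp: differentiable_on_def)
 have "pd i (F ps) = F (N i ps)" for i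
  using D[OF smooth_fun] by blast
 then show ?case
  using diff differentiable_imp_continuous_on[OF diff] sm
  unfolding F_def by blast
qed

lemma smooth_fun_mult:
 assumes "smooth_fun f" "smooth_fun g"
 shows "smooth_fun (\<lambda>x. f x * g x)"
 using smooth_fun_sum_mult[of "[(f, g)]"] assms by simp

lemma smooth_fun_prod:
 assumes "finite I" "\<And>i. i \<in> I \<Longrightarrow> smooth_fun (f i)"
 shows "smooth_fun (\<lambda>x. \<Prod>i\<in>I. f i x)"
 using assms by (induction) (auto intro: smooth_fun_const smooth_fun_mult)

text \<open>A sequence D of successive derivatives is given, and the class closed under partial
  derivatives consists of the multiples of D n composed with the affine form.\<close>

lemma smooth_fun_ridge:
 fixes D :: "nat \<Rightarrow> real \<Rightarrow> real" and l :: "real^'n::finite"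
 assumes D: "\<And>n t. (D n has_real_derivative D (Suc n) t) (at t)"
 shows "smooth_fun (\<lambda>x. D 0 (l \<bullet> x + b))"
proof -
 have "smooth_fun f" if "\<exists>c n. f = (\<lambda>x. c * D n (l \<bullet> x + b))" for f
  using that
 proof (coinduction arbitrary: f rule: smooth_fun.coinduct)
  case smooth_fun
  then obtain c n where f: "f = (\<lambda>x. c * D n (l \<bullet> x + b))" by blast
  have d: "(f has_derivative (\<lambda>h. c * ((l \<bullet> h) * D (Suc n) (l \<bullet> x + b)))) (at x)" for x
  proof -
   have "((\<lambda>x. l \<bullet> x + b) has_derivative (\<lambda>h. l \<bullet> h)) (at x)"
    by (auto intro!: derivative_eq_intros)
   from has_derivative_compose[OF this D[of n, unfolded has_field_derivative_def]]
   show ?thesis unfolding f by (auto intro!: derivative_eq_intros simp: mult.commute)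
  qed
  have "f differentiable_on UNIV" using d by (auto simp: differentiable_on_def differentiable_def)
  moreover have "pd i f = (\<lambda>x. (c * (l \<bullet> axis i 1)) * D (Suc n) (l \<bullet> x + b))" for i
   using frechet_derivative_at[OF d, symmetric] by (auto simp: mult.assoc)
  ultimately show ?case using differentiable_imp_continuous_on by blast
 qed
 moreover have "\<exists>c n. (\<lambda>x. D 0 (l \<bullet> x + b)) = (\<lambda>x. c * D n (l \<bullet> x + b))"
  by (rule exI[of _ 1], rule exI[of _ 0]) simp
 ultimately show ?thesis by blast
qed

definition flat_exp :: "real \<Rightarrow> real" where
 "flat_exp t = (if 0 < t then exp (- 1 / t) else 0)"

lemma poly_exp_decay: "((\<lambda>y. poly q y * exp (- y)) \<longlongrightarrow> 0) (at_top :: real filter)"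
proof (induction q)
 case (pCons a q)
 have gen: "((\<lambda>y. y ^ k * (poly q y * exp (- y))) \<longlongrightarrow> 0) (at_top :: real filter)" for k :: nat and q
 proof -
  have "((\<lambda>y. \<Sum>i\<le>degree q. coeff q i * (y ^ (i + k) / exp y)) \<longlongrightarrow> (\<Sum>i\<le>degree q. coeff q i * 0)) (at_top :: real filter)"
   by (intro tendsto_intros tendsto_power_div_exp_0)
  then show ?thesis
   by (simp add: poly_altdef sum_distrib_left sum_distrib_right exp_minus field_simps power_add)
 qed
 show ?case using gen[of 0 "pCons a q"] by simp
qed simp

text \<open>With y = 1/t, the derivative of q(1/t) exp(-1/t) is y^2 (q(y) - q'(y)) exp(-y), which is
  the recursion; the factor \<open>[:0, 0, 1:]\<close> is y^2.\<close>

fun flat_poly :: "nat \<Rightarrow> real poly" where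
 "flat_poly 0 = 1"
| "flat_poly (Suc n) = [:0, 0, 1:] * (flat_poly n - pderiv (flat_poly n))"

definition flat_deriv :: "nat \<Rightarrow> real \<Rightarrow> real" where
 "flat_deriv n t = (if 0 < t then poly (flat_poly n) (1 / t) * exp (- 1 / t) else 0)"

lemma flat_deriv_0: "flat_deriv 0 = flat_exp"
 by (auto simp: flat_deriv_def flat_exp_def)

lemma flat_deriv_has_derivative: "(flat_deriv n has_real_derivative flat_deriv (Suc n) t) (at t)"
proof (rule linorder_cases[of t 0])
 assume "t < 0"
 have "((\<lambda>_. 0) has_real_derivative flat_deriv (Suc n) t) (at t)"
  using \<open>t < 0\<close> by (simp add: flat_deriv_def)
 then show ?thesis
  by (rule has_field_derivative_transform_within_open[of _ _ _ "{..<0}"]) (use \<open>t < 0\<close> in \<open>auto simp: flat_deriv_def\<close>)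
next
 assume "0 < t"
 have "((\<lambda>t. poly (flat_poly n) (1 / t) * exp (- 1 / t)) has_real_derivative
   poly (pderiv (flat_poly n)) (1 / t) * (- 1 / t^2) * exp (- 1 / t) + poly (flat_poly n) (1 / t) * (exp (- 1 / t) * (1 / t^2))) (at t)"
  using \<open>0 < t\<close> by (auto intro!: derivative_eq_intros DERIV_chain2[OF poly_DERIV] simp: power2_eq_square field_simps)
 also have "poly (pderiv (flat_poly n)) (1 / t) * (- 1 / t^2) * exp (- 1 / t) + poly (flat_poly n) (1 / t) * (exp (- 1 / t) * (1 / t^2)) = flat_deriv (Suc n) t"
  using \<open>0 < t\<close> by (simp add: flat_deriv_def power2_eq_square field_simps)
 finally show ?thesis
  by (rule has_field_derivative_transform_within_open[of _ _ _ "{0<..}"]) (use \<open>0 < t\<close> in \<open>auto simp: flat_deriv_def\<close>)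
next
 assume t: "t = 0"
 \<comment> \<open>The factor \<open>[:0, 1:]\<close> accounts for the 1/h of the difference
   quotient at 0, so flatness reduces to exponential decay against a polynomial.\<close>
 have "((\<lambda>t. poly ([:0, 1:] * flat_poly n) (inverse t) * exp (- inverse t)) \<longlongrightarrow> 0) (at_right 0)"
  by (rule filterlim_compose[OF poly_exp_decay filterlim_inverse_at_top_right])
 then have "((\<lambda>h. flat_deriv n h / h) \<longlongrightarrow> 0) (at_right 0)"
  by (rule Lim_transform_eventually)
    (auto simp: eventually_at_right_field flat_deriv_def field_simps intro!: exI[of _ 1])
 moreover have "((\<lambda>h. flat_deriv n h / h) \<longlongrightarrow> 0) (at_left 0)"
  by (rule Lim_transform_eventually[of "\<lambda>_. 0"])
    (auto simp: eventually_at_left_field flat_deriv_def intro!: exI[of _ "-1"])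
 ultimately have "((\<lambda>h. flat_deriv n h / h) \<longlongrightarrow> 0) (at 0)"
  by (rule filterlim_split_at[rotated])
 then show ?thesis by (simp add: t DERIV_def flat_deriv_def)
qed

lemma smooth_flat_exp: "smooth_fun (\<lambda>x. flat_exp (l \<bullet> x + b))"
 using smooth_fun_ridge[of flat_deriv l b] flat_deriv_has_derivative by (simp add: flat_deriv_0)

lemma flat_exp_bounds: "0 \<le> flat_exp t" "flat_exp t \<le> 1" "0 < flat_exp t \<longleftrightarrow> 0 < t" "flat_exp t \<noteq> 0 \<longleftrightarrow> 0 < t"
 by (auto simp: flat_exp_def)

text \<open>Nonzero exactly on the open box and with values in [0,1]. The parameter m sharpens the
  bump: as m grows it tends pointwise to the indicator of the box.\<close>

definition box_bump :: "real \<Rightarrow> real^'n::finite \<Rightarrow> real^'n \<Rightarrow> real^'n \<Rightarrow> real" where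
 "box_bump m a b x = (\<Prod>i\<in>UNIV. flat_exp (m * (x $ i - a $ i)) * flat_exp (m * (b $ i - x $ i)))"

lemma smooth_box_bump: "smooth_fun (box_bump m a b)"
proof -
 have "smooth_fun (\<lambda>x. flat_exp ((m *\<^sub>R axis i 1) \<bullet> x + (- m * a $ i)) * flat_exp (((- m) *\<^sub>R axis i 1) \<bullet> x + m * b $ i))" for i
  by (intro smooth_fun_mult smooth_flat_exp)
 then have "smooth_fun (\<lambda>x. \<Prod>i\<in>UNIV. flat_exp ((m *\<^sub>R axis i 1) \<bullet> x + (- m * a $ i)) * flat_exp (((- m) *\<^sub>R axis i 1) \<bullet> x + m * b $ i))"
  by (intro smooth_fun_prod) auto
 moreover have "(\<lambda>x. \<Prod>i\<in>UNIV. flat_exp ((m *\<^sub>R axis i 1) \<bullet> x + (- m * a $ i)) * flat_exp (((- m) *\<^sub>R axis i 1) \<bullet> x + m * b $ i)) = box_bump m a b"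
  by (auto simp: box_bump_def inner_axis' algebra_simps)
 ultimately show ?thesis by simp
qed

lemma box_bump_bounds:
 assumes "m > 0"
 shows "0 \<le> box_bump m a b x" "box_bump m a b x \<le> 1" "box_bump m a b x \<noteq> 0 \<longleftrightarrow> x \<in> box a b"
proof -
 show "0 \<le> box_bump m a b x"
  unfolding box_bump_def by (intro prod_nonneg mult_nonneg_nonneg ballI flat_exp_bounds)
 show "box_bump m a b x \<le> 1"
  unfolding box_bump_def by (intro prod_le_1 conjI mult_nonneg_nonneg mult_le_one flat_exp_bounds)
 show "box_bump m a b x \<noteq> 0 \<longleftrightarrow> x \<in> box a b"
  using assms by (auto simp: box_bump_def mem_box_cart flat_exp_bounds zero_less_mult_iff)
qed

lemma box_bump_tendsto: "(\<lambda>m. box_bump (real (Suc m)) a b x) \<longlonglongrightarrow> indicator (box a b) x"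
proof (cases "x \<in> box a b")
 case True
 have f: "(\<lambda>m. flat_exp (real (Suc m) * t)) \<longlonglongrightarrow> 1" if "t > 0" for t
 proof -
  have "(\<lambda>m. exp ((- 1 / t) * inverse (real (Suc m)))) \<longlonglongrightarrow> exp ((- 1 / t) * 0)"
   by (intro tendsto_intros LIMSEQ_inverse_real_of_nat)
  moreover have "exp ((- 1 / t) * inverse (real (Suc m))) = flat_exp (real (Suc m) * t)" for m
   using that by (simp add: flat_exp_def field_simps del: of_nat_Suc)
  ultimately show ?thesis by simp
 qed
 have "(\<lambda>m. box_bump (real (Suc m)) a b x) \<longlonglongrightarrow> (\<Prod>i\<in>(UNIV::'a set). 1 * 1)"
  unfolding box_bump_def using True by (intro tendsto_intros f) (auto simp: mem_box_cart)
 then show ?thesis using True by simp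
next
 case False
 then have "box_bump (real (Suc m)) a b x = 0" for m
  using box_bump_bounds(3)[of "real (Suc m)" a b x] by auto
 then show ?thesis using False by simp
qed

lemma test_box_bump:
 assumes "m > 0" "cbox a b \<subseteq> W"
 shows "test_fun W (\<lambda>x. C * box_bump m a b x)"
proof -
 have sub: "closure {x. C * box_bump m a b x \<noteq> 0} \<subseteq> cbox a b"
  by (rule closure_minimal)
    (auto simp: box_bump_bounds(3)[OF assms(1)] intro: subsetD[OF box_subset_cbox])
 then have "compact (closure {x. C * box_bump m a b x \<noteq> 0})"
  by (metis bounded_cbox bounded_subset closed_closure compact_eq_bounded_closed)
 then show ?thesis unfolding test_fun_def
  using sub assms(2) by (auto intro: smooth_fun_mult smooth_fun_const smooth_box_bump)
qed

section \<open>Lebesgue measure on open sets and the fundamental lemma of the calculus of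
  variations\<close>

lemma AE_lebesgue_on_iff:
 "W \<in> sets lebesgue \<Longrightarrow> (AE x in lebesgue_on W. P x) \<longleftrightarrow> (AE x in lebesgue. x \<in> W \<longrightarrow> P x)"
 by (rule AE_restrict_space_iff) simp

lemma integrable_lebesgue_on_iff:
 fixes f :: "'a::euclidean_space \<Rightarrow> 'b::{banach, second_countable_topology}"
 shows "W \<in> sets lebesgue \<Longrightarrow> integrable (lebesgue_on W) f \<longleftrightarrow> integrable lebesgue (\<lambda>x. indicator W x *\<^sub>R f x)"
 by (rule integrable_restrict_space) simp

lemma integral_lebesgue_on:
 fixes f :: "'a::euclidean_space \<Rightarrow> 'b::{banach, second_countable_topology}"
 shows "W \<in> sets lebesgue \<Longrightarrow> integral\<^sup>L (lebesgue_on W) f = integral\<^sup>L lebesgue (\<lambda>x. indicator W x *\<^sub>R f x)"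
 by (rule integral_restrict_space) simp

lemma open_sets_lebesgue: "open W \<Longrightarrow> W \<in> sets lebesgue"
 by (metis borel_open sets_completionI_sets sets_lborel)

lemma continuous_measurable_lebesgue_on:
 fixes f :: "real^'n::finite \<Rightarrow> 'b::real_normed_vector"
 assumes "continuous_on UNIV f"
 shows "f \<in> borel_measurable (lebesgue_on W)"
proof -
 have "f \<in> borel_measurable lebesgue"
  using borel_measurable_continuous_onI[OF assms] by (intro measurable_completion) simp
 then show ?thesis by (rule measurable_restrict_space1)
qed

text \<open>The positive and negative parts of f are compared as densities: the two measures agree
  on the intersection-stable generator of open boxes, hence everywhere, and densities are unique
  almost everywhere.\<close>

lemma AE_zero_if_box_integrals_zero:
 fixes f :: "'a::euclidean_space \<Rightarrow> real"
 assumes f: "integrable lborel f" and z: "\<And>a b. (\<integral>x. indicator (box a b) x * f x \<partial>lborel) = 0"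
 shows "AE x in lborel. f x = 0"
proof -
 note [measurable] = borel_measurable_integrable[OF f]
 \<comment> \<open>\<open>ennreal\<close> sends negative reals to 0, so these are the densities of
   the positive and of the negative part.\<close>
 let ?M = "density lborel (\<lambda>x. ennreal (f x))" and ?N = "density lborel (\<lambda>x. ennreal (- f x))"
 have fin: "(\<integral>\<^sup>+x. ennreal (g x) * indicator A x \<partial>lborel) \<noteq> \<infinity>" if "integrable lborel g" "A \<in> sets borel" for g :: "'a \<Rightarrow> real" and A
 proof -
  have "(\<integral>\<^sup>+x. ennreal (g x) * indicator A x \<partial>lborel) \<le> (\<integral>\<^sup>+x. ennreal (norm (g x)) \<partial>lborel)"
   by (intro nn_integral_mono) (auto split: split_indicator intro!: ennreal_leI)
  also have "\<dots> < \<infinity>" using that by (simp add: integrable_iff_bounded)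
  finally show ?thesis by simp
 qed
 have "?M = ?N"
 proof (rule measure_eqI_generator_eq)
  let ?E = "range (\<lambda>(a, b). box a b::'a set)"
  show "Int_stable ?E" by (auto simp: Int_stable_def box_Int_box)
  show "?E \<subseteq> Pow UNIV" "sets ?M = sigma_sets UNIV ?E" "sets ?N = sigma_sets UNIV ?E"
   by (simp_all add: borel_eq_box)
  let ?A = "\<lambda>n::nat. box (- (real n *\<^sub>R One)) (real n *\<^sub>R One) :: 'a set"
  show "range ?A \<subseteq> ?E" "(\<Union>i. ?A i) = UNIV" unfolding UN_box_eq_UNIV by auto
  show "emeasure ?M (?A i) \<noteq> \<infinity>" for i
   using fin[OF f, of "?A i"] by (simp add: emeasure_density)
  show "emeasure ?M X = emeasure ?N X" if "X \<in> ?E" for X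
  proof -
   have "\<exists>a b. X = box a b" using that by auto
   then obtain a b where X: "X = box a b" by blast
   have i: "integrable lborel (\<lambda>x. indicator X x * f x)"
    using integrable_mult_indicator[OF _ f, of X] X by simp
   have "(\<integral>\<^sup>+x. ennreal (indicator X x * f x) \<partial>lborel) = (\<integral>\<^sup>+x. ennreal (f x) * indicator X x \<partial>lborel)"
    "(\<integral>\<^sup>+x. ennreal (- (indicator X x * f x)) \<partial>lborel) = (\<integral>\<^sup>+x. ennreal (- f x) * indicator X x \<partial>lborel)"
    by (auto intro!: nn_integral_cong split: split_indicator)
   then have e: "enn2real (\<integral>\<^sup>+x. ennreal (f x) * indicator X x \<partial>lborel) = enn2real (\<integral>\<^sup>+x. ennreal (- f x) * indicator X x \<partial>lborel)"
    using real_lebesgue_integral_def[OF i] z[of a b] X by simp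
   have "X \<in> sets borel" using X by simp
   then have "(\<integral>\<^sup>+x. ennreal (f x) * indicator X x \<partial>lborel) < top" "(\<integral>\<^sup>+x. ennreal (- f x) * indicator X x \<partial>lborel) < top"
    using fin[of f X] fin[of "\<lambda>x. - f x" X] f by (auto simp: less_top)
   from this[THEN ennreal_enn2real]
   have "(\<integral>\<^sup>+x. ennreal (f x) * indicator X x \<partial>lborel) = (\<integral>\<^sup>+x. ennreal (- f x) * indicator X x \<partial>lborel)"
    unfolding e by simp
   then show ?thesis using \<open>X \<in> sets borel\<close> by (simp add: emeasure_density)
  qed
 qed
 moreover have "(\<integral>\<^sup>+x. ennreal (f x) \<partial>lborel) \<noteq> \<infinity>" using fin[OF f, of UNIV] by simp
 ultimately have "AE x in lborel. ennreal (f x) = ennreal (- f x)"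
  by (subst (asm) finite_density_unique) auto
 then show ?thesis
 proof eventually_elim
  case (elim x)
  then show ?case
   by (cases "f x \<ge> 0") (auto simp: ennreal_neg ennreal_eq_0_iff dest!: sym[of 0])
 qed
qed

lemma test_fun_bounds:
 assumes "test_fun W f"
 obtains K B where "compact K" "K \<subseteq> W" "0 \<le> B" "\<And>x. x \<notin> K \<Longrightarrow> f x = 0" "\<And>x i. x \<notin> K \<Longrightarrow> pd i f x = 0"
  "\<And>x. \<bar>f x\<bar> \<le> B" "\<And>x i. \<bar>pd i f x\<bar> \<le> B"
proof -
 define K where "K = closure {x. f x \<noteq> 0}"
 have K: "compact K" "K \<subseteq> W" and s: "smooth_fun f" using assms by (auto simp: test_fun_def K_def)
 have z: "f x = 0" if "x \<notin> K" for x using that closure_subset[of "{x. f x \<noteq> 0}"] by (auto simp: K_def)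
 have zd: "pd i f x = 0" if "x \<notin> K" for x i
 proof -
  have "((\<lambda>_. 0) has_derivative (\<lambda>_. 0)) (at x)" by simp
  then have "(f has_derivative (\<lambda>_. 0)) (at x)"
   by (rule has_derivative_transform_within_open[of _ _ _ _ "- K"]) (use that z K in \<open>auto simp: open_Compl compact_imp_closed\<close>)
  then show ?thesis by (metis frechet_derivative_at)
 qed
 have bd: "\<exists>B. \<forall>x. \<bar>g x\<bar> \<le> B" if "continuous_on UNIV g" "\<And>x. x \<notin> K \<Longrightarrow> g x = 0" for g :: "real^'a \<Rightarrow> real"
 proof -
  have "bounded (g ` K)"
   by (intro compact_imp_bounded compact_continuous_image continuous_on_subset[OF that(1)] K) auto
  then obtain B where "\<And>x. x \<in> K \<Longrightarrow> \<bar>g x\<bar> \<le> B" by (auto simp: bounded_iff)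
  then have "\<bar>g x\<bar> \<le> max B 0" for x using that(2)[of x] by (cases "x \<in> K") (auto simp: le_max_iff_disj)
  then show ?thesis by blast
 qed
 obtain B where B: "\<And>x. \<bar>f x\<bar> \<le> B" using bd[OF smooth_funD(2)[OF s] z] by blast
 have "\<forall>i. \<exists>B. \<forall>x. \<bar>pd i f x\<bar> \<le> B"
  using bd[OF smooth_funD(2)[OF smooth_funD(3)[OF s]] zd] by blast
 then obtain C where C: "\<And>i x. \<bar>pd i f x\<bar> \<le> C i" by metis
 have "\<bar>pd i f x\<bar> \<le> \<bar>B\<bar> + (\<Sum>i\<in>UNIV. \<bar>C i\<bar>)" for i x
 proof -
  have "\<bar>C i\<bar> \<le> (\<Sum>i\<in>UNIV. \<bar>C i\<bar>)" by (rule member_le_sum) auto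
  then show ?thesis using C[of x i] by linarith
 qed
 moreover have "\<bar>f x\<bar> \<le> \<bar>B\<bar> + (\<Sum>i\<in>UNIV. \<bar>C i\<bar>)" for x
  using B[of x] sum_nonneg[of UNIV "\<lambda>i. \<bar>C i\<bar>"] by linarith
 moreover have "0 \<le> \<bar>B\<bar> + (\<Sum>i\<in>UNIV. \<bar>C i\<bar>)" by (simp add: sum_nonneg add_nonneg_nonneg)
 ultimately show ?thesis using that K z zd by blast
qed

lemma loc_integrable_mult:
 fixes u :: "real^'n::finite \<Rightarrow> real"
 assumes u: "loc_integrable W u" and O: "W \<in> sets lebesgue" and K: "compact K" "K \<subseteq> W"
  and g: "continuous_on UNIV g" "\<And>x. x \<notin> K \<Longrightarrow> g x = 0" "\<And>x. \<bar>g x\<bar> \<le> B"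
 shows "integrable (lebesgue_on W) (\<lambda>x. u x * g x)"
proof -
 have Kl: "K \<in> sets lebesgue" using K by (metis borel_compact sets_completionI_sets sets_lborel)
 have "integrable (lebesgue_on K) u" using u K by (auto simp: loc_integrable_def)
 then have i: "integrable lebesgue (\<lambda>x. indicator K x *\<^sub>R u x)"
  by (simp add: integrable_lebesgue_on_iff Kl)
 have m: "g \<in> borel_measurable lebesgue"
  using borel_measurable_continuous_onI[OF g(1)] by (intro measurable_completion) simp
 have "integrable lebesgue (\<lambda>x. (indicator K x *\<^sub>R u x) * g x)"
 proof (rule Bochner_Integration.integrable_bound[OF integrable_mult_left[OF i, of B]])
  show "AE x in lebesgue. norm ((indicator K x *\<^sub>R u x) * g x) \<le> norm ((indicator K x *\<^sub>R u x) * B)"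
  proof (rule AE_I2)
   fix x
   have "\<bar>g x\<bar> \<le> \<bar>B\<bar>" using g(3)[of x] by linarith
   then show "norm ((indicator K x *\<^sub>R u x) * g x) \<le> norm ((indicator K x *\<^sub>R u x) * B)"
    unfolding real_norm_def abs_mult[of _ "g x"] abs_mult[of _ B] by (intro mult_left_mono) auto
  qed
 qed (intro borel_measurable_times m borel_measurable_integrable[OF i])
 moreover have "(\<lambda>x. (indicator K x *\<^sub>R u x) * g x) = (\<lambda>x. indicator W x *\<^sub>R (u x * g x))"
  using g(2) K(2) by (intro ext) (auto simp: indicator_def)
 ultimately show ?thesis by (simp only: integrable_lebesgue_on_iff[OF O])
qed

lemma loc_integrable_test:
 assumes "loc_integrable W u" "W \<in> sets lebesgue" "test_fun W f"
 shows "integrable (lebesgue_on W) (\<lambda>x. u x * f x)" "integrable (lebesgue_on W) (\<lambda>x. u x * pd i f x)"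
proof -
 obtain K B where KB: "compact K" "K \<subseteq> W" "0 \<le> B" "\<And>x. x \<notin> K \<Longrightarrow> f x = 0" "\<And>x i. x \<notin> K \<Longrightarrow> pd i f x = 0"
  "\<And>x. \<bar>f x\<bar> \<le> B" "\<And>x i. \<bar>pd i f x\<bar> \<le> B" using test_fun_bounds[OF assms(3)] by metis
 have s: "smooth_fun f" using assms by (simp add: test_fun_def)
 show "integrable (lebesgue_on W) (\<lambda>x. u x * f x)"
  by (rule loc_integrable_mult[OF assms(1,2) KB(1,2) smooth_funD(2)[OF s] KB(4,6)])
 show "integrable (lebesgue_on W) (\<lambda>x. u x * pd i f x)"
  by (rule loc_integrable_mult[OF assms(1,2) KB(1,2) smooth_funD(2)[OF smooth_funD(3)[OF s]] KB(5,7)])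
qed

text \<open>Sharpened box bumps show that the integral over every box with closure in W vanishes, so
  f is zero almost everywhere on each such box, and countably many closed boxes exhaust W.\<close>

lemma loc_integrable_AE_zero:
 fixes f :: "real^'n::finite \<Rightarrow> real"
 assumes O: "open W" and f: "loc_integrable W f"
  and z: "\<And>\<phi>. test_fun W \<phi> \<Longrightarrow> integral\<^sup>L (lebesgue_on W) (\<lambda>x. f x * \<phi> x) = 0"
 shows "AE x in lebesgue_on W. f x = 0"
proof -
 have Ol: "W \<in> sets lebesgue" using O by (rule open_sets_lebesgue)
 have box0: "(\<integral>x. indicator (box a b) x * f x \<partial>lebesgue) = 0" if ab: "cbox a b \<subseteq> W" for a b
 proof -
  have "integrable (lebesgue_on (cbox a b)) f" using f ab by (auto simp: loc_integrable_def)
  then have i: "integrable lebesgue (\<lambda>x. indicator (cbox a b) x *\<^sub>R f x)"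
   by (simp add: integrable_lebesgue_on_iff)
  have bm: "box_bump m a b \<in> borel_measurable lebesgue" for m
   using borel_measurable_continuous_onI[OF smooth_funD(2)[OF smooth_box_bump]] by (intro measurable_completion) simp
  have "(\<lambda>m. \<integral>x. (indicator (cbox a b) x *\<^sub>R f x) * box_bump (real (Suc m)) a b x \<partial>lebesgue) \<longlonglongrightarrow>
    (\<integral>x. (indicator (cbox a b) x *\<^sub>R f x) * indicator (box a b) x \<partial>lebesgue)"
  proof (rule integral_dominated_convergence[OF _ _ integrable_norm[OF i]])
   show "AE x in lebesgue. norm ((indicator (cbox a b) x *\<^sub>R f x) * box_bump (real (Suc m)) a b x) \<le> norm (indicator (cbox a b) x *\<^sub>R f x)" for m
    using box_bump_bounds[of "real (Suc m)" a b] by (intro AE_I2) (auto simp: abs_mult intro!: mult_left_le)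
   show "AE x in lebesgue. (\<lambda>m. (indicator (cbox a b) x *\<^sub>R f x) * box_bump (real (Suc m)) a b x) \<longlonglongrightarrow> (indicator (cbox a b) x *\<^sub>R f x) * indicator (box a b) x"
    by (intro AE_I2 tendsto_intros box_bump_tendsto)
  qed (use bm borel_measurable_integrable[OF i] in \<open>auto intro!: borel_measurable_times borel_measurable_indicator\<close>)
  moreover have "(\<integral>x. (indicator (cbox a b) x *\<^sub>R f x) * box_bump (real (Suc m)) a b x \<partial>lebesgue) = 0" for m
  proof -
   have "(\<lambda>x. (indicator (cbox a b) x *\<^sub>R f x) * box_bump (real (Suc m)) a b x) = (\<lambda>x. indicator W x *\<^sub>R (f x * (1 * box_bump (real (Suc m)) a b x)))"
    (is "?l = ?r")
   proof (rule ext)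
    fix x
    show "?l x = ?r x"
    proof (cases "x \<in> box a b")
     case True
     then have "x \<in> cbox a b" "x \<in> W" using ab box_subset_cbox[of a b] by auto
     then show ?thesis by simp
    next
     case False
     then have "box_bump (real (Suc m)) a b x = 0"
      using box_bump_bounds(3)[of "real (Suc m)" a b x] by auto
     then show ?thesis by (simp del: of_nat_Suc)
    qed
   qed
   then show ?thesis
    using z[OF test_box_bump[OF _ ab, of "real (Suc m)" 1]] by (simp only: integral_lebesgue_on[OF Ol])
  qed
  ultimately have "(\<integral>x. (indicator (cbox a b) x *\<^sub>R f x) * indicator (box a b) x \<partial>lebesgue) = 0"
   by (simp add: LIMSEQ_const_iff)
  moreover have "(\<lambda>x. (indicator (cbox a b) x *\<^sub>R f x) * indicator (box a b) x) = (\<lambda>x. indicator (box a b) x * f x)"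
   using box_subset_cbox[of a b] by (intro ext) (auto simp: indicator_def)
  ultimately show ?thesis by (simp only:)
 qed
 have AEc: "AE x in lebesgue. x \<in> cbox c d \<longrightarrow> f x = 0" if cd: "cbox c d \<subseteq> W" for c d
 proof -
  have "integrable (lebesgue_on (cbox c d)) f" using f cd by (auto simp: loc_integrable_def)
  then have "integrable lebesgue (\<lambda>x. indicator (cbox c d) x *\<^sub>R f x)"
   by (simp add: integrable_lebesgue_on_iff)
  from integrable_mult_indicator[OF _ this, of "box c d"]
  have i0: "integrable lebesgue (\<lambda>x. indicator (box c d) x *\<^sub>R (indicator (cbox c d) x *\<^sub>R f x))" by simp
  have "(\<lambda>x. indicator (box c d) x *\<^sub>R (indicator (cbox c d) x *\<^sub>R f x)) = (\<lambda>x. indicator (box c d) x * f x)"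
   using box_subset_cbox[of c d] by (intro ext) (auto simp: indicator_def)
  with i0 have i: "integrable lebesgue (\<lambda>x. indicator (box c d) x * f x)" by (simp only:)
  obtain g where g: "g \<in> borel_measurable lborel" "AE x in lborel. indicator (box c d) x * f x = g x"
   using completion_ex_borel_measurable_real[OF borel_measurable_integrable[OF i]] by auto
  have AEg: "AE x in lebesgue. indicator (box c d) x * f x = g x" by (rule AE_completion) (rule g)
  have gi: "integrable lborel g"
  proof -
   have "g \<in> borel_measurable lebesgue" using g(1) by (intro measurable_completion) simp
   then have "integrable lebesgue g"
    using integrable_cong_AE[OF borel_measurable_integrable[OF i] _ AEg] i by simp
   then show ?thesis using g(1) by (simp add: integrable_completion)
  qed
  have "AE x in lborel. g x = 0"
  proof (rule AE_zero_if_box_integrals_zero[OF gi])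
   fix a b :: "real^'n"
   \<comment> \<open>An arbitrary box cut down to \<open>box c d\<close> is again a box, now with
     closure in W, so that the vanishing of box integrals applies to it.\<close>
   define a' b' where "a' = (\<Sum>i\<in>Basis. max (a\<bullet>i) (c\<bullet>i) *\<^sub>R i)" and "b' = (\<Sum>i\<in>Basis. min (b\<bullet>i) (d\<bullet>i) *\<^sub>R i)"
   have 1: "box a b \<inter> box c d = box a' b'" "cbox a b \<inter> cbox c d = cbox a' b'"
    unfolding a'_def b'_def by (rule box_Int_box, rule Int_interval)
   have "(\<integral>x. indicator (box a b) x * g x \<partial>lborel) = (\<integral>x. indicator (box a b) x * g x \<partial>lebesgue)"
    using g by (intro integral_completion[symmetric]) auto
   also have "\<dots> = (\<integral>x. indicator (box a' b') x * f x \<partial>lebesgue)"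
   proof (rule integral_cong_AE)
    have e: "indicator (box a b) x * (indicator (box c d) x * f x) = indicator (box a' b') x * f x" for x
     unfolding 1(1)[symmetric] by (auto split: split_indicator)
    show "AE x in lebesgue. indicator (box a b) x * g x = indicator (box a' b') x * f x"
     using AEg by eventually_elim (metis e)
    have "(\<lambda>x. indicator (box a b) x * (indicator (box c d) x * f x)) \<in> borel_measurable lebesgue"
     by (intro borel_measurable_times[OF borel_measurable_indicator borel_measurable_integrable[OF i]]) auto
    then show "(\<lambda>x. indicator (box a' b') x * f x) \<in> borel_measurable lebesgue" by (simp add: e)
    show "(\<lambda>x. indicator (box a b) x * g x) \<in> borel_measurable lebesgue"
     using g by (intro measurable_completion) auto
   qed
   also have "\<dots> = 0" by (rule box0) (use 1(2) cd in auto)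
   finally show "(\<integral>x. indicator (box a b) x * g x \<partial>lborel) = 0" .
  qed
  then have "AE x in lebesgue. g x = 0" by (rule AE_completion)
  moreover have "AE x in lebesgue. x \<notin> cbox c d - box c d"
   by (intro AE_not_in) (metis negligible_frontier_interval negligible_iff_null_sets)
  ultimately show ?thesis using AEg by eventually_elim (auto simp: indicator_def split: if_splits)
 qed
 obtain \<D> where D: "countable \<D>" "\<D> \<subseteq> Pow W" "\<And>X. X \<in> \<D> \<Longrightarrow> \<exists>a b. X = cbox a b" "\<Union>\<D> = W"
  using open_countable_Union_open_cbox[OF O] by metis
 have "AE x in lebesgue. x \<in> X \<longrightarrow> f x = 0" if X: "X \<in> \<D>" for X
 proof -
  obtain a b where "X = cbox a b" using D(3)[OF X] by blast
  then show ?thesis using AEc[of a b] D(2) X by auto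
 qed
 then have "AE x in lebesgue. \<forall>X\<in>\<D>. x \<in> X \<longrightarrow> f x = 0"
  by (intro AE_ball_countable[THEN iffD2] D(1) ballI)
 then show ?thesis unfolding AE_lebesgue_on_iff[OF Ol]
  by eventually_elim (use D(4) in auto)
qed

section \<open>Sobolev pairs\<close>

lemma weak_gradD:
 assumes "weak_grad W u g"
 shows "loc_integrable W u" "loc_integrable W (\<lambda>x. g x $ i)"
  "test_fun W \<phi> \<Longrightarrow> integral\<^sup>L (lebesgue_on W) (\<lambda>x. u x * pd i \<phi> x) = - integral\<^sup>L (lebesgue_on W) (\<lambda>x. g x $ i * \<phi> x)"
 using assms by (auto simp: weak_grad_def)

lemma loc_integrable_add:
 "loc_integrable W f \<Longrightarrow> loc_integrable W g \<Longrightarrow> loc_integrable W (\<lambda>x. f x + g x)"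
 by (auto simp: loc_integrable_def)

lemma loc_integrable_cmult:
 "loc_integrable W f \<Longrightarrow> loc_integrable W (\<lambda>x. c * f x)"
 by (auto simp: loc_integrable_def)

lemma weak_grad_add:
 assumes O: "open W" and "weak_grad W u g" "weak_grad W v h"
 shows "weak_grad W (\<lambda>x. u x + v x) (\<lambda>x. g x + h x)"
proof -
 note Ol = open_sets_lebesgue[OF O]
 note u = weak_gradD[OF assms(2)] and v = weak_gradD[OF assms(3)]
 show ?thesis unfolding weak_grad_def
 proof (intro conjI allI impI)
  show "loc_integrable W (\<lambda>x. u x + v x)" by (intro loc_integrable_add u v)
  show "loc_integrable W (\<lambda>x. (g x + h x) $ i)" for i
   using loc_integrable_add[OF u(2) v(2)] by simp
  fix f i assume t: "test_fun W f"
  note i = loc_integrable_test[OF u(1) Ol t] loc_integrable_test[OF v(1) Ol t]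
   loc_integrable_test(1)[OF u(2) Ol t] loc_integrable_test(1)[OF v(2) Ol t]
  show "(LINT x|lebesgue_on W. (u x + v x) * pd i f x) = - (LINT x|lebesgue_on W. (g x + h x) $ i * f x)"
   using u(3)[OF t, of i] v(3)[OF t, of i] i by (simp add: distrib_right)
 qed
qed

lemma weak_grad_cmult:
 assumes "weak_grad W u g"
 shows "weak_grad W (\<lambda>x. c * u x) (\<lambda>x. c *\<^sub>R g x)"
proof -
 note u = weak_gradD[OF assms]
 show ?thesis unfolding weak_grad_def
 proof (intro conjI allI impI)
  show "loc_integrable W (\<lambda>x. c * u x)" by (intro loc_integrable_cmult u)
  show "loc_integrable W (\<lambda>x. (c *\<^sub>R g x) $ i)" for i
   using loc_integrable_cmult[OF u(2)] by simp
  fix f i assume t: "test_fun W f"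
  show "(LINT x|lebesgue_on W. (c * u x) * pd i f x) = - (LINT x|lebesgue_on W. (c *\<^sub>R g x) $ i * f x)"
   using u(3)[OF t, of i] by (simp add: mult.assoc)
 qed
qed

lemma AE_lebesgue_on_subset:
 assumes "AE x in lebesgue_on W. P x" "K \<subseteq> W" "K \<in> sets lebesgue" "W \<in> sets lebesgue"
 shows "AE x in lebesgue_on K. P x"
 using assms by (auto simp: AE_lebesgue_on_iff elim!: eventually_mono)

lemma loc_integrable_cong_AE:
 assumes "loc_integrable W f" "g \<in> borel_measurable (lebesgue_on W)" "AE x in lebesgue_on W. f x = g x"
  and O: "W \<in> sets lebesgue"
 shows "loc_integrable W g"
 unfolding loc_integrable_def
proof (intro conjI allI impI)
 fix K assume K: "compact K \<and> K \<subseteq> W"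
 then have Kl: "K \<in> sets lebesgue" by (metis borel_compact sets_completionI_sets sets_lborel)
 have m: "g \<in> borel_measurable (lebesgue_on K)"
  by (rule measurable_restrict_mono[OF assms(2)]) (use K in auto)
 have i: "integrable (lebesgue_on K) f" using assms(1) K by (auto simp: loc_integrable_def)
 have "AE x in lebesgue_on K. f x = g x"
  using AE_lebesgue_on_subset[OF assms(3) _ Kl O] K by auto
 then show "integrable (lebesgue_on K) g"
  using integrable_cong_AE[OF borel_measurable_integrable[OF i] m] i by simp
qed (rule assms)

lemma weak_grad_cong_AE:
 assumes O: "open W" and w: "weak_grad W u g"
  and m: "u' \<in> borel_measurable (lebesgue_on W)" "g' \<in> borel_measurable (lebesgue_on W)"
  and ae: "AE x in lebesgue_on W. u x = u' x" "AE x in lebesgue_on W. g x = g' x"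
 shows "weak_grad W u' g'"
proof -
 note Ol = open_sets_lebesgue[OF O]
 note u = weak_gradD[OF w]
 have gm: "(\<lambda>x. g' x $ i) \<in> borel_measurable (lebesgue_on W)" for i
  using borel_measurable_inner[OF m(2) borel_measurable_const[of "axis i 1"]] by (simp add: inner_axis)
 have l: "loc_integrable W u'" "loc_integrable W (\<lambda>x. g' x $ i)" for i
  by (rule loc_integrable_cong_AE[OF u(1) m(1) ae(1) Ol],
    rule loc_integrable_cong_AE[OF u(2) gm _ Ol], use ae(2) in eventually_elim, simp)
 show ?thesis unfolding weak_grad_def
 proof (intro conjI allI impI l)
  fix f i assume t: "test_fun W f"
  have "(LINT x|lebesgue_on W. u' x * pd i f x) = (LINT x|lebesgue_on W. u x * pd i f x)"
   by (rule integral_cong_AE[OF borel_measurable_integrable borel_measurable_integrable])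
     (use loc_integrable_test[OF l(1) Ol t] loc_integrable_test[OF u(1) Ol t] ae(1) in auto)
  also have "\<dots> = - (LINT x|lebesgue_on W. g x $ i * f x)" by (rule u(3)[OF t])
  also have "(LINT x|lebesgue_on W. g x $ i * f x) = (LINT x|lebesgue_on W. g' x $ i * f x)"
   by (rule integral_cong_AE[OF borel_measurable_integrable borel_measurable_integrable])
     (use loc_integrable_test[OF l(2) Ol t] loc_integrable_test[OF u(2) Ol t] ae(2) in auto)
  finally show "(LINT x|lebesgue_on W. u' x * pd i f x) = - (LINT x|lebesgue_on W. g' x $ i * f x)" .
 qed
qed

lemma weak_grad_unique:
 assumes O: "open W" and w: "weak_grad W u g" "weak_grad W u h"
 shows "AE x in lebesgue_on W. g x = h x"
proof -
 note Ol = open_sets_lebesgue[OF O]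
 note g = weak_gradD[OF w(1)] and h = weak_gradD[OF w(2)]
 have "AE x in lebesgue_on W. g x $ i + (- 1) * h x $ i = 0" for i
 proof (rule loc_integrable_AE_zero[OF O])
  show "loc_integrable W (\<lambda>x. g x $ i + (- 1) * h x $ i)"
   by (intro loc_integrable_add loc_integrable_cmult g h)
  fix \<phi> assume t: "test_fun W \<phi>"
  show "(LINT x|lebesgue_on W. (g x $ i + (- 1) * h x $ i) * \<phi> x) = 0"
   using g(3)[OF t, of i] h(3)[OF t, of i] loc_integrable_test(1)[OF g(2) Ol t, of i] loc_integrable_test(1)[OF h(2) Ol t, of i]
   by (simp add: left_diff_distrib)
 qed
 then have "AE x in lebesgue_on W. \<forall>i\<in>UNIV. g x $ i + (- 1) * h x $ i = 0"
  by (intro AE_finite_allI) auto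
 then show ?thesis by eventually_elim (simp add: vec_eq_iff)
qed

lemma borel_measurable_vec:
 fixes g :: "'a \<Rightarrow> real^'n::finite"
 assumes "\<And>i. (\<lambda>x. g x $ i) \<in> borel_measurable M"
 shows "g \<in> borel_measurable M"
 by (subst borel_measurable_euclidean_space) (use assms in \<open>auto simp: Basis_vec_def inner_axis\<close>)

lemma weak_grad_measurable:
 assumes "weak_grad W u g"
 shows "u \<in> borel_measurable (lebesgue_on W)" "g \<in> borel_measurable (lebesgue_on W)"
 using weak_gradD(1,2)[OF assms] by (auto simp: loc_integrable_def intro!: borel_measurable_vec)

lemma weak_grad_wgrad: "weak_grad W u g \<Longrightarrow> weak_grad W u (wgrad W u)"
 unfolding wgrad_def using someI[of "weak_grad W u" g] by simp

text \<open>\<open>wgrad\<close> is an arbitrary choice among weak gradients. With g as an argument,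
  limits, sums and smoothings can use whichever gradient the construction produces;
  \<open>energy_eq_pair\<close> recovers the energy.\<close>

definition W1p_pair :: "real \<Rightarrow> (real^'n::finite) set \<Rightarrow> (real^'n \<Rightarrow> real) \<Rightarrow> (real^'n \<Rightarrow> real^'n) \<Rightarrow> bool" where
 "W1p_pair p W u g \<longleftrightarrow> weak_grad W u g \<and> Lp_vec p (lebesgue_on W) u \<and> Lp_vec p (lebesgue_on W) g"

lemma W1p_iff_pair: "W1p p W u \<longleftrightarrow> (\<exists>g. W1p_pair p W u g)"
 unfolding W1p_def W1p_pair_def Lp_fun_eq using weak_grad_measurable(2)
 by (auto simp: Lp_vec_def)

lemma W1p_pair_wgrad_AE:
 assumes "open W" "W1p_pair p W u g"
 shows "AE x in lebesgue_on W. g x = wgrad W u x"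
proof -
 have "weak_grad W u g" using assms by (simp add: W1p_pair_def)
 moreover then have "weak_grad W u (wgrad W u)" by (rule weak_grad_wgrad)
 ultimately show ?thesis by (rule weak_grad_unique[OF assms(1)])
qed

text \<open>\<open>W1p\<close> provides some p-integrable weak gradient, not necessarily the chosen
  one; a.e. uniqueness transfers integrability to \<open>wgrad W u\<close>.\<close>

lemma W1p_pair_wgrad:
 assumes "open W" "W1p p W u"
 shows "W1p_pair p W u (wgrad W u)"
proof -
 obtain g where g: "W1p_pair p W u g" using assms W1p_iff_pair by blast
 have w: "weak_grad W u (wgrad W u)" by (rule weak_grad_wgrad[of _ _ g]) (use g in \<open>simp add: W1p_pair_def\<close>)
 have "Lp_vec p (lebesgue_on W) (wgrad W u)"
  by (rule Lp_vec_cong_AE[OF _ weak_grad_measurable(2)[OF w] W1p_pair_wgrad_AE[OF assms(1) g]])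
    (use g in \<open>simp add: W1p_pair_def\<close>)
 then show ?thesis using w g by (simp add: W1p_pair_def)
qed

lemma energy_eq_pair:
 assumes "open W" "W1p_pair p W u g"
 shows "energy p W u = Lp_int p (lebesgue_on W) g + Lp_int p (lebesgue_on W) u"
proof -
 have "W1p p W u" using assms W1p_iff_pair by blast
 from W1p_pair_wgrad[OF assms(1) this]
 have "Lp_int p (lebesgue_on W) g = Lp_int p (lebesgue_on W) (wgrad W u)"
  using assms by (intro Lp_int_cong_AE W1p_pair_wgrad_AE) (auto simp: W1p_pair_def Lp_vec_def)
 then show ?thesis by (simp add: energy_def Lp_int_def)
qed

lemma energy_nonneg: "0 \<le> energy p W u"
 by (simp add: energy_def)

lemma W1p_pair_add:
 assumes "open W" "1 \<le> p" "W1p_pair p W u g" "W1p_pair p W v h"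
 shows "W1p_pair p W (\<lambda>x. u x + v x) (\<lambda>x. g x + h x)"
 using assms by (auto simp: W1p_pair_def intro!: weak_grad_add Lp_vec_add)

lemma W1p_pair_cmult:
 assumes "W1p_pair p W u g"
 shows "W1p_pair p W (\<lambda>x. c * u x) (\<lambda>x. c *\<^sub>R g x)"
 using assms Lp_vec_scaleR[of p "lebesgue_on W" u c]
 by (auto simp: W1p_pair_def intro!: weak_grad_cmult Lp_vec_scaleR)

lemma W1p_pair_diff:
 assumes "open W" "1 \<le> p" "W1p_pair p W u g" "W1p_pair p W v h"
 shows "W1p_pair p W (\<lambda>x. u x - v x) (\<lambda>x. g x - h x)"
 using W1p_pair_add[OF assms(1-3) W1p_pair_cmult[OF assms(4), of "-1"]] by simp

lemma loc_integrableI: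
 fixes f :: "real^'n::finite \<Rightarrow> real"
 assumes f: "integrable (lebesgue_on W) f" and O: "W \<in> sets lebesgue"
 shows "loc_integrable W f"
 unfolding loc_integrable_def
proof (intro conjI allI impI)
 show "f \<in> borel_measurable (lebesgue_on W)" using f by auto
 fix K assume K: "compact K \<and> K \<subseteq> W"
 then have Kl: "K \<in> sets lebesgue" by (metis borel_compact sets_completionI_sets sets_lborel)
 have i: "integrable lebesgue (\<lambda>x. indicator K x *\<^sub>R (indicator W x *\<^sub>R f x))"
  using integrable_mult_indicator[OF Kl, of "\<lambda>x. indicator W x *\<^sub>R f x"] f
  by (simp add: integrable_lebesgue_on_iff O)
 have "(\<lambda>x. indicator K x *\<^sub>R (indicator W x *\<^sub>R f x)) = (\<lambda>x. indicator K x *\<^sub>R f x)"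
  using K by (intro ext) (auto simp: indicator_def)
 with i show "integrable (lebesgue_on K) f" by (simp only: integrable_lebesgue_on_iff[OF Kl])
qed

lemma finite_measure_lebesgue_on_bounded:
 assumes "bounded (W :: 'a::euclidean_space set)" "open W"
 shows "finite_measure (lebesgue_on W)"
 using assms by (intro finite_measure_lebesgue_on bounded_set_imp_lmeasurable open_sets_lebesgue)

lemma tendsto_integral_mult_bounded:
 fixes f :: "nat \<Rightarrow> 'a \<Rightarrow> real"
 assumes f: "\<And>n. integrable M (f n)" and g: "integrable M g" and lim: "(\<lambda>n. \<integral>x. norm (f n x - g x) \<partial>M) \<longlonglongrightarrow> 0"
  and G: "G \<in> borel_measurable M" "\<And>x. \<bar>G x\<bar> \<le> B"
 shows "(\<lambda>n. \<integral>x. f n x * G x \<partial>M) \<longlonglongrightarrow> (\<integral>x. g x * G x \<partial>M)"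
proof -
 have i: "integrable M (\<lambda>x. h x * G x)" if "integrable M h" for h
 proof (rule Bochner_Integration.integrable_bound[OF integrable_mult_left[OF that, of B]])
  show "AE x in M. norm (h x * G x) \<le> norm (h x * B)"
  proof (rule AE_I2)
   fix x
   have "\<bar>G x\<bar> \<le> \<bar>B\<bar>" using G(2)[of x] by linarith
   then show "norm (h x * G x) \<le> norm (h x * B)"
    unfolding real_norm_def abs_mult by (intro mult_left_mono) auto
  qed
 qed (use that G in auto)
 have B0: "0 \<le> B" using G(2) abs_ge_zero order_trans by blast
 have "(\<lambda>n. (\<integral>x. f n x * G x \<partial>M) - (\<integral>x. g x * G x \<partial>M)) \<longlonglongrightarrow> 0"
 proof (rule Lim_null_comparison)
  have "norm ((\<integral>x. f n x * G x \<partial>M) - (\<integral>x. g x * G x \<partial>M)) \<le> (\<integral>x. norm (f n x - g x) \<partial>M) * B" for n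
  proof -
   have "(\<integral>x. f n x * G x \<partial>M) - (\<integral>x. g x * G x \<partial>M) = (\<integral>x. (f n x - g x) * G x \<partial>M)"
    using i[OF f] i[OF g] by (simp add: left_diff_distrib)
   also have "norm \<dots> \<le> (\<integral>x. norm ((f n x - g x) * G x) \<partial>M)"
    by (rule integral_norm_bound)
   also have "\<dots> \<le> (\<integral>x. norm (f n x - g x) * B \<partial>M)"
   proof (rule integral_mono)
    show "integrable M (\<lambda>x. norm ((f n x - g x) * G x))"
     by (intro integrable_norm i Bochner_Integration.integrable_diff f g)
    show "integrable M (\<lambda>x. norm (f n x - g x) * B)"
     by (intro integrable_mult_left integrable_norm Bochner_Integration.integrable_diff f g)
    show "norm ((f n x - g x) * G x) \<le> norm (f n x - g x) * B" for x
     using G(2)[of x] unfolding norm_mult by (intro mult_left_mono) auto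
   qed
   finally show ?thesis by simp
  qed
  then show "\<forall>\<^sub>F n in sequentially. norm ((\<integral>x. f n x * G x \<partial>M) - (\<integral>x. g x * G x \<partial>M)) \<le> (\<integral>x. norm (f n x - g x) \<partial>M) * B"
   by simp
  show "(\<lambda>n. (\<integral>x. norm (f n x - g x) \<partial>M) * B) \<longlonglongrightarrow> 0"
   using tendsto_mult_right[OF lim, of B] by simp
 qed
 then show ?thesis by (simp add: LIM_zero_iff)
qed

lemma integrable_vec_nth:
 fixes g :: "'a \<Rightarrow> real^'n::finite"
 assumes "integrable M g"
 shows "integrable M (\<lambda>x. g x $ i)"
 using integrable_inner_left[of "axis i 1" M g] assms by (simp add: inner_axis)

text \<open>Closedness of the weak gradient: both sides of the defining identity are pairings with
  bounded functions, hence continuous under L^1 convergence.\<close>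

lemma weak_grad_L1_limit:
 fixes u :: "nat \<Rightarrow> real^'n::finite \<Rightarrow> real"
 assumes O: "open W" and w: "\<And>n. weak_grad W (u n) (g n)"
  and i: "\<And>n. integrable (lebesgue_on W) (u n)" "\<And>n. integrable (lebesgue_on W) (g n)"
   "integrable (lebesgue_on W) u0" "integrable (lebesgue_on W) g0"
  and lim: "(\<lambda>n. \<integral>x. norm (u n x - u0 x) \<partial>lebesgue_on W) \<longlonglongrightarrow> 0"
   "(\<lambda>n. \<integral>x. norm (g n x - g0 x) \<partial>lebesgue_on W) \<longlonglongrightarrow> 0"
 shows "weak_grad W u0 g0"
 unfolding weak_grad_def
proof (intro conjI allI impI)
 note Ol = open_sets_lebesgue[OF O]
 show "loc_integrable W u0" by (rule loc_integrableI[OF i(3) Ol])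
 show "loc_integrable W (\<lambda>x. g0 x $ j)" for j by (rule loc_integrableI[OF integrable_vec_nth[OF i(4)] Ol])
 fix f j assume t: "test_fun W f"
 obtain B where B: "\<And>x. \<bar>f x\<bar> \<le> B" "\<And>x i. \<bar>pd i f x\<bar> \<le> B" using test_fun_bounds[OF t] by metis
 have s: "smooth_fun f" using t by (simp add: test_fun_def)
 have "(\<lambda>n. LINT x|lebesgue_on W. u n x * pd j f x) \<longlonglongrightarrow> (LINT x|lebesgue_on W. u0 x * pd j f x)"
  by (rule tendsto_integral_mult_bounded[OF i(1,3) lim(1) _ B(2)])
    (intro continuous_measurable_lebesgue_on smooth_funD(2)[OF smooth_funD(3)[OF s]])
 moreover have "(\<lambda>n. - (LINT x|lebesgue_on W. g n x $ j * f x)) \<longlonglongrightarrow> - (LINT x|lebesgue_on W. g0 x $ j * f x)"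
 proof (intro tendsto_minus tendsto_integral_mult_bounded[OF _ _ _ _ B(1)] integrable_vec_nth i)
  show "(\<lambda>n. LINT x|lebesgue_on W. norm (g n x $ j - g0 x $ j)) \<longlonglongrightarrow> 0"
  proof (rule Lim_null_comparison[OF _ lim(2)], intro always_eventually allI)
   fix n
   have "(LINT x|lebesgue_on W. norm (g n x $ j - g0 x $ j)) \<le> (LINT x|lebesgue_on W. norm (g n x - g0 x))"
   proof (rule integral_mono)
    fix x show "norm (g n x $ j - g0 x $ j) \<le> norm (g n x - g0 x)"
     using component_le_norm_cart[of "g n x - g0 x" j] by simp
   qed (use i in \<open>auto intro!: integrable_norm integrable_vec_nth Bochner_Integration.integrable_diff\<close>)
   then show "norm (LINT x|lebesgue_on W. norm (g n x $ j - g0 x $ j)) \<le> (LINT x|lebesgue_on W. norm (g n x - g0 x))"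
    by simp
  qed
  show "f \<in> borel_measurable (lebesgue_on W)"
   by (intro continuous_measurable_lebesgue_on smooth_funD(2)[OF s])
 qed
 moreover have "(LINT x|lebesgue_on W. u n x * pd j f x) = - (LINT x|lebesgue_on W. g n x $ j * f x)" for n
  by (rule weak_gradD(3)[OF w t])
 ultimately show "(LINT x|lebesgue_on W. u0 x * pd j f x) = - (LINT x|lebesgue_on W. g0 x $ j * f x)"
  by (simp add: LIMSEQ_unique)
qed

lemma W1p_pair_complete:
 assumes O: "open W" "bounded W" and p: "1 < p" and w: "\<And>n. W1p_pair p W (u n) (g n)"
  and Cau: "\<And>e. 0 < e \<Longrightarrow> \<exists>N. \<forall>m\<ge>N. \<forall>n\<ge>N. Lp_int p (lebesgue_on W) (\<lambda>x. u m x - u n x) < e"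
   "\<And>e. 0 < e \<Longrightarrow> \<exists>N. \<forall>m\<ge>N. \<forall>n\<ge>N. Lp_int p (lebesgue_on W) (\<lambda>x. g m x - g n x) < e"
 obtains u0 g0 where "W1p_pair p W u0 g0" "(\<lambda>n. Lp_int p (lebesgue_on W) (\<lambda>x. u n x - u0 x)) \<longlonglongrightarrow> 0"
  "(\<lambda>n. Lp_int p (lebesgue_on W) (\<lambda>x. g n x - g0 x)) \<longlonglongrightarrow> 0"
proof -
 have fin: "finite_measure (lebesgue_on W)" by (rule finite_measure_lebesgue_on_bounded[OF O(2,1)])
 have u: "Lp_vec p (lebesgue_on W) (u n)" "Lp_vec p (lebesgue_on W) (g n)" "weak_grad W (u n) (g n)" for n
  using w[of n] by (auto simp: W1p_pair_def)
 have p1: "1 \<le> p" using p by simp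
 obtain u0 where u0: "Lp_vec p (lebesgue_on W) u0" "(\<lambda>n. Lp_int p (lebesgue_on W) (\<lambda>x. u n x - u0 x)) \<longlonglongrightarrow> 0"
  using Lp_complete[OF p u(1) Cau(1)] by blast
 obtain g0 where g0: "Lp_vec p (lebesgue_on W) g0" "(\<lambda>n. Lp_int p (lebesgue_on W) (\<lambda>x. g n x - g0 x)) \<longlonglongrightarrow> 0"
  using Lp_complete[OF p u(2) Cau(2)] by blast
 have "weak_grad W u0 g0"
  by (rule weak_grad_L1_limit[OF O(1) u(3) Lp_vec_imp_integrable[OF fin p1 u(1)] Lp_vec_imp_integrable[OF fin p1 u(2)]
     Lp_vec_imp_integrable[OF fin p1 u0(1)] Lp_vec_imp_integrable[OF fin p1 g0(1)]
     Lp_tendsto_imp_L1[OF fin p1 u(1) u0] Lp_tendsto_imp_L1[OF fin p1 u(2) g0]])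
 then have "W1p_pair p W u0 g0" using u0 g0 by (simp add: W1p_pair_def)
 then show ?thesis using that u0 g0 by blast
qed

section \<open>C1 functions and integration by parts\<close>

lemma lborel_translation:
 fixes F :: "'a::euclidean_space \<Rightarrow> 'b::{banach, second_countable_topology}"
 assumes [measurable]: "F \<in> borel_measurable borel"
 shows "integrable lborel (\<lambda>x. F (x + c)) \<longleftrightarrow> integrable lborel F"
  "(\<integral>x. F (x + c) \<partial>lborel) = (\<integral>x. F x \<partial>lborel)"
proof -
 have "integrable (distr lborel borel ((+) c)) F \<longleftrightarrow> integrable lborel (\<lambda>x. F (c + x))"
  by (rule integrable_distr_eq) auto
 then show "integrable lborel (\<lambda>x. F (x + c)) \<longleftrightarrow> integrable lborel F"
  by (simp add: lborel_distr_plus add.commute)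
 have "integral\<^sup>L (distr lborel borel ((+) c)) F = (\<integral>x. F (c + x) \<partial>lborel)"
  by (rule integral_distr) auto
 then show "(\<integral>x. F (x + c) \<partial>lborel) = (\<integral>x. F x \<partial>lborel)"
  by (simp add: lborel_distr_plus add.commute)
qed

text \<open>Translation invariance makes the integral of every difference quotient of F zero, and
  the quotients converge to the directional derivative under a common integrable bound.\<close>

lemma integral_pd_zero:
 fixes F :: "real^'n::finite \<Rightarrow> real"
 assumes K: "compact K" and F: "\<And>x. (F has_derivative F' x) (at x)" and z: "\<And>x. x \<notin> K \<Longrightarrow> F x = 0"
  and c: "continuous_on UNIV (\<lambda>x. F' x e)"
 shows "integrable lborel (\<lambda>x. F' x e)" "(\<integral>x. F' x e \<partial>lborel) = 0"
proof -
 \<comment> \<open>The step lengths used below are at most 1, so all difference quotients vanish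
   outside this enlargement of K by \<open>norm e\<close>.\<close>
 define K1 where "K1 = {x + y |x y. x \<in> K \<and> y \<in> cball 0 (norm e)}"
 have K1: "compact K1" unfolding K1_def by (intro compact_sums K compact_cball)
 have cF: "continuous_on UNIV F" using F by (meson continuous_at_imp_continuous_on has_derivative_continuous)
 have z': "F' x e = 0" if "x \<notin> K" for x
 proof -
  have "((\<lambda>_. 0) has_derivative (\<lambda>_. 0)) (at x)" by simp
  then have "(F has_derivative (\<lambda>_. 0)) (at x)"
   by (rule has_derivative_transform_within_open[of _ _ _ _ "- K"]) (use that z K in \<open>auto simp: open_Compl compact_imp_closed\<close>)
  then show ?thesis using F has_derivative_unique by metis
 qed
 have int: "integrable lborel h" if "continuous_on UNIV h" "\<And>x. x \<notin> K \<Longrightarrow> h x = 0" for h :: "real^'n \<Rightarrow> real"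
 proof -
  have "integrable lborel (\<lambda>x. indicator K x *\<^sub>R h x)"
   by (intro borel_integrable_compact K continuous_on_subset[OF that(1)]) auto
  moreover have "(\<lambda>x. indicator K x *\<^sub>R h x) = h" using that(2) by (intro ext) (auto simp: indicator_def)
  ultimately show ?thesis by simp
 qed
 show i': "integrable lborel (\<lambda>x. F' x e)" by (rule int[OF c z'])
 have i: "integrable lborel F" by (rule int[OF cF z])
 have "bounded ((\<lambda>x. F' x e) ` K)"
  by (intro compact_imp_bounded compact_continuous_image continuous_on_subset[OF c] K) auto
 then obtain B0 where B0: "\<And>x. x \<in> K \<Longrightarrow> \<bar>F' x e\<bar> \<le> B0" by (auto simp: bounded_iff)
 define B where "B = max B0 0"
 have B: "0 \<le> B" "\<bar>F' x e\<bar> \<le> B" for x using B0[of x] z'[of x] by (cases "x \<in> K"; auto simp: B_def le_max_iff_disj)+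
 define s where "s n = 1 / real (Suc n)" for n
 have s: "0 < s n" "s n \<le> 1" for n by (auto simp: s_def)
 define q where "q n x = (F (x + s n *\<^sub>R e) - F x) / s n" for n x
 have line: "((\<lambda>t. F (x + t *\<^sub>R e)) has_real_derivative F' (x + t *\<^sub>R e) e) (at t)" for x t
 proof -
  have "((\<lambda>t. x + t *\<^sub>R e) has_derivative (\<lambda>h. h *\<^sub>R e)) (at t)" by (auto intro!: derivative_eq_intros)
  from has_derivative_compose[OF this F]
  have "((\<lambda>t. F (x + t *\<^sub>R e)) has_derivative (\<lambda>h. F' (x + t *\<^sub>R e) (h *\<^sub>R e))) (at t)" .
  moreover have "linear (F' y)" for y using F has_derivative_linear by blast
  ultimately show ?thesis by (simp add: has_field_derivative_def linear_scale mult.commute[of _ "F' _ e"])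
 qed
 have cq: "continuous_on UNIV (q n)" for n
 proof -
  have "s n \<noteq> 0" using s(1)[of n] by simp
  then show ?thesis unfolding q_def
   by (intro continuous_intros continuous_on_compose2[OF cF]) auto
 qed
 have "(\<lambda>n. \<integral>x. q n x \<partial>lborel) \<longlonglongrightarrow> (\<integral>x. F' x e \<partial>lborel)"
 proof (rule integral_dominated_convergence)
  show "integrable lborel (\<lambda>x. indicator K1 x *\<^sub>R B)"
   by (intro borel_integrable_compact K1 continuous_on_const)
  show "AE x in lborel. (\<lambda>n. q n x) \<longlonglongrightarrow> F' x e"
  proof (rule AE_I2)
   fix x
   have "((\<lambda>t. (F (x + t *\<^sub>R e) - F x) / t) \<longlongrightarrow> F' x e) (at 0)"
    using line[of x 0] by (simp add: DERIV_def)
   moreover have "s \<longlonglongrightarrow> 0" unfolding s_def by (rule lim_1_over_n[THEN LIMSEQ_Suc])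
   then have "filterlim s (at 0) sequentially" using s(1) by (auto simp: filterlim_at less_imp_neq[symmetric])
   ultimately show "(\<lambda>n. q n x) \<longlonglongrightarrow> F' x e"
    unfolding q_def by (rule filterlim_compose)
  qed
  show "AE x in lborel. norm (q n x) \<le> indicator K1 x *\<^sub>R B" for n
  proof (rule AE_I2)
   fix x
   have "norm (F (x + s n *\<^sub>R e) - F (x + 0 *\<^sub>R e)) \<le> B * norm (s n - 0)"
    by (rule field_differentiable_bound[of UNIV "\<lambda>t. F (x + t *\<^sub>R e)"]) (use line B in auto)
   then have b: "norm (q n x) \<le> B" using s[of n] by (simp add: q_def field_simps)
   show "norm (q n x) \<le> indicator K1 x *\<^sub>R B"
   proof (cases "x \<in> K1")
    case False
    have "x \<notin> K"
    proof
     assume "x \<in> K"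
     then have "x + 0 \<in> K1" unfolding K1_def by (intro CollectI exI conjI refl) auto
     then show False using False by simp
    qed
    moreover have "x + s n *\<^sub>R e \<notin> K"
    proof
     assume k: "x + s n *\<^sub>R e \<in> K"
     have "\<bar>s n\<bar> * norm e \<le> 1 * norm e" using s[of n] by (intro mult_right_mono) auto
     then have "(x + s n *\<^sub>R e) + (- (s n *\<^sub>R e)) \<in> K1"
      unfolding K1_def using k
      by (intro CollectI exI[of _ "x + s n *\<^sub>R e"] exI[of _ "- (s n *\<^sub>R e)"]) auto
     then show False using False by simp
    qed
    ultimately show ?thesis using False z by (simp add: q_def)
   qed (use b in simp)
  qed
 qed (use borel_measurable_integrable[OF i'] borel_measurable_continuous_onI[OF cq] in auto)
 moreover have "(\<integral>x. q n x \<partial>lborel) = 0" for n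
 proof -
  note tr = lborel_translation[OF borel_measurable_continuous_onI[OF cF], of "s n *\<^sub>R e"]
  have t: "(\<integral>x. F (x + s n *\<^sub>R e) \<partial>lborel) = (\<integral>x. F x \<partial>lborel)"
   and ti: "integrable lborel (\<lambda>x. F (x + s n *\<^sub>R e))" using tr i by auto
  show ?thesis unfolding q_def using t ti i by simp
 qed
 ultimately show "(\<integral>x. F' x e \<partial>lborel) = 0" by (simp add: LIMSEQ_const_iff)
qed

lemma nn_integral_lebesgue_on_borel:
 assumes "W \<in> sets borel" "f \<in> borel_measurable borel"
 shows "(\<integral>\<^sup>+x. f x \<partial>lebesgue_on W) = (\<integral>\<^sup>+x. f x * indicator W x \<partial>lborel)"
proof -
 have "W \<in> sets lebesgue" using assms by simp
 then have "(\<integral>\<^sup>+x. f x \<partial>lebesgue_on W) = (\<integral>\<^sup>+x. f x * indicator W x \<partial>lebesgue)"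
  by (intro nn_integral_restrict_space) simp
 then show ?thesis by (simp add: nn_integral_completion)
qed

definition gradv :: "(real^'n::finite \<Rightarrow> real) \<Rightarrow> real^'n \<Rightarrow> real^'n" where
 "gradv \<phi> x = (\<chi> i. pd i \<phi> x)"

lemma linear_eq_inner_axis:
 fixes L :: "real^'n::finite \<Rightarrow> real"
 assumes "linear L"
 shows "L h = (\<chi> i. L (axis i 1)) \<bullet> h"
proof -
 have "L h = L (\<Sum>i\<in>UNIV. h $ i *\<^sub>R axis i 1)" by (simp add: basis_expansion[of h, unfolded scalar_mult_eq_scaleR])
 also have "\<dots> = (\<Sum>i\<in>UNIV. h $ i * L (axis i 1))"
  using assms by (simp add: linear_sum linear_scale)
 finally show ?thesis by (simp add: inner_vec_def mult.commute)
qed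

lemma smooth_fun_gradv:
 assumes "smooth_fun f"
 shows "(f has_derivative (\<lambda>h. gradv f x \<bullet> h)) (at x)"
proof -
 note d = smooth_funD(4)[OF assms, of x]
 have "frechet_derivative f (at x) = (\<lambda>h. gradv f x \<bullet> h)"
  unfolding gradv_def using linear_eq_inner_axis[OF has_derivative_linear[OF d]] by blast
 then show ?thesis using d by simp
qed

text \<open>Differentiability is required on the whole space, so such functions can be restricted to
  the boundary and followed along lines that leave the domain, with no extension step.\<close>

definition C1_fun :: "(real^'n::finite \<Rightarrow> real) \<Rightarrow> (real^'n \<Rightarrow> real^'n) \<Rightarrow> bool" where
 "C1_fun v G \<longleftrightarrow> (\<forall>x. (v has_derivative (\<lambda>h. G x \<bullet> h)) (at x)) \<and> continuous_on UNIV G"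

lemma C1_fun_continuous: "C1_fun v G \<Longrightarrow> continuous_on S v" "C1_fun v G \<Longrightarrow> continuous_on S G"
 unfolding C1_fun_def
 by (meson continuous_at_imp_continuous_on has_derivative_continuous)
   (auto intro: continuous_on_subset)

lemma C1_fun_measurable:
 "C1_fun v G \<Longrightarrow> v \<in> borel_measurable borel" "C1_fun v G \<Longrightarrow> G \<in> borel_measurable borel"
 by (auto intro!: borel_measurable_continuous_onI C1_fun_continuous)

lemma compact_sets_lebesgue: "compact K \<Longrightarrow> K \<in> sets lebesgue"
 by (metis borel_compact sets_completionI_sets sets_lborel)

lemma loc_integrable_continuous:
 fixes f :: "real^'n::finite \<Rightarrow> real"
 assumes "open W" "continuous_on UNIV f"
 shows "loc_integrable W f"
 unfolding loc_integrable_def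
proof (intro conjI allI impI)
 fix K assume K: "compact K \<and> K \<subseteq> W"
 have i: "integrable lborel (\<lambda>x. indicator K x *\<^sub>R f x)"
  using K by (intro borel_integrable_compact continuous_on_subset[OF assms(2)]) auto
 then have "integrable lebesgue (\<lambda>x. indicator K x *\<^sub>R f x)"
  by (subst integrable_completion) (use borel_measurable_integrable[OF i] in auto)
 then show "integrable (lebesgue_on K) f"
  using K by (simp only: integrable_lebesgue_on_iff[OF compact_sets_lebesgue])
qed (rule continuous_measurable_lebesgue_on[OF assms(2)])

text \<open>The product of v with a test function vanishes off a compact set, so the integral of its
  partial derivative is zero; the product rule splits it into the two terms.\<close>

lemma weak_grad_C1:
 fixes v :: "real^'n::finite \<Rightarrow> real"
 assumes O: "open W" and C: "C1_fun v G"
 shows "weak_grad W v G"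
 unfolding weak_grad_def
proof (intro conjI allI impI)
 note Ol = open_sets_lebesgue[OF O]
 show lv: "loc_integrable W v" by (rule loc_integrable_continuous[OF O C1_fun_continuous(1)[OF C]])
 show lG: "loc_integrable W (\<lambda>x. G x $ i)" for i
  by (intro loc_integrable_continuous O continuous_intros C1_fun_continuous(2)[OF C])
 fix f i assume t: "test_fun W f"
 obtain K where K: "compact K" "K \<subseteq> W" "\<And>x. x \<notin> K \<Longrightarrow> f x = 0" "\<And>x i. x \<notin> K \<Longrightarrow> pd i f x = 0"
  using test_fun_bounds[OF t] by metis
 have s: "smooth_fun f" using t by (simp add: test_fun_def)
 define F' where "F' x h = v x * (gradv f x \<bullet> h) + (G x \<bullet> h) * f x" for x h
 have e: "F' x (axis i 1) = v x * pd i f x + G x $ i * f x" for x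
  by (simp add: F'_def inner_axis gradv_def)
 have d: "((\<lambda>x. v x * f x) has_derivative F' x) (at x)" for x
  unfolding F'_def using C by (intro has_derivative_mult smooth_fun_gradv s) (auto simp: C1_fun_def)
 have c: "continuous_on UNIV (\<lambda>x. F' x (axis i 1))" unfolding e
  by (intro continuous_intros C1_fun_continuous[OF C] smooth_funD(2)[OF s] smooth_funD(2)[OF smooth_funD(3)[OF s]])
 have z: "(\<integral>x. F' x (axis i 1) \<partial>lborel) = 0"
  by (rule integral_pd_zero(2)[OF K(1) d _ c]) (use K in auto)
 have "(\<lambda>x. indicator W x *\<^sub>R F' x (axis i 1)) = (\<lambda>x. F' x (axis i 1))"
 proof (rule ext)
  fix x
  show "indicator W x *\<^sub>R F' x (axis i 1) = F' x (axis i 1)"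
  proof (cases "x \<in> W")
   case False
   then have "x \<notin> K" using K(2) by blast
   then show ?thesis unfolding e by (simp add: K(3,4))
  qed simp
 qed
 then have "(LINT x|lebesgue_on W. F' x (axis i 1)) = (\<integral>x. F' x (axis i 1) \<partial>lebesgue)"
  by (simp only: integral_lebesgue_on[OF Ol])
 also have "\<dots> = 0" using z by (subst integral_completion) (auto intro: borel_measurable_continuous_onI[OF c])
 finally show "(LINT x|lebesgue_on W. v x * pd i f x) = - (LINT x|lebesgue_on W. G x $ i * f x)"
  using loc_integrable_test(2)[OF lv Ol t, of i] loc_integrable_test(1)[OF lG Ol t, of i] by (simp add: e)
qed

lemma W1p_pair_C1:
 fixes v :: "real^'n::finite \<Rightarrow> real"
 assumes O: "open W" "bounded W" and C: "C1_fun v G" and p: "0 \<le> p"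
 shows "W1p_pair p W v G"
proof -
 have fin: "finite_measure (lebesgue_on W)" by (rule finite_measure_lebesgue_on_bounded[OF O(2,1)])
 have cl: "compact (closure W)" using O by (simp add: compact_closure)
 have "Lp_vec p (lebesgue_on W) f" if "continuous_on UNIV f" for f :: "real^'n \<Rightarrow> 'b::euclidean_space"
 proof -
  have "bounded (f ` closure W)"
   by (intro compact_imp_bounded compact_continuous_image continuous_on_subset[OF that] cl) auto
  then obtain B where "\<And>x. x \<in> closure W \<Longrightarrow> norm (f x) \<le> B" by (auto simp: bounded_iff)
  then show ?thesis using closure_subset[of W] p
   by (intro Lp_vec_const_bounded[OF fin continuous_measurable_lebesgue_on[OF that]]) auto
 qed
 from this[OF C1_fun_continuous(1)[OF C]] this[OF C1_fun_continuous(2)[OF C]]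
 show ?thesis
  unfolding W1p_pair_def by (intro conjI weak_grad_C1[OF O(1) C])
qed

lemma test_fun_gradv_bounds:
 assumes "test_fun W f"
 obtains L where "0 \<le> L" "\<And>x. norm (gradv f x) \<le> L" "\<And>x. \<bar>f x\<bar> \<le> L" "\<And>x y. \<bar>f x - f y\<bar> \<le> L * norm (x - y)"
proof -
 obtain B where B: "0 \<le> B" "\<And>x. \<bar>f x\<bar> \<le> B" "\<And>x i. \<bar>pd i f x\<bar> \<le> B" using test_fun_bounds[OF assms] by metis
 have s: "smooth_fun f" using assms by (simp add: test_fun_def)
 define L where "L = B + (\<Sum>i\<in>(UNIV::'a set). B)"
 have L: "0 \<le> L" "B \<le> L" using B by (auto simp: L_def sum_nonneg)
 have g: "norm (gradv f x) \<le> L" for x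
 proof -
  have "norm (gradv f x) \<le> (\<Sum>i\<in>UNIV. \<bar>gradv f x $ i\<bar>)" by (rule norm_le_l1_cart)
  also have "\<dots> \<le> (\<Sum>i\<in>(UNIV::'a set). B)" by (intro sum_mono) (use B in \<open>auto simp: gradv_def\<close>)
  finally show ?thesis using B(1) by (simp add: L_def)
 qed
 have lip: "\<bar>f x - f y\<bar> \<le> L * norm (x - y)" for x y
 proof -
  have "norm (f x - f y) \<le> L * norm (x - y)"
  proof (rule differentiable_bound[of UNIV f "\<lambda>x h. gradv f x \<bullet> h"])
   show "onorm (\<lambda>h. gradv f x \<bullet> h) \<le> L" for x
    by (rule onorm_bound[OF L(1)])
      (metis Cauchy_Schwarz_ineq2 g mult_right_mono norm_ge_zero order_trans real_norm_def)
  qed (auto intro: smooth_fun_gradv[OF s])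
  then show ?thesis by simp
 qed
 show ?thesis by (rule that[OF L(1) g order_trans[OF B(2) L(2)] lip])
qed

lemma test_fun_pd:
 assumes "test_fun W f"
 shows "test_fun W (pd i f)"
proof -
 obtain K where K: "compact K" "K \<subseteq> W" "\<And>x. x \<notin> K \<Longrightarrow> f x = 0" "\<And>x i. x \<notin> K \<Longrightarrow> pd i f x = 0"
  using test_fun_bounds[OF assms] by metis
 have sub: "closure {x. pd i f x \<noteq> 0} \<subseteq> K"
  by (rule closure_minimal) (use K compact_imp_closed in auto)
 then have "compact (closure {x. pd i f x \<noteq> 0})"
  by (metis K(1) bounded_subset closed_closure compact_eq_bounded_closed)
 then show ?thesis using assms sub K(2) smooth_funD(3) by (auto simp: test_fun_def)
qed

text \<open>The quadratic remainder bound is uniform in x, which allows mollifications to be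
  differentiated against any integrable function by a direct estimate.\<close>

lemma test_fun_linearization:
 fixes F :: "real^'n::finite \<Rightarrow> real"
 assumes "test_fun W F"
 obtains L where "0 \<le> L" "\<And>x h. \<bar>F (x + h) - F x - gradv F x \<bullet> h\<bar> \<le> L * norm h * norm h"
  "\<And>x y. norm (gradv F x - gradv F y) \<le> L * norm (x - y)"
proof -
 have s: "smooth_fun F" using assms by (simp add: test_fun_def)
 have "\<forall>i. \<exists>L\<ge>0. \<forall>x y. \<bar>pd i F x - pd i F y\<bar> \<le> L * norm (x - y)"
  using test_fun_gradv_bounds[OF test_fun_pd[OF assms]] by metis
 then obtain L where L: "\<And>i. 0 \<le> L i" "\<And>i x y. \<bar>pd i F x - pd i F y\<bar> \<le> L i * norm (x - y)" by metis
 define M where "M = (\<Sum>i\<in>UNIV. L i)"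
 have M: "0 \<le> M" using L by (auto simp: M_def sum_nonneg)
 have g: "norm (gradv F x - gradv F y) \<le> M * norm (x - y)" for x y
 proof -
  have "norm (gradv F x - gradv F y) \<le> (\<Sum>i\<in>UNIV. \<bar>(gradv F x - gradv F y) $ i\<bar>)" by (rule norm_le_l1_cart)
  also have "\<dots> \<le> (\<Sum>i\<in>UNIV. L i * norm (x - y))" by (intro sum_mono) (use L in \<open>auto simp: gradv_def\<close>)
  finally show ?thesis by (simp add: M_def sum_distrib_right)
 qed
 have "\<bar>F (x + h) - F x - gradv F x \<bullet> h\<bar> \<le> M * norm h * norm h" for x h
 proof -
  have "norm (F (x + h) - F x - gradv F x \<bullet> ((x + h) - x)) \<le> norm ((x + h) - x) * (M * norm h)"
  proof (rule differentiable_bound_linearization[where S = "cball x (norm h)" and f' = "\<lambda>x h. gradv F x \<bullet> h"])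
   show "x + t *\<^sub>R (x + h - x) \<in> cball x (norm h)" if "t \<in> {0..1}" for t
    using that by (auto simp: dist_norm mult_left_le_one_le)
   show "onorm ((\<lambda>v. gradv F y \<bullet> v) - (\<lambda>v. gradv F x \<bullet> v)) \<le> M * norm h" if "y \<in> cball x (norm h)" for y
    unfolding fun_diff_def
   proof (rule onorm_bound)
    show "0 \<le> M * norm h" using M by simp
    fix v
    have "norm (gradv F y \<bullet> v - gradv F x \<bullet> v) \<le> norm (gradv F y - gradv F x) * norm v"
     unfolding inner_diff_left[symmetric] real_norm_def by (rule Cauchy_Schwarz_ineq2)
    also have "\<dots> \<le> (M * norm (y - x)) * norm v" by (intro mult_right_mono g) auto
    also have "\<dots> \<le> (M * norm h) * norm v"
     using that M by (intro mult_right_mono mult_left_mono) (auto simp: dist_norm norm_minus_commute)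
    finally show "norm (gradv F y \<bullet> v - gradv F x \<bullet> v) \<le> M * norm h * norm v" .
   qed
  qed (auto intro!: has_derivative_at_withinI smooth_fun_gradv[OF s])
  then show ?thesis by (simp add: mult_ac)
 qed
 then show ?thesis using that M g by blast
qed

section \<open>Mollification\<close>

definition box_mass :: "'n::finite itself \<Rightarrow> real \<Rightarrow> real" where
 "box_mass _ d = (\<integral>x. box_bump 1 (\<chi> i. - d) (\<chi> i. d) (x :: real^'n) \<partial>lborel)"

text \<open>The kernel is built on a cube. Its half-width is \<delta> divided by the dimension
  because the Euclidean norm is at most the sum of the absolute coordinates, so the cube lies in the
  ball of radius \<delta>.\<close>

definition moll :: "real \<Rightarrow> real^'n::finite \<Rightarrow> real" where
 "moll \<delta> x = inverse (box_mass TYPE('n) (\<delta> / CARD('n))) * box_bump 1 (\<chi> i. - (\<delta> / CARD('n))) (\<chi> i. \<delta> / CARD('n)) x"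

lemma box_bump_translate: "box_bump m a b (x - w) = box_bump m (a + w) (b + w) x"
 by (simp add: box_bump_def algebra_simps)

lemma integrable_box_bump: "integrable lborel (box_bump 1 a b)"
proof -
 have "integrable lborel (\<lambda>x. indicator (cbox a b) x *\<^sub>R box_bump 1 a b x)"
  by (intro borel_integrable_compact compact_cbox continuous_on_subset[OF smooth_funD(2)[OF smooth_box_bump]]) auto
 moreover have "(\<lambda>x. indicator (cbox a b) x *\<^sub>R box_bump 1 a b x) = box_bump 1 a b"
  using box_bump_bounds(3)[of 1 a b] box_subset_cbox[of a b] by (intro ext) (auto simp: indicator_def)
 ultimately show ?thesis by simp
qed

lemma box_mass_pos:
 assumes "d > 0"
 shows "box_mass TYPE('n::finite) d > 0"
proof -
 let ?a = "(\<chi> i. - d) :: real^'n" and ?b = "(\<chi> i. d) :: real^'n"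
 have "box_mass TYPE('n) d \<ge> 0" unfolding box_mass_def
  by (intro integral_nonneg_AE AE_I2 box_bump_bounds) simp
 moreover have "box_mass TYPE('n) d \<noteq> 0"
 proof
  assume "box_mass TYPE('n) d = 0"
  then have "AE x in lborel. box_bump 1 ?a ?b x = 0"
   unfolding box_mass_def
   by (subst (asm) integral_nonneg_eq_0_iff_AE) (auto intro: integrable_box_bump intro!: AE_I2 box_bump_bounds)
  then have "AE x in lborel. x \<notin> box ?a ?b"
   by eventually_elim (use box_bump_bounds(3)[of 1 ?a ?b] in auto)
  then have "box ?a ?b \<in> null_sets lborel" by (subst (asm) AE_iff_null_sets[symmetric]) auto
  moreover have "0 \<in> box ?a ?b" using assms by (simp add: mem_box_cart)
  then have "\<not> negligible (box ?a ?b)" using open_not_negligible[of "box ?a ?b"] by auto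
  ultimately show False by (metis negligible_iff_null_sets null_sets_completionI)
 qed
 ultimately show ?thesis by simp
qed

lemma moll_props:
 fixes D :: real
 assumes "D > 0"
 shows "0 \<le> moll D (x::real^'n::finite)" "integrable lborel (moll D :: real^'n \<Rightarrow> real)" "(\<integral>x. moll D (x::real^'n) \<partial>lborel) = 1"
  "D \<le> norm x \<Longrightarrow> moll D x = 0" "smooth_fun (moll D :: real^'n \<Rightarrow> real)" "test_fun UNIV (moll D :: real^'n \<Rightarrow> real)"
  "cball w D \<subseteq> W \<Longrightarrow> test_fun W (\<lambda>z::real^'n. moll D (z - w))"
proof -
 define d where "d = D / CARD('n)"
 have d: "d > 0" using assms by (simp add: d_def)
 let ?a = "(\<chi> i. - d) :: real^'n" and ?b = "(\<chi> i. d) :: real^'n"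
 have m: "moll D = (\<lambda>x::real^'n. inverse (box_mass TYPE('n) d) * box_bump 1 ?a ?b x)"
  by (auto simp: moll_def d_def)
 note p = box_mass_pos[OF d, where 'n='n]
 show "0 \<le> moll D x" unfolding m using p by (intro mult_nonneg_nonneg box_bump_bounds(1)) auto
 show "integrable lborel (moll D :: real^'n \<Rightarrow> real)" unfolding m by (intro integrable_mult_right integrable_box_bump)
 show "(\<integral>x. moll D (x::real^'n) \<partial>lborel) = 1" unfolding m using p by (simp add: box_mass_def)
 show "smooth_fun (moll D :: real^'n \<Rightarrow> real)" unfolding m by (intro smooth_fun_mult smooth_fun_const smooth_box_bump)
 show "test_fun UNIV (moll D :: real^'n \<Rightarrow> real)" unfolding m by (rule test_box_bump) auto
 have box: "norm x < D" if "x \<in> box ?a ?b" for x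
 proof -
  have "norm x \<le> (\<Sum>i\<in>UNIV. \<bar>x $ i\<bar>)" by (rule norm_le_l1_cart)
  also have "\<dots> < (\<Sum>i\<in>(UNIV::'n set). d)"
   using that by (intro sum_strict_mono) (auto simp: mem_box_cart abs_less_iff minus_less_iff)
  also have "\<dots> = D" by (simp add: d_def)
  finally show ?thesis .
 qed
 show "moll D x = 0" if "D \<le> norm x"
  unfolding m using that box[of x] box_bump_bounds(3)[of 1 ?a ?b x] by (cases "x \<in> box ?a ?b") auto
 have cbox: "norm x \<le> D" if "x \<in> cbox ?a ?b" for x
 proof -
  have "norm x \<le> (\<Sum>i\<in>UNIV. \<bar>x $ i\<bar>)" by (rule norm_le_l1_cart)
  also have "\<dots> \<le> (\<Sum>i\<in>(UNIV::'n set). d)"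
   using that by (intro sum_mono) (auto simp: mem_box_cart abs_le_iff minus_le_iff)
  also have "\<dots> = D" by (simp add: d_def)
  finally show ?thesis .
 qed
 show "test_fun W (\<lambda>z::real^'n. moll D (z - w))" if "cball w D \<subseteq> W"
  unfolding m box_bump_translate
 proof (rule test_box_bump)
  show "cbox (?a + w) (?b + w) \<subseteq> W"
  proof
   fix x assume "x \<in> cbox (?a + w) (?b + w)"
   then have "x - w \<in> cbox ?a ?b" by (simp add: mem_box_cart algebra_simps)
   then show "x \<in> W" using cbox[of "x - w"] that by (auto simp: dist_norm norm_minus_commute)
  qed
 qed simp
qed

text \<open>The kernel is taken at z - w, so that as a function of z it is a bump around w and can
  serve as a test function; differentiation in w therefore produces the minus sign of
  \<open>mconv_grad\<close>.\<close>

definition mconv :: "(real^'n::finite \<Rightarrow> real) \<Rightarrow> (real^'n \<Rightarrow> 'b::euclidean_space) \<Rightarrow> real^'n \<Rightarrow> 'b" where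
 "mconv \<eta> f w = (\<integral>z. \<eta> (z - w) *\<^sub>R f z \<partial>lborel)"

definition mconv_grad :: "(real^'n::finite \<Rightarrow> real) \<Rightarrow> (real^'n \<Rightarrow> real) \<Rightarrow> real^'n \<Rightarrow> real^'n" where
 "mconv_grad \<eta> f w = - (\<integral>z. f z *\<^sub>R gradv \<eta> (z - w) \<partial>lborel)"

lemma continuous_gradv: "smooth_fun \<phi> \<Longrightarrow> continuous_on UNIV (gradv \<phi>)"
 unfolding gradv_def by (intro continuous_on_vec_lambda smooth_funD(2) smooth_funD(3))

lemma integrable_bounded_scaleR:
 fixes f :: "'a \<Rightarrow> 'b::euclidean_space" and k :: "'a \<Rightarrow> real"
 assumes "integrable M f" "k \<in> borel_measurable M" "\<And>x. \<bar>k x\<bar> \<le> B"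
 shows "integrable M (\<lambda>x. k x *\<^sub>R f x)"
proof (rule Bochner_Integration.integrable_bound[OF integrable_scaleR_right[OF assms(1), of B]])
 show "AE x in M. norm (k x *\<^sub>R f x) \<le> norm (B *\<^sub>R f x)"
 proof (rule AE_I2)
  fix x
  have "\<bar>k x\<bar> \<le> \<bar>B\<bar>" using assms(3)[of x] by linarith
  then show "norm (k x *\<^sub>R f x) \<le> norm (B *\<^sub>R f x)" by (simp add: mult_right_mono)
 qed
qed (use assms in measurable)

lemma integrable_scaleR_bounded:
 fixes f :: "'a \<Rightarrow> real" and k :: "'a \<Rightarrow> 'b::euclidean_space"
 assumes "integrable M f" "k \<in> borel_measurable M" "\<And>x. norm (k x) \<le> B"
 shows "integrable M (\<lambda>x. f x *\<^sub>R k x)"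
proof (rule Bochner_Integration.integrable_bound[OF integrable_mult_left[OF assms(1), of B]])
 show "AE x in M. norm (f x *\<^sub>R k x) \<le> norm (f x * B)"
 proof (rule AE_I2)
  fix x
  have "norm (k x) \<le> \<bar>B\<bar>" using assms(3)[of x] by linarith
  then show "norm (f x *\<^sub>R k x) \<le> norm (f x * B)" by (simp add: abs_mult mult_left_mono)
 qed
qed (use assms in measurable)

lemma continuous_translate_measurable:
 fixes f :: "'a::euclidean_space \<Rightarrow> 'b::real_normed_vector"
 assumes "continuous_on UNIV f"
 shows "(\<lambda>z. f (z - w)) \<in> borel_measurable lborel"
proof -
 have "continuous_on UNIV (\<lambda>z. f (z - w))"
  by (intro continuous_on_compose2[OF assms] continuous_intros) auto
 then show ?thesis by (simp add: borel_measurable_continuous_onI)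
qed

lemma mconv_integrable:
 fixes f :: "real^'n::finite \<Rightarrow> 'b::euclidean_space"
 assumes "test_fun UNIV h" "integrable lborel f"
 shows "integrable lborel (\<lambda>z. h (z - w) *\<^sub>R f z)"
proof -
 obtain L where "\<And>x. \<bar>h x\<bar> \<le> L" using test_fun_gradv_bounds[OF assms(1)] by metis
 moreover have "continuous_on UNIV h" using assms by (auto simp: test_fun_def smooth_funD)
 ultimately show ?thesis by (intro integrable_bounded_scaleR assms continuous_translate_measurable)
qed

lemma mconv_grad_integrable:
 assumes "test_fun UNIV h" "integrable lborel f"
 shows "integrable lborel (\<lambda>z. f z *\<^sub>R gradv h (z - w))"
proof -
 obtain L where "\<And>x. norm (gradv h x) \<le> L" using test_fun_gradv_bounds[OF assms(1)] by metis
 moreover have "continuous_on UNIV (gradv h)" using assms by (auto simp: test_fun_def continuous_gradv)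
 ultimately show ?thesis by (intro integrable_scaleR_bounded assms continuous_translate_measurable)
qed

lemma mconv_Lipschitz:
 fixes h :: "real^'n::finite \<Rightarrow> real"
 assumes "test_fun UNIV h"
 obtains L where "0 \<le> L" "\<And>f w. integrable lborel f \<Longrightarrow> \<bar>mconv h f w\<bar> \<le> L * (\<integral>z. \<bar>f z\<bar> \<partial>lborel)"
  "\<And>f w w'. integrable lborel f \<Longrightarrow> \<bar>mconv h f w - mconv h f w'\<bar> \<le> L * norm (w - w') * (\<integral>z. \<bar>f z\<bar> \<partial>lborel)"
proof -
 obtain L where L: "0 \<le> L" "\<And>x. \<bar>h x\<bar> \<le> L" "\<And>x y. \<bar>h x - h y\<bar> \<le> L * norm (x - y)"
  using test_fun_gradv_bounds[OF assms(1)] by metis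
 show ?thesis
 proof (rule that[OF L(1)])
  fix f :: "real^'n \<Rightarrow> real" and w w' assume f: "integrable lborel f"
  note i = mconv_integrable[OF assms f]
  have "\<bar>mconv h f w\<bar> \<le> (\<integral>z. \<bar>h (z - w) *\<^sub>R f z\<bar> \<partial>lborel)"
   unfolding mconv_def using integral_norm_bound[of lborel "\<lambda>z. h (z - w) *\<^sub>R f z"] by simp
  also have "\<dots> \<le> (\<integral>z. L * \<bar>f z\<bar> \<partial>lborel)"
  proof (rule integral_mono)
   show "integrable lborel (\<lambda>z. \<bar>h (z - w) *\<^sub>R f z\<bar>)"
    using integrable_norm[OF i[of w]] by (simp only: real_norm_def)
   show "\<bar>h (z - w) *\<^sub>R f z\<bar> \<le> L * \<bar>f z\<bar>" for z
    using L(2)[of "z - w"] by (simp add: abs_mult mult_right_mono)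
  qed (use f in auto)
  finally show "\<bar>mconv h f w\<bar> \<le> L * (\<integral>z. \<bar>f z\<bar> \<partial>lborel)" by simp
  have "mconv h f w - mconv h f w' = (\<integral>z. h (z - w) *\<^sub>R f z - h (z - w') *\<^sub>R f z \<partial>lborel)"
   unfolding mconv_def using i[of w] i[of w'] by simp
  also have "\<bar>\<dots>\<bar> \<le> (\<integral>z. \<bar>h (z - w) *\<^sub>R f z - h (z - w') *\<^sub>R f z\<bar> \<partial>lborel)"
   using integral_norm_bound[of lborel "\<lambda>z. h (z - w) *\<^sub>R f z - h (z - w') *\<^sub>R f z"] by simp
  also have "\<dots> \<le> (\<integral>z. L * norm (w - w') * \<bar>f z\<bar> \<partial>lborel)"
  proof (rule integral_mono)
   show "integrable lborel (\<lambda>z. \<bar>h (z - w) *\<^sub>R f z - h (z - w') *\<^sub>R f z\<bar>)"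
    using i[of w] i[of w'] by auto
   show "\<bar>h (z - w) *\<^sub>R f z - h (z - w') *\<^sub>R f z\<bar> \<le> L * norm (w - w') * \<bar>f z\<bar>" for z
    using L(3)[of "z - w" "z - w'"]
    by (simp add: left_diff_distrib[symmetric] abs_mult norm_minus_commute mult_right_mono)
  qed (use f in auto)
  finally show "\<bar>mconv h f w - mconv h f w'\<bar> \<le> L * norm (w - w') * (\<integral>z. \<bar>f z\<bar> \<partial>lborel)" by simp
 qed
qed

text \<open>Integrating the second-order remainder of H against |f| bounds the error of
  linearization by L |w' - w|^2 times the L^1 norm of f; the Lipschitz bound on the gradient of H
  gives continuity likewise.\<close>

lemma C1_fun_mconv:
 fixes f :: "real^'n::finite \<Rightarrow> real"
 assumes t: "test_fun UNIV H" and f: "integrable lborel f"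
 shows "C1_fun (mconv H f) (mconv_grad H f)"
 unfolding C1_fun_def
proof (intro conjI allI)
 obtain L where L: "0 \<le> L" "\<And>x h. \<bar>H (x + h) - H x - gradv H x \<bullet> h\<bar> \<le> L * norm h * norm h"
  "\<And>x y. norm (gradv H x - gradv H y) \<le> L * norm (x - y)"
  using test_fun_linearization[OF t] by metis
 define I where "I = (\<integral>z. \<bar>f z\<bar> \<partial>lborel)"
 have I: "0 \<le> I" by (simp add: I_def)
 note i = mconv_integrable[OF t f] and ig = mconv_grad_integrable[OF t f]
 show "(mconv H f has_derivative (\<lambda>h. mconv_grad H f w \<bullet> h)) (at w)" for w
  unfolding has_derivative_at_alt
 proof (intro conjI allI impI bounded_linear_inner_right)
  fix e :: real assume e: "0 < e"
  have rem: "norm (mconv H f w' - mconv H f w - mconv_grad H f w \<bullet> (w' - w)) \<le> L * norm (w' - w) * norm (w' - w) * I" for w'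
  proof -
   have ii: "integrable lborel (\<lambda>z. (f z *\<^sub>R gradv H (z - w)) \<bullet> (w' - w))"
    using ig[of w] by (rule integrable_inner_left)
   have eq: "mconv H f w' - mconv H f w - mconv_grad H f w \<bullet> (w' - w)
    = (\<integral>z. H (z - w') *\<^sub>R f z - H (z - w) *\<^sub>R f z + (f z *\<^sub>R gradv H (z - w)) \<bullet> (w' - w) \<partial>lborel)"
    by (simp only: mconv_def mconv_grad_def inner_minus_left integral_inner_left[OF ig[of w]] diff_minus_eq_add
     Bochner_Integration.integral_add[OF Bochner_Integration.integrable_diff[OF i[of w'] i[of w]] ii]
     Bochner_Integration.integral_diff[OF i[of w'] i[of w]])
   have "norm (mconv H f w' - mconv H f w - mconv_grad H f w \<bullet> (w' - w)) \<le> (\<integral>z. norm (H (z - w') *\<^sub>R f z - H (z - w) *\<^sub>R f z + (f z *\<^sub>R gradv H (z - w)) \<bullet> (w' - w)) \<partial>lborel)"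
    unfolding eq by (rule integral_norm_bound)
   also have "\<dots> \<le> (\<integral>z. L * norm (w' - w) * norm (w' - w) * \<bar>f z\<bar> \<partial>lborel)"
   proof (rule integral_mono)
    show "integrable lborel (\<lambda>z. norm (H (z - w') *\<^sub>R f z - H (z - w) *\<^sub>R f z + (f z *\<^sub>R gradv H (z - w)) \<bullet> (w' - w)))"
     by (rule integrable_norm[OF Bochner_Integration.integrable_add[OF Bochner_Integration.integrable_diff[OF i[of w'] i[of w]] ii]])
    fix z
    have "\<bar>H ((z - w) + (w - w')) - H (z - w) - gradv H (z - w) \<bullet> (w - w')\<bar> \<le> L * norm (w' - w) * norm (w' - w)"
     using L(2)[of "z - w" "w - w'"] by (simp add: norm_minus_commute)
    moreover have "H (z - w') *\<^sub>R f z - H (z - w) *\<^sub>R f z + (f z *\<^sub>R gradv H (z - w)) \<bullet> (w' - w)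
     = (H ((z - w) + (w - w')) - H (z - w) - gradv H (z - w) \<bullet> (w - w')) * f z"
     by (simp add: algebra_simps)
    ultimately show "norm (H (z - w') *\<^sub>R f z - H (z - w) *\<^sub>R f z + (f z *\<^sub>R gradv H (z - w)) \<bullet> (w' - w)) \<le> L * norm (w' - w) * norm (w' - w) * \<bar>f z\<bar>"
     by (simp only: real_norm_def abs_mult) (rule mult_right_mono, simp_all)
   qed (use f in auto)
   finally show ?thesis by (simp add: I_def)
  qed
  define d where "d = e / (L * I + 1)"
  have LI: "0 \<le> L * I" using L I by simp
  have d: "d > 0" using e LI by (simp add: d_def add_nonneg_pos)
  show "\<exists>d>0. \<forall>w'. norm (w' - w) < d \<longrightarrow> norm (mconv H f w' - mconv H f w - mconv_grad H f w \<bullet> (w' - w)) \<le> e * norm (w' - w)"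
  proof (rule exI[of _ d], intro conjI allI impI)
   fix w' assume w': "norm (w' - w) < d"
   have "(L * I) * norm (w' - w) \<le> (L * I + 1) * d" using w' LI d by (intro mult_mono) auto
   also have "\<dots> = e" using LI by (simp add: d_def)
   finally have "(L * I) * norm (w' - w) * norm (w' - w) \<le> e * norm (w' - w)" by (intro mult_right_mono) auto
   then show "norm (mconv H f w' - mconv H f w - mconv_grad H f w \<bullet> (w' - w)) \<le> e * norm (w' - w)"
    using rem[of w'] by (simp add: mult_ac)
  qed (rule d)
 qed
 have lip: "norm (mconv_grad H f w' - mconv_grad H f w) \<le> (L * I) * norm (w' - w)" for w w'
 proof -
  have "norm (mconv_grad H f w' - mconv_grad H f w) = norm (\<integral>z. f z *\<^sub>R gradv H (z - w) - f z *\<^sub>R gradv H (z - w') \<partial>lborel)"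
   unfolding mconv_grad_def using ig[of w] ig[of w'] by simp
  also have "\<dots> \<le> (\<integral>z. norm (f z *\<^sub>R gradv H (z - w) - f z *\<^sub>R gradv H (z - w')) \<partial>lborel)"
   by (rule integral_norm_bound)
  also have "\<dots> \<le> (\<integral>z. L * norm (w' - w) * \<bar>f z\<bar> \<partial>lborel)"
  proof (rule integral_mono)
   show "integrable lborel (\<lambda>z. norm (f z *\<^sub>R gradv H (z - w) - f z *\<^sub>R gradv H (z - w')))"
    by (rule integrable_norm[OF Bochner_Integration.integrable_diff[OF ig[of w] ig[of w']]])
   show "norm (f z *\<^sub>R gradv H (z - w) - f z *\<^sub>R gradv H (z - w')) \<le> L * norm (w' - w) * \<bar>f z\<bar>" for z
    using mult_left_mono[OF L(3)[of "z - w" "z - w'"], of "\<bar>f z\<bar>"]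
    by (simp add: scaleR_diff_right[symmetric] mult_ac)
  qed (use f in auto)
  finally show ?thesis by (simp add: I_def mult_ac)
 qed
 show "continuous_on UNIV (mconv_grad H f)"
 proof (rule continuous_on_iff[THEN iffD2], intro ballI allI impI)
  fix w and e :: real assume e: "0 < e"
  define d where "d = e / (L * I + 1)"
  have LI: "0 \<le> L * I" using L I by simp
  have d: "d > 0" using e LI by (simp add: d_def add_nonneg_pos)
  show "\<exists>d>0. \<forall>w'\<in>UNIV. dist w' w < d \<longrightarrow> dist (mconv_grad H f w') (mconv_grad H f w) < e"
  proof (rule exI[of _ d], intro conjI ballI impI)
   fix w' assume w': "dist w' w < d"
   have "(L * I) * norm (w' - w) \<le> (L * I) * d" using w' LI by (intro mult_left_mono) (auto simp: dist_norm)
   also have "\<dots> < (L * I + 1) * d" using d by simp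
   also have "\<dots> = e" using LI by (simp add: d_def)
   finally show "dist (mconv_grad H f w') (mconv_grad H f w) < e" using lip[of w' w] by (simp add: dist_norm)
  qed (rule d)
 qed
qed

lemma integral_lebesgue_on_vanishing:
 fixes f :: "real^'n::finite \<Rightarrow> real"
 assumes "W \<in> sets lebesgue" "f \<in> borel_measurable borel" "\<And>x. x \<notin> W \<Longrightarrow> f x = 0"
 shows "integral\<^sup>L (lebesgue_on W) f = integral\<^sup>L lborel f"
proof -
 have "(\<lambda>x. indicator W x *\<^sub>R f x) = f" using assms(3) by (intro ext) (auto simp: indicator_def)
 then show ?thesis using assms(2) by (simp only: integral_lebesgue_on[OF assms(1)]) (simp add: integral_completion)
qed

text \<open>As the closed ball around w lies in W, the translated kernel is an admissible test
  function and the definition of the weak gradient moves the derivative from the kernel to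
  u.\<close>

lemma mconv_grad_weak:
 fixes u :: "real^'n::finite \<Rightarrow> real"
 assumes O: "open W" and d: "0 < d" and sub: "cball w d \<subseteq> W" and wk: "weak_grad W u g"
  and u: "integrable lborel u" "\<And>x. x \<notin> W \<Longrightarrow> u x = 0" and g: "integrable lborel g" "\<And>x. x \<notin> W \<Longrightarrow> g x = 0"
 shows "mconv_grad (moll d) u w = mconv (moll d) g w"
proof -
 note Ol = open_sets_lebesgue[OF O]
 note mp = moll_props[OF d, where 'n='n]
 have t: "test_fun W (\<lambda>z. moll d (z - w))" by (rule mp(7)[OF sub])
 have pdt: "pd i (\<lambda>z. moll d (z - w)) z = gradv (moll d) (z - w) $ i" for i z
 proof -
  have "((\<lambda>z. z - w) has_derivative (\<lambda>h. h)) (at z)" by (auto intro!: derivative_eq_intros)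
  from has_derivative_compose[OF this smooth_fun_gradv[OF mp(5)]]
  have "((\<lambda>z. moll d (z - w)) has_derivative (\<lambda>h. gradv (moll d) (z - w) \<bullet> h)) (at z)" .
  from frechet_derivative_at[OF this, symmetric] show ?thesis by (simp add: inner_axis)
 qed
 have mm: "(\<lambda>z. moll d (z - w)) \<in> borel_measurable borel" "(\<lambda>z. gradv (moll d) (z - w)) \<in> borel_measurable borel"
  using continuous_translate_measurable[OF smooth_funD(2)[OF mp(5)], of w]
   continuous_translate_measurable[OF continuous_gradv[OF mp(5)], of w] by simp_all
 have gm: "(\<lambda>z. gradv (moll d) (z - w) $ i) \<in> borel_measurable borel" for i
  using borel_measurable_inner[OF mm(2) borel_measurable_const[of "axis i 1"]] by (simp add: inner_axis)
 have um: "u \<in> borel_measurable borel" "g \<in> borel_measurable borel" using u g by auto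
 have gi: "(\<lambda>z. g z $ i) \<in> borel_measurable borel" for i
  using borel_measurable_inner[OF um(2) borel_measurable_const[of "axis i 1"]] by (simp add: inner_axis)
 have "mconv_grad (moll d) u w $ i = mconv (moll d) g w $ i" for i
 proof -
  have "mconv_grad (moll d) u w $ i = - (\<integral>z. (u z *\<^sub>R gradv (moll d) (z - w)) \<bullet> axis i 1 \<partial>lborel)"
   unfolding mconv_grad_def
   by (simp add: inner_axis integral_inner_left[OF mconv_grad_integrable[OF mp(6) u(1)], of w "axis i 1", simplified inner_axis, simplified])
  also have "(\<integral>z. (u z *\<^sub>R gradv (moll d) (z - w)) \<bullet> axis i 1 \<partial>lborel) = (\<integral>z. u z * pd i (\<lambda>z. moll d (z - w)) z \<partial>lborel)"
   by (simp add: pdt inner_axis)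
  also have "\<dots> = (LINT z|lebesgue_on W. u z * pd i (\<lambda>z. moll d (z - w)) z)"
   by (rule integral_lebesgue_on_vanishing[OF Ol, symmetric]) (use um gm u in \<open>auto simp: pdt\<close>)
  also have "\<dots> = - (LINT z|lebesgue_on W. g z $ i * moll d (z - w))"
   by (rule weak_gradD(3)[OF wk t])
  also have "(LINT z|lebesgue_on W. g z $ i * moll d (z - w)) = (\<integral>z. g z $ i * moll d (z - w) \<partial>lborel)"
   by (rule integral_lebesgue_on_vanishing[OF Ol]) (use gi mm g in auto)
  also have "\<dots> = (\<integral>z. (moll d (z - w) *\<^sub>R g z) \<bullet> axis i 1 \<partial>lborel)"
   by (simp add: inner_axis mult.commute)
  also have "\<dots> = mconv (moll d) g w \<bullet> axis i 1"
   unfolding mconv_def by (rule integral_inner_left[OF mconv_integrable[OF mp(6) g(1)]])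
  finally show ?thesis by (simp add: inner_axis)
 qed
 then show ?thesis by (simp add: vec_eq_iff)
qed

section \<open>Jensen's inequality, density of continuous functions and bounds for
  mollifications\<close>

text \<open>The tangent inequality of \<open>powr\<close> at the mean m is integrated against the
  probability density H. If the right-hand side is infinite there is nothing to prove, hence the
  form with nonnegative integrals.\<close>

lemma nn_Jensen_powr:
 fixes h :: "'a \<Rightarrow> real"
 assumes p: "1 < p" and [measurable]: "H \<in> borel_measurable M" "h \<in> borel_measurable M"
  and H: "\<And>x. 0 \<le> H x" "integrable M H" "(\<integral>x. H x \<partial>M) = 1" and h: "\<And>x. 0 \<le> h x" "integrable M (\<lambda>x. H x * h x)"
 shows "ennreal ((\<integral>x. H x * h x \<partial>M) powr p) \<le> (\<integral>\<^sup>+x. ennreal (H x * h x powr p) \<partial>M)"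
proof (cases "(\<integral>\<^sup>+x. ennreal (H x * h x powr p) \<partial>M) = \<infinity>")
 case False
 have i: "integrable M (\<lambda>x. H x * h x powr p)"
  by (rule integrableI_bounded) (use False H in \<open>auto simp: abs_mult less_top\<close>)
 define m where "m = (\<integral>x. H x * h x \<partial>M)"
 have m: "0 \<le> m" unfolding m_def using H h by (intro integral_nonneg_AE) auto
 have "(\<integral>x. m powr p * H x + p * m powr (p - 1) * (H x * h x - m * H x) \<partial>M) \<le> (\<integral>x. H x * h x powr p \<partial>M)"
 proof (rule integral_mono[OF _ i])
  show "integrable M (\<lambda>x. m powr p * H x + p * m powr (p - 1) * (H x * h x - m * H x))"
   using H h by (auto intro!: Bochner_Integration.integrable_add Bochner_Integration.integrable_diff integrable_mult_right)
  fix x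
  have "H x * (m powr p + p * m powr (p - 1) * (h x - m)) \<le> H x * h x powr p"
   by (intro mult_left_mono powr_tangent_le) (use m h H p in auto)
  then show "m powr p * H x + p * m powr (p - 1) * (H x * h x - m * H x) \<le> H x * h x powr p"
   by (simp add: algebra_simps)
 qed
 moreover have "(\<integral>x. m powr p * H x + p * m powr (p - 1) * (H x * h x - m * H x) \<partial>M) = m powr p"
  using H h m_def by (simp add: Bochner_Integration.integrable_diff)
 ultimately have "m powr p \<le> (\<integral>x. H x * h x powr p \<partial>M)" by simp
 then show ?thesis
  unfolding m_def[symmetric] using H by (subst nn_integral_eq_integral[OF i]) (auto intro: ennreal_leI)
qed simp

lemma borel_imp_lebesgue_on:
 fixes f :: "'a::euclidean_space \<Rightarrow> 'b::euclidean_space"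
 shows "f \<in> borel_measurable borel \<Longrightarrow> f \<in> borel_measurable (lebesgue_on W)"
 by (intro measurable_restrict_space1 measurable_completion) simp

text \<open>Two dominated convergence steps: f is truncated at a height k, and the truncation is
  approximated by continuous functions converging almost everywhere and kept bounded.\<close>

lemma Lp_dense_continuous:
 fixes f :: "'a::euclidean_space \<Rightarrow> 'b::euclidean_space"
 assumes O: "open W" "bounded W" and p: "1 < p" and fb: "f \<in> borel_measurable borel"
  and f: "Lp_vec p (lebesgue_on W) f" and e: "0 < E"
 obtains h where "continuous_on UNIV h" "Lp_vec p (lebesgue_on W) h" "Lp_int p (lebesgue_on W) (\<lambda>x. f x - h x) < E"
proof -
 let ?M = "lebesgue_on W"
 have fin: "finite_measure ?M" by (rule finite_measure_lebesgue_on_bounded[OF O(2,1)])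
 note Ol = open_sets_lebesgue[OF O(1)]
 define fk where "fk k x = (if norm (f x) \<le> real k then f x else 0)" for k :: nat and x
 have fkm[measurable]: "fk k \<in> borel_measurable borel" for k
  unfolding fk_def using fb by measurable
 note fkM = borel_imp_lebesgue_on[OF fkm]
 have fkL: "Lp_vec p ?M (fk k)" for k
  by (rule Lp_vec_const_bounded[OF fin fkM, of _ "real k"]) (use p in \<open>auto simp: fk_def\<close>)
 have "(\<lambda>k. Lp_int p ?M (\<lambda>x. f x - fk k x)) \<longlonglongrightarrow> (\<integral>x. 0 \<partial>?M)"
  unfolding Lp_int_def
 proof (rule integral_dominated_convergence[OF _ _ Lp_vec_integrable[OF f]])
  show "AE x in ?M. (\<lambda>k. norm (f x - fk k x) powr p) \<longlonglongrightarrow> 0"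
  proof (rule AE_I2)
   fix x
   have "\<forall>\<^sub>F k in sequentially. norm (f x - fk k x) powr p = 0"
    using eventually_ge_at_top[of "nat \<lceil>norm (f x)\<rceil>"]
    by eventually_elim (auto simp: fk_def nat_le_iff ceiling_le_iff)
   then show "(\<lambda>k. norm (f x - fk k x) powr p) \<longlonglongrightarrow> 0" by (simp add: tendsto_eventually)
  qed
  show "AE x in ?M. norm (norm (f x - fk k x) powr p) \<le> norm (f x) powr p" for k
   by (auto simp: fk_def)
 qed (use Lp_vec_measurable[OF f] fkM in auto)
 then have "(\<lambda>k. Lp_int p ?M (\<lambda>x. f x - fk k x)) \<longlonglongrightarrow> 0" by simp
 from order_tendstoD(2)[OF this, of "E / 2 powr p"] e
 obtain k where k: "Lp_int p ?M (\<lambda>x. f x - fk k x) < E / 2 powr p"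
  by (auto simp: eventually_sequentially)
 have "fk k \<in> borel_measurable lebesgue" by (intro measurable_completion) simp
 then have "fk k measurable_on UNIV" by (intro lebesgue_measurable_imp_measurable_on) auto
 then obtain N g where N: "negligible N" and g: "\<And>n. continuous_on UNIV (g n)"
  and lim: "\<And>x. x \<notin> N \<Longrightarrow> (\<lambda>n. g n x) \<longlonglongrightarrow> fk k x"
  unfolding measurable_on_def by auto
 let ?B = "cball (0::'b) (real k)"
 \<comment> \<open>Projection onto the ball of radius k is continuous and fixes the truncated
   function, so it makes the approximants bounded without changing their limit.\<close>
 define h where "h n x = closest_point ?B (g n x)" for n x
 have ccp: "continuous_on UNIV (closest_point ?B)"
  by (rule continuous_on_closest_point) auto
 have hc: "continuous_on UNIV (h n)" for n
  unfolding h_def by (intro continuous_on_compose2[OF ccp g]) auto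
 have hb: "norm (h n x) \<le> real k" for n x
  using closest_point_in_set[of ?B "g n x"] by (simp add: h_def)
 have hM: "h n \<in> borel_measurable ?M" for n
  using borel_imp_lebesgue_on[OF borel_measurable_continuous_onI[OF hc]] .
 have hL: "Lp_vec p ?M (h n)" for n
  by (rule Lp_vec_const_bounded[OF fin hM hb]) (use p in simp)
 have "(\<lambda>n. Lp_int p ?M (\<lambda>x. fk k x - h n x)) \<longlonglongrightarrow> (\<integral>x. 0 \<partial>?M)"
  unfolding Lp_int_def
 proof (rule integral_dominated_convergence)
  interpret finite_measure ?M by fact
  show "integrable ?M (\<lambda>x. (2 * real k) powr p)" by simp
  have "AE x in lebesgue. x \<notin> N" using N by (intro AE_not_in) (simp add: negligible_iff_null_sets)
  then have "AE x in ?M. x \<notin> N" unfolding AE_lebesgue_on_iff[OF Ol] by eventually_elim simp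
  then show "AE x in ?M. (\<lambda>n. norm (fk k x - h n x) powr p) \<longlonglongrightarrow> 0"
  proof eventually_elim
   case (elim x)
   have "(\<lambda>n. h n x) \<longlonglongrightarrow> closest_point ?B (fk k x)"
    unfolding h_def using ccp lim[OF elim]
    by (intro isCont_tendsto_compose[of _ "closest_point ?B"]) (auto simp: continuous_on_eq_continuous_at)
   moreover have "closest_point ?B (fk k x) = fk k x" by (rule closest_point_self) (simp add: fk_def)
   ultimately have "(\<lambda>n. norm (fk k x - h n x)) \<longlonglongrightarrow> norm (fk k x - fk k x)"
    by (intro tendsto_intros) simp
   then have "(\<lambda>n. norm (fk k x - h n x)) \<longlonglongrightarrow> 0" by simp
   from tendsto_powr'[OF this tendsto_const, of p] p show ?case by simp
  qed
  show "AE x in ?M. norm (norm (fk k x - h n x) powr p) \<le> (2 * real k) powr p" for n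
  proof (rule AE_I2)
   fix x
   have "norm (fk k x) \<le> real k" by (simp add: fk_def)
   then have "norm (fk k x - h n x) \<le> 2 * real k"
    using norm_triangle_ineq4[of "fk k x" "h n x"] hb[of n x] by linarith
   then show "norm (norm (fk k x - h n x) powr p) \<le> (2 * real k) powr p"
    using p by (simp add: powr_mono2)
  qed
 qed (use hM fkM in auto)
 then have "(\<lambda>n. Lp_int p ?M (\<lambda>x. fk k x - h n x)) \<longlonglongrightarrow> 0" by simp
 from order_tendstoD(2)[OF this, of "E / 2 powr p"] e
 obtain n where n: "Lp_int p ?M (\<lambda>x. fk k x - h n x) < E / 2 powr p"
  by (auto simp: eventually_sequentially)
 have "Lp_int p ?M (\<lambda>x. f x - h n x) \<le> 2 powr (p - 1) * (Lp_int p ?M (\<lambda>x. f x - fk k x) + Lp_int p ?M (\<lambda>x. fk k x - h n x))"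
  by (rule Lp_int_triangle[OF _ f fkL hL]) (use p in simp)
 also have "\<dots> < 2 powr (p - 1) * (E / 2 powr p + E / 2 powr p)"
  using k n by (intro mult_strict_left_mono) auto
 also have "\<dots> = E" by (simp add: powr_diff)
 finally show ?thesis using that[OF hc hL] by blast
qed

lemma mconv_translate:
 fixes f :: "real^'n::finite \<Rightarrow> 'b::euclidean_space"
 assumes t: "test_fun UNIV h" and f: "integrable lborel f"
 shows "integrable lborel (\<lambda>y. h y *\<^sub>R f (w + y))" "mconv h f w = (\<integral>y. h y *\<^sub>R f (w + y) \<partial>lborel)"
proof -
 note i = mconv_integrable[OF t f, of w]
 note tr = lborel_translation[of "\<lambda>z. h (z - w) *\<^sub>R f z" w]
 show "integrable lborel (\<lambda>y. h y *\<^sub>R f (w + y))"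
  using tr(1) i by (auto simp: add.commute)
 show "mconv h f w = (\<integral>y. h y *\<^sub>R f (w + y) \<partial>lborel)"
  unfolding mconv_def using tr(2) i by (auto simp: add.commute)
qed

text \<open>Jensen for the probability density \<open>moll d\<close>, followed by Fubini, reduces
  the error of mollification to the errors of single shifts y. The map A will be a contraction
  towards the centre.\<close>

lemma mconv_Lp_bound:
 fixes f F :: "real^'n::finite \<Rightarrow> 'b::euclidean_space" and A :: "real^'n \<Rightarrow> real^'n"
 assumes p: "1 < p" and d: "0 < d" and f: "integrable lborel f" and F[measurable]: "F \<in> borel_measurable borel"
  and A[measurable]: "A \<in> borel_measurable borel" and O[measurable]: "W \<in> sets borel"
  and K: "\<And>y. norm y < d \<Longrightarrow> (\<integral>\<^sup>+x. ennreal (norm (F x - f (A x + y)) powr p) * indicator W x \<partial>lborel) \<le> K"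
 shows "(\<integral>\<^sup>+x. ennreal (norm (F x - mconv (moll d) f (A x)) powr p) * indicator W x \<partial>lborel) \<le> K"
proof -
 note mp = moll_props[OF d, where 'n='n]
 define h where "h = (moll d :: real^'n \<Rightarrow> real)"
 have h: "\<And>x. 0 \<le> h x" "integrable lborel h" "(\<integral>x. h x \<partial>lborel) = 1" "test_fun UNIV h"
  and hm[measurable]: "h \<in> borel_measurable borel"
  using mp(1,2,3,6) by (auto simp: h_def)
 have fm[measurable]: "f \<in> borel_measurable borel" using f by auto
 have "(\<integral>\<^sup>+x. ennreal (norm (F x - mconv h f (A x)) powr p) * indicator W x \<partial>lborel)
   \<le> (\<integral>\<^sup>+x. (\<integral>\<^sup>+y. ennreal (h y * norm (F x - f (A x + y)) powr p) * indicator W x \<partial>lborel) \<partial>lborel)"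
 proof (rule nn_integral_mono)
  fix x
  note tr = mconv_translate[OF h(4) f, of "A x"]
  have i: "integrable lborel (\<lambda>y. h y *\<^sub>R (F x - f (A x + y)))"
   unfolding scaleR_diff_right by (intro Bochner_Integration.integrable_diff integrable_scaleR_left h tr)
  have "F x - mconv h f (A x) = (\<integral>y. h y *\<^sub>R F x \<partial>lborel) - (\<integral>y. h y *\<^sub>R f (A x + y) \<partial>lborel)"
   using h by (simp add: tr)
  also have "\<dots> = (\<integral>y. h y *\<^sub>R (F x - f (A x + y)) \<partial>lborel)"
   unfolding scaleR_diff_right using h tr by (intro Bochner_Integration.integral_diff[symmetric] integrable_scaleR_left)
  finally have "norm (F x - mconv h f (A x)) \<le> (\<integral>y. norm (h y *\<^sub>R (F x - f (A x + y))) \<partial>lborel)"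
   using integral_norm_bound[of lborel "\<lambda>y. h y *\<^sub>R (F x - f (A x + y))"] by simp
  also have "\<dots> = (\<integral>y. h y * norm (F x - f (A x + y)) \<partial>lborel)" using h by simp
  finally have "ennreal (norm (F x - mconv h f (A x)) powr p) \<le> ennreal ((\<integral>y. h y * norm (F x - f (A x + y)) \<partial>lborel) powr p)"
   using p by (intro ennreal_leI powr_mono2) auto
  also have "\<dots> \<le> (\<integral>\<^sup>+y. ennreal (h y * norm (F x - f (A x + y)) powr p) \<partial>lborel)"
   by (rule nn_Jensen_powr[OF p]) (use h integrable_norm[OF i] in \<open>auto\<close>)
  finally show "ennreal (norm (F x - mconv h f (A x)) powr p) * indicator W x
   \<le> (\<integral>\<^sup>+y. ennreal (h y * norm (F x - f (A x + y)) powr p) * indicator W x \<partial>lborel)"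
   by (auto split: split_indicator)
 qed
 also have "\<dots> = (\<integral>\<^sup>+y. (\<integral>\<^sup>+x. ennreal (h y * norm (F x - f (A x + y)) powr p) * indicator W x \<partial>lborel) \<partial>lborel)"
  by (rule lborel_pair.Fubini') measurable
 also have "\<dots> \<le> (\<integral>\<^sup>+y. ennreal (h y) * K \<partial>lborel)"
 proof (rule nn_integral_mono)
  fix y
  have "(\<integral>\<^sup>+x. ennreal (h y * norm (F x - f (A x + y)) powr p) * indicator W x \<partial>lborel)
   = ennreal (h y) * (\<integral>\<^sup>+x. ennreal (norm (F x - f (A x + y)) powr p) * indicator W x \<partial>lborel)"
   by (subst nn_integral_cmult[symmetric]) (auto simp: ennreal_mult h mult.assoc)
  also have "\<dots> \<le> ennreal (h y) * K"
  proof (cases "norm y < d")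
   case False
   then show ?thesis using mp(4)[of y] by (simp add: h_def)
  qed (intro mult_left_mono K, auto)
  finally show "(\<integral>\<^sup>+x. ennreal (h y * norm (F x - f (A x + y)) powr p) * indicator W x \<partial>lborel) \<le> ennreal (h y) * K" .
 qed
 also have "\<dots> = (\<integral>\<^sup>+y. ennreal (h y) \<partial>lborel) * K" by (rule nn_integral_multc) auto
 also have "(\<integral>\<^sup>+y. ennreal (h y) \<partial>lborel) = 1"
  using nn_integral_eq_integral[OF h(2)] h by simp
 finally show ?thesis by (simp add: h_def)
qed

text \<open>The Jacobian is K^n with n the dimension, and K is at least 1/2, so the change of
  variables costs at most the factor 2^n.\<close>

lemma nn_integral_affine_le:
 fixes h :: "'a::euclidean_space \<Rightarrow> ennreal"
 assumes h[measurable]: "h \<in> borel_measurable borel" and O[measurable]: "W \<in> sets borel"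
  and K: "1/2 \<le> K" and sub: "\<And>x. x \<in> W \<Longrightarrow> t + K *\<^sub>R x \<in> W"
 shows "(\<integral>\<^sup>+x. h (t + K *\<^sub>R x) * indicator W x \<partial>lborel) \<le> ennreal (2 ^ DIM('a)) * (\<integral>\<^sup>+x. h x * indicator W x \<partial>lborel)"
proof -
 have k0: "K \<noteq> 0" "0 < K" using K by auto
 have "(\<integral>\<^sup>+x. h x * indicator W x \<partial>lborel) = (\<integral>\<^sup>+x. h x * indicator W x \<partial>density (distr lborel borel (\<lambda>x. t + K *\<^sub>R x)) (\<lambda>_. \<bar>K\<bar>^DIM('a)))"
  using lborel_affine[OF k0(1), of t] by simp
 also have "\<dots> = (\<integral>\<^sup>+x. ennreal (K^DIM('a)) * (h (t + K *\<^sub>R x) * indicator W (t + K *\<^sub>R x)) \<partial>lborel)"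
  using k0 by (subst nn_integral_density) (auto simp: nn_integral_distr)
 finally have eq: "(\<integral>\<^sup>+x. h x * indicator W x \<partial>lborel) = \<dots>" .
 have "(\<integral>\<^sup>+x. h (t + K *\<^sub>R x) * indicator W x \<partial>lborel) \<le> (\<integral>\<^sup>+x. ennreal (2 ^ DIM('a)) * (ennreal (K^DIM('a)) * (h (t + K *\<^sub>R x) * indicator W (t + K *\<^sub>R x))) \<partial>lborel)"
 proof (rule nn_integral_mono)
  fix x
  have "1 \<le> (2 * K) ^ DIM('a)" using K by (intro one_le_power) simp
  then have 1: "ennreal 1 \<le> ennreal (2 ^ DIM('a)) * ennreal (K^DIM('a))"
   using k0 by (subst ennreal_mult[symmetric]) (auto simp: power_mult_distrib intro!: ennreal_leI)
  have "h (t + K *\<^sub>R x) * indicator W x \<le> h (t + K *\<^sub>R x) * indicator W (t + K *\<^sub>R x)"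
   using sub by (auto split: split_indicator)
  also have "\<dots> \<le> (ennreal (2 ^ DIM('a)) * ennreal (K^DIM('a))) * (h (t + K *\<^sub>R x) * indicator W (t + K *\<^sub>R x))"
   using mult_right_mono[OF 1, of "h (t + K *\<^sub>R x) * indicator W (t + K *\<^sub>R x)"] by simp
  finally show "h (t + K *\<^sub>R x) * indicator W x \<le> ennreal (2 ^ DIM('a)) * (ennreal (K^DIM('a)) * (h (t + K *\<^sub>R x) * indicator W (t + K *\<^sub>R x)))"
   by (simp add: mult.assoc)
 qed
 also have "\<dots> = ennreal (2 ^ DIM('a)) * (\<integral>\<^sup>+x. h x * indicator W x \<partial>lborel)"
  unfolding eq by (rule nn_integral_cmult) measurable
 finally show ?thesis .
qed

lemma ennreal_Lp_int:
 fixes f :: "'a::euclidean_space \<Rightarrow> 'b::euclidean_space"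
 assumes O: "open W" and b: "f \<in> borel_measurable borel" and f: "Lp_vec p (lebesgue_on W) f"
 shows "(\<integral>\<^sup>+x. ennreal (norm (f x) powr p) * indicator W x \<partial>lborel) = ennreal (Lp_int p (lebesgue_on W) f)"
proof -
 have "(\<integral>\<^sup>+x. ennreal (norm (f x) powr p) * indicator W x \<partial>lborel) = (\<integral>\<^sup>+x. ennreal (norm (f x) powr p) \<partial>lebesgue_on W)"
  using O b by (intro nn_integral_lebesgue_on_borel[symmetric]) auto
 also have "\<dots> = ennreal (Lp_int p (lebesgue_on W) f)"
  unfolding Lp_int_def by (rule nn_integral_eq_integral[OF Lp_vec_integrable[OF f]]) simp
 finally show ?thesis .
qed

lemma Lp_int_leI:
 fixes f :: "'a::euclidean_space \<Rightarrow> 'b::euclidean_space"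
 assumes O: "open W" and b: "f \<in> borel_measurable borel" and K: "0 \<le> K"
  and le: "(\<integral>\<^sup>+x. ennreal (norm (f x) powr p) * indicator W x \<partial>lborel) \<le> ennreal K"
 shows "Lp_vec p (lebesgue_on W) f" "Lp_int p (lebesgue_on W) f \<le> K"
proof -
 have e: "(\<integral>\<^sup>+x. ennreal (norm (f x) powr p) * indicator W x \<partial>lborel) = (\<integral>\<^sup>+x. ennreal (norm (f x) powr p) \<partial>lebesgue_on W)"
  using O b by (intro nn_integral_lebesgue_on_borel[symmetric]) auto
 have m: "f \<in> borel_measurable (lebesgue_on W)" by (rule borel_imp_lebesgue_on[OF b])
 have "integrable (lebesgue_on W) (\<lambda>x. norm (f x) powr p)"
  by (rule integrableI_bounded) (use m le e le_less_trans[OF _ ennreal_less_top] in auto)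
 then show L: "Lp_vec p (lebesgue_on W) f" using m by (simp add: Lp_vec_def)
 show "Lp_int p (lebesgue_on W) f \<le> K"
  using le ennreal_Lp_int[OF O b L] K by simp
qed

lemma integral_norm_bound_AE:
 fixes f :: "'a \<Rightarrow> 'b::{banach, second_countable_topology}"
 assumes "integrable M f" "integrable M g" "AE x in M. norm (f x) \<le> g x"
 shows "norm (\<integral>x. f x \<partial>M) \<le> (\<integral>x. g x \<partial>M)"
proof -
 have "norm (\<integral>x. f x \<partial>M) \<le> (\<integral>x. norm (f x) \<partial>M)" by (rule integral_norm_bound)
 also have "\<dots> \<le> (\<integral>x. g x \<partial>M)" by (rule integral_mono_AE) (use assms in auto)
 finally show ?thesis .
qed

section \<open>Density and compactness on strictly star-shaped domains\<close>

text \<open>Strictness lies in \<open>closure W\<close>: every contraction moves even boundary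
  points into the open set, which leaves space for a mollifier there.\<close>

locale star_domain =
 fixes W :: "(real^'n::finite) set" and c :: "real^'n"
 assumes open_dom: "open W" and bounded_dom: "bounded W"
  and star: "\<And>x s. x \<in> closure W \<Longrightarrow> 0 < s \<Longrightarrow> s \<le> 1 \<Longrightarrow> c + (1 - s) *\<^sub>R (x - c) \<in> W"
begin

abbreviation "MW \<equiv> lebesgue_on W"

definition shrink :: "real \<Rightarrow> real^'n \<Rightarrow> real^'n" where
 "shrink s x = c + (1 - s) *\<^sub>R (x - c)"

lemma shrink_affine: "shrink s x + y = (s *\<^sub>R c + y) + (1 - s) *\<^sub>R x"
 by (simp add: shrink_def algebra_simps)

lemma continuous_on_shrink [continuous_intros]: "continuous_on S (shrink s)"
 unfolding shrink_def by (intro continuous_intros)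

lemma shrink_measurable [measurable]: "shrink s \<in> borel_measurable borel"
 by (intro borel_measurable_continuous_onI continuous_on_shrink)

lemma compact_closure_dom: "compact (closure W)"
 using bounded_dom by (simp add: compact_closure)

lemma finite_dom: "finite_measure MW"
 by (rule finite_measure_lebesgue_on_bounded[OF bounded_dom open_dom])

lemma dom_borel [measurable]: "W \<in> sets borel"
 using open_dom by simp

lemma ex_room:
 assumes "0 < s" "s \<le> 1"
 shows "\<exists>d. 0 < d \<and> d \<le> s \<and> (\<forall>x\<in>closure W. cball (shrink s x) d \<subseteq> W)"
proof -
 have "compact (shrink s ` closure W)" by (intro compact_continuous_image continuous_on_shrink compact_closure_dom)
 moreover have "shrink s ` closure W \<subseteq> W" using star assms by (auto simp: shrink_def)
 ultimately obtain e where e: "e > 0" "(\<Union>x\<in>shrink s ` closure W. cball x e) \<subseteq> W"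
  using compact_subset_open_imp_cball_epsilon_subset open_dom by metis
 have "cball (shrink s x) (min e s) \<subseteq> W" if "x \<in> closure W" for x
 proof -
  have "cball (shrink s x) (min e s) \<subseteq> cball (shrink s x) e" by auto
  then show ?thesis using e(2) that by blast
 qed
 then show ?thesis using e(1) assms by (intro exI[of _ "min e s"]) auto
qed

text \<open>A mollification radius valid uniformly on the closure, by compactness of the contracted
  closure. The bound by s makes the total displacement of a point of order s.\<close>

definition room :: "real \<Rightarrow> real" where
 "room s = (SOME \<delta>. 0 < \<delta> \<and> \<delta> \<le> s \<and> (\<forall>x\<in>closure W. cball (shrink s x) \<delta> \<subseteq> W))"

lemma room:
 assumes "0 < s" "s \<le> 1"
 shows "0 < room s" "room s \<le> s" "x \<in> closure W \<Longrightarrow> cball (shrink s x) (room s) \<subseteq> W"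
 using someI_ex[OF ex_room[OF assms]] by (auto simp: room_def)

lemma room_add:
 assumes "0 < s" "s \<le> 1" "x \<in> closure W" "norm y \<le> room s"
 shows "shrink s x + y \<in> W"
 using room(3)[OF assms(1-3)] assms(4) by (auto simp: subset_iff dist_norm)

text \<open>Contraction precedes averaging, so for x in the closure of W only values of f inside W
  are used; the result is defined and smooth up to the boundary and beyond.\<close>

definition smoothing :: "real \<Rightarrow> (real^'n \<Rightarrow> 'b::euclidean_space) \<Rightarrow> real^'n \<Rightarrow> 'b" where
 "smoothing s f x = mconv (moll (room s)) f (shrink s x)"

definition smoothing_grad :: "real \<Rightarrow> (real^'n \<Rightarrow> real) \<Rightarrow> real^'n \<Rightarrow> real^'n" where
 "smoothing_grad s f x = (1 - s) *\<^sub>R mconv_grad (moll (room s)) f (shrink s x)"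

lemma C1_fun_smoothing:
 assumes "0 < s" "s \<le> 1" "integrable lborel f"
 shows "C1_fun (smoothing s f) (smoothing_grad s f)"
proof -
 note C = C1_fun_mconv[OF moll_props(6)[OF room(1)[OF assms(1,2)]] assms(3)]
 have "(smoothing s f has_derivative (\<lambda>h. smoothing_grad s f x \<bullet> h)) (at x)" for x
 proof -
  have "(shrink s has_derivative (\<lambda>h. (1 - s) *\<^sub>R h)) (at x)"
   unfolding shrink_def by (auto intro!: derivative_eq_intros)
  from has_derivative_compose[OF this, of "mconv (moll (room s)) f"] C
  show ?thesis unfolding smoothing_def smoothing_grad_def C1_fun_def
   by (fastforce elim: has_derivative_eq_rhs)
 qed
 moreover have "continuous_on UNIV (smoothing_grad s f)"
  unfolding smoothing_grad_def
  by (intro continuous_intros continuous_on_compose2[OF C1_fun_continuous(2)[OF C]]) auto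
 ultimately show ?thesis by (simp add: C1_fun_def)
qed

lemma smoothing_grad_eq:
 assumes s: "0 < s" "s \<le> 1" and x: "x \<in> closure W" and wk: "weak_grad W u g"
  and u: "integrable lborel u" "\<And>x. x \<notin> W \<Longrightarrow> u x = 0" and g: "integrable lborel g" "\<And>x. x \<notin> W \<Longrightarrow> g x = 0"
 shows "smoothing_grad s u x = (1 - s) *\<^sub>R smoothing s g x"
 unfolding smoothing_grad_def smoothing_def
 using mconv_grad_weak[OF open_dom room(1)[OF s] room(3)[OF s x] wk u g] by simp

lemma smoothing_measurable:
 fixes f :: "real^'n \<Rightarrow> 'b::euclidean_space"
 assumes [measurable]: "f \<in> borel_measurable borel" and s: "0 < s" "s \<le> 1"
 shows "smoothing s f \<in> borel_measurable borel"
proof -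
 have [measurable]: "moll (room s) \<in> borel_measurable (borel :: (real^'n) measure)"
  using moll_props(2)[OF room(1)[OF s]] by auto
 show ?thesis unfolding smoothing_def mconv_def by measurable
qed

lemma integrable_lborel_vanishing:
 fixes f :: "real^'n \<Rightarrow> 'b::euclidean_space"
 assumes b: "f \<in> borel_measurable borel" and z: "\<And>x. x \<notin> W \<Longrightarrow> f x = 0" and i: "integrable MW f"
 shows "integrable lborel f"
proof -
 have "(\<lambda>x. indicator W x *\<^sub>R f x) = f" using z by (intro ext) (auto simp: indicator_def)
 then have "integrable lebesgue f"
  using i by (simp only: integrable_lebesgue_on_iff[OF open_sets_lebesgue[OF open_dom]])
 then show ?thesis using b by (simp add: integrable_completion)
qed

lemma smoothing_Lp_bound:
 fixes f F :: "real^'n \<Rightarrow> 'b::euclidean_space"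
 assumes p: "1 < p" and s: "0 < s" "s \<le> 1" and f: "integrable lborel f" and F: "F \<in> borel_measurable borel" and K0: "0 \<le> K"
  and K: "\<And>y. norm y < room s \<Longrightarrow> (\<integral>\<^sup>+x. ennreal (norm (F x - f (shrink s x + y)) powr p) * indicator W x \<partial>lborel) \<le> ennreal K"
 shows "Lp_vec p MW (\<lambda>x. F x - smoothing s f x)" "Lp_int p MW (\<lambda>x. F x - smoothing s f x) \<le> K"
proof -
 have m: "(\<lambda>x. F x - smoothing s f x) \<in> borel_measurable borel"
  using F smoothing_measurable[OF _ s, of f] f by auto
 have le: "(\<integral>\<^sup>+x. ennreal (norm (F x - smoothing s f x) powr p) * indicator W x \<partial>lborel) \<le> ennreal K"
  unfolding smoothing_def
  by (rule mconv_Lp_bound[OF p room(1)[OF s] f F _ _ K]) auto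
 show "Lp_vec p MW (\<lambda>x. F x - smoothing s f x)" "Lp_int p MW (\<lambda>x. F x - smoothing s f x) \<le> K"
  by (rule Lp_int_leI[OF open_dom m K0 le])+
qed

lemma nn_shrink_le:
 fixes h :: "real^'n \<Rightarrow> ennreal"
 assumes "h \<in> borel_measurable borel" "0 < s" "s \<le> 1/2" "norm y \<le> room s"
 shows "(\<integral>\<^sup>+x. h (shrink s x + y) * indicator W x \<partial>lborel) \<le> ennreal (2 ^ CARD('n)) * (\<integral>\<^sup>+x. h x * indicator W x \<partial>lborel)"
 unfolding shrink_affine
proof (rule nn_integral_affine_le[where 'a="real^'n", simplified])
 show "s *\<^sub>R c + y + (1 - s) *\<^sub>R x \<in> W" if "x \<in> W" for x
  using room_add[of s x y] that assms closure_subset[of W] unfolding shrink_affine by auto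
qed (use assms in auto)

lemma norm_triple_powr_le:
 fixes a b d :: "'b::real_normed_vector"
 assumes "1 \<le> p"
 shows "norm (a + b + d) powr p \<le> 4 powr p * (norm a powr p + norm b powr p + norm d powr p)"
proof -
 have "norm (a + b + d) powr p \<le> 2 powr (p - 1) * (norm (a + b) powr p + norm d powr p)"
  by (rule norm_add_powr_le[OF assms])
 also have "\<dots> \<le> 2 powr (p - 1) * (2 powr (p - 1) * (norm a powr p + norm b powr p) + norm d powr p)"
  by (intro mult_left_mono add_right_mono norm_add_powr_le assms) auto
 also have "\<dots> \<le> 2 powr p * (2 powr p * (norm a powr p + norm b powr p) + 2 powr p * norm d powr p)"
 proof (intro mult_mono add_mono)
  show "norm d powr p \<le> 2 powr p * norm d powr p"
   using ge_one_powr_ge_zero[of 2 p] assms by (simp add: mult_le_cancel_right1)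
 qed (auto intro: powr_mono)
 also have "\<dots> = 4 powr p * (norm a powr p + norm b powr p + norm d powr p)"
  using powr_mult[of 2 2 p] by (simp add: algebra_simps)
 finally show ?thesis .
qed

text \<open>The offset 2 keeps the scales at most 1/2, so the contraction factor 1 - s stays at
  least 1/2 as the change of variables requires.\<close>

definition sc :: "nat \<Rightarrow> real" where "sc j = 1 / real (j + 2)"

lemma sc: "0 < sc j" "sc j \<le> 1/2" "sc j \<le> 1" "sc \<longlonglongrightarrow> 0"
proof -
 show "0 < sc j" "sc j \<le> 1/2" by (auto simp: sc_def field_simps)
 then show "sc j \<le> 1" by linarith
 show "sc \<longlonglongrightarrow> 0"
  using LIMSEQ_ignore_initial_segment[OF lim_1_over_n, of 2] by (simp add: sc_def[abs_def])
qed

lemma shrink_dist: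
 obtains D where "0 \<le> D" "\<And>s x y. 0 < s \<Longrightarrow> s \<le> 1 \<Longrightarrow> x \<in> closure W \<Longrightarrow> norm y \<le> room s \<Longrightarrow> norm (shrink s x + y - x) \<le> s * D"
  "\<And>x. x \<in> closure W \<Longrightarrow> norm (x - c) \<le> D"
proof -
 have "bounded ((\<lambda>x. x - c) ` closure W)"
  by (intro compact_imp_bounded compact_continuous_image compact_closure_dom continuous_intros)
 then obtain D where D: "\<And>x. x \<in> closure W \<Longrightarrow> norm (x - c) \<le> D" by (auto simp: bounded_iff)
 show ?thesis
 proof (rule that[of "max D 0 + 1"])
  fix s :: real and x y :: "real^'n" assume s: "0 < s" "s \<le> 1" and x: "x \<in> closure W" and y: "norm y \<le> room s"
  have "norm (shrink s x + y - x) = norm (y - s *\<^sub>R (x - c))" by (simp add: shrink_def algebra_simps)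
  also have "\<dots> \<le> norm y + s * norm (x - c)" using norm_triangle_ineq4[of y "s *\<^sub>R (x - c)"] s by simp
  also have "\<dots> \<le> s + s * max D 0"
  proof (rule add_mono)
   show "norm y \<le> s" using y room(2)[OF s] by simp
   show "s * norm (x - c) \<le> s * max D 0" using s D[OF x] by (intro mult_left_mono) auto
  qed
  finally show "norm (shrink s x + y - x) \<le> s * (max D 0 + 1)" by (simp add: algebra_simps)
 next
  show "norm (z - c) \<le> max D 0 + 1" if "z \<in> closure W" for z
   using D[OF that] by linarith
 qed auto
qed

text \<open>With T a contraction plus a small shift and h a continuous approximation, f - f(T)
  splits into f - h, h - h(T) and h(T) - f(T). The middle part is small by uniform continuity, the
  last by change of variables.\<close>

lemma smoothing_tendsto:
 fixes f :: "real^'n \<Rightarrow> 'b::euclidean_space"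
 assumes p: "1 < p" and fb[measurable]: "f \<in> borel_measurable borel" and f: "Lp_vec p MW f" and z: "\<And>x. x \<notin> W \<Longrightarrow> f x = 0"
 shows "(\<lambda>j. Lp_int p MW (\<lambda>x. smoothing (sc j) f x - f x)) \<longlonglongrightarrow> 0"
proof (rule LIMSEQ_I)
 fix r :: real assume r: "0 < r"
 have p1: "1 \<le> p" using p by simp
 have fi: "integrable lborel f"
  by (rule integrable_lborel_vanishing[OF fb z Lp_vec_imp_integrable[OF finite_dom p1 f]])
 define m where "m = measure MW (space MW)"
 \<comment> \<open>The factor \<open>4 powr p\<close> is the price of the three-term split; its
   parts contribute at most E, m E and 2^n E, where m is the volume of the domain and n the
   dimension.\<close>
 define Cn where "Cn = 4 powr p * (2 + m + 2 ^ CARD('n))"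
 have m0: "0 \<le> m" by (simp add: m_def)
 have Cn: "0 < Cn" unfolding Cn_def using m0 by (intro mult_pos_pos) (auto intro!: add_pos_pos add_pos_nonneg)
 define E where "E = r / (2 * Cn)"
 have e: "0 < E" using r Cn by (simp add: E_def)
 obtain h where h: "continuous_on UNIV h" "Lp_vec p MW h" "Lp_int p MW (\<lambda>x. f x - h x) < E"
  using Lp_dense_continuous[OF open_dom bounded_dom p fb f e] by blast
 have hb[measurable]: "h \<in> borel_measurable borel" using h(1) by (rule borel_measurable_continuous_onI)
 have "uniformly_continuous_on (closure W) h"
  by (intro compact_uniformly_continuous compact_closure_dom continuous_on_subset[OF h(1)]) auto
 from uniformly_continuous_onE[OF this, of "E powr (1/p)"] e
 obtain d where d: "d > 0" "\<And>x x'. x \<in> closure W \<Longrightarrow> x' \<in> closure W \<Longrightarrow> dist x' x < d \<Longrightarrow> dist (h x') (h x) < E powr (1/p)"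
  by auto
 obtain D where D: "0 \<le> D" "\<And>s x y. 0 < s \<Longrightarrow> s \<le> 1 \<Longrightarrow> x \<in> closure W \<Longrightarrow> norm y \<le> room s \<Longrightarrow> norm (shrink s x + y - x) \<le> s * D"
  using shrink_dist by metis
 have "(\<lambda>j. sc j * D) \<longlonglongrightarrow> 0 * D" by (intro tendsto_intros sc)
 then obtain N where N: "\<And>j. j \<ge> N \<Longrightarrow> sc j * D < d"
  using order_tendstoD(2)[of "\<lambda>j. sc j * D" 0 sequentially d] d by (auto simp: eventually_sequentially)
 have fh: "(\<integral>\<^sup>+x. ennreal (norm (f x - h x) powr p) * indicator W x \<partial>lborel) \<le> ennreal E"
  using ennreal_Lp_int[OF open_dom _ Lp_vec_diff[OF p1 f h(2)]] h(3) by (auto intro!: ennreal_leI)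
 have em: "emeasure lborel W = ennreal m"
 proof -
  interpret finite_measure MW by (rule finite_dom)
  have "ennreal m = emeasure MW (space MW)" unfolding m_def by (rule emeasure_eq_measure[symmetric])
  also have "\<dots> = emeasure lborel W" by (simp add: emeasure_restrict_space space_restrict_space)
  finally show ?thesis by simp
 qed
 have "Lp_int p MW (\<lambda>x. f x - smoothing (sc j) f x) \<le> Cn * E" if j: "j \<ge> N" for j
 proof (rule smoothing_Lp_bound(2)[OF p sc(1,3) fi fb])
  show "0 \<le> Cn * E" using Cn e by simp
  fix y :: "real^'n" assume y: "norm y < room (sc j)"
  let ?T = "\<lambda>x. shrink (sc j) x + y"
  have "(\<integral>\<^sup>+x. ennreal (norm (f x - f (?T x)) powr p) * indicator W x \<partial>lborel)
   \<le> (\<integral>\<^sup>+x. ennreal (4 powr p) * (ennreal (norm (f x - h x) powr p) * indicator W x + ennreal E * indicator W x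
     + ennreal (norm (f (?T x) - h (?T x)) powr p) * indicator W x) \<partial>lborel)"
  proof (rule nn_integral_mono)
   fix x
   show "ennreal (norm (f x - f (?T x)) powr p) * indicator W x \<le> ennreal (4 powr p) * (ennreal (norm (f x - h x) powr p) * indicator W x + ennreal E * indicator W x
     + ennreal (norm (f (?T x) - h (?T x)) powr p) * indicator W x)"
   proof (cases "x \<in> W")
    case True
    then have x: "x \<in> closure W" using closure_subset by auto
    have T: "?T x \<in> closure W" using room_add[OF sc(1,3) x, of y j] y closure_subset by auto
    have "dist (?T x) x < d" using D(2)[OF sc(1,3) x, of y j] y N[OF j] by (simp add: dist_norm)
    then have "norm (h x - h (?T x)) < E powr (1/p)"
     using d(2)[OF x T] by (simp add: dist_norm norm_minus_commute)
    then have "norm (h x - h (?T x)) powr p \<le> (E powr (1/p)) powr p" using p by (intro powr_mono2) auto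
    also have "\<dots> = E" using p e by (simp add: powr_powr)
    finally have hh: "norm (h x - h (?T x)) powr p \<le> E" .
    have "norm (f x - f (?T x)) powr p \<le> 4 powr p * (norm (f x - h x) powr p + norm (h x - h (?T x)) powr p + norm (h (?T x) - f (?T x)) powr p)"
     using norm_triple_powr_le[OF p1, of "f x - h x" "h x - h (?T x)" "h (?T x) - f (?T x)"] by simp
    also have "\<dots> \<le> 4 powr p * (norm (f x - h x) powr p + E + norm (f (?T x) - h (?T x)) powr p)"
     using hh by (intro mult_left_mono) (auto simp: norm_minus_commute)
    finally show ?thesis using True e
     by (simp add: ennreal_mult[symmetric] ennreal_plus[symmetric] ennreal_leI del: ennreal_plus)
   qed simp
  qed
  also have "\<dots> = ennreal (4 powr p) * ((\<integral>\<^sup>+x. ennreal (norm (f x - h x) powr p) * indicator W x \<partial>lborel) + (\<integral>\<^sup>+x. ennreal E * indicator W x \<partial>lborel)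
     + (\<integral>\<^sup>+x. ennreal (norm (f (?T x) - h (?T x)) powr p) * indicator W x \<partial>lborel))"
   by (simp add: nn_integral_cmult nn_integral_add)
  also have "\<dots> \<le> ennreal (4 powr p) * (ennreal E + ennreal E * ennreal m + ennreal (2 ^ CARD('n)) * ennreal E)"
  proof (intro mult_left_mono add_mono fh)
   show "(\<integral>\<^sup>+x. ennreal E * indicator W x \<partial>lborel) \<le> ennreal E * ennreal m"
    by (simp add: nn_integral_cmult em)
   have "(\<integral>\<^sup>+x. ennreal (norm (f (?T x) - h (?T x)) powr p) * indicator W x \<partial>lborel)
    \<le> ennreal (2 ^ CARD('n)) * (\<integral>\<^sup>+x. ennreal (norm (f x - h x) powr p) * indicator W x \<partial>lborel)"
    by (rule nn_shrink_le[of "\<lambda>x. ennreal (norm (f x - h x) powr p)"]) (use sc y in auto)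
   also have "\<dots> \<le> ennreal (2 ^ CARD('n)) * ennreal E" by (intro mult_left_mono fh) auto
   finally show "(\<integral>\<^sup>+x. ennreal (norm (f (?T x) - h (?T x)) powr p) * indicator W x \<partial>lborel) \<le> \<dots>" .
  qed auto
  also have "\<dots> = ennreal (4 powr p * (E + E * m + 2 ^ CARD('n) * E))"
   using e m0 by (simp add: ennreal_mult[symmetric] ennreal_plus[symmetric] del: ennreal_plus)
  also have "\<dots> \<le> ennreal (Cn * E)"
   unfolding Cn_def using e by (intro ennreal_leI) (simp add: algebra_simps)
  finally show "(\<integral>\<^sup>+x. ennreal (norm (f x - f (?T x)) powr p) * indicator W x \<partial>lborel) \<le> ennreal (Cn * E)" .
 qed
 moreover have "Cn * E < r" using r Cn by (simp add: E_def)
 ultimately show "\<exists>no. \<forall>j\<ge>no. norm (Lp_int p MW (\<lambda>x. smoothing (sc j) f x - f x) - 0) < r"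
  unfolding Lp_int_minus_commute[of p MW "smoothing _ f"]
  by (intro exI[of _ N]) (auto intro: le_less_trans)
qed

lemma ex_borel_representative_real:
 assumes "u \<in> borel_measurable MW"
 obtains u' :: "real^'n \<Rightarrow> real" where "u' \<in> borel_measurable borel" "\<And>x. x \<notin> W \<Longrightarrow> u' x = 0" "AE x in MW. u x = u' x"
proof -
 have "(\<lambda>x. u x * indicator W x) \<in> borel_measurable lebesgue"
  using assms by (subst (asm) borel_measurable_restrict_space_iff) (auto simp: mult.commute)
 then obtain v where v: "v \<in> borel_measurable lborel" "AE x in lborel. u x * indicator W x = v x"
  using completion_ex_borel_measurable_real by blast
 have "AE x in lebesgue. u x * indicator W x = v x" by (rule AE_completion[OF v(2)])
 then have "AE x in MW. u x = indicator W x * v x"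
  unfolding AE_lebesgue_on_iff[OF open_sets_lebesgue[OF open_dom]] by eventually_elim auto
 then show ?thesis using v by (intro that[of "\<lambda>x. indicator W x * v x"]) auto
qed

lemma ex_borel_representative_vec:
 assumes "g \<in> borel_measurable MW"
 obtains g' :: "real^'n \<Rightarrow> real^'n" where "g' \<in> borel_measurable borel" "\<And>x. x \<notin> W \<Longrightarrow> g' x = 0" "AE x in MW. g x = g' x"
proof -
 have "(\<lambda>x. g x $ i) \<in> borel_measurable MW" for i
  using borel_measurable_inner[OF assms borel_measurable_const[of "axis i 1"]] by (simp add: inner_axis)
 then have "\<forall>i. \<exists>v. v \<in> borel_measurable borel \<and> (\<forall>x. x \<notin> W \<longrightarrow> v x = 0) \<and> (AE x in MW. g x $ i = v x)"
  by (intro allI) (rule ex_borel_representative_real, assumption, blast)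
 then obtain v where v: "\<And>i. v i \<in> borel_measurable borel" "\<And>i x. x \<notin> W \<Longrightarrow> v i x = 0" "\<And>i. AE x in MW. g x $ i = v i x"
  by metis
 have "AE x in MW. \<forall>i\<in>UNIV. g x $ i = v i x" by (intro AE_finite_allI v(3)) auto
 then have "AE x in MW. g x = (\<chi> i. v i x)" by eventually_elim (simp add: vec_eq_iff)
 then show ?thesis
  using v by (intro that[of "\<lambda>x. \<chi> i. v i x"] borel_measurable_vec) (auto simp: vec_eq_iff)
qed

text \<open>Uniform convergence on the closure, boundary points included; it later shows that the
  trace of a function continuous up to the boundary is its restriction. Only a representative u'
  equal to u almost everywhere in W is averaged.\<close>

lemma smoothing_uniform:
 assumes cu: "continuous_on (closure W) u" and u': "integrable lborel u'" "AE x in MW. u x = u' x" and e: "0 < E"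
 shows "\<exists>N. \<forall>j\<ge>N. \<forall>x\<in>closure W. \<bar>smoothing (sc j) u' x - u x\<bar> \<le> (E::real)"
proof -
 have "uniformly_continuous_on (closure W) u" by (intro compact_uniformly_continuous compact_closure_dom cu)
 from uniformly_continuous_onE[OF this e]
 obtain d where d: "d > 0" "\<And>x x'. x \<in> closure W \<Longrightarrow> x' \<in> closure W \<Longrightarrow> dist x' x < d \<Longrightarrow> dist (u x') (u x) < E"
  by metis
 obtain D where D: "0 \<le> D" "\<And>s x y. 0 < s \<Longrightarrow> s \<le> 1 \<Longrightarrow> x \<in> closure W \<Longrightarrow> norm y \<le> room s \<Longrightarrow> norm (shrink s x + y - x) \<le> s * D"
  using shrink_dist by metis
 have "(\<lambda>j. sc j * D) \<longlonglongrightarrow> 0 * D" by (intro tendsto_intros sc)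
 then obtain N where N: "\<And>j. j \<ge> N \<Longrightarrow> sc j * D < d"
  using order_tendstoD(2)[of "\<lambda>j. sc j * D" 0 sequentially d] d by (auto simp: eventually_sequentially)
 have ae: "AE z in lborel. z \<in> W \<longrightarrow> u z = u' z"
  using u'(2) unfolding AE_lebesgue_on_iff[OF open_sets_lebesgue[OF open_dom]] by (simp add: AE_completion_iff)
 have "\<bar>smoothing (sc j) u' x - u x\<bar> \<le> E" if j: "j \<ge> N" and x: "x \<in> closure W" for j x
 proof -
  let ?h = "moll (room (sc j)) :: real^'n \<Rightarrow> real" and ?w = "shrink (sc j) x"
  note mp = moll_props[OF room(1)[OF sc(1)[of j] sc(3)[of j]], where 'n='n]
  note i = mconv_integrable[OF mp(6) u'(1), of ?w]
  note tr = lborel_translation[of "\<lambda>z. ?h (z - ?w)" ?w]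
  have mm: "(\<lambda>z. ?h (z - ?w)) \<in> borel_measurable borel"
   using continuous_translate_measurable[OF smooth_funD(2)[OF mp(5)], of ?w] by simp
  have h: "integrable lborel (\<lambda>z. ?h (z - ?w))" "(\<integral>z. ?h (z - ?w) \<partial>lborel) = 1"
   using tr[OF mm] mp(2,3) by auto
  have "smoothing (sc j) u' x - u x = (\<integral>z. ?h (z - ?w) *\<^sub>R u' z \<partial>lborel) - (\<integral>z. ?h (z - ?w) * u x \<partial>lborel)"
   using h by (simp add: smoothing_def mconv_def)
  also have "\<dots> = (\<integral>z. ?h (z - ?w) *\<^sub>R u' z - ?h (z - ?w) * u x \<partial>lborel)"
   using h i by (intro Bochner_Integration.integral_diff[symmetric]) auto
  finally have eq: "smoothing (sc j) u' x - u x = (\<integral>z. ?h (z - ?w) *\<^sub>R u' z - ?h (z - ?w) * u x \<partial>lborel)" .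
  have "norm (smoothing (sc j) u' x - u x) \<le> (\<integral>z. ?h (z - ?w) * E \<partial>lborel)"
   unfolding eq
  proof (rule integral_norm_bound_AE)
   show "integrable lborel (\<lambda>z. ?h (z - ?w) *\<^sub>R u' z - ?h (z - ?w) * u x)"
    using h i by (intro Bochner_Integration.integrable_diff) auto
   show "integrable lborel (\<lambda>z. ?h (z - ?w) * E)" using h by simp
   show "AE z in lborel. norm (?h (z - ?w) *\<^sub>R u' z - ?h (z - ?w) * u x) \<le> ?h (z - ?w) * E"
    using ae
   proof eventually_elim
    case (elim z)
    show ?case
    proof (cases "norm (z - ?w) < room (sc j)")
     case True
     have z: "z \<in> W" using room_add[OF sc(1,3) x, of "z - ?w" j] True by simp
     have "dist z x < d" using D(2)[OF sc(1,3) x, of "z - ?w" j] True N[OF j] by (simp add: dist_norm)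
     then have "\<bar>u z - u x\<bar> \<le> E" using d(2)[OF x, of z] z closure_subset[of W] by (auto simp: dist_real_def)
     then have "?h (z - ?w) * \<bar>u' z - u x\<bar> \<le> ?h (z - ?w) * E"
      using elim z mp(1) by (intro mult_left_mono) auto
     then show ?thesis using mp(1)[of "z - ?w"] by (simp add: right_diff_distrib[symmetric] abs_mult)
    next
     case False
     then show ?thesis using mp(4)[of "z - ?w"] by simp
    qed
   qed
  qed
  then show ?thesis using h by simp
 qed
 then show ?thesis by blast
qed

text \<open>Smoothing commutes with the weak gradient up to the factor 1 - s from the contraction,
  so the convergence of smoothings in L^p can be used for u and for its gradient alike.\<close>

theorem W1p_dense_C1:
 assumes p: "1 < p" and w: "W1p_pair p W u g"
 obtains v G where "\<And>j::nat. C1_fun (v j) (G j)"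
  "(\<lambda>j. Lp_int p MW (\<lambda>x. v j x - u x)) \<longlonglongrightarrow> 0" "(\<lambda>j. Lp_int p MW (\<lambda>x. G j x - g x)) \<longlonglongrightarrow> 0"
  "\<And>\<epsilon>. continuous_on (closure W) u \<Longrightarrow> 0 < \<epsilon> \<Longrightarrow> \<exists>N. \<forall>j\<ge>N. \<forall>x\<in>closure W. \<bar>v j x - u x\<bar> \<le> \<epsilon>"
proof -
 have p1: "1 \<le> p" using p by simp
 have wk: "weak_grad W u g" and u: "Lp_vec p MW u" and g: "Lp_vec p MW g" using w by (auto simp: W1p_pair_def)
 obtain u' where u': "u' \<in> borel_measurable borel" "\<And>x. x \<notin> W \<Longrightarrow> u' x = 0" "AE x in MW. u x = u' x"
  using ex_borel_representative_real[OF Lp_vec_measurable[OF u]] by blast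
 obtain g' where g': "g' \<in> borel_measurable borel" "\<And>x. x \<notin> W \<Longrightarrow> g' x = 0" "AE x in MW. g x = g' x"
  using ex_borel_representative_vec[OF Lp_vec_measurable[OF g]] by blast
 note um = borel_imp_lebesgue_on[OF u'(1), of W] and gm = borel_imp_lebesgue_on[OF g'(1), of W]
 note uL = Lp_vec_cong_AE[OF u um u'(3)] and gL = Lp_vec_cong_AE[OF g gm g'(3)]
 note ui = integrable_lborel_vanishing[OF u'(1,2) Lp_vec_imp_integrable[OF finite_dom p1 uL]]
  and gi = integrable_lborel_vanishing[OF g'(1,2) Lp_vec_imp_integrable[OF finite_dom p1 gL]]
 have wk': "weak_grad W u' g'" by (rule weak_grad_cong_AE[OF open_dom wk um gm u'(3) g'(3)])
 have C: "C1_fun (smoothing (sc j) u') (smoothing_grad (sc j) u')" for j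
  by (rule C1_fun_smoothing[OF sc(1,3) ui])
 have sm: "smoothing (sc j) u' \<in> borel_measurable MW" "smoothing (sc j) g' \<in> borel_measurable MW"
  "smoothing_grad (sc j) u' \<in> borel_measurable MW" for j
  using smoothing_measurable[OF u'(1) sc(1,3)] smoothing_measurable[OF g'(1) sc(1,3)] C1_fun_measurable(2)[OF C]
  by (auto intro: borel_imp_lebesgue_on)
 note tg = smoothing_tendsto[OF p g'(1) gL g'(2)]
 show ?thesis
 proof (rule that[OF C])
  have "Lp_int p MW (\<lambda>x. smoothing (sc j) u' x - u x) = Lp_int p MW (\<lambda>x. smoothing (sc j) u' x - u' x)" for j
   by (rule Lp_int_cong_AE) (use sm um Lp_vec_measurable[OF u] u'(3) in auto)
  then show "(\<lambda>j. Lp_int p MW (\<lambda>x. smoothing (sc j) u' x - u x)) \<longlonglongrightarrow> 0"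
   using smoothing_tendsto[OF p u'(1) uL u'(2)] by simp
  have d: "Lp_vec p MW (\<lambda>x. g' x - smoothing (sc j) g' x)" for j
  proof -
   have "Lp_vec p MW (smoothing_grad (sc j) u')"
    using W1p_pair_C1[OF open_dom bounded_dom C, of p j] p by (simp add: W1p_pair_def)
   from Lp_vec_scaleR[OF this, of "1 / (1 - sc j)"]
   have "Lp_vec p MW (\<lambda>x. (1 / (1 - sc j)) *\<^sub>R smoothing_grad (sc j) u' x)" .
   then have "Lp_vec p MW (smoothing (sc j) g')"
   proof (rule Lp_vec_cong_AE[OF _ sm(2)], intro AE_I2)
    fix x assume "x \<in> space MW"
    then have "x \<in> closure W" using closure_subset by auto
    moreover have "1 - sc j \<noteq> 0" using sc(2)[of j] by simp
    ultimately show "(1 / (1 - sc j)) *\<^sub>R smoothing_grad (sc j) u' x = smoothing (sc j) g' x"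
     by (simp add: smoothing_grad_eq[OF sc(1,3) _ wk' ui u'(2) gi g'(2)])
   qed
   then show ?thesis by (intro Lp_vec_diff p1 gL)
  qed
  have le: "Lp_int p MW (\<lambda>x. smoothing_grad (sc j) u' x - g x)
   \<le> 2 powr (p - 1) * (Lp_int p MW (\<lambda>x. smoothing (sc j) g' x - g' x) + sc j powr p * Lp_int p MW g')" for j
  proof -
   \<comment> \<open>With s = \<open>sc j\<close> and S g' the smoothing of g', the difference (1 -
     s) S g' - g' is rewritten as (s - 1)(g' - S g') - s g'; both parts tend to 0 in L^p.\<close>
   have "Lp_int p MW (\<lambda>x. smoothing_grad (sc j) u' x - g x) = Lp_int p MW (\<lambda>x. (sc j - 1) *\<^sub>R (g' x - smoothing (sc j) g' x) + (- sc j) *\<^sub>R g' x)"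
   proof (rule Lp_int_cong_AE)
    have "AE x in MW. x \<in> W" by (rule AE_I2) simp
    then show "AE x in MW. smoothing_grad (sc j) u' x - g x = (sc j - 1) *\<^sub>R (g' x - smoothing (sc j) g' x) + (- sc j) *\<^sub>R g' x"
     using g'(3)
    proof eventually_elim
     case (elim x)
     then have "x \<in> closure W" using closure_subset by auto
     then show ?case using elim
      by (simp add: smoothing_grad_eq[OF sc(1,3) _ wk' ui u'(2) gi g'(2)] algebra_simps)
    qed
   qed (use sm gm Lp_vec_measurable[OF g] in auto)
   also have "\<dots> \<le> 2 powr (p - 1) * (Lp_int p MW (\<lambda>x. (sc j - 1) *\<^sub>R (g' x - smoothing (sc j) g' x)) + Lp_int p MW (\<lambda>x. (- sc j) *\<^sub>R g' x))"
    by (intro Lp_int_add_le p1 Lp_vec_scaleR d gL)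
   also have "\<dots> \<le> 2 powr (p - 1) * (1 * Lp_int p MW (\<lambda>x. smoothing (sc j) g' x - g' x) + sc j powr p * Lp_int p MW g')"
    unfolding Lp_int_scaleR Lp_int_minus_commute[of p MW g'] using sc(1-3)[of j] p
    by (intro mult_left_mono add_mono mult_right_mono) (auto intro!: powr_le1)
   finally show ?thesis by simp
  qed
  have "(\<lambda>j. 2 powr (p - 1) * (Lp_int p MW (\<lambda>x. smoothing (sc j) g' x - g' x) + sc j powr p * Lp_int p MW g')) \<longlonglongrightarrow> 2 powr (p - 1) * (0 + 0 * Lp_int p MW g')"
  proof (intro tendsto_intros tg)
   have "\<forall>\<^sub>F j in sequentially. 0 \<le> sc j" by (simp add: less_imp_le sc)
   with tendsto_powr'[OF sc(4) tendsto_const, of p] p show "(\<lambda>j. sc j powr p) \<longlonglongrightarrow> 0" by simp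
  qed
  then have lim: "(\<lambda>j. 2 powr (p - 1) * (Lp_int p MW (\<lambda>x. smoothing (sc j) g' x - g' x) + sc j powr p * Lp_int p MW g')) \<longlonglongrightarrow> 0"
   by simp
  show "(\<lambda>j. Lp_int p MW (\<lambda>x. smoothing_grad (sc j) u' x - g x)) \<longlonglongrightarrow> 0"
   by (rule Lim_null_comparison[OF _ lim]) (simp add: le)
 qed (rule smoothing_uniform[OF _ ui u'(3)])
qed

end

section \<open>Rellich compactness\<close>

text \<open>The fundamental theorem of calculus along the segment, then Jensen on the unit interval
  to bring the p-th power under the integral.\<close>

lemma C1_fun_segment_powr_le:
 fixes a b :: "real^'n::finite"
 assumes p: "1 < p" and C: "C1_fun v G"
 shows "ennreal (\<bar>v a - v b\<bar> powr p) \<le> ennreal (norm (b - a) powr p) *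
  (\<integral>\<^sup>+t. ennreal (norm (G (a + t *\<^sub>R (b - a))) powr p) * indicator {0..1} t \<partial>lborel)"
proof -
 define f where "f t = v (a + t *\<^sub>R (b - a))" for t
 define f' where "f' t = G (a + t *\<^sub>R (b - a)) \<bullet> (b - a)" for t
 have cl: "continuous_on UNIV (\<lambda>t::real. G (a + t *\<^sub>R (b - a)))"
  by (intro continuous_on_compose2[OF C1_fun_continuous(2)[OF C]] continuous_intros) auto
 have c': "continuous_on UNIV f'" unfolding f'_def by (intro continuous_intros cl)
 have [measurable]: "(\<lambda>t::real. G (a + t *\<^sub>R (b - a))) \<in> borel_measurable borel" "f' \<in> borel_measurable borel"
  using cl c' by (auto intro: borel_measurable_continuous_onI)
 have d: "(f has_real_derivative f' t) (at t)" for t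
 proof -
  have "((\<lambda>t. a + t *\<^sub>R (b - a)) has_derivative (\<lambda>h. h *\<^sub>R (b - a))) (at t)"
   by (auto intro!: derivative_eq_intros)
  from has_derivative_compose[OF this, of v] C
  have "(f has_derivative (\<lambda>h. G (a + t *\<^sub>R (b - a)) \<bullet> (h *\<^sub>R (b - a)))) (at t)"
   unfolding f_def[abs_def] C1_fun_def by blast
  then show ?thesis
   unfolding has_field_derivative_def f'_def by (rule has_derivative_eq_rhs) (auto simp: fun_eq_iff)
 qed
 have ftc: "(\<integral>t. indicator {0..1} t *\<^sub>R f' t \<partial>lborel) = f 1 - f 0"
  by (rule integral_FTC_Icc) (use d c' in \<open>auto simp: has_real_derivative_iff_has_vector_derivative intro: has_vector_derivative_at_within continuous_on_subset\<close>)
 have i: "integrable lborel (\<lambda>t. indicator {0..1} t *\<^sub>R f' t)"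
  by (intro borel_integrable_compact continuous_on_subset[OF c']) auto
 define I where "I = (\<integral>t. indicator {0..1} t * \<bar>f' t\<bar> \<partial>lborel)"
 have "\<bar>f 1 - f 0\<bar> \<le> I"
  unfolding I_def using integral_norm_bound[of lborel "\<lambda>t. indicator {0..1} t *\<^sub>R f' t"] ftc by (simp add: abs_mult)
 moreover have "v a = f 0" "v b = f 1" by (auto simp: f_def)
 ultimately have "ennreal (\<bar>v a - v b\<bar> powr p) \<le> ennreal (I powr p)"
  using p by (intro ennreal_leI powr_mono2) auto
 also have "\<dots> \<le> (\<integral>\<^sup>+t. ennreal (indicator {0..1} t * \<bar>f' t\<bar> powr p) \<partial>lborel)"
  unfolding I_def
 proof (rule nn_Jensen_powr[OF p])
  show "integrable lborel (\<lambda>t. indicat_real {0..1} t * \<bar>f' t\<bar>)"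
   using integrable_norm[OF i] by (simp add: abs_mult)
 qed auto
 also have "\<dots> \<le> (\<integral>\<^sup>+t. ennreal (norm (b - a) powr p) * (ennreal (norm (G (a + t *\<^sub>R (b - a))) powr p) * indicator {0..1} t) \<partial>lborel)"
 proof (rule nn_integral_mono)
  fix t :: real
  have "\<bar>f' t\<bar> powr p \<le> (norm (b - a) * norm (G (a + t *\<^sub>R (b - a)))) powr p"
   unfolding f'_def using p Cauchy_Schwarz_ineq2[of "G (a + t *\<^sub>R (b - a))" "b - a"]
   by (intro powr_mono2) (auto simp: mult.commute)
  then show "ennreal (indicator {0..1} t * \<bar>f' t\<bar> powr p) \<le> ennreal (norm (b - a) powr p) * (ennreal (norm (G (a + t *\<^sub>R (b - a))) powr p) * indicator {0..1} t)"
   by (auto simp: powr_mult ennreal_mult[symmetric] ennreal_leI split: split_indicator)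
 qed
 also have "\<dots> = ennreal (norm (b - a) powr p) * (\<integral>\<^sup>+t. ennreal (norm (G (a + t *\<^sub>R (b - a))) powr p) * indicator {0..1} t \<partial>lborel)"
  by (rule nn_integral_cmult) measurable
 finally show ?thesis .
qed

text \<open>At each tolerance 1/(j+1) some further subsequence is eventually within that tolerance;
  this survives passing to subsequences, so the diagonal sequence is Cauchy at every tolerance. No
  property of d is used.\<close>

lemma diagonal_Cauchy_subsequence:
 fixes d :: "nat \<Rightarrow> nat \<Rightarrow> real"
 assumes ex: "\<And>e s. 0 < e \<Longrightarrow> strict_mono (s :: nat \<Rightarrow> nat) \<Longrightarrow>
  \<exists>r. strict_mono (r :: nat \<Rightarrow> nat) \<and> (\<exists>N. \<forall>m\<ge>N. \<forall>n\<ge>N. d (s (r m)) (s (r n)) < e)"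
 obtains r :: "nat \<Rightarrow> nat" where "strict_mono r" "\<And>e. 0 < e \<Longrightarrow> \<exists>N. \<forall>m\<ge>N. \<forall>n\<ge>N. d (r m) (r n) < e"
proof -
 define P where "P j s \<longleftrightarrow> (\<exists>N. \<forall>m\<ge>N. \<forall>n\<ge>N. d (s m) (s n) < 1 / real (Suc j))" for j and s :: "nat \<Rightarrow> nat"
 interpret subseqs P
 proof
  fix j s assume "strict_mono (s :: nat \<Rightarrow> nat)"
  then show "\<exists>r'. strict_mono r' \<and> P j (s \<circ> r')" using ex[of "1 / real (Suc j)" s] by (simp add: P_def)
 qed
 have st: "P j (s \<circ> r)" if r: "strict_mono r" and "P j s" for r s j
 proof -
  obtain N where N: "\<And>m n. m \<ge> N \<Longrightarrow> n \<ge> N \<Longrightarrow> d (s m) (s n) < 1 / real (Suc j)"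
   using \<open>P j s\<close> by (auto simp: P_def)
  have "d (s (r m)) (s (r n)) < 1 / real (Suc j)" if "m \<ge> N" "n \<ge> N" for m n
   by (rule N) (use that seq_suble[OF r] order_trans in blast)+
  then show ?thesis by (auto simp: P_def)
 qed
 show ?thesis
 proof (rule that[OF subseq_diagseq])
  fix e :: real assume "0 < e"
  then obtain j where j: "1 / real (Suc j) < e" using nat_approx_posE by blast
  have "P j (diagseq \<circ> (+) (Suc j))" by (rule diagseq_holds[OF st])
  then obtain N where N: "\<And>m n. m \<ge> N \<Longrightarrow> n \<ge> N \<Longrightarrow> d (diagseq (Suc j + m)) (diagseq (Suc j + n)) < 1 / real (Suc j)"
   by (auto simp: P_def)
  have "d (diagseq m) (diagseq n) < e" if "m \<ge> N + Suc j" "n \<ge> N + Suc j" for m n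
  proof -
   have "N \<le> m - Suc j" "N \<le> n - Suc j" using that by linarith+
   from N[OF this] show ?thesis using that j by (simp del: of_nat_Suc)
  qed
  then show "\<exists>N. \<forall>m\<ge>N. \<forall>n\<ge>N. d (diagseq m) (diagseq n) < e" by blast
 qed
qed

context star_domain
begin

text \<open>The way from x to its contracted and shifted image is split into a radial segment of
  length at most s D and a shift of length at most s, both of order s; this yields the factor
  \<open>s powr p\<close>.\<close>

lemma C1_shrink_difference:
 assumes p: "1 < p"
 obtains K where "0 \<le> K" "\<And>s y (v :: real^'n \<Rightarrow> real) G. 0 < s \<Longrightarrow> s \<le> 1/2 \<Longrightarrow> norm y \<le> room s \<Longrightarrow> C1_fun v G \<Longrightarrow>
  (\<integral>\<^sup>+x. ennreal (\<bar>v x - v (shrink s x + y)\<bar> powr p) * indicator W x \<partial>lborel) \<le> ennreal (s powr p * K * Lp_int p MW G)"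
proof -
 obtain D where D: "0 \<le> D" "\<And>x. x \<in> closure W \<Longrightarrow> norm (x - c) \<le> D" using shrink_dist by metis
 define K where "K = 2 powr (p - 1) * 2 ^ CARD('n) * (D powr p + 1)"
 show ?thesis
 proof (rule that[of K])
  show "0 \<le> K" by (simp add: K_def)
  fix s :: real and y :: "real^'n" and v :: "real^'n \<Rightarrow> real" and G assume s: "0 < s" "s \<le> 1/2" and y: "norm y \<le> room s" and C: "C1_fun v G"
  have s1: "s \<le> 1" using s by simp
  have [measurable]: "v \<in> borel_measurable borel" "G \<in> borel_measurable borel" using C1_fun_measurable[OF C] by auto
  define E where "E = Lp_int p MW G"
  have GL: "Lp_vec p MW G" using W1p_pair_C1[OF open_dom bounded_dom C, of p] p by (simp add: W1p_pair_def)
  have E: "(\<integral>\<^sup>+x. ennreal (norm (G x) powr p) * indicator W x \<partial>lborel) = ennreal E" "0 \<le> E"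
   using ennreal_Lp_int[OF open_dom _ GL] by (auto simp: E_def)
  \<comment> \<open>Covers both segments: for each fixed parameter T the intermediate points are an
    affine image of W inside W with dilation factor at least 1/2, so integrating the gradient over
    them costs at most 2^n.\<close>
  have gen: "(\<integral>\<^sup>+x. ennreal (\<bar>v (A x) - v (B x)\<bar> powr p) * indicator W x \<partial>lborel) \<le> ennreal (R powr p * 2 ^ CARD('n) * E)"
   if AB: "A \<in> borel_measurable borel" "B \<in> borel_measurable borel"
    and aff: "\<And>x T. 0 \<le> T \<Longrightarrow> T \<le> 1 \<Longrightarrow> A x + T *\<^sub>R (B x - A x) = t T + q T *\<^sub>R x"
    and k: "\<And>T. 0 \<le> T \<Longrightarrow> T \<le> 1 \<Longrightarrow> 1/2 \<le> q T"
    and sub: "\<And>x T. x \<in> W \<Longrightarrow> 0 \<le> T \<Longrightarrow> T \<le> 1 \<Longrightarrow> t T + q T *\<^sub>R x \<in> W"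
    and R: "\<And>x. x \<in> W \<Longrightarrow> norm (B x - A x) \<le> R" for A B :: "real^'n \<Rightarrow> real^'n" and t q R
  proof -
   note [measurable] = AB
   have "(\<integral>\<^sup>+x. ennreal (\<bar>v (A x) - v (B x)\<bar> powr p) * indicator W x \<partial>lborel)
    \<le> (\<integral>\<^sup>+x. (\<integral>\<^sup>+T. ennreal (R powr p) * (ennreal (norm (G (A x + T *\<^sub>R (B x - A x))) powr p) * indicator {0..1} T * indicator W x) \<partial>lborel) \<partial>lborel)"
   proof (rule nn_integral_mono)
    fix x
    show "ennreal (\<bar>v (A x) - v (B x)\<bar> powr p) * indicator W x
     \<le> (\<integral>\<^sup>+T. ennreal (R powr p) * (ennreal (norm (G (A x + T *\<^sub>R (B x - A x))) powr p) * indicator {0..1} T * indicator W x) \<partial>lborel)"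
    proof (cases "x \<in> W")
     case True
     have "ennreal (\<bar>v (A x) - v (B x)\<bar> powr p) \<le> ennreal (norm (B x - A x) powr p) *
      (\<integral>\<^sup>+T. ennreal (norm (G (A x + T *\<^sub>R (B x - A x))) powr p) * indicator {0..1} T \<partial>lborel)"
      by (rule C1_fun_segment_powr_le[OF p C])
     also have "\<dots> \<le> ennreal (R powr p) * (\<integral>\<^sup>+T. ennreal (norm (G (A x + T *\<^sub>R (B x - A x))) powr p) * indicator {0..1} T \<partial>lborel)"
      using R[OF True] p by (intro mult_right_mono ennreal_leI powr_mono2) auto
     finally show ?thesis using True by (simp add: nn_integral_cmult)
    qed simp
   qed
   also have "\<dots> = (\<integral>\<^sup>+T. (\<integral>\<^sup>+x. ennreal (R powr p) * (ennreal (norm (G (A x + T *\<^sub>R (B x - A x))) powr p) * indicator {0..1} T * indicator W x) \<partial>lborel) \<partial>lborel)"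
    by (rule lborel_pair.Fubini') measurable
   also have "\<dots> \<le> (\<integral>\<^sup>+(T::real). ennreal (R powr p) * (ennreal (2 ^ CARD('n)) * ennreal E) * indicator {0..1} T \<partial>lborel)"
   proof (rule nn_integral_mono)
    fix T :: real
    show "(\<integral>\<^sup>+x. ennreal (R powr p) * (ennreal (norm (G (A x + T *\<^sub>R (B x - A x))) powr p) * indicator {0..1} T * indicator W x) \<partial>lborel)
     \<le> ennreal (R powr p) * (ennreal (2 ^ CARD('n)) * ennreal E) * indicator {0..1} T"
    proof (cases "T \<in> {0..1}")
     case True
     then have t: "0 \<le> T" "T \<le> 1" by auto
     have "(\<integral>\<^sup>+x. ennreal (norm (G (A x + T *\<^sub>R (B x - A x))) powr p) * indicator W x \<partial>lborel)
      = (\<integral>\<^sup>+x. ennreal (norm (G (t T + q T *\<^sub>R x)) powr p) * indicator W x \<partial>lborel)"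
      by (simp add: aff[OF t])
     also have "\<dots> \<le> ennreal (2 ^ CARD('n)) * (\<integral>\<^sup>+x. ennreal (norm (G x) powr p) * indicator W x \<partial>lborel)"
      using nn_integral_affine_le[of "\<lambda>x. ennreal (norm (G x) powr p)" W "q T" "t T"] k[OF t] sub[OF _ t] by simp
     finally have "(\<integral>\<^sup>+x. ennreal (norm (G (A x + T *\<^sub>R (B x - A x))) powr p) * indicator W x \<partial>lborel) \<le> ennreal (2 ^ CARD('n)) * ennreal E"
      by (simp add: E)
     then show ?thesis using True by (simp add: nn_integral_cmult mult_left_mono)
    qed simp
   qed
   also have "\<dots> = ennreal (R powr p * 2 ^ CARD('n) * E)"
    using E(2) by (simp add: nn_integral_cmult ennreal_mult mult.assoc)
   finally show ?thesis .
  qed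
  have sub1: "shrink (T * s) x \<in> W" if "x \<in> W" "0 \<le> T" "T \<le> 1" for x T
  proof (cases "T = 0")
   case False
   have "0 < T * s" "T * s \<le> 1" using False that s mult_le_one[of T s] by auto
   then show ?thesis using star[of x "T * s"] that closure_subset by (auto simp: shrink_def)
  qed (use that in \<open>simp add: shrink_def\<close>)
  have 1: "(\<integral>\<^sup>+x. ennreal (\<bar>v x - v (shrink s x)\<bar> powr p) * indicator W x \<partial>lborel) \<le> ennreal ((s * D) powr p * 2 ^ CARD('n) * E)"
  proof (rule gen[of "\<lambda>x. x" "shrink s" "\<lambda>T. (T * s) *\<^sub>R c" "\<lambda>T. 1 - T * s" "s * D"])
   show "x + T *\<^sub>R (shrink s x - x) = (T * s) *\<^sub>R c + (1 - T * s) *\<^sub>R x" for x T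
    by (simp add: shrink_def algebra_simps)
   show "1 / 2 \<le> 1 - T * s" if "0 \<le> T" "T \<le> 1" for T
    using mult_mono[of T 1 s "1/2"] that s by simp
   show "(T * s) *\<^sub>R c + (1 - T * s) *\<^sub>R x \<in> W" if "x \<in> W" "0 \<le> T" "T \<le> 1" for x T
    using sub1[OF that] shrink_affine[of "T * s" x 0] by simp
   show "norm (shrink s x - x) \<le> s * D" if "x \<in> W" for x
   proof -
    have "shrink s x - x = (- s) *\<^sub>R (x - c)" by (simp add: shrink_def algebra_simps)
    then have "norm (shrink s x - x) = s * norm (x - c)" using s by simp
    then show ?thesis using D(2)[of x] that closure_subset[of W] s by (auto intro!: mult_left_mono)
   qed
  qed auto
  have 2: "(\<integral>\<^sup>+x. ennreal (\<bar>v (shrink s x) - v (shrink s x + y)\<bar> powr p) * indicator W x \<partial>lborel) \<le> ennreal (s powr p * 2 ^ CARD('n) * E)"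
  proof (rule gen[of "shrink s" "\<lambda>x. shrink s x + y" "\<lambda>T. s *\<^sub>R c + T *\<^sub>R y" "\<lambda>T. 1 - s" s])
   show "shrink s x + T *\<^sub>R (shrink s x + y - shrink s x) = s *\<^sub>R c + T *\<^sub>R y + (1 - s) *\<^sub>R x" for x T
    using shrink_affine[of s x "T *\<^sub>R y"] by simp
   show "s *\<^sub>R c + T *\<^sub>R y + (1 - s) *\<^sub>R x \<in> W" if "x \<in> W" "0 \<le> T" "T \<le> 1" for x T
   proof -
    have "norm (T *\<^sub>R y) \<le> room s" using y that mult_left_le_one_le[of "norm y" T] by simp
    then show ?thesis using room_add[OF s(1) s1, of x "T *\<^sub>R y"] that closure_subset[of W] by (auto simp: shrink_affine)
   qed
   show "norm (shrink s x + y - shrink s x) \<le> s" for x using y room(2)[OF s(1) s1] by simp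
  qed (use s in auto)
  have "(\<integral>\<^sup>+x. ennreal (\<bar>v x - v (shrink s x + y)\<bar> powr p) * indicator W x \<partial>lborel)
   \<le> (\<integral>\<^sup>+x. ennreal (2 powr (p - 1)) * (ennreal (\<bar>v x - v (shrink s x)\<bar> powr p) * indicator W x + ennreal (\<bar>v (shrink s x) - v (shrink s x + y)\<bar> powr p) * indicator W x) \<partial>lborel)"
  proof (rule nn_integral_mono)
   fix x
   have "\<bar>v x - v (shrink s x + y)\<bar> powr p \<le> 2 powr (p - 1) * (\<bar>v x - v (shrink s x)\<bar> powr p + \<bar>v (shrink s x) - v (shrink s x + y)\<bar> powr p)"
    using norm_add_powr_le[of p "v x - v (shrink s x)" "v (shrink s x) - v (shrink s x + y)"] p by simp
   then show "ennreal (\<bar>v x - v (shrink s x + y)\<bar> powr p) * indicator W x \<le> ennreal (2 powr (p - 1)) * (ennreal (\<bar>v x - v (shrink s x)\<bar> powr p) * indicator W x + ennreal (\<bar>v (shrink s x) - v (shrink s x + y)\<bar> powr p) * indicator W x)"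
    by (auto simp: ennreal_mult[symmetric] ennreal_plus[symmetric] ennreal_leI simp del: ennreal_plus split: split_indicator)
  qed
  also have "\<dots> = ennreal (2 powr (p - 1)) * ((\<integral>\<^sup>+x. ennreal (\<bar>v x - v (shrink s x)\<bar> powr p) * indicator W x \<partial>lborel) + (\<integral>\<^sup>+x. ennreal (\<bar>v (shrink s x) - v (shrink s x + y)\<bar> powr p) * indicator W x \<partial>lborel))"
   by (simp add: nn_integral_cmult nn_integral_add)
  also have "\<dots> \<le> ennreal (2 powr (p - 1)) * (ennreal ((s * D) powr p * 2 ^ CARD('n) * E) + ennreal (s powr p * 2 ^ CARD('n) * E))"
   by (intro mult_left_mono add_mono 1 2) auto
  also have "\<dots> = ennreal (s powr p * K * E)"
   using E(2) s D(1) by (simp add: ennreal_mult[symmetric] ennreal_plus[symmetric] K_def powr_mult algebra_simps del: ennreal_plus)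
  finally show "(\<integral>\<^sup>+x. ennreal (\<bar>v x - v (shrink s x + y)\<bar> powr p) * indicator W x \<partial>lborel) \<le> ennreal (s powr p * K * Lp_int p MW G)"
   by (simp add: E_def)
 qed
qed

text \<open>At a fixed scale the smoothings are uniformly bounded and uniformly Lipschitz, so
  Arzela-Ascoli applies; the distance from a function to its smoothing is of order
  \<open>sc j powr p\<close>, uniformly in n. Diagonalization combines the scales.\<close>

lemma Rellich_C1:
 fixes v :: "nat \<Rightarrow> real^'n \<Rightarrow> real"
 assumes p: "1 < p" and C: "\<And>n. C1_fun (v n) (G n)" and B: "\<And>n. Lp_int p MW (v n) \<le> B" "\<And>n. Lp_int p MW (G n) \<le> B"
 obtains r :: "nat \<Rightarrow> nat" where "strict_mono r" "\<And>e. 0 < e \<Longrightarrow> \<exists>N. \<forall>m\<ge>N. \<forall>n\<ge>N. Lp_int p MW (\<lambda>x. v (r m) x - v (r n) x) < e"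
proof -
 interpret finite_measure MW by (rule finite_dom)
 have p1: "1 \<le> p" using p by simp
 have B0: "0 \<le> B" using order_trans[OF Lp_int_nonneg B(1)] .
 have vL: "Lp_vec p MW (v n)" for n using W1p_pair_C1[OF open_dom bounded_dom C, of p n] p by (simp add: W1p_pair_def)
 \<comment> \<open>Extension by zero, because \<open>smoothing\<close> integrates over the whole
   space; for x in W the shifted contractions stay in W, where w and v agree.\<close>
 define w where "w n x = indicator W x * v n x" for n x
 have vb: "v n \<in> borel_measurable borel" for n using C1_fun_measurable(1)[OF C] .
 have wb: "w n \<in> borel_measurable borel" for n unfolding w_def using vb[of n] by measurable
 have vM: "v n \<in> borel_measurable MW" and wM: "w n \<in> borel_measurable MW" for n
  using borel_imp_lebesgue_on[OF vb] borel_imp_lebesgue_on[OF wb] by auto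
 have wv: "AE x in MW. v n x = w n x" for n by (rule AE_I2) (simp add: w_def)
 have wL: "Lp_vec p MW (w n)" for n by (rule Lp_vec_cong_AE[OF vL wM wv])
 have wI: "integrable MW (w n)" for n by (rule Lp_vec_imp_integrable[OF finite_dom p1 wL])
 have wi: "integrable lborel (w n)" for n
  by (rule integrable_lborel_vanishing[OF wb _ wI]) (simp add: w_def)
 define m where "m = measure MW (space MW)"
 have m0: "0 \<le> m" by (simp add: m_def)
 have L1: "(\<integral>z. \<bar>w n z\<bar> \<partial>lborel) \<le> m + B" for n
 proof -
  have "(\<integral>z. \<bar>w n z\<bar> \<partial>lborel) = (\<integral>z. \<bar>w n z\<bar> \<partial>MW)"
  proof (rule integral_lebesgue_on_vanishing[OF open_sets_lebesgue[OF open_dom], symmetric])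
   show "(\<lambda>z. \<bar>w n z\<bar>) \<in> borel_measurable borel" using wb[of n] by measurable
  qed (simp add: w_def)
  also have "\<dots> \<le> (\<integral>z. 1 + norm (v n z) powr p \<partial>MW)"
  proof (rule integral_mono)
   show "integrable MW (\<lambda>z. \<bar>w n z\<bar>)" using wI[of n] by simp
   show "integrable MW (\<lambda>z. 1 + norm (v n z) powr p)" using Lp_vec_integrable[OF vL[of n]] by auto
   show "\<bar>w n z\<bar> \<le> 1 + norm (v n z) powr p" if "z \<in> space MW" for z
    using le_add_powr[of "\<bar>v n z\<bar>" 1 p] p that by (simp add: w_def)
  qed
  also have "\<dots> = m + Lp_int p MW (v n)" using Lp_vec_integrable[OF vL[of n]] by (simp add: Lp_int_def m_def)
  finally show ?thesis using B(1)[of n] by simp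
 qed
 obtain K where K: "0 \<le> K" "\<And>s y (v :: real^'n \<Rightarrow> real) G. 0 < s \<Longrightarrow> s \<le> 1/2 \<Longrightarrow> norm y \<le> room s \<Longrightarrow> C1_fun v G \<Longrightarrow>
  (\<integral>\<^sup>+x. ennreal (\<bar>v x - v (shrink s x + y)\<bar> powr p) * indicator W x \<partial>lborel) \<le> ennreal (s powr p * K * Lp_int p MW G)"
  by (rule C1_shrink_difference[OF p]) (rule that)
 define S where "S j n = smoothing (sc j) (w n)" for j n
 have SL: "Lp_vec p MW (\<lambda>x. w n x - S j n x)" "Lp_int p MW (\<lambda>x. w n x - S j n x) \<le> sc j powr p * K * B" for j n
 proof -
  have le: "(\<integral>\<^sup>+x. ennreal (norm (w n x - w n (shrink (sc j) x + y)) powr p) * indicator W x \<partial>lborel) \<le> ennreal (sc j powr p * K * B)"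
   if y: "norm y < room (sc j)" for y
  proof -
   have "(\<integral>\<^sup>+x. ennreal (norm (w n x - w n (shrink (sc j) x + y)) powr p) * indicator W x \<partial>lborel)
    = (\<integral>\<^sup>+x. ennreal (\<bar>v n x - v n (shrink (sc j) x + y)\<bar> powr p) * indicator W x \<partial>lborel)"
   proof (rule nn_integral_cong)
    fix x
    show "ennreal (norm (w n x - w n (shrink (sc j) x + y)) powr p) * indicator W x = ennreal (\<bar>v n x - v n (shrink (sc j) x + y)\<bar> powr p) * indicator W x"
    proof (cases "x \<in> W")
     case True
     then have "shrink (sc j) x + y \<in> W" using room_add[OF sc(1,3)[of j], of x y] y closure_subset[of W] by auto
     then show ?thesis using True by (simp add: w_def)
    qed simp
   qed
   also have "\<dots> \<le> ennreal (sc j powr p * K * Lp_int p MW (G n))" by (rule K(2)[OF sc(1,2) _ C]) (use y in simp)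
   also have "\<dots> \<le> ennreal (sc j powr p * K * B)" using K(1) by (intro ennreal_leI mult_left_mono B) auto
   finally show ?thesis .
  qed
  have nn: "0 \<le> sc j powr p * K * B" using K B0 by simp
  show "Lp_vec p MW (\<lambda>x. w n x - S j n x)" "Lp_int p MW (\<lambda>x. w n x - S j n x) \<le> sc j powr p * K * B"
   unfolding S_def by (rule smoothing_Lp_bound[OF p sc(1,3) wi wb nn le]; assumption)+
 qed
 have SV: "Lp_vec p MW (S j n)" for j n
  using Lp_vec_diff[OF p1 wL SL(1), of n n j] by simp
 show ?thesis
 proof (rule diagonal_Cauchy_subsequence[of "\<lambda>m n. Lp_int p MW (\<lambda>x. v m x - v n x)"])
  fix e :: real and s :: "nat \<Rightarrow> nat" assume e: "0 < e" and s: "strict_mono s"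
  have "\<forall>\<^sub>F j in sequentially. 0 \<le> sc j" by (simp add: less_imp_le sc)
  with tendsto_powr'[OF sc(4) tendsto_const, of p] p have "(\<lambda>j. sc j powr p) \<longlonglongrightarrow> 0" by simp
  then have lim: "(\<lambda>j. 4 powr p * (2 * (sc j powr p * K * B))) \<longlonglongrightarrow> 4 powr p * (2 * (0 * K * B))"
   by (intro tendsto_intros)
  have "\<forall>\<^sub>F j in sequentially. 4 powr p * (2 * (sc j powr p * K * B)) < e / 2"
   by (rule order_tendstoD(2)[OF lim]) (use e in simp)
  then obtain j where j: "4 powr p * (2 * (sc j powr p * K * B)) < e / 2" by (auto simp: eventually_sequentially)
  \<comment> \<open>With \<epsilon>^p = q the contribution of the smoothed functions is at most e/4,
    besides the two smoothing errors, which the choice of j keeps below e/2.\<close>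
  define q where "q = e / (4 * (4 powr p * (m + 1)))"
  define \<epsilon> where "\<epsilon> = q powr (1 / p)"
  have "0 < q" unfolding q_def using e m0 by simp
  then have "0 < \<epsilon>" "\<epsilon> powr p = q" using p by (auto simp: \<epsilon>_def powr_powr)
  then have \<epsilon>: "0 < \<epsilon>" "\<epsilon> powr p = e / (4 * (4 powr p * (m + 1)))" by (auto simp: q_def)
  obtain L where L: "0 \<le> L" "\<And>f (w :: real^'n). integrable lborel f \<Longrightarrow> \<bar>mconv (moll (room (sc j))) f w\<bar> \<le> L * (\<integral>z. \<bar>f z\<bar> \<partial>lborel)"
   "\<And>f w (w' :: real^'n). integrable lborel f \<Longrightarrow> \<bar>mconv (moll (room (sc j))) f w - mconv (moll (room (sc j))) f w'\<bar> \<le> L * norm (w - w') * (\<integral>z. \<bar>f z\<bar> \<partial>lborel)"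
   by (rule mconv_Lipschitz[OF moll_props(6)[OF room(1)[OF sc(1)[of j] sc(3)[of j]]]]) (rule that)
  have Lb: "norm (S j n x) \<le> L * (m + B)" for n x
   using L(2)[OF wi, of n "shrink (sc j) x"] mult_left_mono[OF L1[of n] L(1)] by (simp add: S_def smoothing_def)
  have Ll: "norm (S j n x - S j n y) \<le> (L * (m + B)) * norm (x - y)" for n x y
  proof -
   have "norm (shrink (sc j) x - shrink (sc j) y) = (1 - sc j) * norm (x - y)"
    using sc(3)[of j] by (simp add: shrink_def scaleR_diff_right[symmetric])
   also have "\<dots> \<le> 1 * norm (x - y)" using sc(1)[of j] by (intro mult_right_mono) auto
   finally have "norm (shrink (sc j) x - shrink (sc j) y) \<le> norm (x - y)" by simp
   then have "L * norm (shrink (sc j) x - shrink (sc j) y) * (\<integral>z. \<bar>w n z\<bar> \<partial>lborel) \<le> L * norm (x - y) * (m + B)"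
    using L(1) L1[of n] by (intro mult_mono) auto
   then show ?thesis
    using L(3)[OF wi, of n "shrink (sc j) x" "shrink (sc j) y"] by (simp add: S_def smoothing_def mult_ac)
  qed
  define c0 where "c0 = L * (m + B)"
  have c0: "0 \<le> c0" using L m0 B0 by (simp add: c0_def)
  obtain g k where gk: "strict_mono (k :: nat \<Rightarrow> nat)"
   "\<And>e. 0 < e \<Longrightarrow> \<exists>N. \<forall>n x. n \<ge> N \<and> x \<in> closure W \<longrightarrow> norm (S j (s (k n)) x - g x) < e"
  proof (rule Arzela_Ascoli[OF compact_closure_dom, of "\<lambda>n. S j (s n)" c0])
   show "norm (S j (s n) x) \<le> c0" for n x unfolding c0_def by (rule Lb)
   fix x and e :: real assume "0 < e"
   show "\<exists>d>0. \<forall>n y. y \<in> closure W \<and> norm (x - y) < d \<longrightarrow> norm (S j (s n) x - S j (s n) y) < e"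
   proof (rule exI[of _ "e / (c0 + 1)"], intro conjI allI impI)
    show d: "0 < e / (c0 + 1)" using \<open>0 < e\<close> c0 by simp
    fix n y assume y: "y \<in> closure W \<and> norm (x - y) < e / (c0 + 1)"
    have "norm (S j (s n) x - S j (s n) y) \<le> c0 * norm (x - y)" unfolding c0_def by (rule Ll)
    also have "\<dots> \<le> c0 * (e / (c0 + 1))" using y c0 by (intro mult_left_mono) auto
    also have "\<dots> < (c0 + 1) * (e / (c0 + 1))" using d by (intro mult_strict_right_mono) auto
    also have "\<dots> = e" using c0 by simp
    finally show "norm (S j (s n) x - S j (s n) y) < e" .
   qed
  qed blast
  obtain N where N: "\<And>n x. n \<ge> N \<Longrightarrow> x \<in> closure W \<Longrightarrow> norm (S j (s (k n)) x - g x) < \<epsilon> / 2"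
   using gk(2)[of "\<epsilon> / 2"] \<epsilon> by auto
  have fin: "Lp_int p MW (\<lambda>x. v (s (k a)) x - v (s (k b)) x) < e" if ab: "a \<ge> N" "b \<ge> N" for a b
  proof -
   let ?a = "s (k a)" and ?b = "s (k b)"
   have Sab: "Lp_int p MW (\<lambda>x. S j ?a x - S j ?b x) \<le> \<epsilon> powr p * m"
   proof -
    have "Lp_int p MW (\<lambda>x. S j ?a x - S j ?b x) \<le> (\<integral>x. \<epsilon> powr p \<partial>MW)"
     unfolding Lp_int_def
    proof (rule integral_mono)
     show "integrable MW (\<lambda>x. norm (S j ?a x - S j ?b x) powr p)"
      by (rule Lp_vec_integrable[OF Lp_vec_diff[OF p1 SV SV]])
     fix x assume "x \<in> space MW"
     then have x: "x \<in> closure W" using closure_subset by auto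
     have "norm (S j ?a x - S j ?b x) \<le> norm (S j ?a x - g x) + norm (S j ?b x - g x)"
      using norm_triangle_ineq4[of "S j ?a x - g x" "S j ?b x - g x"] by simp
     also have "\<dots> \<le> \<epsilon>" using N[OF ab(1) x] N[OF ab(2) x] by linarith
     finally show "norm (S j ?a x - S j ?b x) powr p \<le> \<epsilon> powr p" using p by (intro powr_mono2) auto
    qed simp
    then show ?thesis by (simp add: m_def mult.commute)
   qed
   have "Lp_int p MW (\<lambda>x. v ?a x - v ?b x) = Lp_int p MW (\<lambda>x. w ?a x - w ?b x)"
    by (rule Lp_int_cong_AE[OF borel_measurable_diff[OF vM vM] borel_measurable_diff[OF wM wM]]) (rule AE_I2, simp add: w_def)
   also have "\<dots> \<le> (\<integral>x. 4 powr p * (norm (w ?a x - S j ?a x) powr p + norm (S j ?a x - S j ?b x) powr p + norm (w ?b x - S j ?b x) powr p) \<partial>MW)"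
    unfolding Lp_int_def
   proof (rule integral_mono)
    show "integrable MW (\<lambda>x. norm (w ?a x - w ?b x) powr p)" by (rule Lp_vec_integrable[OF Lp_vec_diff[OF p1 wL wL]])
    show "integrable MW (\<lambda>x. 4 powr p * (norm (w ?a x - S j ?a x) powr p + norm (S j ?a x - S j ?b x) powr p + norm (w ?b x - S j ?b x) powr p))"
     by (intro integrable_mult_right Bochner_Integration.integrable_add Lp_vec_integrable[OF SL(1)] Lp_vec_integrable[OF Lp_vec_diff[OF p1 SV SV]])
    show "norm (w ?a x - w ?b x) powr p \<le> 4 powr p * (norm (w ?a x - S j ?a x) powr p + norm (S j ?a x - S j ?b x) powr p + norm (w ?b x - S j ?b x) powr p)" for x
     using norm_triple_powr_le[OF p1, of "w ?a x - S j ?a x" "S j ?a x - S j ?b x" "S j ?b x - w ?b x"] by (simp add: abs_minus_commute)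
   qed
   also have "\<dots> = 4 powr p * (Lp_int p MW (\<lambda>x. w ?a x - S j ?a x) + Lp_int p MW (\<lambda>x. S j ?a x - S j ?b x) + Lp_int p MW (\<lambda>x. w ?b x - S j ?b x))"
    unfolding Lp_int_def using Lp_vec_integrable[OF SL(1)[of ?a j]] Lp_vec_integrable[OF SL(1)[of ?b j]] Lp_vec_integrable[OF Lp_vec_diff[OF p1 SV[of j ?a] SV[of j ?b]]]
    by (simp del: real_norm_def)
   also have "\<dots> \<le> 4 powr p * (sc j powr p * K * B + \<epsilon> powr p * m + sc j powr p * K * B)"
    by (intro mult_left_mono add_mono SL(2) Sab) auto
   also have "\<dots> = 4 powr p * (2 * (sc j powr p * K * B)) + 4 powr p * (\<epsilon> powr p * m)" by (simp add: algebra_simps)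
   also have "4 powr p * (\<epsilon> powr p * m) \<le> e / 4"
   proof -
    have "4 powr p * (\<epsilon> powr p * m) \<le> 4 powr p * (\<epsilon> powr p * (m + 1))" by (intro mult_left_mono) auto
    also have "\<dots> = e / 4"
    proof -
     define X where "X = 4 powr p * (m + 1)"
     have X: "X \<noteq> 0" using m0 by (simp add: X_def)
     have E: "\<epsilon> powr p = e / (4 * X)" unfolding \<epsilon>(2) X_def ..
     have "4 powr p * (\<epsilon> powr p * (m + 1)) = \<epsilon> powr p * X" by (simp add: X_def)
     also have "\<dots> = e / 4" using X by (simp only: E) simp
     finally show ?thesis .
    qed
    finally show ?thesis .
   qed
   finally show ?thesis using j e by linarith
  qed
  show "\<exists>r. strict_mono (r :: nat \<Rightarrow> nat) \<and> (\<exists>N. \<forall>m\<ge>N. \<forall>n\<ge>N. Lp_int p MW (\<lambda>x. v (s (r m)) x - v (s (r n)) x) < e)"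
  proof (rule exI[of _ k], rule conjI[OF gk(1)], rule exI[of _ N], intro allI impI)
   fix a b assume "N \<le> a" "N \<le> b"
   then show "Lp_int p MW (\<lambda>x. v (s (k a)) x - v (s (k b)) x) < e" by (rule fin)
  qed
 qed (rule that; assumption)
qed

text \<open>Each u n is replaced by a C1 function within 1/(n+1), with gradients still bounded;
  since these errors tend to 0, the Cauchy property carries back from the C1 sequence.\<close>

theorem Rellich:
 fixes u :: "nat \<Rightarrow> real^'n \<Rightarrow> real"
 assumes p: "1 < p" and W: "\<And>n. W1p_pair p W (u n) (g n)" and B: "\<And>n. Lp_int p MW (u n) \<le> B" "\<And>n. Lp_int p MW (g n) \<le> B"
 obtains r :: "nat \<Rightarrow> nat" where "strict_mono r" "\<And>e. 0 < e \<Longrightarrow> \<exists>N. \<forall>m\<ge>N. \<forall>n\<ge>N. Lp_int p MW (\<lambda>x. u (r m) x - u (r n) x) < e"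
proof -
 have p1: "1 \<le> p" using p by simp
 have L: "Lp_vec p MW (u n)" "Lp_vec p MW (g n)" for n using W by (auto simp: W1p_pair_def)
 have "\<exists>v G. C1_fun v G \<and> Lp_int p MW (\<lambda>x. v x - u n x) < 1 / real (Suc n) \<and> Lp_int p MW (\<lambda>x. G x - g n x) < 1" for n
 proof (rule W1p_dense_C1[OF p W[of n]])
  fix v G assume vG: "\<And>j::nat. C1_fun (v j) (G j)"
   "(\<lambda>j. Lp_int p MW (\<lambda>x. v j x - u n x)) \<longlonglongrightarrow> 0" "(\<lambda>j. Lp_int p MW (\<lambda>x. G j x - g n x)) \<longlonglongrightarrow> 0"
  have "\<forall>\<^sub>F j in sequentially. Lp_int p MW (\<lambda>x. v j x - u n x) < 1 / real (Suc n) \<and> Lp_int p MW (\<lambda>x. G j x - g n x) < 1"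
   by (intro eventually_conj order_tendstoD(2)[OF vG(2)] order_tendstoD(2)[OF vG(3)]) auto
  then obtain j where "Lp_int p MW (\<lambda>x. v j x - u n x) < 1 / real (Suc n) \<and> Lp_int p MW (\<lambda>x. G j x - g n x) < 1"
   using eventually_happens'[OF sequentially_bot] by blast
  then show "\<exists>v G. C1_fun v G \<and> Lp_int p MW (\<lambda>x. v x - u n x) < 1 / real (Suc n) \<and> Lp_int p MW (\<lambda>x. G x - g n x) < 1"
   using vG(1)[of j] by blast
 qed
 then have "\<forall>n. \<exists>vG. C1_fun (fst vG) (snd vG) \<and> Lp_int p MW (\<lambda>x. fst vG x - u n x) < 1 / real (Suc n) \<and> Lp_int p MW (\<lambda>x. snd vG x - g n x) < 1"
  by (simp del: of_nat_Suc)
 from choice[OF this] obtain f where f: "\<And>n. C1_fun (fst (f n)) (snd (f n)) \<and> Lp_int p MW (\<lambda>x. fst (f n) x - u n x) < 1 / real (Suc n) \<and> Lp_int p MW (\<lambda>x. snd (f n) x - g n x) < 1"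
  by blast
 define v where "v n = fst (f n)" for n
 define G where "G n = snd (f n)" for n
 have C: "C1_fun (v n) (G n)" and v: "Lp_int p MW (\<lambda>x. v n x - u n x) < 1 / real (Suc n)"
  and G: "Lp_int p MW (\<lambda>x. G n x - g n x) < 1" for n
  using f[of n] by (simp_all add: v_def G_def)
 have CL: "Lp_vec p MW (v n)" "Lp_vec p MW (G n)" for n
  using W1p_pair_C1[OF open_dom bounded_dom C, of p n] p by (auto simp: W1p_pair_def)
 define B' where "B' = 2 powr (p - 1) * (1 + B)"
 have Bv: "Lp_int p MW (v n) \<le> B'" for n
 proof -
  have "Lp_int p MW (v n) \<le> 2 powr (p - 1) * (Lp_int p MW (\<lambda>x. v n x - u n x) + Lp_int p MW (u n))"
   using Lp_int_add_le[OF p1 Lp_vec_diff[OF p1 CL(1) L(1)] L(1), of n n n] by simp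
  also have "\<dots> \<le> B'" unfolding B'_def
  proof (intro mult_left_mono add_mono B)
   have "1 / real (Suc n) \<le> 1" by simp
   then show "Lp_int p MW (\<lambda>x. v n x - u n x) \<le> 1" using v[of n] by linarith
  qed auto
  finally show ?thesis .
 qed
 have BG: "Lp_int p MW (G n) \<le> B'" for n
 proof -
  have "Lp_int p MW (G n) \<le> 2 powr (p - 1) * (Lp_int p MW (\<lambda>x. G n x - g n x) + Lp_int p MW (g n))"
   using Lp_int_add_le[OF p1 Lp_vec_diff[OF p1 CL(2) L(2)] L(2), of n n n] by simp
  also have "\<dots> \<le> B'" unfolding B'_def by (intro mult_left_mono add_mono B less_imp_le[OF G]) auto
  finally show ?thesis .
 qed
 obtain r :: "nat \<Rightarrow> nat" where r: "strict_mono r"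
  "\<And>e. 0 < e \<Longrightarrow> \<exists>N. \<forall>m\<ge>N. \<forall>n\<ge>N. Lp_int p MW (\<lambda>x. v (r m) x - v (r n) x) < e"
  by (rule Rellich_C1[where v = v and G = G and B = B', OF p C Bv BG]) (rule that)
 show ?thesis
 proof (rule that[OF r(1)])
  fix e :: real assume e: "0 < e"
  define e' where "e' = e / (3 * 4 powr p)"
  have e': "0 < e'" "4 powr p * (e' + e' + e') = e" using e by (auto simp: e'_def)
  obtain N where N: "\<And>m n. m \<ge> N \<Longrightarrow> n \<ge> N \<Longrightarrow> Lp_int p MW (\<lambda>x. v (r m) x - v (r n) x) < e'"
   using r(2)[OF e'(1)] by blast
  obtain N' where N': "1 / real (Suc N') < e'" using e'(1) nat_approx_posE by blast
  have close: "Lp_int p MW (\<lambda>x. v (r m) x - u (r m) x) < e'" if "m \<ge> N'" for m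
  proof -
   have "N' \<le> r m" using that seq_suble[OF r(1), of m] by simp
   then have "1 / real (Suc (r m)) \<le> 1 / real (Suc N')" by (simp add: divide_simps)
   then show ?thesis using v[of "r m"] N' by linarith
  qed
  have "Lp_int p MW (\<lambda>x. u (r m) x - u (r n) x) < e" if mn: "m \<ge> max N N'" "n \<ge> max N N'" for m n
  proof -
   note d = Lp_vec_diff[OF p1 CL(1) L(1), of "r m" "r m"] Lp_vec_diff[OF p1 CL(1) L(1), of "r n" "r n"] Lp_vec_diff[OF p1 CL(1) CL(1), of "r m" "r n"]
   have "Lp_int p MW (\<lambda>x. u (r m) x - u (r n) x) \<le> (\<integral>x. 4 powr p * (norm (v (r m) x - u (r m) x) powr p + norm (v (r m) x - v (r n) x) powr p + norm (v (r n) x - u (r n) x) powr p) \<partial>MW)"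
    unfolding Lp_int_def
   proof (rule integral_mono)
    show "integrable MW (\<lambda>x. norm (u (r m) x - u (r n) x) powr p)" by (rule Lp_vec_integrable[OF Lp_vec_diff[OF p1 L(1) L(1)]])
    show "integrable MW (\<lambda>x. 4 powr p * (norm (v (r m) x - u (r m) x) powr p + norm (v (r m) x - v (r n) x) powr p + norm (v (r n) x - u (r n) x) powr p))"
     by (intro integrable_mult_right Bochner_Integration.integrable_add Lp_vec_integrable d)
    show "norm (u (r m) x - u (r n) x) powr p \<le> 4 powr p * (norm (v (r m) x - u (r m) x) powr p + norm (v (r m) x - v (r n) x) powr p + norm (v (r n) x - u (r n) x) powr p)" for x
     using norm_triple_powr_le[OF p1, of "u (r m) x - v (r m) x" "v (r m) x - v (r n) x" "v (r n) x - u (r n) x"] by (simp add: abs_minus_commute)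
   qed
   also have "\<dots> = 4 powr p * (Lp_int p MW (\<lambda>x. v (r m) x - u (r m) x) + Lp_int p MW (\<lambda>x. v (r m) x - v (r n) x) + Lp_int p MW (\<lambda>x. v (r n) x - u (r n) x))"
    unfolding Lp_int_def using d[THEN Lp_vec_integrable] by (simp del: real_norm_def)
   also have "\<dots> < 4 powr p * (e' + e' + e')"
    using close[of m] close[of n] N[of m n] mn by (intro mult_strict_left_mono add_strict_mono) auto
   finally show ?thesis using e'(2) by simp
  qed
  then show "\<exists>N. \<forall>m\<ge>N. \<forall>n\<ge>N. Lp_int p MW (\<lambda>x. u (r m) x - u (r n) x) < e" by blast
 qed
qed

end

section \<open>Boundary integrals and edge layers\<close>

lemma sets_boundary_measure: "sets (boundary_measure k \<gamma>) = sets (restrict_space borel (frontier (cusp_domain k \<gamma>)))"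
 and space_boundary_measure: "space (boundary_measure k \<gamma>) = frontier (cusp_domain k \<gamma>)"
proof -
 let ?F = "frontier (cusp_domain k \<gamma>)"
 have eq: "{B \<inter> ?F | B. B \<in> sets borel} = sets (restrict_space borel ?F)"
  by (auto simp: sets_restrict_space)
 have "sets (boundary_measure k \<gamma>) = sigma_sets ?F (sets (restrict_space borel ?F))"
  unfolding boundary_measure_def eq by (rule sets_measure_of) (auto simp: sets_restrict_space)
 also have "\<dots> = sets (restrict_space borel ?F)"
  using sets.sigma_sets_eq[of "restrict_space borel ?F"] by (simp add: space_restrict_space)
 finally show "sets (boundary_measure k \<gamma>) = sets (restrict_space borel ?F)" .
 show "space (boundary_measure k \<gamma>) = ?F"
  unfolding boundary_measure_def by (rule space_measure_of) auto
qed

text \<open>\<open>measure_of\<close> returns the null measure unless the given set function is a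
  measure on the generated sigma-algebra. The upper bound holds in either case, and the boundary
  estimates rest on it.\<close>

lemma emeasure_boundary_measure_le:
 "emeasure (boundary_measure (k::'n::finite) \<gamma>) A \<le> hausdorff (real CARD('n) - 1) A"
 unfolding boundary_measure_def by (auto simp: emeasure_measure_of_conv)

text \<open>A separated set of greatest cardinality exists because each ball of radius r/2 in a
  finite cover contains at most one of its points; maximality then forces it to be a net.\<close>

lemma ex_separated_net:
 fixes A :: "'a::euclidean_space set"
 assumes A: "bounded A" and r: "0 < r"
 obtains X where "finite X" "X \<subseteq> A" "\<And>x y. x \<in> X \<Longrightarrow> y \<in> X \<Longrightarrow> x \<noteq> y \<Longrightarrow> r \<le> dist x y" "A \<subseteq> (\<Union>x\<in>X. ball x r)"
proof -
 define sep where "sep X \<longleftrightarrow> finite X \<and> X \<subseteq> A \<and> (\<forall>x\<in>X. \<forall>y\<in>X. x \<noteq> y \<longrightarrow> r \<le> dist x y)" for X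
 have "compact (closure A)" using A by (simp add: compact_closure)
 then obtain K where K: "finite K" "closure A \<subseteq> (\<Union>x\<in>K. ball x (r/2))"
  using compact_eq_totally_bounded[of "closure A"] r by (metis half_gt_zero_iff)
 have card: "card X \<le> card K" if X: "sep X" for X
 proof -
  have "\<forall>x\<in>X. \<exists>z\<in>K. x \<in> ball z (r/2)" using X K(2) closure_subset[of A] by (fastforce simp: sep_def)
  then obtain f where f: "\<And>x. x \<in> X \<Longrightarrow> f x \<in> K \<and> x \<in> ball (f x) (r/2)" by metis
  have "inj_on f X"
  proof (rule inj_onI)
   fix x y assume xy: "x \<in> X" "y \<in> X" "f x = f y"
   have "dist x y < r" using f[OF xy(1)] f[OF xy(2)] xy(3) dist_triangle_half_r[of "f x" x r y] by simp
   then show "x = y" using X xy unfolding sep_def by force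
  qed
  then show ?thesis using f K(1) by (intro card_inj_on_le[of f]) auto
 qed
 have "sep {}" by (simp add: sep_def)
 moreover have "\<forall>Y. sep Y \<longrightarrow> card Y < Suc (card K)" using card by (simp add: less_Suc_eq_le)
 ultimately obtain X where X: "sep X" "\<And>Y. sep Y \<Longrightarrow> card Y \<le> card X"
  using ex_has_greatest_nat[of sep "{}" card "Suc (card K)"] by blast
 have "A \<subseteq> (\<Union>x\<in>X. ball x r)"
 proof
  fix a assume a: "a \<in> A"
  show "a \<in> (\<Union>x\<in>X. ball x r)"
  proof (rule ccontr)
   assume n: "a \<notin> (\<Union>x\<in>X. ball x r)"
   then have d: "r \<le> dist x a" if "x \<in> X" for x using that by (auto simp: not_less)
   then have "a \<notin> X" using r by force
   moreover have "sep (insert a X)" using X(1) a d by (auto simp: sep_def dist_commute)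
   ultimately show False using X(2)[of "insert a X"] X(1) by (simp add: sep_def)
  qed
 qed
 then show ?thesis using that X(1) unfolding sep_def by blast
qed

lemma hausdorff_pre_finite_cover:
 fixes A :: "'a::euclidean_space set"
 assumes X: "finite X" and cov: "A \<subseteq> (\<Union>x\<in>X. ball x r)" and r: "0 < r" "2 * r \<le> d" and s: "0 \<le> s"
 shows "hausdorff_pre s d A \<le> ennreal (real (card X) * (unit_ball_vol s * r powr s))"
proof -
 obtain h where h: "bij_betw h {0..<card X} X" using ex_bij_betw_nat_finite[OF X] by blast
 \<comment> \<open>The cover is padded with empty sets, which contribute nothing because
   \<open>0 powr s = 0\<close> also for s = 0.\<close>
 define C where "C i = (if i < card X then cball (h i) r else {})" for i
 define T where "T i = ennreal (unit_ball_vol s * (diameter (C i) / 2) powr s)" for i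
 have "A \<subseteq> (\<Union>i. C i)"
 proof
  fix a assume "a \<in> A"
  then obtain x where x: "x \<in> X" "a \<in> ball x r" using cov by blast
  have "x \<in> h ` {0..<card X}" using h x(1) by (simp add: bij_betw_def)
  then obtain i where "i < card X" "h i = x" by auto
  then have "a \<in> C i" using x(2) by (simp add: C_def)
  then show "a \<in> (\<Union>i. C i)" by blast
 qed
 moreover have "\<forall>i. bounded (C i) \<and> diameter (C i) \<le> d" using r by (auto simp: C_def)
 ultimately have "hausdorff_pre s d A \<le> (\<Sum>i. T i)"
  unfolding hausdorff_pre_def T_def by (intro Inf_lower) blast
 also have "(\<Sum>i. T i) = (\<Sum>i\<in>{..<card X}. T i)"
  by (rule suminf_finite) (auto simp: T_def C_def)
 also have "\<dots> = (\<Sum>i\<in>{..<card X}. ennreal (unit_ball_vol s * r powr s))"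
  by (rule sum.cong) (use r in \<open>auto simp: T_def C_def\<close>)
 also have "\<dots> = ennreal (real (card X) * (unit_ball_vol s * r powr s))"
  using s by (simp add: ennreal_of_nat_eq_real_of_nat ennreal_mult)
 finally show ?thesis .
qed

text \<open>For a maximal 2R-separated set, the balls of radius 2R cover A while those of radius R
  are disjoint and each holds layer volume at least t (K R)^(n-1). So the number of balls times
  R^(n-1) is at most K^(1-n) times the scaled layer volume; radius 2R explains the 2 in 2/K.\<close>

lemma hausdorff_le_layers:
 fixes A U :: "(real^'n::finite) set" and Ly :: "nat \<Rightarrow> (real^'n) set" and t :: "nat \<Rightarrow> real"
 assumes A: "bounded A" and K: "0 < K" and R0: "0 < R0" and t: "\<And>j. 0 < t j"
  and Ly[measurable]: "\<And>j. Ly j \<in> sets borel" and U: "open U"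
  and sub: "\<And>x. x \<in> A \<Longrightarrow> ball x R0 \<subseteq> U"
  and low: "\<And>x R. x \<in> A \<Longrightarrow> 0 < R \<Longrightarrow> R < R0 \<Longrightarrow> \<forall>\<^sub>F j in sequentially. ennreal (t j * (K * R) ^ (CARD('n) - 1)) \<le> emeasure lborel (Ly j \<inter> ball x R)"
 shows "hausdorff (real CARD('n) - 1) A \<le> ennreal (unit_ball_vol (real CARD('n) - 1) * (2 / K) ^ (CARD('n) - 1)) *
  liminf (\<lambda>j. ennreal (1 / t j) * emeasure lborel (Ly j \<inter> U))"
proof -
 let ?m = "CARD('n) - 1"
 have m: "real CARD('n) - 1 = real ?m" by (simp add: of_nat_diff)
 define w where "w = unit_ball_vol (real ?m)"
 have w: "0 \<le> w" by (simp add: w_def)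
 have "hausdorff_pre (real ?m) d A \<le> ennreal (w * (2 / K) ^ ?m) * liminf (\<lambda>j. ennreal (1 / t j) * emeasure lborel (Ly j \<inter> U))"
  if d: "0 < d" for d
 proof -
  \<comment> \<open>Radius 2R for the cover means diameters up to 4R, which must not exceed d; R0/2
    keeps R strictly below the radius where the lower bound is available.\<close>
  define R where "R = min (R0 / 2) (d / 4)"
  have R: "0 < R" "R < R0" "4 * R \<le> d" using R0 d by (auto simp: R_def min_def)
  have r2: "0 < 2 * R" using R by simp
  obtain X where X: "finite X" "X \<subseteq> A" "\<And>x y. x \<in> X \<Longrightarrow> y \<in> X \<Longrightarrow> x \<noteq> y \<Longrightarrow> 2 * R \<le> dist x y" "A \<subseteq> (\<Union>x\<in>X. ball x (2 * R))"
   by (rule ex_separated_net[OF A r2]) (rule that)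
  define N where "N = real (card X)"
  have pre: "hausdorff_pre (real ?m) d A \<le> ennreal (N * (w * (2 * R) ^ ?m))"
  proof -
   have pw: "(2 * R) powr real ?m = (2 * R) ^ ?m" by (rule powr_realpow[OF r2])
   have "2 * (2 * R) \<le> d" using R by simp
   from hausdorff_pre_finite_cover[OF X(1,4) r2 this, of "real ?m"]
   show ?thesis by (simp only: pw N_def w_def of_nat_0_le_iff simp_thms)
  qed
  have "\<forall>\<^sub>F j in sequentially. \<forall>x\<in>X. ennreal (t j * (K * R) ^ ?m) \<le> emeasure lborel (Ly j \<inter> ball x R)"
   using X(1,2) low R by (intro eventually_ball_finite) auto
  then have "\<forall>\<^sub>F j in sequentially. ennreal (N * (K * R) ^ ?m) \<le> ennreal (1 / t j) * emeasure lborel (Ly j \<inter> U)"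
  proof eventually_elim
   case (elim j)
   have disj: "disjoint_family_on (\<lambda>x. Ly j \<inter> ball x R) X"
    unfolding disjoint_family_on_def
   proof (intro ballI impI)
    fix x y assume xy: "x \<in> X" "y \<in> X" "x \<noteq> y"
    have "ball x R \<inter> ball y R = {}"
    proof (rule ccontr)
     assume "ball x R \<inter> ball y R \<noteq> {}"
     then obtain z where "dist x z < R" "dist y z < R" by auto
     then have "dist x y < 2 * R" using dist_triangle2[of x y z] by (simp add: dist_commute)
     then show False using X(3)[OF xy] by simp
    qed
    then show "Ly j \<inter> ball x R \<inter> (Ly j \<inter> ball y R) = {}" by blast
   qed
   have "ennreal (N * (t j * (K * R) ^ ?m)) = (\<Sum>x\<in>X. ennreal (t j * (K * R) ^ ?m))"
    using t[of j] K R by (simp add: N_def ennreal_of_nat_eq_real_of_nat ennreal_mult)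
   also have "\<dots> \<le> (\<Sum>x\<in>X. emeasure lborel (Ly j \<inter> ball x R))" by (intro sum_mono) (use elim in auto)
   also have "\<dots> = emeasure lborel (\<Union>x\<in>X. Ly j \<inter> ball x R)"
    by (rule sum_emeasure) (use disj X(1) in auto)
   also have "\<dots> \<le> emeasure lborel (Ly j \<inter> U)"
   proof (rule emeasure_mono)
    show "(\<Union>x\<in>X. Ly j \<inter> ball x R) \<subseteq> Ly j \<inter> U"
     using sub X(2) R(2) subset_ball[of R R0] by (fastforce simp: less_imp_le)
    show "Ly j \<inter> U \<in> sets lborel" using U by auto
   qed
   finally have "ennreal (1 / t j) * ennreal (N * (t j * (K * R) ^ ?m)) \<le> ennreal (1 / t j) * emeasure lborel (Ly j \<inter> U)"
    by (rule mult_left_mono) simp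
   moreover have "ennreal (1 / t j) * ennreal (N * (t j * (K * R) ^ ?m)) = ennreal (N * (K * R) ^ ?m)"
    using t[of j] K R by (subst ennreal_mult[symmetric]) (auto simp: N_def)
   ultimately show ?case by simp
  qed
  then have low': "ennreal (N * (K * R) ^ ?m) \<le> liminf (\<lambda>j. ennreal (1 / t j) * emeasure lborel (Ly j \<inter> U))"
   by (rule Liminf_bounded)
  have "N * (w * (2 * R) ^ ?m) = (w * (2 / K) ^ ?m) * (N * (K * R) ^ ?m)"
   using K by (simp add: power_mult_distrib power_divide)
  moreover have "0 \<le> w * (2 / K) ^ ?m" "0 \<le> N * (K * R) ^ ?m"
   using K R w by (auto simp: N_def)
  ultimately have "ennreal (N * (w * (2 * R) ^ ?m)) = ennreal (w * (2 / K) ^ ?m) * ennreal (N * (K * R) ^ ?m)"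
   by (simp only: ennreal_mult)
  also have "\<dots> \<le> ennreal (w * (2 / K) ^ ?m) * liminf (\<lambda>j. ennreal (1 / t j) * emeasure lborel (Ly j \<inter> U))"
   by (intro mult_left_mono low') simp
  finally show ?thesis using pre by simp
 qed
 then show ?thesis unfolding hausdorff_def m w_def by (intro SUP_least) auto
qed

text \<open>Heuristically, its volume divided by s approximates the integral of the positive part of
  e . nu over the boundary, so the layer is a volume substitute for the surface seen in direction
  e.\<close>

definition edge_layer :: "(real^'n::finite) set \<Rightarrow> real^'n \<Rightarrow> real \<Rightarrow> (real^'n) set" where
 "edge_layer W e s = {y \<in> W. y + s *\<^sub>R e \<notin> W}"

lemma edge_layer_borel:
 assumes "open W"
 shows "edge_layer W e s \<in> sets borel"
proof -
 have "open ((\<lambda>y. y + s *\<^sub>R e) -` W)" by (intro open_vimage assms continuous_intros)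
 moreover have "edge_layer W e s = W - (\<lambda>y. y + s *\<^sub>R e) -` W" by (auto simp: edge_layer_def)
 ultimately show ?thesis using assms by auto
qed

lemma emeasure_lborel_translate:
 fixes S :: "'a::euclidean_space set"
 assumes "S \<in> sets borel"
 shows "emeasure lborel ((\<lambda>y. y + v) -` S) = emeasure lborel S"
proof -
 have "emeasure lborel S = emeasure (distr lborel borel ((+) v)) S" by (simp add: lborel_distr_plus)
 also have "\<dots> = emeasure lborel ((+) v -` S)" using assms by (subst emeasure_distr) auto
 also have "(+) v -` S = (\<lambda>y. y + v) -` S" by (auto simp: add.commute)
 finally show ?thesis by simp
qed

text \<open>Points of W and Q off the layer are moved by the step into W, hence stay in Q, and miss
  S because nothing in Q is moved onto S. Comparing volumes, the part lost from W and Q is at least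
  S.\<close>

lemma edge_layer_measure_ge:
 fixes W Q S :: "(real^'n::finite) set"
 assumes O: "open W" and Q: "open Q" "bounded Q" and S: "S \<in> sets borel" "S \<subseteq> Q \<inter> W" "\<And>y. y \<in> S \<Longrightarrow> y - s *\<^sub>R e \<notin> Q"
  and out: "\<And>y. y \<in> Q \<Longrightarrow> y + s *\<^sub>R e \<notin> Q \<Longrightarrow> y + s *\<^sub>R e \<notin> W"
 shows "emeasure lborel S \<le> emeasure lborel (edge_layer W e s \<inter> Q)"
proof -
 let ?L = "edge_layer W e s \<inter> Q"
 have Lb: "?L \<in> sets borel" using edge_layer_borel[OF O] Q by auto
 define R where "R = (W \<inter> Q) - ?L"
 have Rb: "R \<in> sets borel" using Lb O Q by (auto simp: R_def)
 have fin: "emeasure lborel (W \<inter> Q) < \<infinity>"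
  by (rule emeasure_bounded_finite) (use Q(2) in \<open>auto intro: bounded_subset\<close>)
 have finR: "emeasure lborel R \<noteq> \<infinity>"
 proof -
  have "emeasure lborel R \<le> emeasure lborel (W \<inter> Q)"
   by (rule emeasure_mono) (use O Q in \<open>auto simp: R_def\<close>)
  from le_less_trans[OF this fin] show ?thesis by simp
 qed
 have "emeasure lborel R \<le> emeasure lborel ((\<lambda>y. y + s *\<^sub>R e) -` ((W \<inter> Q) - S))"
 proof (rule emeasure_mono)
  show "R \<subseteq> (\<lambda>y. y + s *\<^sub>R e) -` ((W \<inter> Q) - S)"
  proof
   fix y assume y: "y \<in> R"
   then have 1: "y \<in> Q" "y + s *\<^sub>R e \<in> W" by (auto simp: R_def edge_layer_def)
   then have 2: "y + s *\<^sub>R e \<in> Q" using out by blast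
   have "y + s *\<^sub>R e \<notin> S" using S(3)[of "y + s *\<^sub>R e"] 1 by auto
   then show "y \<in> (\<lambda>y. y + s *\<^sub>R e) -` ((W \<inter> Q) - S)" using 1 2 by auto
  qed
  have "(\<lambda>y. y + s *\<^sub>R e) \<in> borel_measurable borel" by measurable
  from measurable_sets_borel[OF this, of "(W \<inter> Q) - S"]
  show "(\<lambda>y. y + s *\<^sub>R e) -` ((W \<inter> Q) - S) \<in> sets lborel" using O Q S by auto
 qed
 also have "\<dots> = emeasure lborel ((W \<inter> Q) - S)"
  by (rule emeasure_lborel_translate) (use O Q S in auto)
 finally have le: "emeasure lborel R \<le> emeasure lborel ((W \<inter> Q) - S)" .
 have "emeasure lborel S + emeasure lborel R \<le> emeasure lborel S + emeasure lborel ((W \<inter> Q) - S)"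
  by (rule add_left_mono[OF le])
 also have "\<dots> = emeasure lborel (W \<inter> Q)"
  using S O Q by (subst plus_emeasure) (auto intro!: arg_cong[where f="emeasure lborel"])
 also have "\<dots> = emeasure lborel ?L + emeasure lborel R"
  using Lb Rb by (subst plus_emeasure) (auto simp: R_def edge_layer_def intro!: arg_cong[where f="emeasure lborel"])
 finally show ?thesis using finR by (simp add: ennreal_add_left_cancel_le add.commute)
qed

text \<open>A box crossed by the boundary in the signed axis direction e: leaving the box by a short step in direction e leads
  outside the domain, while points that leave it by a short step in direction -e lie inside. Hence every line of
  direction e through the box meets the layer of points that a short step in direction e takes out of the domain.\<close>

definition edge_box :: "(real^'n::finite) set \<Rightarrow> 'n \<Rightarrow> real \<Rightarrow> real \<Rightarrow> real \<Rightarrow> real^'n \<Rightarrow> bool" where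
 "edge_box W i \<sigma> \<kappa> \<rho> x \<longleftrightarrow> (\<exists>a b s0. box a b \<subseteq> ball x \<rho> \<and> (\<forall>j. j \<noteq> i \<longrightarrow> \<kappa> * \<rho> \<le> b $ j - a $ j) \<and> 0 < s0 \<and> s0 < b $ i - a $ i \<and>
   (\<forall>s y. 0 < s \<longrightarrow> s < s0 \<longrightarrow> y \<in> box a b \<longrightarrow> y - s *\<^sub>R (\<sigma> *\<^sub>R axis i 1) \<notin> box a b \<longrightarrow> y \<in> W) \<and>
   (\<forall>s y. 0 < s \<longrightarrow> s < s0 \<longrightarrow> y \<in> box a b \<longrightarrow> y + s *\<^sub>R (\<sigma> *\<^sub>R axis i 1) \<notin> box a b \<longrightarrow> y + s *\<^sub>R (\<sigma> *\<^sub>R axis i 1) \<notin> W))"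

lemma emeasure_box_cart_ge:
 fixes a b :: "real^'n::finite"
 assumes i: "s \<le> b $ i - a $ i" and j: "\<And>j. j \<noteq> i \<Longrightarrow> w \<le> b $ j - a $ j" and sw: "0 \<le> s" "0 \<le> w"
 shows "ennreal (s * w ^ (CARD('n) - 1)) \<le> emeasure lborel (box a b)"
proof -
 have nn: "0 \<le> b $ j - a $ j" for j using i j[of j] sw by (cases "j = i") auto
 have "s * w ^ (CARD('n) - 1) = s * (\<Prod>j\<in>UNIV - {i}. w)" by (simp add: card_Diff_singleton)
 also have "\<dots> \<le> (b $ i - a $ i) * (\<Prod>j\<in>UNIV - {i}. b $ j - a $ j)"
  using i j sw nn by (intro mult_mono prod_mono) (auto intro: prod_nonneg)
 also have "\<dots> = (\<Prod>j\<in>UNIV. b $ j - a $ j)" by (simp add: prod.remove[of UNIV i])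
 also have "\<dots> = measure lborel (cbox a b)"
  using nn by (subst content_cbox_cart) (auto simp: interval_ne_empty_cart)
 also have "\<dots> = measure lborel (box a b)" using measure_lborel_box_eq[of a b] measure_lborel_cbox_eq[of a b] by simp
 finally have le: "s * w ^ (CARD('n) - 1) \<le> measure lborel (box a b)" .
 have "emeasure lborel (box a b) \<noteq> top"
  using emeasure_bounded_finite[OF bounded_box, of a b] by simp
 then show ?thesis using ennreal_leI[OF le] by (simp add: emeasure_eq_ennreal_measure)
qed

lemma edge_box_layer:
 fixes x :: "real^'n::finite"
 assumes O: "open W" and S: "S = 1 \<or> S = -1" and K: "0 < K" "0 < r" and eb: "edge_box W i S K r x"
 shows "\<exists>s0>0. \<forall>s. 0 < s \<longrightarrow> s < s0 \<longrightarrow> ennreal (s * (K * r) ^ (CARD('n) - 1)) \<le> emeasure lborel (edge_layer W (S *\<^sub>R axis i 1) s \<inter> ball x r)"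
proof -
 let ?e = "S *\<^sub>R axis i 1 :: real^'n"
 obtain a b s0 where ab: "box a b \<subseteq> ball x r" "\<And>j. j \<noteq> i \<Longrightarrow> K * r \<le> b $ j - a $ j" "0 < s0" "s0 < b $ i - a $ i"
   "\<And>s y. 0 < s \<Longrightarrow> s < s0 \<Longrightarrow> y \<in> box a b \<Longrightarrow> y - s *\<^sub>R ?e \<notin> box a b \<Longrightarrow> y \<in> W"
   "\<And>s y. 0 < s \<Longrightarrow> s < s0 \<Longrightarrow> y \<in> box a b \<Longrightarrow> y + s *\<^sub>R ?e \<notin> box a b \<Longrightarrow> y + s *\<^sub>R ?e \<notin> W"
  using eb unfolding edge_box_def by blast
 have "ennreal (s * (K * r) ^ (CARD('n) - 1)) \<le> emeasure lborel (edge_layer W ?e s \<inter> ball x r)" if s: "0 < s" "s < s0" for s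
 proof -
  \<comment> \<open>The slab of thickness s at the face where lines of direction e enter the box:
    the lower face in coordinate i if S = 1, the upper one otherwise.\<close>
  define a' where "a' = (if S = 1 then a else (\<chi> j. if j = i then b $ i - s else a $ j))"
  define b' where "b' = (if S = 1 then (\<chi> j. if j = i then a $ i + s else b $ j) else b)"
  have sub: "box a' b' \<subseteq> box a b"
  proof
   fix y assume y: "y \<in> box a' b'"
   have "a $ j < y $ j \<and> y $ j < b $ j" for j
    using y[unfolded mem_box_cart, rule_format, of j] s ab(4) by (auto simp: a'_def b'_def split: if_splits)
   then show "y \<in> box a b" by (simp add: mem_box_cart)
  qed
  have notin: "y - s *\<^sub>R ?e \<notin> box a b" if y: "y \<in> box a' b'" for y
  proof
   assume "y - s *\<^sub>R ?e \<in> box a b"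
   then have "a $ i < (y - s *\<^sub>R ?e) $ i" "(y - s *\<^sub>R ?e) $ i < b $ i" unfolding mem_box_cart by blast+
   moreover have "(y - s *\<^sub>R ?e) $ i = y $ i - s * S" by (simp add: axis_def)
   ultimately show False using y[unfolded mem_box_cart, rule_format, of i] S by (auto simp: a'_def b'_def)
  qed
  have "ennreal (s * (K * r) ^ (CARD('n) - 1)) \<le> emeasure lborel (box a' b')"
   by (rule emeasure_box_cart_ge[of _ _ i]) (use s ab(2) K in \<open>auto simp: a'_def b'_def\<close>)
  also have "\<dots> \<le> emeasure lborel (edge_layer W ?e s \<inter> box a b)"
  proof (rule edge_layer_measure_ge[OF O open_box bounded_box])
   show "box a' b' \<subseteq> box a b \<inter> W" using sub notin ab(5)[OF s] by blast
  qed (use notin ab(6)[OF s] in auto)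
  also have "\<dots> \<le> emeasure lborel (edge_layer W ?e s \<inter> ball x r)"
   by (rule emeasure_mono) (use ab(1) edge_layer_borel[OF O] in auto)
  finally show ?thesis .
 qed
 then show ?thesis using ab(3) by blast
qed

text \<open>A discrete layer-cake. Summed over i it agrees with F in [0,1] up to a factor 2 on
  either side, which reduces integrals of a continuous function to measures of its open superlevel
  sets.\<close>

definition dyadic :: "real \<Rightarrow> nat \<Rightarrow> real" where
 "dyadic F i = (if (1/2)^i < F then (1/2)^i else 0)"

lemma dyadic_first:
 assumes "0 < F"
 obtains i where "(1/2)^i < F" "\<And>j. j < i \<Longrightarrow> F \<le> (1/2::real)^j"
proof -
 have "\<exists>i. (1/2::real)^i < F" using assms real_arch_pow_inv[of F "1/2"] by auto
 then show ?thesis using that[of "LEAST i. (1/2::real)^i < F"] LeastI_ex not_less_Least not_le by metis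
qed

lemma le_dyadic_sum:
 assumes "0 \<le> F" "F \<le> 1"
 shows "ennreal F \<le> 2 * (\<Sum>i. ennreal (dyadic F i))"
proof (cases "F = 0")
 case False
 then obtain i where i: "(1/2)^i < F" "\<And>j. j < i \<Longrightarrow> F \<le> (1/2::real)^j" using dyadic_first[of F] assms by auto
 have "F \<le> 2 * (1/2)^i"
 proof (cases i)
  case 0
  then show ?thesis using assms by simp
 next
  case (Suc j)
  then show ?thesis using i(2)[of j] by simp
 qed
 then have "ennreal F \<le> 2 * ennreal (dyadic F i)"
  using i(1) by (auto simp: dyadic_def ennreal_mult'[symmetric] ennreal_numeral[symmetric] simp del: ennreal_numeral intro!: ennreal_leI)
 also have "\<dots> \<le> 2 * (\<Sum>i. ennreal (dyadic F i))"
  using sum_le_suminf[of "\<lambda>i. ennreal (dyadic F i)" "{i}"] by (intro mult_left_mono) auto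
 finally show ?thesis .
qed simp

lemma dyadic_sum_le:
 assumes "0 \<le> F"
 shows "(\<Sum>i. ennreal (dyadic F i)) \<le> 2 * ennreal F"
proof (cases "F = 0")
 case True
 then have "dyadic F i = 0" for i by (simp add: dyadic_def not_less)
 then show ?thesis by simp
next
 case False
 then obtain i0 where i: "(1/2)^i0 < F" "\<And>j. j < i0 \<Longrightarrow> F \<le> (1/2::real)^j" using dyadic_first[of F] assms by auto
 define g :: "nat \<Rightarrow> real" where "g i = (if i0 \<le> i then (1/2)^i else 0)" for i
 have "(\<lambda>i. (1/2)^i0 * (1/2::real)^i) sums ((1/2)^i0 * (1 / (1 - 1/2)))"
  by (intro sums_mult geometric_sums) simp
 moreover have "g (i + i0) = (1/2)^i0 * (1/2)^i" for i by (simp add: g_def power_add)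
 ultimately have "(\<lambda>i. g (i + i0)) sums (2 * (1/2)^i0)" by (simp add: mult.commute[of _ 2])
 moreover have "(\<Sum>i<i0. g i) = 0" by (simp add: g_def)
 ultimately have gs: "g sums (2 * (1/2)^i0)" using sums_iff_shift[of g i0 "2 * (1/2)^i0"] by simp
 have "(\<Sum>i. ennreal (dyadic F i)) \<le> (\<Sum>i. ennreal (g i))"
 proof (intro suminf_le ennreal_leI)
  show "dyadic F i \<le> g i" for i using i(2)[of i] by (cases "i0 \<le> i") (auto simp: dyadic_def g_def)
 qed auto
 also have "\<dots> = ennreal (2 * (1/2)^i0)"
  using gs by (subst suminf_ennreal2) (auto simp: g_def sums_iff)
 also have "\<dots> \<le> ennreal (2 * F)" using i(1) by (intro ennreal_leI) simp
 finally show ?thesis using assms by (simp add: ennreal_mult)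
qed

text \<open>Serves twice: as the thickness of the layers, and as the margin that keeps the pieces of
  the boundary away from the tip and from the cusp part.\<close>

definition step :: "nat \<Rightarrow> real" where "step j = 1 / real (Suc j)"

lemma step: "0 < step j" "step \<longlonglongrightarrow> 0"
proof -
 show "0 < step j" by (simp add: step_def)
 show "step \<longlonglongrightarrow> 0" unfolding step_def[abs_def] by (rule LIMSEQ_Suc[OF lim_1_over_n])
qed

lemma eventually_step: "0 < s0 \<Longrightarrow> \<forall>\<^sub>F j in sequentially. step j < s0"
 using order_tendstoD(2)[OF step(2)] by simp

lemma ennreal_liminf_cmult:
 fixes q :: "nat \<Rightarrow> ennreal"
 assumes "0 < c" "c < top"
 shows "c * liminf q = liminf (\<lambda>j. c * q j)"
proof -
 have "continuous_on UNIV (\<lambda>x::ennreal. c * x)"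
  using assms(2) by (intro ennreal_continuous_on_cmult continuous_on_id)
 moreover have "mono (\<lambda>x::ennreal. c * x)" by (auto simp: mono_def mult_left_mono)
 ultimately show ?thesis using Liminf_compose_continuous_mono[of "\<lambda>x. c * x" sequentially q] by simp
qed

lemma emeasure_piece_le_layers:
 fixes P :: "nat \<Rightarrow> (real^'n::finite) set"
 assumes O: "open W" "bounded W" and S: "S = 1 \<or> S = -1" and K: "0 < K"
  and M: "\<And>A. emeasure M A \<le> hausdorff (real CARD('n) - 1) A" "sets M = sets (restrict_space borel (frontier W))"
  and P: "\<And>m. P m \<in> sets M" "incseq P" "\<And>m. \<exists>\<rho>0>0. \<forall>x\<in>P m. \<forall>\<rho>. 0 < \<rho> \<longrightarrow> \<rho> < \<rho>0 \<longrightarrow> edge_box W i S K \<rho> x"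
  and U: "open U"
 shows "emeasure M ((\<Union>m. P m) \<inter> U) \<le> ennreal (unit_ball_vol (real CARD('n) - 1) * (2 / K) ^ (CARD('n) - 1)) *
  liminf (\<lambda>j. ennreal (1 / step j) * emeasure lborel (edge_layer W (S *\<^sub>R axis i 1) (step j) \<inter> U))" (is "_ \<le> ?R")
proof -
 \<comment> \<open>Points with a definite distance to the complement of U. On \<open>P m\<close> cut
   with V m one radius works for all points, and these sets increase to the union of the P m cut
   with U.\<close>
 define V where "V m = {x. ball x (1 / real (Suc m)) \<subseteq> U}" for m
 have Vc: "closed (V m)" for m
 proof -
  have "- V m = (\<Union>z\<in>- U. ball z (1 / real (Suc m)))"
   by (auto simp: V_def subset_iff dist_commute)
  then have "open (- V m)" by auto
  then show ?thesis by (simp add: closed_def)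
 qed
 define A where "A m = P m \<inter> V m" for m
 have sp: "P m \<subseteq> frontier W" for m
  using P(1)[of m] M(2) by (auto simp: sets_restrict_space)
 have Am: "A m \<in> sets M" for m
 proof -
  have "A m = P m \<inter> (frontier W \<inter> V m)" using sp[of m] by (auto simp: A_def)
  moreover have "frontier W \<inter> V m \<in> sets M" using Vc[of m] unfolding M(2) sets_restrict_space by auto
  ultimately show ?thesis using P(1)[of m] by auto
 qed
 have Ai: "incseq A"
 proof (rule incseq_SucI)
  fix m
  have "ball x (1 / real (Suc (Suc m))) \<subseteq> ball x (1 / real (Suc m))" for x :: "real^'n"
   by (rule subset_ball) (simp add: field_simps)
  then have "V m \<subseteq> V (Suc m)" unfolding V_def by blast
  then show "A m \<subseteq> A (Suc m)" using incseq_SucD[OF P(2), of m] by (auto simp: A_def)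
 qed
 have Au: "(\<Union>m. P m) \<inter> U = (\<Union>m. A m)"
 proof
  show "(\<Union>m. A m) \<subseteq> (\<Union>m. P m) \<inter> U"
  proof
   fix x assume "x \<in> (\<Union>m. A m)"
   then obtain m where m: "x \<in> P m" "ball x (1 / real (Suc m)) \<subseteq> U" by (auto simp: A_def V_def)
   then have "x \<in> U" using centre_in_ball[of x "1 / real (Suc m)"] by auto
   then show "x \<in> (\<Union>m. P m) \<inter> U" using m by auto
  qed
  show "(\<Union>m. P m) \<inter> U \<subseteq> (\<Union>m. A m)"
  proof
   fix x assume x: "x \<in> (\<Union>m. P m) \<inter> U"
   then obtain m where m: "x \<in> P m" by auto
   obtain e where e: "0 < e" "ball x e \<subseteq> U" using U x open_contains_ball by blast
   obtain l where l: "1 / real (Suc l) < e" using nat_approx_posE[OF e(1)] by blast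
   have "1 / real (Suc (max m l)) \<le> 1 / real (Suc l)" by (simp add: field_simps)
   then have "ball x (1 / real (Suc (max m l))) \<subseteq> ball x e" using l by (intro subset_ball) linarith
   then have "x \<in> V (max m l)" using e(2) unfolding V_def by blast
   moreover have "x \<in> P (max m l)" using m incseqD[OF P(2), of m "max m l"] by auto
   ultimately show "x \<in> (\<Union>m. A m)" by (auto simp: A_def)
  qed
 qed
 have "emeasure M (A m) \<le> ?R" for m
 proof -
  obtain \<rho>0 where r0: "0 < \<rho>0" "\<And>x \<rho>. x \<in> P m \<Longrightarrow> 0 < \<rho> \<Longrightarrow> \<rho> < \<rho>0 \<Longrightarrow> edge_box W i S K \<rho> x"
   using P(3)[of m] by blast
  have "emeasure M (A m) \<le> hausdorff (real CARD('n) - 1) (A m)" by (rule M(1))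
  also have "\<dots> \<le> ?R"
  proof (rule hausdorff_le_layers[of "A m" K "min \<rho>0 (1 / real (Suc m))" step])
   show "bounded (A m)" using sp[of m] bounded_closure[OF O(2)] by (auto simp: A_def frontier_def intro: bounded_subset[of "closure W"])
   show "0 < min \<rho>0 (1 / real (Suc m))" using r0 by simp
   show "edge_layer W (S *\<^sub>R axis i 1) (step j) \<in> sets borel" for j by (rule edge_layer_borel[OF O(1)])
   show "ball x (min \<rho>0 (1 / real (Suc m))) \<subseteq> U" if "x \<in> A m" for x
   proof -
    have "ball x (min \<rho>0 (1 / real (Suc m))) \<subseteq> ball x (1 / real (Suc m))" by (rule subset_ball) simp
    then show ?thesis using that by (auto simp: A_def V_def)
   qed
   fix x \<rho> assume x: "x \<in> A m" and \<rho>: "0 < \<rho>" "\<rho> < min \<rho>0 (1 / real (Suc m))"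
   have "edge_box W i S K \<rho> x" using r0(2)[of x \<rho>] x \<rho> by (auto simp: A_def)
   from edge_box_layer[OF O(1) S K \<rho>(1) this]
   obtain s0 where s0: "0 < s0" "\<And>s. 0 < s \<Longrightarrow> s < s0 \<Longrightarrow> ennreal (s * (K * \<rho>) ^ (CARD('n) - 1)) \<le> emeasure lborel (edge_layer W (S *\<^sub>R axis i 1) s \<inter> ball x \<rho>)"
    by blast
   show "\<forall>\<^sub>F j in sequentially. ennreal (step j * (K * \<rho>) ^ (CARD('n) - 1)) \<le> emeasure lborel (edge_layer W (S *\<^sub>R axis i 1) (step j) \<inter> ball x \<rho>)"
    using eventually_step[OF s0(1)] by eventually_elim (rule s0(2)[OF step(1)])
  qed (use K U step in auto)
  finally show ?thesis .
 qed
 then have "(SUP m. emeasure M (A m)) \<le> ?R" by (rule SUP_least)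
 then show ?thesis unfolding Au using SUP_emeasure_incseq[OF _ Ai, of M] Am by (simp add: image_subset_iff)
qed

text \<open>Covering by balls around a separated net, each containing an edge box, bounds the Hausdorff measure from above by the volume of the
  layers; no lower bound, and no additivity of the Hausdorff measure, is needed.\<close>

lemma nn_integral_piece_le_layers:
 fixes P :: "nat \<Rightarrow> (real^'n::finite) set" and F :: "real^'n \<Rightarrow> real"
 assumes O: "open W" "bounded W" and s: "s = 1 \<or> s = -1" and K: "0 < K"
  and M: "\<And>A. emeasure M A \<le> hausdorff (real CARD('n) - 1) A" "sets M = sets (restrict_space borel (frontier W))"
  and P: "\<And>m. P m \<in> sets M" "incseq P" "\<And>m. \<exists>r0>0. \<forall>x\<in>P m. \<forall>r. 0 < r \<longrightarrow> r < r0 \<longrightarrow> edge_box W i s K r x"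
  and F: "continuous_on UNIV F" "\<And>x. 0 \<le> F x"
 shows "(\<integral>\<^sup>+x. ennreal (F x) * indicator (\<Union>m. P m) x \<partial>M) \<le> ennreal (4 * (unit_ball_vol (real CARD('n) - 1) * (2 / K) ^ (CARD('n) - 1))) *
  liminf (\<lambda>j. \<integral>\<^sup>+x. ennreal (1 / step j) * (ennreal (F x) * indicator (edge_layer W (s *\<^sub>R axis i 1) (step j)) x) \<partial>lborel)"
proof -
 define C0 where "C0 = unit_ball_vol (real CARD('n) - 1) * (2 / K) ^ (CARD('n) - 1)"
 have C0: "0 \<le> C0" unfolding C0_def using K by (intro mult_nonneg_nonneg) auto
 define PP where "PP = (\<Union>m. P m)"
 have PPm: "PP \<in> sets M" unfolding PP_def using P(1) by auto
 have sM: "space M = frontier W" using sets_eq_imp_space_eq[OF M(2)] by (simp add: space_restrict_space)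
 let ?Ly = "\<lambda>j. edge_layer W (s *\<^sub>R axis i 1) (step j)"
 have Lyb[measurable]: "?Ly j \<in> sets borel" for j by (rule edge_layer_borel[OF O(1)])
 have cl: "compact (closure W)" using O by (simp add: compact_closure)
 have "bounded (F ` closure W)" by (intro compact_imp_bounded compact_continuous_image continuous_on_subset[OF F(1)] cl) auto
 then obtain B0 where B0: "\<And>x. x \<in> closure W \<Longrightarrow> \<bar>F x\<bar> \<le> B0" by (auto simp: bounded_iff)
 \<comment> \<open>Division by B brings F into [0,1] on the closure, where the dyadic lower bound is
   valid; the maximum with 1 makes B positive.\<close>
 define B where "B = max B0 1"
 have B: "0 < B" "\<And>x. x \<in> closure W \<Longrightarrow> F x \<le> B" using B0 by (force simp: B_def)+
 define f where "f x = F x / B" for x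
 have f: "0 \<le> f x" "x \<in> closure W \<Longrightarrow> f x \<le> 1" "F x = B * f x" for x
  using F(2)[of x] B(1) B(2)[of x] by (auto simp: f_def)
 have fc: "continuous_on UNIV f" unfolding f_def using B(1) by (intro continuous_intros F) auto
 define U where "U l = {x. (1/2)^l < f x}" for l :: nat
 have Uo: "open (U l)" for l unfolding U_def using fc by (intro open_Collect_less) auto
 have dy: "ennreal (dyadic (f x) l) = ennreal ((1/2)^l) * indicator (U l) x" for l x
  by (auto simp: dyadic_def U_def)
 have UM: "PP \<inter> U l \<in> sets M" for l
 proof -
  have "PP \<inter> U l = PP \<inter> (frontier W \<inter> U l)" using sets.sets_into_space[OF PPm] sM by auto
  moreover have "frontier W \<inter> U l \<in> sets M" using Uo[of l] unfolding M(2) sets_restrict_space by auto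
  ultimately show ?thesis using PPm by auto
 qed
 define q where "q j l = ennreal (1 / step j) * emeasure lborel (?Ly j \<inter> U l)" for j l
 have "(\<integral>\<^sup>+x. ennreal (f x) * indicator PP x \<partial>M) \<le> (\<integral>\<^sup>+x. 2 * (\<Sum>l. ennreal ((1/2)^l) * indicator (PP \<inter> U l) x) \<partial>M)"
 proof (rule nn_integral_mono)
  fix x assume "x \<in> space M"
  then have x: "x \<in> closure W" unfolding sM by (simp add: frontier_def)
  show "ennreal (f x) * indicator PP x \<le> 2 * (\<Sum>l. ennreal ((1/2)^l) * indicator (PP \<inter> U l) x)"
  proof (cases "x \<in> PP")
   case True
   then show ?thesis using le_dyadic_sum[OF f(1) f(2)[OF x]] by (simp add: dy indicator_inter_arith)
  qed simp
 qed
 also have "\<dots> = 2 * (\<Sum>l. ennreal ((1/2)^l) * emeasure M (PP \<inter> U l))"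
  using UM by (simp add: nn_integral_cmult nn_integral_suminf nn_integral_cmult_indicator del: power_divide)
 also have "\<dots> \<le> 2 * (\<Sum>l. ennreal ((1/2)^l) * (ennreal C0 * liminf (\<lambda>j. q j l)))"
  unfolding PP_def q_def C0_def
  by (intro mult_left_mono suminf_le emeasure_piece_le_layers[OF O s K M P Uo]) auto
 also have "\<dots> = 2 * ennreal C0 * (\<Sum>l. ennreal ((1/2)^l) * liminf (\<lambda>j. q j l))"
  by (simp add: mult.left_commute[of _ "ennreal C0"] mult.assoc ennreal_suminf_cmult del: power_divide)
 \<comment> \<open>Sum and liminf are exchanged by Fatou's lemma for counting measure; the layer
   bound controls only the liminf for each level separately.\<close>
 also have "(\<Sum>l. ennreal ((1/2)^l) * liminf (\<lambda>j. q j l)) \<le> liminf (\<lambda>j. \<Sum>l. ennreal ((1/2)^l) * q j l)"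
 proof -
  have "(\<Sum>l. ennreal ((1/2)^l) * liminf (\<lambda>j. q j l)) = (\<integral>\<^sup>+l. ennreal ((1/2)^l) * liminf (\<lambda>j. q j l) \<partial>count_space UNIV)"
   by (simp add: nn_integral_count_space_nat)
  also have "\<dots> \<le> (\<integral>\<^sup>+l. liminf (\<lambda>j. ennreal ((1/2)^l) * q j l) \<partial>count_space UNIV)"
  proof (rule nn_integral_mono)
   fix l :: nat
   have "ennreal ((1/2)^l) * liminf (\<lambda>j. q j l) = liminf (\<lambda>j. ennreal ((1/2)^l) * q j l)"
    by (subst ennreal_liminf_cmult) auto
   then show "ennreal ((1/2)^l) * liminf (\<lambda>j. q j l) \<le> liminf (\<lambda>j. ennreal ((1/2)^l) * q j l)" by simp
  qed
  also have "\<dots> \<le> liminf (\<lambda>j. \<integral>\<^sup>+l. ennreal ((1/2)^l) * q j l \<partial>count_space UNIV)"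
   by (rule nn_integral_liminf) auto
  finally show ?thesis by (simp add: nn_integral_count_space_nat)
 qed
 also have "liminf (\<lambda>j. \<Sum>l. ennreal ((1/2)^l) * q j l) \<le> liminf (\<lambda>j. 2 * (\<integral>\<^sup>+x. ennreal (1 / step j) * (ennreal (f x) * indicator (?Ly j) x) \<partial>lborel))"
 proof (rule Liminf_mono, intro always_eventually allI)
  fix j
  have [measurable]: "U l \<in> sets borel" for l using Uo by auto
  have fb[measurable]: "f \<in> borel_measurable borel" by (rule borel_measurable_continuous_onI[OF fc])
  have "(\<Sum>l. ennreal ((1/2)^l) * q j l) = (\<Sum>l. \<integral>\<^sup>+x. ennreal (1 / step j) * (ennreal ((1/2)^l) * indicator (?Ly j \<inter> U l) x) \<partial>lborel)"
   by (simp add: q_def nn_integral_cmult nn_integral_cmult_indicator mult_ac del: power_divide)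
  also have "\<dots> = (\<integral>\<^sup>+x. (\<Sum>l. ennreal (1 / step j) * (ennreal ((1/2)^l) * indicator (?Ly j \<inter> U l) x)) \<partial>lborel)"
   by (rule nn_integral_suminf[symmetric]) measurable
  also have "\<dots> \<le> (\<integral>\<^sup>+x. 2 * (ennreal (1 / step j) * (ennreal (f x) * indicator (?Ly j) x)) \<partial>lborel)"
  proof (rule nn_integral_mono)
   fix x
   show "(\<Sum>l. ennreal (1 / step j) * (ennreal ((1/2)^l) * indicator (?Ly j \<inter> U l) x)) \<le> 2 * (ennreal (1 / step j) * (ennreal (f x) * indicator (?Ly j) x))"
   proof (cases "x \<in> ?Ly j")
    case True
    have "(\<Sum>l. ennreal (1 / step j) * (ennreal ((1/2)^l) * indicator (?Ly j \<inter> U l) x)) = ennreal (1 / step j) * (\<Sum>l. ennreal (dyadic (f x) l))"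
     using True by (simp add: dy indicator_inter_arith ennreal_suminf_cmult del: power_divide)
    also have "\<dots> \<le> ennreal (1 / step j) * (2 * ennreal (f x))"
     by (intro mult_left_mono dyadic_sum_le f) simp
    finally show ?thesis using True by (simp add: mult_ac)
   qed simp
  qed
  also have "\<dots> = 2 * (\<integral>\<^sup>+x. ennreal (1 / step j) * (ennreal (f x) * indicator (?Ly j) x) \<partial>lborel)"
   by (rule nn_integral_cmult) measurable
  finally show "(\<Sum>l. ennreal ((1/2)^l) * q j l) \<le> \<dots>" .
 qed
 also have "liminf (\<lambda>j. 2 * (\<integral>\<^sup>+x. ennreal (1 / step j) * (ennreal (f x) * indicator (?Ly j) x) \<partial>lborel)) = 2 * liminf (\<lambda>j. \<integral>\<^sup>+x. ennreal (1 / step j) * (ennreal (f x) * indicator (?Ly j) x) \<partial>lborel)"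
  by (subst ennreal_liminf_cmult) auto
 finally have main: "(\<integral>\<^sup>+x. ennreal (f x) * indicator PP x \<partial>M) \<le> 2 * ennreal C0 * (2 * liminf (\<lambda>j. \<integral>\<^sup>+x. ennreal (1 / step j) * (ennreal (f x) * indicator (?Ly j) x) \<partial>lborel))"
  by (simp add: mult_left_mono)
 have fM: "f \<in> borel_measurable M"
  using borel_measurable_continuous_onI[OF fc] measurable_cong_sets[OF M(2) refl] by (auto intro: measurable_restrict_space1)
 have "(\<integral>\<^sup>+x. ennreal (F x) * indicator PP x \<partial>M) = ennreal B * (\<integral>\<^sup>+x. ennreal (f x) * indicator PP x \<partial>M)"
  using B(1) f(1) fM PPm by (subst nn_integral_cmult[symmetric]) (auto simp: f(3) ennreal_mult mult.assoc)
 also have "\<dots> \<le> ennreal B * (2 * ennreal C0 * (2 * liminf (\<lambda>j. \<integral>\<^sup>+x. ennreal (1 / step j) * (ennreal (f x) * indicator (?Ly j) x) \<partial>lborel)))"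
  by (intro mult_left_mono main) simp
 also have "\<dots> = ennreal (4 * C0) * (ennreal B * liminf (\<lambda>j. \<integral>\<^sup>+x. ennreal (1 / step j) * (ennreal (f x) * indicator (?Ly j) x) \<partial>lborel))"
 proof -
  have "ennreal (4 * C0) = 2 * 2 * ennreal C0" using C0 by (simp add: ennreal_mult)
  then show ?thesis by (simp only: mult_ac)
 qed
 also have "ennreal B * liminf (\<lambda>j. \<integral>\<^sup>+x. ennreal (1 / step j) * (ennreal (f x) * indicator (?Ly j) x) \<partial>lborel)
  = liminf (\<lambda>j. ennreal B * (\<integral>\<^sup>+x. ennreal (1 / step j) * (ennreal (f x) * indicator (?Ly j) x) \<partial>lborel))"
  by (rule ennreal_liminf_cmult) (use B(1) in auto)
 also have "(\<lambda>j. ennreal B * (\<integral>\<^sup>+x. ennreal (1 / step j) * (ennreal (f x) * indicator (?Ly j) x) \<partial>lborel))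
  = (\<lambda>j. \<integral>\<^sup>+x. ennreal (1 / step j) * (ennreal (F x) * indicator (?Ly j) x) \<partial>lborel)"
 proof
  fix j
  have fb[measurable]: "f \<in> borel_measurable borel" by (rule borel_measurable_continuous_onI[OF fc])
  show "ennreal B * (\<integral>\<^sup>+x. ennreal (1 / step j) * (ennreal (f x) * indicator (?Ly j) x) \<partial>lborel) = (\<integral>\<^sup>+x. ennreal (1 / step j) * (ennreal (F x) * indicator (?Ly j) x) \<partial>lborel)"
   using B(1) f(1) by (subst nn_integral_cmult[symmetric]) (auto simp: f(3) ennreal_mult mult_ac)
 qed
 finally show ?thesis unfolding PP_def C0_def .
qed

section \<open>From edge layers to volume integrals\<close>

text \<open>Either a is at most a small multiple \<mu> of b, and the product is dominated by a small
  multiple of b^p, or b is at most a / \<mu> and the product is at most a multiple of a^p.\<close>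

lemma Young_powr:
 fixes p E R :: real
 assumes p: "1 < p" and e: "0 < E" and R: "0 \<le> R"
 obtains C where "0 \<le> C" "\<And>a b. 0 \<le> a \<Longrightarrow> 0 \<le> b \<Longrightarrow> R * (a powr (p - 1) * b) \<le> E * b powr p + C * a powr p"
proof -
 \<comment> \<open>Chosen so that \<mu>^(p-1) = E / (R + 1); the 1 covers R = 0.\<close>
 define \<mu> where "\<mu> = (E / (R + 1)) powr (1 / (p - 1))"
 have l: "0 < \<mu>" using e R by (simp add: \<mu>_def)
 have lp: "\<mu> powr (p - 1) = E / (R + 1)" using p e R by (simp add: \<mu>_def powr_powr)
 show ?thesis
 proof (rule that[of "R / \<mu>"])
  show "0 \<le> R / \<mu>" using R l by simp
  fix a b :: real assume a: "0 \<le> a" and b: "0 \<le> b"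
  have split: "x powr p = x powr (p - 1) * x" if "0 \<le> x" for x :: real
   using that powr_add[of x "p - 1" 1] by (cases "x = 0") auto
  show "R * (a powr (p - 1) * b) \<le> E * b powr p + R / \<mu> * a powr p"
  proof (cases "a \<le> \<mu> * b")
   case True
   have "a powr (p - 1) \<le> (\<mu> * b) powr (p - 1)" using True a p by (intro powr_mono2) auto
   also have "\<dots> = E / (R + 1) * b powr (p - 1)" using l b lp by (simp add: powr_mult)
   finally have "R * (a powr (p - 1) * b) \<le> R * (E / (R + 1) * b powr (p - 1) * b)"
    using R b by (intro mult_left_mono mult_right_mono)
   also have "\<dots> = (R / (R + 1)) * (E * b powr p)" using split[OF b] by simp
   also have "\<dots> \<le> 1 * (E * b powr p)" using R e by (intro mult_right_mono) auto
   finally show ?thesis using R l by (simp add: add_increasing2)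
  next
   case False
   then have "b \<le> a / \<mu>" using l by (simp add: field_simps)
   then have "R * (a powr (p - 1) * b) \<le> R * (a powr (p - 1) * (a / \<mu>))"
    using R by (intro mult_left_mono) auto
   also have "\<dots> = R / \<mu> * a powr p" using split[OF a] by simp
   finally show ?thesis using e by (simp add: add_increasing)
  qed
 qed
qed

lemma nn_integral_lborel_translate:
 fixes f :: "'a::euclidean_space \<Rightarrow> ennreal"
 assumes "f \<in> borel_measurable borel"
 shows "(\<integral>\<^sup>+x. f (x + c) \<partial>lborel) = (\<integral>\<^sup>+x. f x \<partial>lborel)"
proof -
 have "(\<integral>\<^sup>+x. f x \<partial>lborel) = (\<integral>\<^sup>+x. f x \<partial>distr lborel borel ((+) c))" by (simp add: lborel_distr_plus)
 also have "\<dots> = (\<integral>\<^sup>+x. f (c + x) \<partial>lborel)" using assms by (subst nn_integral_distr) auto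
 finally show ?thesis by (simp add: add.commute)
qed

text \<open>Integrating |v|^p times the linear function (x - c) . e along lines of direction e; the factor makes the integrand
  nonnegative where the line leaves the domain and vanish at the hyperplane through c where it is cut off.\<close>

lemma edge_layer_integral_le:
 fixes W :: "(real^'n::finite) set" and e c :: "real^'n"
 assumes O: "open W" "bounded W" and p: "1 < p" and e: "norm e = 1"
  and T: "\<And>y s. y \<in> W \<Longrightarrow> 0 < s \<Longrightarrow> 0 < (y - s *\<^sub>R e - c) \<bullet> e \<Longrightarrow> y - s *\<^sub>R e \<in> W"
  and R: "\<And>y. y \<in> W \<Longrightarrow> (y - c) \<bullet> e \<le> R" "0 \<le> R" and C: "C1_fun v G"
 shows "liminf (\<lambda>j. \<integral>\<^sup>+x. ennreal (1 / step j) * (ennreal (max 0 ((x - c) \<bullet> e) * \<bar>v x\<bar> powr p) * indicator (edge_layer W e (step j)) x) \<partial>lborel)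
  \<le> (\<integral>\<^sup>+x. ennreal (2 * \<bar>v x\<bar> powr p + p * R * (\<bar>v x\<bar> powr (p - 1) * norm (G x))) * indicator W x \<partial>lborel)"
proof -
 define l where "l x = (x - c) \<bullet> e" for x
 have ee: "e \<bullet> e = 1" using e by (simp add: norm_eq_sqrt_inner)
 have ls: "l (y - s *\<^sub>R e) = l y - s" for y s by (simp add: l_def inner_diff_left ee)
 define F where "F x = max 0 (l x) * \<bar>v x\<bar> powr p" for x
 \<comment> \<open>The derivative of l |v|^p in the direction e, since l has slope 1 along
   e.\<close>
 define H where "H x = \<bar>v x\<bar> powr p + l x * (p * (\<bar>v x\<bar> powr (p - 2) * v x) * (G x \<bullet> e))" for x
 define K where "K x = 2 * \<bar>v x\<bar> powr p + p * R * (\<bar>v x\<bar> powr (p - 1) * norm (G x))" for x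
 have vc: "continuous_on UNIV v" and Gc: "continuous_on UNIV G" using C1_fun_continuous[OF C] by auto
 have cpow: "continuous_on UNIV (\<lambda>x. \<bar>v x\<bar> powr q)" if "0 < q" for q
  using that by (intro continuous_on_powr' continuous_intros vc) auto
 \<comment> \<open>For p < 2 the factor |t|^(p-2) is unbounded near 0; the product with t is still
   continuous because its modulus is at most |t|^(p-1).\<close>
 have csgn: "continuous_on UNIV (\<lambda>x. \<bar>v x\<bar> powr (p - 2) * v x)"
 proof -
  have "continuous_on UNIV (\<lambda>t::real. \<bar>t\<bar> powr (p - 2) * t)"
   unfolding continuous_on_eq_continuous_at[OF open_UNIV]
  proof
   fix t :: real
   show "isCont (\<lambda>t. \<bar>t\<bar> powr (p - 2) * t) t"
   proof (cases "t = 0")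
    case False
    then show ?thesis by (intro continuous_intros) auto
   next
    case True
    have "((\<lambda>t::real. \<bar>t\<bar> powr (p - 1)) \<longlongrightarrow> \<bar>0\<bar> powr (p - 1)) (at 0)"
    proof -
     have "continuous_on UNIV (\<lambda>t::real. \<bar>t\<bar> powr (p - 1))"
      using p by (intro continuous_on_powr' continuous_intros) auto
     then have "isCont (\<lambda>t::real. \<bar>t\<bar> powr (p - 1)) 0"
      using continuous_on_eq_continuous_at[OF open_UNIV] by blast
     then show ?thesis by (simp only: isCont_def)
    qed
    then have t0: "((\<lambda>t::real. \<bar>t\<bar> powr (p - 1)) \<longlongrightarrow> 0) (at 0)" by simp
    have "((\<lambda>t::real. \<bar>t\<bar> powr (p - 2) * t) \<longlongrightarrow> 0) (at 0)"
    proof (rule Lim_null_comparison[OF _ t0])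
     show "\<forall>\<^sub>F t in at 0. norm (\<bar>t\<bar> powr (p - 2) * t) \<le> \<bar>t\<bar> powr (p - 1)"
      using norm_powr_inner_le[of _ p "1::real"] by (intro always_eventually allI) simp
    qed
    then show ?thesis using True by (simp add: isCont_def)
   qed
  qed
  then show ?thesis by (rule continuous_on_compose2[OF _ vc]) auto
 qed
 have lc: "continuous_on UNIV l" unfolding l_def by (intro continuous_intros)
 have Fc: "continuous_on UNIV F" unfolding F_def using p by (intro continuous_intros lc cpow) auto
 have Hc: "continuous_on UNIV H" unfolding H_def using p by (intro continuous_intros lc cpow csgn Gc) auto
 have Kc: "continuous_on UNIV K" unfolding K_def using p by (intro continuous_intros cpow Gc) auto
 note mb[measurable] = borel_measurable_continuous_onI[OF Fc] borel_measurable_continuous_onI[OF Hc]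
  borel_measurable_continuous_onI[OF Kc] borel_measurable_continuous_onI[OF lc]
 have [measurable]: "W \<in> sets borel" using O by auto
 have F0: "0 \<le> F x" for x by (simp add: F_def)
 have R0: "0 \<le> p * R * (\<bar>v x\<bar> powr (p - 1) * norm (G x))" for x using p R(2) by simp
 have K0: "0 \<le> K x" for x using R0[of x] by (simp add: K_def)
 have dF: "((\<lambda>t. l (y - t *\<^sub>R e) * \<bar>v (y - t *\<^sub>R e)\<bar> powr p) has_real_derivative - H (y - t *\<^sub>R e)) (at t)" for y t
 proof -
  have a: "((\<lambda>t. y - t *\<^sub>R e) has_derivative (\<lambda>h. - (h *\<^sub>R e))) (at t)"
   by (auto intro!: derivative_eq_intros)
  have "(v has_derivative (\<lambda>h. G (y - t *\<^sub>R e) \<bullet> h)) (at (y - t *\<^sub>R e))" using C by (auto simp: C1_fun_def)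
  from has_derivative_compose[OF a this] have "((\<lambda>t. v (y - t *\<^sub>R e)) has_derivative (\<lambda>h. G (y - t *\<^sub>R e) \<bullet> (- (h *\<^sub>R e)))) (at t)" .
  from has_derivative_compose[OF this has_derivative_norm_powr[OF p]]
  have b: "((\<lambda>t. \<bar>v (y - t *\<^sub>R e)\<bar> powr p) has_derivative (\<lambda>h. p * \<bar>v (y - t *\<^sub>R e)\<bar> powr (p - 2) * (v (y - t *\<^sub>R e) * (G (y - t *\<^sub>R e) \<bullet> (- (h *\<^sub>R e)))))) (at t)"
   by simp
  have d: "((\<lambda>t. l y - t) has_derivative (\<lambda>h. - h)) (at t)" by (auto intro!: derivative_eq_intros)
  show ?thesis unfolding ls has_field_derivative_def
   by (rule has_derivative_eq_rhs[OF has_derivative_mult[OF d b]]) (auto simp: fun_eq_iff H_def ls algebra_simps)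
 qed
 have "bounded (closure W)" using O(2) by (rule bounded_closure)
 then obtain r where "\<And>x. x \<in> closure W \<Longrightarrow> norm x \<le> r" by (auto simp: bounded_iff)
 then have r: "closure W \<subseteq> cball 0 r" by auto
 have fin: "emeasure lborel W < \<infinity>" by (rule emeasure_bounded_finite[OF O(2)])
 define m where "m = enn2real (emeasure lborel W)"
 have m: "emeasure lborel W = ennreal m" "0 \<le> m" using fin by (auto simp: m_def less_top)
 let ?L = "\<lambda>s. edge_layer W e s"
 have main: "\<forall>\<^sub>F j in sequentially. (\<integral>\<^sup>+x. ennreal (1 / step j) * (ennreal (F x) * indicator (?L (step j)) x) \<partial>lborel)
   \<le> (\<integral>\<^sup>+x. ennreal (K x) * indicator W x \<partial>lborel) + ennreal (\<omega> * m)" if w: "0 < \<omega>" for \<omega>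
 proof -
  have "uniformly_continuous_on (cball 0 (r + 1)) H"
   by (intro compact_uniformly_continuous compact_cball continuous_on_subset[OF Hc]) auto
  from uniformly_continuous_onE[OF this w] obtain d where d: "0 < d"
   "\<And>x x'. x \<in> cball 0 (r + 1) \<Longrightarrow> x' \<in> cball 0 (r + 1) \<Longrightarrow> dist x' x < d \<Longrightarrow> dist (H x') (H x) < \<omega>"
   by metis
  have "\<forall>\<^sub>F j in sequentially. step j < min d 1" using d(1) by (intro eventually_step) simp
  then show ?thesis
  proof eventually_elim
   case (elim j)
   define s where "s = step j"
   have s: "0 < s" "s < d" "s < 1" using elim step(1)[of j] by (auto simp: s_def)
   have [measurable]: "?L s \<in> sets borel" by (rule edge_layer_borel[OF O(1)])
   \<comment> \<open>Points from which a backward step of length s does not reach the hyperplane l =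
     0. By T that step stays in W, and it ends off the layer because the forward step returns to
     W.\<close>
   define Z where "Z = {y \<in> W. s < l y}"
   have [measurable]: "Z \<in> sets borel" unfolding Z_def by measurable
   define X where "X = (\<integral>\<^sup>+y. ennreal (F (y - s *\<^sub>R e)) * indicator Z y \<partial>lborel)"
   have [measurable]: "(\<lambda>y. F (y - s *\<^sub>R e)) \<in> borel_measurable borel"
    by (intro borel_measurable_continuous_onI continuous_on_compose2[OF Fc] continuous_intros) auto
   have "X = (\<integral>\<^sup>+y. ennreal (F (y + s *\<^sub>R e - s *\<^sub>R e)) * indicator Z (y + s *\<^sub>R e) \<partial>lborel)"
    unfolding X_def by (rule nn_integral_lborel_translate[symmetric]) measurable
   also have "\<dots> \<le> (\<integral>\<^sup>+y. ennreal (F y) * indicator (W - ?L s) y \<partial>lborel)"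
   proof (rule nn_integral_mono)
    fix y
    show "ennreal (F (y + s *\<^sub>R e - s *\<^sub>R e)) * indicator Z (y + s *\<^sub>R e) \<le> ennreal (F y) * indicator (W - ?L s) y"
    proof (cases "y + s *\<^sub>R e \<in> Z")
     case True
     then have yz: "y + s *\<^sub>R e \<in> W" "s < l (y + s *\<^sub>R e)" by (auto simp: Z_def)
     have "0 < l (y + s *\<^sub>R e - s *\<^sub>R e)" using yz(2) unfolding ls by simp
     then have "y \<in> W" using T[OF yz(1) s(1)] by (simp add: l_def)
     then have "y \<in> W - ?L s" using yz(1) by (auto simp: edge_layer_def)
     then show ?thesis using True by simp
    qed simp
   qed
   finally have XL: "X \<le> (\<integral>\<^sup>+y. ennreal (F y) * indicator (W - ?L s) y \<partial>lborel)" .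
   have bF: "bounded (F ` cball 0 r)"
    by (intro compact_imp_bounded compact_continuous_image continuous_on_subset[OF Fc] compact_cball) auto
   then obtain B where "\<forall>y\<in>F ` cball 0 r. norm y \<le> B" unfolding bounded_iff by blast
   then have B: "\<bar>F x\<bar> \<le> B" if "x \<in> cball 0 r" for x using that by auto
   have "(\<integral>\<^sup>+y. ennreal (F y) * indicator (W - ?L s) y \<partial>lborel) \<le> (\<integral>\<^sup>+y. ennreal B * indicator W y \<partial>lborel)"
   proof (rule nn_integral_mono)
    fix y
    show "ennreal (F y) * indicator (W - ?L s) y \<le> ennreal B * indicator W y"
     using B[of y] r closure_subset[of W] by (auto split: split_indicator intro!: ennreal_leI)
   qed
   \<comment> \<open>Finiteness of X is what later permits cancelling it: the layer integral plus X
     is at most the integral over W, which is at most s times the volume bound plus X.\<close>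
   also have "\<dots> < \<infinity>" by (simp add: nn_integral_cmult_indicator m ennreal_mult_less_top)
   finally have Xfin: "X \<noteq> \<infinity>" using XL by (auto simp: top_unique)
   \<comment> \<open>On Z the mean value theorem compares F at y and at y - s e, and uniform
     continuity replaces the intermediate point by y up to \<omega>. Off Z, l is at most s and F is
     already of order s.\<close>
   have point: "F y \<le> s * (K y + \<omega>) + F (y - s *\<^sub>R e) * indicator Z y" if y: "y \<in> W" for y
   proof (cases "y \<in> Z")
    case False
    then have "l y \<le> s" using y by (auto simp: Z_def)
    then have "F y \<le> s * \<bar>v y\<bar> powr p" unfolding F_def using s(1) by (intro mult_right_mono) auto
    also have "\<dots> \<le> s * (K y + \<omega>)" using s(1) w R0[of y] by (intro mult_left_mono) (auto simp: K_def)
    finally show ?thesis using False by simp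
   next
    case True
    then have ly: "s < l y" by (simp add: Z_def)
    define f where "f t = l (y - t *\<^sub>R e) * \<bar>v (y - t *\<^sub>R e)\<bar> powr p" for t
    obtain z where z: "0 < z" "z < s" "f s - f 0 = (s - 0) * (- H (y - z *\<^sub>R e))"
     using MVT2[OF s(1), of f "\<lambda>t. - H (y - t *\<^sub>R e)"] dF unfolding f_def by blast
    have Fy: "F y = f 0" "F (y - s *\<^sub>R e) = f s" using ly s(1) by (auto simp: F_def f_def ls)
    have ny: "norm y \<le> r" using y r closure_subset[of W] by auto
    have "norm (y - z *\<^sub>R e) \<le> norm y + z" using norm_triangle_ineq4[of y "z *\<^sub>R e"] e z by simp
    then have nz: "norm (y - z *\<^sub>R e) \<le> r + 1" using ny z s by linarith
    have "y - z *\<^sub>R e \<in> cball 0 (r + 1)" using nz by (simp only: mem_cball_0)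
    moreover have "y \<in> cball 0 (r + 1)" using ny by simp
    moreover have "dist (y - z *\<^sub>R e) y < d" using z s e by (simp add: dist_norm)
    ultimately have "dist (H (y - z *\<^sub>R e)) (H y) < \<omega>" by (intro d(2))
    then have "H (y - z *\<^sub>R e) \<le> H y + \<omega>" by (simp add: dist_real_def)
    moreover have "H y \<le> K y"
    proof -
     have "\<bar>\<bar>v y\<bar> powr (p - 2) * v y * (G y \<bullet> e)\<bar> \<le> \<bar>v y\<bar> powr (p - 1) * norm (G y)"
     proof -
      have "\<bar>\<bar>v y\<bar> powr (p - 2) * v y\<bar> \<le> \<bar>v y\<bar> powr (p - 1)" using norm_powr_inner_le[of "v y" p "1::real"] by simp
      moreover have "\<bar>G y \<bullet> e\<bar> \<le> norm (G y)" using Cauchy_Schwarz_ineq2[of "G y" e] e by simp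
      ultimately show ?thesis unfolding abs_mult[of _ "G y \<bullet> e"] by (intro mult_mono) auto
     qed
     then have Q: "\<bar>v y\<bar> powr (p - 2) * v y * (G y \<bullet> e) \<le> \<bar>v y\<bar> powr (p - 1) * norm (G y)" by linarith
     have lp: "0 \<le> l y * p" "l y * p \<le> R * p"
      using R(1)[OF y] ly s(1) p by (auto simp: l_def)
     have "l y * p * (\<bar>v y\<bar> powr (p - 2) * v y * (G y \<bullet> e)) \<le> l y * p * (\<bar>v y\<bar> powr (p - 1) * norm (G y))"
      by (rule mult_left_mono[OF Q lp(1)])
     also have "\<dots> \<le> (R * p) * (\<bar>v y\<bar> powr (p - 1) * norm (G y))"
      by (rule mult_right_mono[OF lp(2)]) simp
     finally have "l y * p * (\<bar>v y\<bar> powr (p - 2) * v y * (G y \<bullet> e)) \<le> (R * p) * (\<bar>v y\<bar> powr (p - 1) * norm (G y))" .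
     moreover have "H y = \<bar>v y\<bar> powr p + l y * p * (\<bar>v y\<bar> powr (p - 2) * v y * (G y \<bullet> e))" by (simp add: H_def mult_ac)
     moreover have "K y = 2 * \<bar>v y\<bar> powr p + (R * p) * (\<bar>v y\<bar> powr (p - 1) * norm (G y))" by (simp add: K_def mult_ac)
     moreover have "0 \<le> \<bar>v y\<bar> powr p" by simp
     ultimately show ?thesis by linarith
    qed
    ultimately have "H (y - z *\<^sub>R e) \<le> K y + \<omega>" by simp
    then have "s * H (y - z *\<^sub>R e) \<le> s * (K y + \<omega>)" using s(1) by (intro mult_left_mono) auto
    then show ?thesis using z(3) True by (simp add: Fy)
   qed
   have "(\<integral>\<^sup>+y. ennreal (F y) * indicator (?L s) y \<partial>lborel) + X \<le> (\<integral>\<^sup>+y. ennreal (F y) * indicator (?L s) y \<partial>lborel) + (\<integral>\<^sup>+y. ennreal (F y) * indicator (W - ?L s) y \<partial>lborel)"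
    by (intro add_left_mono XL)
   also have "\<dots> = (\<integral>\<^sup>+y. ennreal (F y) * indicator W y \<partial>lborel)"
    by (subst nn_integral_add[symmetric]) (auto intro!: nn_integral_cong simp: edge_layer_def split: split_indicator)
   also have "\<dots> \<le> (\<integral>\<^sup>+y. ennreal s * (ennreal (K y) * indicator W y + ennreal \<omega> * indicator W y) + ennreal (F (y - s *\<^sub>R e)) * indicator Z y \<partial>lborel)"
   proof (rule nn_integral_mono)
    fix y
    show "ennreal (F y) * indicator W y \<le> ennreal s * (ennreal (K y) * indicator W y + ennreal \<omega> * indicator W y) + ennreal (F (y - s *\<^sub>R e)) * indicator Z y"
    proof (cases "y \<in> W")
     case True
     have "ennreal (F y) \<le> ennreal (s * (K y + \<omega>) + F (y - s *\<^sub>R e) * indicator Z y)"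
      by (rule ennreal_leI[OF point[OF True]])
     also have "\<dots> = ennreal (s * (K y + \<omega>)) + ennreal (F (y - s *\<^sub>R e) * indicator Z y)"
      using s w K0[of y] F0 by (intro ennreal_plus) auto
     also have "ennreal (s * (K y + \<omega>)) = ennreal s * (ennreal (K y) + ennreal \<omega>)"
      using s w K0[of y] by (simp add: ennreal_mult)
     also have "ennreal (F (y - s *\<^sub>R e) * indicator Z y) = ennreal (F (y - s *\<^sub>R e)) * indicator Z y"
      by (auto split: split_indicator)
     finally show ?thesis using True by simp
    qed simp
   qed
   also have "\<dots> = ennreal s * ((\<integral>\<^sup>+y. ennreal (K y) * indicator W y \<partial>lborel) + ennreal \<omega> * emeasure lborel W) + X"
    unfolding X_def by (simp add: nn_integral_add nn_integral_cmult nn_integral_cmult_indicator)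
   finally have "(\<integral>\<^sup>+y. ennreal (F y) * indicator (?L s) y \<partial>lborel) \<le> ennreal s * ((\<integral>\<^sup>+y. ennreal (K y) * indicator W y \<partial>lborel) + ennreal \<omega> * emeasure lborel W)"
    using Xfin by (simp add: ennreal_add_left_cancel_le add.commute[of _ X])
   then have "ennreal (1 / s) * (\<integral>\<^sup>+y. ennreal (F y) * indicator (?L s) y \<partial>lborel) \<le> ennreal (1 / s) * (ennreal s * ((\<integral>\<^sup>+y. ennreal (K y) * indicator W y \<partial>lborel) + ennreal \<omega> * emeasure lborel W))"
    by (rule mult_left_mono) simp
   also have "\<dots> = (ennreal (1 / s) * ennreal s) * ((\<integral>\<^sup>+y. ennreal (K y) * indicator W y \<partial>lborel) + ennreal \<omega> * emeasure lborel W)"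
    by (simp add: mult.assoc)
   also have "ennreal (1 / s) * ennreal s = 1" using s(1) by (simp add: ennreal_mult[symmetric])
   finally have "ennreal (1 / s) * (\<integral>\<^sup>+y. ennreal (F y) * indicator (?L s) y \<partial>lborel) \<le> (\<integral>\<^sup>+y. ennreal (K y) * indicator W y \<partial>lborel) + ennreal (\<omega> * m)"
    using w m by (simp add: ennreal_mult)
   then show ?case unfolding s_def[symmetric] by (simp add: nn_integral_cmult)
  qed
 qed
 have "liminf (\<lambda>j. \<integral>\<^sup>+x. ennreal (1 / step j) * (ennreal (F x) * indicator (?L (step j)) x) \<partial>lborel) \<le> (\<integral>\<^sup>+x. ennreal (K x) * indicator W x \<partial>lborel)"
 proof (rule ennreal_le_epsilon)
  fix E :: real assume e0: "0 < E"
  define \<omega> where "\<omega> = E / (m + 1)"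
  have w: "0 < \<omega>" using e0 m(2) by (simp add: \<omega>_def)
  have "\<omega> * m \<le> \<omega> * (m + 1)" using w by simp
  also have "\<dots> = E" using m(2) by (simp add: \<omega>_def)
  finally have wm: "\<omega> * m \<le> E" .
  have "liminf (\<lambda>j. \<integral>\<^sup>+x. ennreal (1 / step j) * (ennreal (F x) * indicator (?L (step j)) x) \<partial>lborel)
   \<le> (\<integral>\<^sup>+x. ennreal (K x) * indicator W x \<partial>lborel) + ennreal (\<omega> * m)"
   by (rule Liminf_le[OF _ main[OF w]]) simp
  also have "\<dots> \<le> (\<integral>\<^sup>+x. ennreal (K x) * indicator W x \<partial>lborel) + ennreal E"
   by (intro add_left_mono ennreal_leI wm)
  finally show "liminf (\<lambda>j. \<integral>\<^sup>+x. ennreal (1 / step j) * (ennreal (F x) * indicator (?L (step j)) x) \<partial>lborel)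
   \<le> (\<integral>\<^sup>+x. ennreal (K x) * indicator W x \<partial>lborel) + ennreal E" .
 qed
 then show ?thesis unfolding F_def K_def l_def .
qed

section \<open>Geometry of the cusp\<close>

definition xprime :: "'n::finite \<Rightarrow> real^'n \<Rightarrow> real^'n" where
 "xprime k x = (\<chi> i. if i = k then 0 else x $ i)"

lemma xprime_nth: "xprime k x $ i = (if i = k then 0 else x $ i)"
 by (simp add: xprime_def)

lemma xprime_add: "xprime k (x + z) = xprime k x + xprime k z"
 and xprime_scaleR: "xprime k (r *\<^sub>R x) = r *\<^sub>R xprime k x"
 by (auto simp: vec_eq_iff xprime_nth)

lemma norm_square_cart: "(norm x)\<^sup>2 = (\<Sum>i\<in>UNIV. (x $ i)\<^sup>2)" for x :: "real^'n::finite"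
 by (simp add: norm_vec_def L2_set_def sum_nonneg)

lemma xprime_norm_eq: "xprime_norm k x = norm (xprime k x)"
proof -
 have "(norm (xprime k x))\<^sup>2 = (\<Sum>i\<in>UNIV - {k}. (x $ i)\<^sup>2)"
  unfolding norm_square_cart by (rule sum.mono_neutral_cong_right) (auto simp: xprime_nth)
 then show ?thesis unfolding xprime_norm_def by (metis norm_ge_zero real_sqrt_unique)
qed

lemma norm_square_xprime: "(norm x)\<^sup>2 = (norm (xprime k x))\<^sup>2 + (x $ k)\<^sup>2"
proof -
 have "(norm (xprime k x))\<^sup>2 = (\<Sum>i\<in>UNIV - {k}. (x $ i)\<^sup>2)"
  unfolding norm_square_cart by (rule sum.mono_neutral_cong_right) (auto simp: xprime_nth)
 then show ?thesis unfolding norm_square_cart[of x] by (simp add: sum.remove[of UNIV k])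
qed

lemma cusp_center_nth: "cusp_center k $ i = (if i = k then 2 else 0)"
 by (simp add: cusp_center_def)

lemma xprime_cusp_center: "xprime k (x - cusp_center k) = xprime k x"
 by (auto simp: vec_eq_iff xprime_nth cusp_center_nth)

lemma norm_square_center: "(norm (x - cusp_center k))\<^sup>2 = (norm (xprime k x))\<^sup>2 + (x $ k - 2)\<^sup>2"
 unfolding norm_square_xprime[of "x - cusp_center k" k] xprime_cusp_center by (simp add: cusp_center_nth)

lemma norm_less_sqrt2_iff: "norm x < sqrt 2 \<longleftrightarrow> (norm x)\<^sup>2 < 2" "norm x \<le> sqrt 2 \<longleftrightarrow> (norm x)\<^sup>2 \<le> 2" "norm x = sqrt 2 \<longleftrightarrow> (norm x)\<^sup>2 = 2"
proof -
 have *: "(sqrt 2)\<^sup>2 = (2::real)" by simp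
 show "norm x < sqrt 2 \<longleftrightarrow> (norm x)\<^sup>2 < 2" using abs_le_square_iff[of "sqrt 2" "norm x"] by (simp add: * flip: not_le)
 show "norm x \<le> sqrt 2 \<longleftrightarrow> (norm x)\<^sup>2 \<le> 2" using abs_le_square_iff[of "norm x" "sqrt 2"] by (simp add: *)
 show "norm x = sqrt 2 \<longleftrightarrow> (norm x)\<^sup>2 = 2" using power2_eq_iff_nonneg[of "norm x" "sqrt 2"] by (simp add: *)
qed

lemma ball_center_iff: "x \<in> ball (cusp_center k) (sqrt 2) \<longleftrightarrow> (norm (xprime k x))\<^sup>2 + (x $ k - 2)\<^sup>2 < 2"
 unfolding norm_square_center[symmetric] norm_less_sqrt2_iff(1)[symmetric]
 by (simp add: dist_norm norm_minus_commute)

lemma continuous_on_xprime [continuous_intros]: "continuous_on S (xprime k)"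
proof -
 have "linear (xprime k)" by (rule linearI) (simp_all add: xprime_add xprime_scaleR)
 then show ?thesis by (simp add: linear_continuous_on linear_conv_bounded_linear)
qed

definition cusp_part :: "'n::finite \<Rightarrow> (real \<Rightarrow> real) \<Rightarrow> (real^'n) set" where
 "cusp_part k \<gamma> = {x. norm (xprime k x) < \<gamma> (x $ k) \<and> 0 < x $ k \<and> x $ k \<le> 1}"

lemma cusp_domain_eq: "cusp_domain k \<gamma> = cusp_part k \<gamma> \<union> ball (cusp_center k) (sqrt 2)"
 by (simp add: cusp_domain_def cusp_part_def xprime_norm_eq)

locale cusp =
 fixes k :: "'n::finite" and \<gamma> :: "real \<Rightarrow> real"
 assumes g_cont: "continuous_on {0..1} \<gamma>"
  and g_nonneg: "\<And>t. t \<in> {0..1} \<Longrightarrow> \<gamma> t \<ge> 0"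
  and g_mono: "mono_on {0..1} \<gamma>"
  and g_diff: "\<And>t. t \<in> {0<..<1} \<Longrightarrow> \<gamma> differentiable (at t)"
  and g0: "\<gamma> 0 = 0" and g1: "\<gamma> 1 = 1"
  and g_deriv_mono: "mono_on {0<..<1} (deriv \<gamma>)"
  and g_deriv_lim: "(deriv \<gamma> \<longlongrightarrow> 0) (at_right 0)"
begin

abbreviation "W \<equiv> cusp_domain k \<gamma>"
abbreviation "cc \<equiv> cusp_center k"

lemma g_le: "0 \<le> a \<Longrightarrow> a \<le> b \<Longrightarrow> b \<le> 1 \<Longrightarrow> \<gamma> a \<le> \<gamma> b"
 using g_mono by (auto simp: mono_on_def)

lemma g_le1: "0 \<le> a \<Longrightarrow> a \<le> 1 \<Longrightarrow> \<gamma> a \<le> 1"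
 using g_le[of a 1] g1 by simp

lemma g_MVT:
 assumes "0 \<le> a" "a < b" "b \<le> 1"
 obtains z where "a < z" "z < b" "\<gamma> b - \<gamma> a = (b - a) * deriv \<gamma> z"
proof -
 have "\<exists>l z. a < z \<and> z < b \<and> (\<gamma> has_real_derivative l) (at z) \<and> \<gamma> b - \<gamma> a = (b - a) * l"
  by (rule MVT[OF assms(2)]) (use assms g_diff in \<open>auto intro: continuous_on_subset[OF g_cont]\<close>)
 then show ?thesis using that DERIV_imp_deriv by metis
qed

text \<open>As \<gamma>' tends to 0 at 0, the graph lies below the diagonal at some x, so its mean
  slope on [x,1] exceeds 1; monotonicity of \<gamma>' keeps a slope m > 1 from the intermediate
  point on.\<close>

lemma g_below_chord:
 obtains t0 m where "0 < t0" "t0 < 1" "1 < m" "\<And>t. t0 \<le> t \<Longrightarrow> t \<le> 1 \<Longrightarrow> \<gamma> t \<le> 1 - m * (1 - t)"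
proof -
 have "\<forall>\<^sub>F t in at_right 0. deriv \<gamma> t < 1/2" by (rule order_tendstoD(2)[OF g_deriv_lim]) simp
 then obtain b where b: "0 < b" "\<And>y. 0 < y \<Longrightarrow> y < b \<Longrightarrow> deriv \<gamma> y < 1/2" by (auto simp: eventually_at_right_field)
 define x where "x = min b (1/2)"
 have x: "0 < x" "x < 1" "x \<le> b" using b by (auto simp: x_def)
 obtain y where y: "0 < y" "y < x" "\<gamma> x - \<gamma> 0 = (x - 0) * deriv \<gamma> y" using g_MVT[of 0 x] x by auto
 have "x * deriv \<gamma> y \<le> x * (1/2)" using b(2)[of y] y x by (intro mult_left_mono) auto
 then have gx: "\<gamma> x \<le> x / 2" using y(3) g0 by simp
 obtain t0 where t0: "x < t0" "t0 < 1" "\<gamma> 1 - \<gamma> x = (1 - x) * deriv \<gamma> t0" using g_MVT[of x 1] x by auto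
 have "(1 - x) * 1 < (1 - x) * deriv \<gamma> t0"
 proof -
  have "\<gamma> x < x" using gx x(1) by simp
  then show ?thesis unfolding t0(3)[symmetric] g1 by simp
 qed
 then have m: "1 < deriv \<gamma> t0" using x by simp
 show ?thesis
 proof (rule that[of t0 "deriv \<gamma> t0"])
  fix t assume t: "t0 \<le> t" "t \<le> 1"
  show "\<gamma> t \<le> 1 - deriv \<gamma> t0 * (1 - t)"
  proof (cases "t = 1")
   case False
   then obtain z where z: "t < z" "z < 1" "\<gamma> 1 - \<gamma> t = (1 - t) * deriv \<gamma> z" using g_MVT[of t 1] t t0 x by auto
   have "deriv \<gamma> t0 \<le> deriv \<gamma> z" using g_deriv_mono t0 x z t by (auto simp: mono_on_def)
   then have "(1 - t) * deriv \<gamma> t0 \<le> (1 - t) * deriv \<gamma> z" using t by (intro mult_left_mono) auto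
   then show ?thesis using z(3) g1 by (simp add: mult.commute)
  qed (simp add: g1)
 qed (use t0 x m in auto)
qed

text \<open>At height 1 the sphere meets the graph and has slope 1 there, while \<gamma> rises with
  slope above 1. Just below height 1 the graph is therefore inside the ball and contributes no
  boundary.\<close>

lemma ex_corner:
 obtains t1 where "0 < t1" "t1 < 1" "\<And>x. x $ k < 1 \<Longrightarrow> t1 < x $ k \<Longrightarrow> norm (xprime k x) = \<gamma> (x $ k) \<Longrightarrow> x \<in> W"
proof -
 obtain t0 m where t0: "0 < t0" "t0 < 1" and m: "1 < m" and le: "\<And>t. t0 \<le> t \<Longrightarrow> t \<le> 1 \<Longrightarrow> \<gamma> t \<le> 1 - m * (1 - t)"
  by (rule g_below_chord) (rule that)
 \<comment> \<open>With e = 1 - x_k the sum (1 - m e)^2 + (1 + e)^2 is below 2 exactly for 0 < e < 2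
   (m - 1) / (m^2 + 1).\<close>
 define t1 where "t1 = max t0 (1 - 2 * (m - 1) / (m\<^sup>2 + 1))"
 have mp: "0 < m\<^sup>2 + 1" using m by (simp add: add_nonneg_pos)
 show ?thesis
 proof (rule that[of t1])
  show "0 < t1" "t1 < 1" using t0 m mp by (auto simp: t1_def)
  fix x :: "real^'n" assume x: "x $ k < 1" "t1 < x $ k" "norm (xprime k x) = \<gamma> (x $ k)"
  define e where "e = 1 - x $ k"
  have e: "0 < e" "e < 2 * (m - 1) / (m\<^sup>2 + 1)" using x by (auto simp: e_def t1_def)
  have t: "t0 \<le> x $ k" "x $ k \<le> 1" using x by (auto simp: t1_def)
  have g: "0 \<le> \<gamma> (x $ k)" "\<gamma> (x $ k) \<le> 1 - m * e" using g_nonneg[of "x $ k"] le[OF t] t t0 by (auto simp: e_def)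
  have "(\<gamma> (x $ k))\<^sup>2 \<le> (1 - m * e)\<^sup>2" using g by (intro power_mono) auto
  moreover have "(x $ k - 2)\<^sup>2 = (1 + e)\<^sup>2" by (simp add: e_def power2_eq_square algebra_simps)
  moreover have "(1 - m * e)\<^sup>2 + (1 + e)\<^sup>2 = 2 - e * (2 * (m - 1) - (m\<^sup>2 + 1) * e)"
   by (simp add: power2_eq_square algebra_simps)
  moreover have "(m\<^sup>2 + 1) * e < 2 * (m - 1)" using e(2) mp by (simp add: pos_less_divide_eq mult.commute)
  then have "0 < e * (2 * (m - 1) - (m\<^sup>2 + 1) * e)" using e(1) by simp
  ultimately have "(norm (xprime k x))\<^sup>2 + (x $ k - 2)\<^sup>2 < 2" unfolding x(3) by linarith
  then show "x \<in> W" unfolding cusp_domain_eq ball_center_iff[symmetric] by simp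
 qed
qed

text \<open>The hypotheses allow \<gamma>' to be unbounded near 1, so the bound is taken up to t1 <
  1, from the value of the monotone \<gamma>' at a point between t1 and 1.\<close>

lemma ex_Lipschitz:
 assumes "0 < t1" "t1 < 1"
 obtains L where "1 \<le> L" "\<And>a b. 0 \<le> a \<Longrightarrow> a \<le> b \<Longrightarrow> b \<le> t1 \<Longrightarrow> \<gamma> b - \<gamma> a \<le> L * (b - a)"
proof -
 define t2 where "t2 = (t1 + 1) / 2"
 have t2: "t1 < t2" "t2 < 1" using assms by (auto simp: t2_def)
 show ?thesis
 proof (rule that[of "\<bar>deriv \<gamma> t2\<bar> + 1"])
  fix a b assume ab: "0 \<le> a" "a \<le> b" "b \<le> t1"
  show "\<gamma> b - \<gamma> a \<le> (\<bar>deriv \<gamma> t2\<bar> + 1) * (b - a)"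
  proof (cases "a = b")
   case False
   then obtain z where z: "a < z" "z < b" "\<gamma> b - \<gamma> a = (b - a) * deriv \<gamma> z" using g_MVT[of a b] ab assms by auto
   have "deriv \<gamma> z \<le> deriv \<gamma> t2" using g_deriv_mono z t2 ab assms by (auto simp: mono_on_def)
   then have "(b - a) * deriv \<gamma> z \<le> (b - a) * (\<bar>deriv \<gamma> t2\<bar> + 1)" using ab by (intro mult_left_mono) auto
   then show ?thesis using z(3) by (simp add: mult.commute)
  qed simp
 qed simp
qed

lemma cusp_closed: "closed {x. x $ k \<in> {0..1} \<and> norm (xprime k x) \<le> \<gamma> (x $ k)}"
proof -
 let ?A = "{x::real^'n. x $ k \<in> {0..1}}"
 have A: "closed ?A" unfolding atLeastAtMost_iff by (intro closed_Collect_conj closed_Collect_le continuous_intros)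
 have "continuous_on ?A (\<lambda>x. \<gamma> (x $ k) - norm (xprime k x))"
  by (intro continuous_intros continuous_on_compose2[OF g_cont]) auto
 from continuous_closed_preimage[OF this A, of "{0..}"]
 have "closed (?A \<inter> (\<lambda>x. \<gamma> (x $ k) - norm (xprime k x)) -` {0..})" by simp
 moreover have "?A \<inter> (\<lambda>x. \<gamma> (x $ k) - norm (xprime k x)) -` {0..} = {x. x $ k \<in> {0..1} \<and> norm (xprime k x) \<le> \<gamma> (x $ k)}"
  by auto
 ultimately show ?thesis by simp
qed

text \<open>The last clause is for points on the axis: \<gamma> may vanish on an initial interval,
  yet above the height of a closure point it is positive.\<close>

lemma closure_cusp_part:
 assumes "x \<in> closure (cusp_part k \<gamma>)"
 shows "0 \<le> x $ k" "x $ k \<le> 1" "norm (xprime k x) \<le> \<gamma> (x $ k)" "\<And>t. x $ k < t \<Longrightarrow> t \<le> 1 \<Longrightarrow> 0 < \<gamma> t"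
proof -
 have "closure (cusp_part k \<gamma>) \<subseteq> {x. x $ k \<in> {0..1} \<and> norm (xprime k x) \<le> \<gamma> (x $ k)}"
  by (rule closure_minimal[OF _ cusp_closed]) (auto simp: cusp_part_def)
 from subsetD[OF this assms] show x: "0 \<le> x $ k" "x $ k \<le> 1" "norm (xprime k x) \<le> \<gamma> (x $ k)" by auto
 fix t assume t: "x $ k < t" "t \<le> 1"
 then have "0 < t - x $ k" by simp
 then obtain y where y: "y \<in> cusp_part k \<gamma>" "dist y x < t - x $ k"
  using assms unfolding closure_approachable by blast
 have "y $ k - x $ k \<le> norm (y - x)" using component_le_norm_cart[of "y - x" k] by simp
 then have "y $ k < t" using y(2) by (simp add: dist_norm)
 moreover have "0 < \<gamma> (y $ k)" "0 < y $ k" using y(1) le_less_trans[OF norm_ge_zero] by (auto simp: cusp_part_def)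
 ultimately show "0 < \<gamma> t" using g_le[of "y $ k" t] t(2) by linarith
qed

text \<open>The cusp part contains its top slice at height 1, but that slice lies in the ball, so
  the height may be taken strictly below 1.\<close>

lemma dom_open: "open W"
proof -
 let ?A = "{x::real^'n. 0 < x $ k \<and> x $ k < 1}"
 have A: "open ?A" by (intro open_Collect_conj open_Collect_less continuous_intros)
 have "continuous_on ?A (\<lambda>x. \<gamma> (x $ k) - norm (xprime k x))"
  by (intro continuous_intros continuous_on_compose2[OF g_cont]) auto
 from continuous_open_preimage[OF this A, of "{0<..}"]
 have o: "open (?A \<inter> (\<lambda>x. \<gamma> (x $ k) - norm (xprime k x)) -` {0<..})" by simp
 have "W = (?A \<inter> (\<lambda>x. \<gamma> (x $ k) - norm (xprime k x)) -` {0<..}) \<union> ball cc (sqrt 2)"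
 proof -
  have "x \<in> ball cc (sqrt 2)" if "x \<in> cusp_part k \<gamma>" "x $ k = 1" for x
  proof -
   have "norm (xprime k x) < 1" using that g1 by (simp add: cusp_part_def)
   then have "(norm (xprime k x))\<^sup>2 < 1" by (simp add: power_less_one_iff abs_square_less_1)
   then show ?thesis unfolding ball_center_iff that(2) by simp
  qed
  then show ?thesis unfolding cusp_domain_eq by (fastforce simp: cusp_part_def)
 qed
 then show ?thesis using o by auto
qed

lemma cusp_domain_bound:
 assumes "x \<in> W"
 shows "norm (x - cc) \<le> 3"
proof (cases "x \<in> ball cc (sqrt 2)")
 case True
 then have "norm (x - cc) < sqrt 2" by (simp add: dist_norm norm_minus_commute)
 also have "sqrt 2 \<le> 3" by (rule real_le_lsqrt) auto
 finally show ?thesis by simp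
next
 case False
 then have x: "norm (xprime k x) < \<gamma> (x $ k)" "0 < x $ k" "x $ k \<le> 1" using assms by (auto simp: cusp_domain_eq cusp_part_def)
 then have "norm (xprime k x) \<le> 1" using g_le1[of "x $ k"] by simp
 then have "(norm (xprime k x))\<^sup>2 \<le> 1" by (simp add: power_le_one)
 moreover have "(x $ k - 2)\<^sup>2 \<le> 2\<^sup>2" using x by (intro power2_le_iff_abs_le[THEN iffD2]) auto
 ultimately have "(norm (x - cc))\<^sup>2 \<le> 3\<^sup>2" unfolding norm_square_center by simp
 then show ?thesis by (rule power2_le_imp_le) simp
qed

lemma dom_bounded: "bounded W"
proof -
 have "W \<subseteq> cball cc 3" using cusp_domain_bound by (auto simp: dist_norm norm_minus_commute)
 then show ?thesis using bounded_cball bounded_subset by blast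
qed

lemma closure_dom: "x \<in> closure W \<Longrightarrow> x \<in> closure (cusp_part k \<gamma>) \<or> x \<in> cball cc (sqrt 2)"
 unfolding cusp_domain_eq closure_Un using closure_ball[of "sqrt 2" cc] by auto

text \<open>Moving towards the centre raises the height and shrinks |x'|, so the point stays below
  the graph up to height 1. Above that, |y'| is at most 2 - y_k < 1, which puts it in the
  ball.\<close>

lemma dom_star:
 assumes x: "x \<in> closure W" and s: "0 < s" "s \<le> 1"
 shows "cc + (1 - s) *\<^sub>R (x - cc) \<in> W"
proof -
 let ?y = "cc + (1 - s) *\<^sub>R (x - cc)"
 have yp: "xprime k ?y = (1 - s) *\<^sub>R xprime k x" and yk: "?y $ k = 2 - (1 - s) * (2 - x $ k)"
  by (auto simp: vec_eq_iff xprime_nth cusp_center_nth algebra_simps)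
 have s1: "0 \<le> 1 - s" "1 - s < 1" using s by auto
 from closure_dom[OF x] show ?thesis
 proof
  assume "x \<in> cball cc (sqrt 2)"
  then have "norm (x - cc) \<le> sqrt 2" by (simp add: dist_norm norm_minus_commute)
  then have "(1 - s) * norm (x - cc) \<le> (1 - s) * sqrt 2" using s1 by (intro mult_left_mono) auto
  also have "\<dots> < 1 * sqrt 2" using s1 by (intro mult_strict_right_mono) auto
  finally have "norm (?y - cc) < sqrt 2" using s1 by simp
  then show ?thesis by (simp add: cusp_domain_eq dist_norm norm_minus_commute)
 next
  assume "x \<in> closure (cusp_part k \<gamma>)"
  note cl = closure_cusp_part[OF this]
  have up: "x $ k < ?y $ k"
  proof -
   have "(1 - s) * (2 - x $ k) < 1 * (2 - x $ k)" using s1 cl(2) by (intro mult_strict_right_mono) auto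
   then show ?thesis unfolding yk by simp
  qed
  show ?thesis
  proof (cases "?y $ k \<le> 1")
   case True
   have "norm (xprime k ?y) < \<gamma> (?y $ k)"
   proof (cases "norm (xprime k x) = 0")
    case True': True
    then show ?thesis unfolding yp using cl(4)[OF up True] by simp
   next
    case False
    then have "norm (xprime k ?y) < norm (xprime k x)" unfolding yp using s1 by simp
    also have "\<dots> \<le> \<gamma> (?y $ k)" using cl(3) g_le[OF cl(1) less_imp_le[OF up] True] by simp
    finally show ?thesis .
   qed
   then have "?y \<in> cusp_part k \<gamma>" using True up cl(1) by (simp add: cusp_part_def)
   then show ?thesis by (simp add: cusp_domain_eq)
  next
   case False
   define a where "a = (1 - s) * (2 - x $ k)"
   have a: "0 \<le> a" "a < 1" using False s1 cl(2) unfolding yk a_def by auto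
   have "norm (xprime k x) \<le> 2 - x $ k" using cl(1-3) g_le1[of "x $ k"] by simp
   then have "norm (xprime k ?y) \<le> a" unfolding yp a_def using s1 by (simp add: mult_left_mono)
   then have "(norm (xprime k ?y))\<^sup>2 \<le> a\<^sup>2" by (intro power_mono) auto
   moreover have "(?y $ k - 2)\<^sup>2 = a\<^sup>2" unfolding yk a_def by (simp add: power2_commute)
   moreover have "a\<^sup>2 < 1" using a by (simp add: power_less_one_iff)
   ultimately have "(norm (xprime k ?y))\<^sup>2 + (?y $ k - 2)\<^sup>2 < 2" by linarith
   then show ?thesis unfolding cusp_domain_eq ball_center_iff[symmetric] by blast
  qed
 qed
qed

sublocale star_domain W cc
 by unfold_locales (use dom_open dom_bounded dom_star in auto)

text \<open>Provides the condition on lines in the layer estimate: moving along an axis towards the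
  hyperplane through the centre, without reaching it, does not leave the domain.\<close>

lemma dom_retract:
 assumes S: "S = 1 \<or> S = -1" and y: "y \<in> W" and s: "0 < s"
  and pos: "0 < (y - s *\<^sub>R (S *\<^sub>R axis i 1) - cc) \<bullet> (S *\<^sub>R axis i 1)"
 shows "y - s *\<^sub>R (S *\<^sub>R axis i 1) \<in> W"
proof -
 define z where "z = y - s *\<^sub>R (S *\<^sub>R axis i 1)"
 have zn: "z $ j = (if j = i then y $ i - s * S else y $ j)" for j by (simp add: axis_def z_def)
 have pos': "0 < S * (y $ i - s * S - cc $ i)" using pos unfolding z_def[symmetric] inner_scaleR_right inner_axis vector_minus_component zn by (simp add: axis_def)
 have S2: "S * S = 1" using S by auto
 have shorter: "\<bar>z $ i - cc $ i\<bar> \<le> \<bar>y $ i - cc $ i\<bar>" using S pos' s by (auto simp: zn)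
 have "z \<in> W"
 proof (cases "i = k")
  case False
  have "norm (xprime k z) \<le> norm (xprime k y)"
  proof (rule norm_le_componentwise_cart)
   fix j show "norm (xprime k z $ j) \<le> norm (xprime k y $ j)"
    using shorter False by (auto simp: xprime_nth zn cusp_center_nth)
  qed
  moreover have "z $ k = y $ k" using False by (simp add: zn)
  moreover from calculation have "(norm (xprime k z))\<^sup>2 \<le> (norm (xprime k y))\<^sup>2" by (intro power_mono) auto
  ultimately have z: "norm (xprime k z) \<le> norm (xprime k y)" "z $ k = y $ k" "(norm (xprime k z))\<^sup>2 \<le> (norm (xprime k y))\<^sup>2" by auto
  show ?thesis
  proof (cases "y \<in> ball cc (sqrt 2)")
   case True
   then have "z \<in> ball cc (sqrt 2)" unfolding ball_center_iff z(2) using z(3) by linarith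
   then show ?thesis by (simp add: cusp_domain_eq)
  next
   case False
   then have "y \<in> cusp_part k \<gamma>" using y by (simp add: cusp_domain_eq)
   then have "z \<in> cusp_part k \<gamma>" unfolding cusp_part_def mem_Collect_eq z(2) using z(1) by linarith
   then show ?thesis by (simp add: cusp_domain_eq)
  qed
 next
  case True
  have xp: "xprime k z = xprime k y" using True by (auto simp: vec_eq_iff xprime_nth zn)
  have zk: "z $ k = y $ k - s * S" using True by (simp add: zn)
  have sq: "(z $ k - 2)\<^sup>2 \<le> (y $ k - 2)\<^sup>2" using shorter True by (simp add: cusp_center_nth abs_le_square_iff)
  show ?thesis
  proof (cases "y \<in> ball cc (sqrt 2)")
   case True': True
   then show ?thesis using sq unfolding cusp_domain_eq Un_iff ball_center_iff xp by auto
  next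
   case False
   then have yc: "norm (xprime k y) < \<gamma> (y $ k)" "0 < y $ k" "y $ k \<le> 1" using y by (auto simp: cusp_domain_eq cusp_part_def)
   \<comment> \<open>A point outside the ball lies in the cusp part, at height at most 1 < 2, so
     approaching the centre along the last axis means moving upwards.\<close>
   have "S = -1"
   proof (rule ccontr)
    assume "S \<noteq> -1"
    then show False using S pos' True yc s by (simp add: cusp_center_nth)
   qed
   then have zk': "z $ k = y $ k + s" "z $ k < 2" using zk pos' True by (auto simp: cusp_center_nth)
   show ?thesis
   proof (cases "z $ k \<le> 1")
    case True'': True
    have "norm (xprime k z) < \<gamma> (z $ k)" unfolding xp using yc g_le[of "y $ k" "z $ k"] True'' zk' s by simp
    then have "z \<in> cusp_part k \<gamma>" using True'' zk' yc s by (simp add: cusp_part_def)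
    then show ?thesis by (simp add: cusp_domain_eq)
   next
    case False': False
    have "norm (xprime k y) < 1" using yc g_le1[of "y $ k"] by simp
    then have "(norm (xprime k z))\<^sup>2 < 1" unfolding xp by (simp add: abs_square_less_1)
    moreover have "(z $ k - 2)\<^sup>2 < 1" using False' zk'(2) by (simp add: abs_square_less_1)
    ultimately have "(norm (xprime k z))\<^sup>2 + (z $ k - 2)\<^sup>2 < 2" by linarith
    then show ?thesis unfolding cusp_domain_eq ball_center_iff[symmetric] by blast
   qed
  qed
 qed
 then show ?thesis unfolding z_def .
qed

end

section \<open>Boxes across the boundary of the cusp domain\<close>

text \<open>The box has length r in direction i and is thin otherwise. Steps shorter than r/8 across
  its faces end within the ranges of \<open>inside\<close> and \<open>outside\<close>. Separate
  bounds \<open>lo\<close> and \<open>hi\<close> allow boxes lying on one side of x only.\<close>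

lemma edge_boxI:
 fixes x :: "real^'n::finite"
 assumes S: "S = 1 \<or> S = -1" and r: "0 < r" and w: "real CARD('n) * w \<le> r / 4"
  and lh: "\<And>j. j \<noteq> i \<Longrightarrow> - w \<le> lo j \<and> hi j \<le> w \<and> lo j + \<kappa> * r \<le> hi j"
  and inside: "\<And>z. (\<And>j. j \<noteq> i \<Longrightarrow> lo j < z $ j \<and> z $ j < hi j) \<Longrightarrow> - r / 2 < S * z $ i \<Longrightarrow> S * z $ i < - r / 4 \<Longrightarrow> x + z \<in> W"
  and outside: "\<And>z. (\<And>j. j \<noteq> i \<Longrightarrow> lo j < z $ j \<and> z $ j < hi j) \<Longrightarrow> r / 2 \<le> S * z $ i \<Longrightarrow> S * z $ i < r \<Longrightarrow> x + z \<notin> W"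
 shows "edge_box W i S \<kappa> r x"
proof -
 define a :: "real^'n" where "a = (\<chi> j. if j = i then x $ i - r / 2 else x $ j + lo j)"
 define b :: "real^'n" where "b = (\<chi> j. if j = i then x $ i + r / 2 else x $ j + hi j)"
 have mem: "y \<in> box a b \<longleftrightarrow> x $ i - r / 2 < y $ i \<and> y $ i < x $ i + r / 2 \<and> (\<forall>j. j \<noteq> i \<longrightarrow> x $ j + lo j < y $ j \<and> y $ j < x $ j + hi j)" for y
  unfolding mem_box_cart a_def b_def by auto
 have "box a b \<subseteq> ball x r"
 proof
  fix y assume y: "y \<in> box a b"
  have "\<bar>(y - x) $ j\<bar> \<le> (if j = i then r / 2 else 0) + \<bar>w\<bar>" for j
   using y lh[of j] unfolding mem by (cases "j = i") (force simp: abs_le_iff)+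
  then have "(\<Sum>j\<in>UNIV. \<bar>(y - x) $ j\<bar>) \<le> (\<Sum>j\<in>UNIV. (if j = i then r / 2 else 0) + \<bar>w\<bar>)" by (rule sum_mono)
  also have "\<dots> = r / 2 + real CARD('n) * \<bar>w\<bar>" by (simp add: sum.distrib)
  finally have *: "norm (y - x) \<le> r / 2 + real CARD('n) * \<bar>w\<bar>" using norm_le_l1_cart[of "y - x"] by linarith
  have "norm (y - x) < r"
  proof (cases "0 \<le> w")
   case True then show ?thesis using * w r by simp
  next
   case False
   have "j = i" for j using y lh[of j] False unfolding mem by force
   then have "(\<Sum>j\<in>UNIV. \<bar>(y - x) $ j\<bar>) = (\<Sum>j\<in>{i}. \<bar>(y - x) $ j\<bar>)" by (intro sum.cong) auto
   then show ?thesis using norm_le_l1_cart[of "y - x"] y r unfolding mem by auto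
  qed
  then show "y \<in> ball x r" by (simp add: dist_norm norm_minus_commute)
 qed
 moreover have "\<kappa> * r \<le> b $ j - a $ j" if "j \<noteq> i" for j using lh[OF that] that by (simp add: a_def b_def)
 moreover have "r / 8 < b $ i - a $ i" using r by (simp add: a_def b_def)
 moreover have "y \<in> W" if s: "0 < s" "s < r / 8" and y: "y \<in> box a b" "y - s *\<^sub>R (S *\<^sub>R axis i 1) \<notin> box a b" for s y
 proof -
  have yi: "\<not> (x $ i - r / 2 < y $ i - s * S \<and> y $ i - s * S < x $ i + r / 2)"
   using y unfolding mem by (auto simp: axis_def)
  have yb: "x $ i - r / 2 < y $ i" "y $ i < x $ i + r / 2" using y(1) unfolding mem by auto
  have "- r / 2 < S * (y - x) $ i" "S * (y - x) $ i < - r / 4" using S yi yb s by auto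
  then have "x + (y - x) \<in> W" by (intro inside) (use y(1) in \<open>auto simp: mem\<close>)
  then show ?thesis by simp
 qed
 moreover have "y + s *\<^sub>R (S *\<^sub>R axis i 1) \<notin> W" if s: "0 < s" "s < r / 8" and y: "y \<in> box a b" "y + s *\<^sub>R (S *\<^sub>R axis i 1) \<notin> box a b" for s y
 proof -
  define y' where "y' = y + s *\<^sub>R (S *\<^sub>R axis i 1)"
  have y'i: "y' $ i = y $ i + s * S" and y'j: "j \<noteq> i \<Longrightarrow> y' $ j = y $ j" for j by (auto simp: y'_def axis_def)
  have yi: "\<not> (x $ i - r / 2 < y $ i + s * S \<and> y $ i + s * S < x $ i + r / 2)"
   using y unfolding mem y'_def[symmetric] y'i by (auto simp: y'j)
  have yb: "x $ i - r / 2 < y $ i" "y $ i < x $ i + r / 2" using y(1) unfolding mem by auto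
  have "r / 2 \<le> S * (y' - x) $ i" "S * (y' - x) $ i < r" using S yi yb s by (auto simp: y'i)
  then have "x + (y' - x) \<notin> W" by (intro outside) (use y(1) in \<open>auto simp: mem y'j\<close>)
  then show ?thesis by (simp add: y'_def)
 qed
 ultimately show ?thesis unfolding edge_box_def using r by (intro exI[of _ a] exI[of _ b] exI[of _ "r / 8"]) auto
qed

text \<open>In the expansion of |V + Z|^2 the large component of V makes a displacement of order r
  in coordinate i change the square by order g r / q, which outweighs the other coordinates, of size
  w. L w is a reserve for the variation of \<gamma> over a height w.\<close>

lemma edge_quadratic:
 fixes V Z :: "real^'n::finite"
 defines "n \<equiv> real CARD('n)" and "q \<equiv> sqrt (real CARD('n))" and "g \<equiv> norm V"
 assumes S: "S = 1 \<or> S = -1" and L: "1 \<le> L" and r: "0 < r" "r \<le> g / (2 * q)" and w: "w = r / (16 * q * (n + L))"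
  and V: "g / q \<le> S * V $ i" and Z: "\<And>j. j \<noteq> i \<Longrightarrow> \<bar>Z $ j\<bar> \<le> w"
 shows "- r / 2 < S * Z $ i \<Longrightarrow> S * Z $ i < - r / 4 \<Longrightarrow> (norm (V + Z))\<^sup>2 < (g - L * w)\<^sup>2" (is "?A \<Longrightarrow> ?B \<Longrightarrow> ?C")
  and "r / 2 \<le> S * Z $ i \<Longrightarrow> g\<^sup>2 + 7 * (g / q * r) / 8 \<le> (norm (V + Z))\<^sup>2" (is "?A' \<Longrightarrow> ?C'")
  and "0 < w" "16 * (L * w) \<le> r" "16 * (n * w) \<le> r" "2 * r \<le> g" "16 * w \<le> r / q" "0 < g"
proof -
 have n1: "1 \<le> n" unfolding n_def by (simp add: Suc_leI)
 have q1: "1 \<le> q" using n1 by (simp add: q_def n_def)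
 have g0: "0 < g"
 proof -
  have "0 < g / (2 * q)" using r by linarith
  then show ?thesis using q1 by (simp add: zero_less_divide_iff)
 qed
 then show "0 < g" .
 have nL: "0 < n + L" using n1 L by simp
 have w0: "0 < w" unfolding w using r(1) q1 nL by simp
 then show "0 < w" .
 \<comment> \<open>The constant 16 q (n + L) in w is chosen to give 16 (n w + L w) = \<tau>, so both
   errors are small fractions of the gain g \<tau>.\<close>
 define \<tau> where "\<tau> = r / q"
 have \<tau>: "0 < \<tau>" "\<tau> \<le> r" using r(1) q1 by (auto simp: \<tau>_def divide_le_eq mult_left_le)
 have wn: "16 * ((n + L) * w) = \<tau>"
 proof -
  have "16 * (s * (r / (16 * q * s))) = r / q" if "0 < s" for s using that q1 by (simp add: field_simps)
  from this[OF nL] show ?thesis unfolding w \<tau>_def .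
 qed
 have nw: "0 \<le> n * w" "0 \<le> L * w" "w \<le> n * w" using w0 n1 L by auto
 have eqs: "16 * (n * w) + 16 * (L * w) = \<tau>" using wn by (simp add: distrib_right)
 show Lw: "16 * (L * w) \<le> r" and nw': "16 * (n * w) \<le> r" using eqs nw \<tau> by linarith+
 have w16: "16 * w \<le> \<tau>" using eqs nw by linarith
 then show "16 * w \<le> r / q" by (simp add: \<tau>_def)
 have gq: "2 * r \<le> g / q" using r(2) by (simp add: field_simps)
 also have "g / q \<le> g" using q1 g0 by (simp add: divide_le_eq mult_left_le)
 finally show rg: "2 * r \<le> g" .
 have Vj: "\<bar>V $ j\<bar> \<le> g" for j unfolding g_def by (rule component_le_norm_cart)
 have "\<bar>\<Sum>j\<in>UNIV - {i}. V $ j * Z $ j\<bar> \<le> (\<Sum>j\<in>UNIV - {i}. g * w)"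
  
 proof (rule order_trans[OF sum_abs], rule sum_mono)
  fix j assume "j \<in> UNIV - {i}"
  then show "\<bar>V $ j * Z $ j\<bar> \<le> g * w" unfolding abs_mult using Vj[of j] Z[of j] g0 by (intro mult_mono) auto
 qed
 also have "\<dots> \<le> (\<Sum>j\<in>(UNIV::'n set). g * w)" by (rule sum_mono2) (use g0 w0 in auto)
 finally have c: "\<bar>\<Sum>j\<in>UNIV - {i}. V $ j * Z $ j\<bar> \<le> g * (n * w)" by (simp add: n_def algebra_simps)
 have ss: "V $ i * Z $ i = (S * V $ i) * (S * Z $ i)" using S by auto
 have VZ: "V \<bullet> Z = (S * V $ i) * (S * Z $ i) + (\<Sum>j\<in>UNIV - {i}. V $ j * Z $ j)"
  unfolding inner_vec_def ss[symmetric] by (simp add: sum.remove[of UNIV i])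
 have "(\<Sum>j\<in>UNIV - {i}. (Z $ j)\<^sup>2) \<le> (\<Sum>j\<in>UNIV - {i}. w\<^sup>2)"
  using Z by (intro sum_mono) (simp add: abs_le_square_iff[symmetric] w0 less_imp_le)
 also have "\<dots> \<le> (\<Sum>j\<in>(UNIV::'n set). w\<^sup>2)" by (rule sum_mono2) auto
 finally have "(\<Sum>j\<in>UNIV - {i}. (Z $ j)\<^sup>2) \<le> n * w\<^sup>2" by (simp add: n_def)
 moreover have "(Z $ i)\<^sup>2 = (S * Z $ i)\<^sup>2" using S by auto
 ultimately have ZZ: "(norm Z)\<^sup>2 \<le> (S * Z $ i)\<^sup>2 + n * w\<^sup>2"
  unfolding norm_square_cart by (simp add: sum.remove[of UNIV i])
 have N: "(norm (V + Z))\<^sup>2 = g\<^sup>2 + 2 * (V \<bullet> Z) + (norm Z)\<^sup>2"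
  unfolding g_def power2_norm_eq_inner by (simp add: inner_add_left inner_add_right inner_commute)
 have gt: "g / q * r = g * \<tau>" by (simp add: \<tau>_def)
 have gs: "16 * (g * (n * w)) + 16 * (g * (L * w)) = g * \<tau>" unfolding eqs[symmetric] by (simp add: algebra_simps)
 have gn: "0 \<le> g * (n * w)" "0 \<le> g * (L * w)" using g0 nw by auto
 show ?C if a: ?A and b: ?B
 proof -
  define t where "t = - (S * Z $ i)"
  have t: "r / 4 < t" "t < r / 2" using a b by (auto simp: t_def)
  have "g / q * t \<le> (S * V $ i) * t" by (rule mult_right_mono[OF V]) (use t r in auto)
  then have 1: "V \<bullet> Z \<le> - (g / q * t) + g * (n * w)" using c unfolding VZ t_def by simp
  have "t * t \<le> t * (g / q / 4)" using t gq r by (intro mult_left_mono) auto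
  then have 2: "(S * Z $ i)\<^sup>2 \<le> (g / q * t) / 4" by (simp add: t_def power2_eq_square algebra_simps)
  have 3: "g * \<tau> \<le> 4 * (g / q * t)" using t g0 q1 unfolding gt[symmetric] by (simp add: divide_right_mono)
  have "w \<le> g / 16" using w16 \<tau> rg by linarith
  then have "(n * w) * w \<le> (n * w) * (g / 16)" using nw by (intro mult_left_mono) auto
  then have 4: "n * w\<^sup>2 \<le> g * (n * w) / 16" by (simp add: power2_eq_square algebra_simps)
  have 5: "0 < g / q * t" using g0 q1 t r by simp
  have 6: "(g - L * w)\<^sup>2 \<ge> g\<^sup>2 - 2 * (g * (L * w))" unfolding power2_diff using zero_le_power2[of "L * w"] by (simp add: mult.assoc)
  \<comment> \<open>Here T stands for g t / q, A for g n w, B for g L w and h for g \<tau>; naming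
    the nonlinear terms leaves a linear problem.\<close>
  have "a + 2 * b + c < d" if "b \<le> - T + A" "s \<le> T / 4" "h \<le> 4 * T" "m \<le> A / 16" "0 < T" "a - 2 * B \<le> d" "16 * A + 16 * B = h" "c \<le> s + m" "0 \<le> B"
   for a b c d s h m T A B :: real using that by linarith
  from this[OF 1 2 3 4 5 6 gs ZZ gn(2)] show ?C unfolding N .
 qed
 show ?C' if a: ?A'
 proof -
  have "g / q * (r / 2) \<le> (S * V $ i) * (S * Z $ i)" by (rule mult_mono[OF V a]) (use V g0 q1 r in \<open>auto intro: order_trans[rotated, OF V]\<close>)
  then have "g * \<tau> / 2 - g * (n * w) \<le> V \<bullet> Z"
  proof -
   have "g / q * (r / 2) = g * \<tau> / 2" unfolding gt[symmetric] by simp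
   then show ?thesis using \<open>g / q * (r / 2) \<le> _\<close> c unfolding VZ abs_le_iff by linarith
  qed
  moreover have "7 * h / 8 \<le> 2 * b + c" if "h / 2 - A \<le> b" "16 * A + 16 * B = h" "0 \<le> B" "0 \<le> c" for h A B b c :: real
   using that by linarith
  ultimately show ?C' unfolding N gt using gs gn(2) zero_le_power2[of "norm Z"] by (metis add.assoc add_left_mono)
 qed
qed

lemma ex_large_component:
 fixes V :: "real^'n::finite"
 obtains i s where "s = 1 \<or> s = (-1::real)" "norm V / sqrt (real CARD('n)) \<le> s * V $ i"
proof -
 let ?c = "norm V / sqrt (real CARD('n))"
 have "\<exists>i. ?c \<le> \<bar>V $ i\<bar>"
 proof (rule ccontr)
  assume "\<not> (\<exists>i. ?c \<le> \<bar>V $ i\<bar>)"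
  then have "\<And>i. (V $ i)\<^sup>2 < ?c\<^sup>2"
   using abs_le_square_iff[of ?c] by (metis abs_norm_cancel abs_divide abs_of_nonneg not_le real_sqrt_ge_zero of_nat_0_le_iff)
  then have "(\<Sum>i\<in>UNIV. (V $ i)\<^sup>2) < (\<Sum>i\<in>(UNIV::'n set). ?c\<^sup>2)" by (intro sum_strict_mono) auto
  then show False by (simp add: norm_square_cart[symmetric] power_divide)
 qed
 then obtain i where i: "?c \<le> \<bar>V $ i\<bar>" by blast
 show ?thesis
 proof (cases "0 \<le> V $ i")
  case True then show ?thesis using that[of 1 i] i by simp
 next
  case False then show ?thesis using that[of "-1" i] i by simp
 qed
qed

section \<open>Pieces of the boundary and the trace inequality for C1 functions\<close>

context cusp
begin

definition cusp_graph :: "(real^'n) set" where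
 "cusp_graph = {x. x $ k \<in> {0..1} \<and> norm (xprime k x) = \<gamma> (x $ k)}"

text \<open>Boundary points of positive weight: the lateral surface away from the tip, the rim where it meets the sphere, and
  the free part of the sphere. On each piece the weight is dominated by one coordinate of x - cc, which is what
  the layer estimate controls.\<close>

definition piece :: "real \<Rightarrow> 'n \<Rightarrow> real \<Rightarrow> nat \<Rightarrow> (real^'n) set" where
 "piece t1 i \<sigma> m = frontier W \<inter>
   ({x \<in> cusp_graph. i \<noteq> k \<and> x $ k \<le> t1 \<and> step m \<le> norm (xprime k x) \<and> norm (xprime k x) \<le> sqrt (real CARD('n)) * (\<sigma> * (x - cc) $ i)}
   \<union> {x. i \<noteq> k \<and> x $ k = 1 \<and> norm (xprime k x) = 1 \<and> 1 \<le> sqrt (real CARD('n)) * (\<sigma> * (x - cc) $ i)}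
   \<union> ({x. norm (x - cc) = sqrt 2 \<and> sqrt 2 \<le> sqrt (real CARD('n)) * (\<sigma> * (x - cc) $ i)} - (\<Union>y\<in>cusp_part k \<gamma>. ball y (step m))))"

lemma q1: "1 \<le> sqrt (real CARD('n))"
 by (simp add: Suc_leI)

lemma cusp_graph_closed: "closed cusp_graph"
proof -
 let ?A = "{x::real^'n. x $ k \<in> {0..1}}"
 have A: "closed ?A" unfolding atLeastAtMost_iff by (intro closed_Collect_conj closed_Collect_le continuous_intros)
 have "continuous_on ?A (\<lambda>x. \<gamma> (x $ k) - norm (xprime k x))"
  by (intro continuous_intros continuous_on_compose2[OF g_cont]) auto
 from continuous_closed_preimage[OF this A, of "{0}"]
 have "closed (?A \<inter> (\<lambda>x. \<gamma> (x $ k) - norm (xprime k x)) -` {0})" by simp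
 moreover have "?A \<inter> (\<lambda>x. \<gamma> (x $ k) - norm (xprime k x)) -` {0} = cusp_graph" by (auto simp: cusp_graph_def)
 ultimately show ?thesis by simp
qed

lemma frontier_dom: "x \<in> frontier W \<longleftrightarrow> x \<in> closure W \<and> x \<notin> W"
 using dom_open by (simp add: frontier_def interior_open)

lemma not_dom: "x \<notin> W \<Longrightarrow> 2 \<le> (norm (xprime k x))\<^sup>2 + (x $ k - 2)\<^sup>2"
 using ball_center_iff[of x k] by (auto simp: cusp_domain_eq)

text \<open>On the graph \<gamma>(x_k) equals |x'|, so the weight can be compared with coordinates
  of x'.\<close>

lemma cusp_weight_eq: "cusp_weight k \<gamma> x = (if x \<in> cusp_graph \<and> norm (xprime k x) < 1 then norm (xprime k x) else 1)"
 by (auto simp: cusp_weight_def cusp_graph_def xprime_norm_eq)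

lemma cusp_weight_bounds: "0 \<le> cusp_weight k \<gamma> x" "cusp_weight k \<gamma> x \<le> 1"
 by (auto simp: cusp_weight_eq)

lemma continuous_imp_bm_measurable:
 "f \<in> borel_measurable borel \<Longrightarrow> f \<in> borel_measurable (boundary_measure k \<gamma>)"
 by (subst measurable_cong_sets[OF sets_boundary_measure refl]) (rule measurable_restrict_space1)

lemma cusp_weight_measurable [measurable]: "cusp_weight k \<gamma> \<in> borel_measurable (boundary_measure k \<gamma>)"
proof (rule continuous_imp_bm_measurable)
 have [measurable]: "cusp_graph \<in> sets borel" using cusp_graph_closed by (rule borel_closed)
 have [measurable]: "(\<lambda>x. norm (xprime k x)) \<in> borel_measurable borel"
  by (intro borel_measurable_continuous_onI continuous_intros)
 show "cusp_weight k \<gamma> \<in> borel_measurable borel"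
  unfolding cusp_weight_eq[abs_def] by measurable
qed

lemma piece_measurable: "piece t1 i s m \<in> sets (boundary_measure k \<gamma>)"
proof -
 let ?q = "sqrt (real CARD('n))"
 have c1: "{x. step m \<le> norm (xprime k x)} \<inter> {x. norm (xprime k x) \<le> ?q * (s * (x - cc) $ i)} \<inter> {x. x $ k \<le> t1} \<in> sets borel"
  by (intro sets.Int borel_closed closed_Collect_le continuous_intros)
 have c2: "{x. x $ k = 1} \<inter> {x. norm (xprime k x) = 1} \<inter> {x. 1 \<le> ?q * (s * (x - cc) $ i)} \<in> sets borel"
  by (intro sets.Int borel_closed closed_Collect_le closed_Collect_eq continuous_intros)
 have c3: "{x. norm (x - cc) = sqrt 2} \<inter> {x. sqrt 2 \<le> ?q * (s * (x - cc) $ i)} - (\<Union>y\<in>cusp_part k \<gamma>. ball y (step m)) \<in> sets borel"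
  by (intro sets.Int sets.Diff borel_closed borel_open closed_Collect_le closed_Collect_eq continuous_intros open_UN) auto
 have g: "cusp_graph \<in> sets borel" using cusp_graph_closed by (rule borel_closed)
 define S where "S = ((if i = k then {} else (cusp_graph \<inter> ({x. step m \<le> norm (xprime k x)} \<inter> {x. norm (xprime k x) \<le> ?q * (s * (x - cc) $ i)} \<inter> {x. x $ k \<le> t1}))
   \<union> ({x. x $ k = 1} \<inter> {x. norm (xprime k x) = 1} \<inter> {x. 1 \<le> ?q * (s * (x - cc) $ i)}))
   \<union> ({x. norm (x - cc) = sqrt 2} \<inter> {x. sqrt 2 \<le> ?q * (s * (x - cc) $ i)} - (\<Union>y\<in>cusp_part k \<gamma>. ball y (step m))))"
 have U: "(if b then {} else A \<inter> B \<union> C) \<union> D \<in> sets borel" if "A \<in> sets borel" "B \<in> sets borel" "C \<in> sets borel" "D \<in> sets borel" for b and A B C D :: "(real^'n) set"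
  using that by auto
 have "S \<in> sets borel" unfolding S_def by (rule U[OF g c1 c2 c3])
 moreover have "piece t1 i s m = frontier W \<inter> S" unfolding piece_def S_def by (cases "i = k") auto
 ultimately show ?thesis unfolding sets_boundary_measure sets_restrict_space by blast
qed

lemma step_le_iff: "step a \<le> step b \<longleftrightarrow> b \<le> a" by (simp add: step_def field_simps)

lemma piece_incseq: "incseq (piece t1 i \<sigma>)"
proof (rule incseq_SucI)
 fix m
 have "step (Suc m) \<le> step m" by (simp add: step_le_iff)
 moreover have "ball y (step (Suc m)) \<subseteq> ball y (step m)" for y :: "real^'n" by (rule subset_ball) (simp add: step_le_iff)
 ultimately show "piece t1 i \<sigma> m \<subseteq> piece t1 i \<sigma> (Suc m)" unfolding piece_def by fastforce
qed

lemma piece_weight: "x \<in> piece t1 i S m \<Longrightarrow> cusp_weight k \<gamma> x \<le> sqrt (real CARD('n)) * (S * (x - cc) $ i)"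
proof -
 have s: "sqrt 2 \<le> c \<Longrightarrow> 1 \<le> c" for c :: real using real_sqrt_ge_1_iff[of 2] by linarith
 assume "x \<in> piece t1 i S m"
 then consider "x \<in> cusp_graph" "norm (xprime k x) \<le> sqrt (real CARD('n)) * (S * (x - cc) $ i)" | "1 \<le> sqrt (real CARD('n)) * (S * (x - cc) $ i)"
  unfolding piece_def using s by blast
 then show ?thesis
 proof cases
  case 1
  then show ?thesis using g_le1[of "x $ k"] unfolding cusp_weight_eq by (auto simp: cusp_graph_def)
 next
  case 2 then show ?thesis using cusp_weight_bounds(2)[of x] by simp
 qed
qed

text \<open>A boundary point off the closed cusp part is on the sphere at positive distance from the
  cusp. Otherwise it is on the graph, positive weight rules out |x'| = 0, and heights strictly
  between t1 and 1 are excluded; a largest component selects the axis.\<close>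

lemma pieces_cover:
 assumes t1: "\<And>x. x $ k < 1 \<Longrightarrow> t1 < x $ k \<Longrightarrow> norm (xprime k x) = \<gamma> (x $ k) \<Longrightarrow> x \<in> W"
  and x: "x \<in> frontier W" and w: "0 < cusp_weight k \<gamma> x"
 shows "\<exists>i s m. (s = 1 \<or> s = -1) \<and> x \<in> piece t1 i s m"
proof -
 let ?q = "sqrt (real CARD('n))"
 have q: "0 < ?q" by simp
 have xc: "x \<in> closure W" "x \<notin> W" using x by (auto simp: frontier_dom)
 show ?thesis
 proof (cases "x \<in> closure (cusp_part k \<gamma>)")
  case False
  then have "x \<in> cball cc (sqrt 2)" using closure_dom[OF xc(1)] by blast
  moreover have "x \<notin> ball cc (sqrt 2)" using xc(2) by (simp add: cusp_domain_eq)
  ultimately have n: "norm (x - cc) = sqrt 2" by (simp add: dist_norm norm_minus_commute)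
  have "open (- closure (cusp_part k \<gamma>))" by (intro open_Compl closed_closure)
  then obtain r where r: "0 < r" "ball x r \<subseteq> - closure (cusp_part k \<gamma>)" using False open_contains_ball by blast
  obtain m where m: "step m < r" unfolding step_def using reals_Archimedean[OF r(1)] by (auto simp: inverse_eq_divide)
  have "x \<notin> (\<Union>y\<in>cusp_part k \<gamma>. ball y (step m))"
  proof
   assume "x \<in> (\<Union>y\<in>cusp_part k \<gamma>. ball y (step m))"
   then obtain y where y: "y \<in> cusp_part k \<gamma>" "dist y x < step m" by auto
   then have "y \<in> ball x r" using m by (simp add: dist_commute)
   then show False using r(2) y(1) closure_subset by blast
  qed
  moreover obtain i s where "s = 1 \<or> s = (-1::real)" "norm (x - cc) / ?q \<le> s * (x - cc) $ i" by (rule ex_large_component)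
  moreover from this(2) have "sqrt 2 \<le> ?q * (s * (x - cc) $ i)" unfolding n pos_divide_le_eq[OF q] by (simp add: mult.commute)
  ultimately show ?thesis using x n unfolding piece_def by blast
 next
  case True
  note cl = closure_cusp_part[OF this]
  have gx: "norm (xprime k x) = \<gamma> (x $ k)"
  proof (rule ccontr)
   assume "norm (xprime k x) \<noteq> \<gamma> (x $ k)"
   then have l: "norm (xprime k x) < \<gamma> (x $ k)" using cl(3) by simp
   then have "x $ k \<noteq> 0" using g0 norm_ge_zero[of "xprime k x"] by (metis not_le)
   then have "x \<in> cusp_part k \<gamma>" using l cl by (simp add: cusp_part_def)
   then show False using xc by (simp add: cusp_domain_eq)
  qed
  then have gr: "x \<in> cusp_graph" using cl by (simp add: cusp_graph_def)
  have pos: "0 < norm (xprime k x)"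
   using w gr unfolding cusp_weight_eq by (auto split: if_splits)
  obtain m where m: "step m < norm (xprime k x)" unfolding step_def using reals_Archimedean[OF pos] by (auto simp: inverse_eq_divide)
  obtain i s where i: "s = 1 \<or> s = (-1::real)" "norm (xprime k x) / ?q \<le> s * xprime k x $ i" by (rule ex_large_component)
  have "0 < norm (xprime k x) / ?q" using pos q by simp
  then have ik: "i \<noteq> k" using i(2) by (auto simp: xprime_nth)
  then have i': "norm (xprime k x) \<le> ?q * (s * (x - cc) $ i)"
   using i(2) unfolding pos_divide_le_eq[OF q] by (simp add: xprime_nth cusp_center_nth mult.commute)
  show ?thesis
  proof (cases "x $ k = 1")
   case True
   then have "norm (xprime k x) = 1" using gx g1 by simp
   then show ?thesis using True x ik i i' unfolding piece_def by auto
  next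
   case False
   then have "x $ k \<le> t1" using t1[of x] gx xc(2) cl(2) by fastforce
   then have "x \<in> piece t1 i s m" unfolding piece_def using x gr ik m i' by (simp del: vector_minus_component)
   then show ?thesis using i(1) by blast
  qed
 qed
qed


lemma xprime_nth_neq: "i \<noteq> k \<Longrightarrow> xprime k x $ i = (x - cc) $ i"
 by (simp add: xprime_nth cusp_center_nth)

text \<open>The box is placed where a single surface decides membership: below x on the lateral
  surface, above x at the rim, around x on the free sphere. The bound on r makes r small compared
  with the radial length on each piece, uniformly in x.\<close>

lemma piece_edge_box:
 fixes r t1 L :: real
 defines "n \<equiv> real CARD('n)" and "q \<equiv> sqrt (real CARD('n))"
 assumes t1: "0 < t1" "t1 < 1" and L: "1 \<le> L" "\<And>a b. 0 \<le> a \<Longrightarrow> a \<le> b \<Longrightarrow> b \<le> t1 \<Longrightarrow> \<gamma> b - \<gamma> a \<le> L * (b - a)"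
  and s: "s = 1 \<or> s = -1" and x: "x \<in> piece t1 i s m" and r: "0 < r" "r < step m / (2 * q)"
 shows "edge_box W i s (1 / (16 * q * (n + L))) r x"
proof -
 have q: "1 \<le> q" using q1 by (simp add: q_def)
 define w where "w = r / (16 * q * (n + L))"
 have aux: "a + 7 * b / 8 \<le> c \<Longrightarrow> 0 < b \<Longrightarrow> a < c" for a b c :: real by linarith
 have aux2: "1 + 7 * h / 8 \<le> a \<Longrightarrow> 1 - 2 * w \<le> b \<Longrightarrow> 0 < w \<Longrightarrow> 16 * w \<le> h \<Longrightarrow> \<not> a + b < 2" for a b h w :: real by linarith
 have kw: "1 / (16 * q * (n + L)) * r = w" by (simp add: w_def)
 have xf: "x \<in> frontier W" using x by (simp add: piece_def)
 have nx: "2 \<le> (norm (xprime k x))\<^sup>2 + (x $ k - 2)\<^sup>2" using xf by (intro not_dom) (simp add: frontier_dom)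
 have st: "0 < step m" "step m \<le> 1" by (auto simp: step_def)
 have gr: "r \<le> g / (2 * q)" if "step m \<le> g" for g
  using r(2) divide_right_mono[OF that, of "2 * q"] q by linarith
 have qle: "g / q \<le> c" if "g \<le> q * c" for g c using that q by (simp add: divide_le_eq mult.commute)
 have w0: "0 < w" unfolding w_def n_def using q L(1) r(1) by (intro divide_pos_pos mult_pos_pos add_nonneg_pos) auto
 note EQ = edge_quadratic[where V = V and Z = Z and L = L and w = w and i = i for V Z :: "real^'n", folded n_def q_def, OF s L(1) r(1) _ w_def]
 note x' = x[unfolded piece_def, folded q_def]
 have xp0: "xprime k z $ k = 0" for z by (simp add: xprime_nth)
 consider (1) "x \<in> cusp_graph" "i \<noteq> k" "x $ k \<le> t1" "step m \<le> norm (xprime k x)" "norm (xprime k x) \<le> q * (s * (x - cc) $ i)"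
  | (2) "i \<noteq> k" "x $ k = 1" "norm (xprime k x) = 1" "1 \<le> q * (s * (x - cc) $ i)"
  | (3) "norm (x - cc) = sqrt 2" "sqrt 2 \<le> q * (s * (x - cc) $ i)" "x \<notin> (\<Union>y\<in>cusp_part k \<gamma>. ball y (step m))"
  using x' by blast
 then show ?thesis
 proof cases
  case 1
  define g where "g = norm (xprime k x)"
  have gk: "0 \<le> x $ k" "g = \<gamma> (x $ k)" using 1(1) by (auto simp: cusp_graph_def g_def)
  have Vi: "norm (xprime k x) / q \<le> s * xprime k x $ i" unfolding xprime_nth_neq[OF 1(2)] by (rule qle[OF 1(5)])
  note E = EQ[OF gr[OF 1(4)] Vi]
  have E0: "0 < w" "16 * (L * w) \<le> r" "16 * (n * w) \<le> r" "2 * r \<le> g" "0 < g" using w0 E(4-8)[of 0] unfolding g_def by (auto simp: less_imp_le)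
  have Lw: "0 \<le> L * w" using E0(1) L(1) by simp
  have "g - \<gamma> 0 \<le> L * (x $ k - 0)" unfolding gk(2) by (rule L(2)) (use gk 1 in auto)
  then have "L * w < L * (x $ k)" using E0 Lw g0 r(1) by simp
  then have wx: "w < x $ k" using L(1) by simp
  show ?thesis
  \<comment> \<open>Lowering the height keeps it at most t1, where \<gamma> is Lipschitz: for inner
    points \<gamma> drops by at most L w, while for outer points \<gamma> is no larger and the
    distance to the centre in height grows, which excludes the ball too.\<close>
  proof (rule edge_boxI[OF s r(1), where w = w and lo = "\<lambda>j. - w" and hi = "\<lambda>j. if j = k then 0 else w"])
   show "real CARD('n) * w \<le> r / 4" using E0(3) r(1) by (simp add: n_def)
   show "- w \<le> - w \<and> (if j = k then 0 else w) \<le> w \<and> - w + 1 / (16 * q * (n + L)) * r \<le> (if j = k then 0 else w)" for j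
    unfolding kw using E0(1) by simp
   fix z assume z: "\<And>j. j \<noteq> i \<Longrightarrow> - w < z $ j \<and> z $ j < (if j = k then 0 else w)"
   have zj: "\<bar>xprime k z $ j\<bar> \<le> w" if "j \<noteq> i" for j
    using z[OF that] E0(1) by (auto simp: xprime_nth abs_le_iff)
   have zi: "xprime k z $ i = z $ i" using 1(2) by (simp add: xprime_nth)
   have zk: "- w < z $ k" "z $ k < 0" using z[of k] 1(2) by auto
   {
    assume "- r / 2 < s * z $ i" "s * z $ i < - r / 4"
    then have "(norm (xprime k (x + z)))\<^sup>2 < (g - L * w)\<^sup>2" unfolding xprime_add g_def by (intro E(1)) (auto simp: zi zj)
    then have a: "norm (xprime k (x + z)) < g - L * w" by (rule power2_less_imp_less) (use E0 Lw r in linarith)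
    have "\<gamma> (x $ k) - \<gamma> (x $ k + z $ k) \<le> L * (x $ k - (x $ k + z $ k))" by (rule L(2)) (use zk wx 1 in auto)
    also have "\<dots> \<le> L * w" using zk L(1) by (intro mult_left_mono) auto
    finally have "norm (xprime k (x + z)) < \<gamma> ((x + z) $ k)" using a gk(2) by simp
    then have "x + z \<in> cusp_part k \<gamma>" using zk wx 1(3) t1 by (simp add: cusp_part_def)
    then show "x + z \<in> W" by (simp add: cusp_domain_eq)
   }
   {
    assume "r / 2 \<le> s * z $ i"
    then have "g\<^sup>2 + 7 * (g / q * r) / 8 \<le> (norm (xprime k (x + z)))\<^sup>2" unfolding xprime_add g_def by (intro E(2)) (auto simp: zi zj)
    moreover have "0 < g / q * r" using E0 q r by simp
    ultimately have a: "g\<^sup>2 < (norm (xprime k (x + z)))\<^sup>2" by (rule aux)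
    have "g < norm (xprime k (x + z))" by (rule power2_less_imp_less[OF a]) simp
    moreover have "\<gamma> ((x + z) $ k) \<le> g" unfolding gk(2) using g_le[of "x $ k + z $ k" "x $ k"] zk wx 1 t1 by simp
    ultimately have "x + z \<notin> cusp_part k \<gamma>" by (auto simp: cusp_part_def)
    moreover have "(x $ k - 2)\<^sup>2 \<le> ((x + z) $ k - 2)\<^sup>2" using zk 1(3) t1 by (simp add: abs_le_square_iff[symmetric])
    then have "x + z \<notin> ball cc (sqrt 2)" using a nx unfolding ball_center_iff g_def by linarith
    ultimately show "x + z \<notin> W" by (simp add: cusp_domain_eq)
   }
  qed
 next
  case 2
  have Vi: "norm (xprime k x) / q \<le> s * xprime k x $ i" unfolding xprime_nth_neq[OF 2(1)] 2(3) by (rule qle[OF 2(4)])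
  have "step m \<le> norm (xprime k x)" using st 2(3) by simp
  note E = EQ[OF gr[OF this] Vi, unfolded 2(3)]
  have E0: "0 < w" "16 * (L * w) \<le> r" "16 * (n * w) \<le> r" "2 * r \<le> 1" "16 * w \<le> r / q" using w0 E(4-8)[of 0] by (auto simp: less_imp_le)
  have Lw: "0 \<le> L * w" "w \<le> L * w" using E0(1) L(1) by auto
  show ?thesis
  \<comment> \<open>Above height 1 the cusp part is absent and the quadratic description of the ball
    alone decides; the slope of \<gamma> at 1 does not enter.\<close>
  proof (rule edge_boxI[OF s r(1), where w = w and lo = "\<lambda>j. if j = k then 0 else - w" and hi = "\<lambda>j. w"])
   show "real CARD('n) * w \<le> r / 4" using E0(3) r(1) by (simp add: n_def)
   show "- w \<le> (if j = k then 0 else - w) \<and> w \<le> w \<and> (if j = k then 0 else - w) + 1 / (16 * q * (n + L)) * r \<le> w" for j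
    unfolding kw using E0(1) by simp
   fix z assume z: "\<And>j. j \<noteq> i \<Longrightarrow> (if j = k then 0 else - w) < z $ j \<and> z $ j < w"
   have zj: "\<bar>xprime k z $ j\<bar> \<le> w" if "j \<noteq> i" for j
    using z[OF that] E0(1) by (auto simp: xprime_nth abs_le_iff)
   have zi: "xprime k z $ i = z $ i" using 2(1) by (simp add: xprime_nth)
   have zk: "0 < z $ k" "z $ k < w" using z[of k] 2(1) by auto
   have xzk: "((x + z) $ k - 2)\<^sup>2 = 1 - 2 * z $ k + (z $ k)\<^sup>2" using 2(2) by (simp add: power2_eq_square algebra_simps)
   {
    assume "- r / 2 < s * z $ i" "s * z $ i < - r / 4"
    then have "(norm (xprime k (x + z)))\<^sup>2 < (1 - L * w)\<^sup>2" unfolding xprime_add by (intro E(1)) (auto simp: zi zj)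
    also have "\<dots> \<le> 1" using Lw E0 by (intro power_le_one) auto
    finally have "(norm (xprime k (x + z)))\<^sup>2 < 1" .
    moreover have "z $ k \<le> 2" using zk Lw E0 by linarith
    then have "z $ k * z $ k \<le> 2 * z $ k" using zk(1) by (intro mult_right_mono) auto
    then have "((x + z) $ k - 2)\<^sup>2 \<le> 1" unfolding xzk unfolding power2_eq_square by linarith
    ultimately have "(norm (xprime k (x + z)))\<^sup>2 + ((x + z) $ k - 2)\<^sup>2 < 2" by linarith
    then show "x + z \<in> W" unfolding cusp_domain_eq ball_center_iff[symmetric] by blast
   }
   {
    assume "r / 2 \<le> s * z $ i"
    then have "1\<^sup>2 + 7 * (1 / q * r) / 8 \<le> (norm (xprime k (x + z)))\<^sup>2" unfolding xprime_add by (intro E(2)) (auto simp: zi zj)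
    then have "1 + 7 * (r / q) / 8 \<le> (norm (xprime k (x + z)))\<^sup>2" by simp
    moreover have "1 - 2 * w \<le> ((x + z) $ k - 2)\<^sup>2" unfolding xzk using zk zero_le_power2[of "z $ k"] by linarith
    ultimately have "\<not> (norm (xprime k (x + z)))\<^sup>2 + ((x + z) $ k - 2)\<^sup>2 < 2" using E0(1,5) by (rule aux2)
    then have "x + z \<notin> ball cc (sqrt 2)" unfolding ball_center_iff .
    moreover have "x + z \<notin> cusp_part k \<gamma>" using zk 2(2) by (simp add: cusp_part_def)
    ultimately show "x + z \<notin> W" by (simp add: cusp_domain_eq)
   }
  qed
 next
  case 3
  have Vi: "norm (x - cc) / q \<le> s * (x - cc) $ i" unfolding 3(1) by (rule qle[OF 3(2)])
  have "step m \<le> norm (x - cc)" unfolding 3(1) using st real_sqrt_ge_1_iff[of 2] by linarith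
  note E = EQ[OF gr[OF this] Vi, unfolded 3(1)]
  have E0: "0 < w" "16 * (L * w) \<le> r" "16 * (n * w) \<le> r" "2 * r \<le> sqrt 2" using w0 E(4-8)[of 0] by (auto simp: less_imp_le)
  have Lw: "0 \<le> L * w" using E0(1) L(1) by simp
  have bm: "x + z \<in> ball cc (sqrt 2) \<longleftrightarrow> (norm ((x - cc) + z))\<^sup>2 < 2" for z
   unfolding norm_less_sqrt2_iff(1)[symmetric] by (simp add: dist_norm norm_minus_commute algebra_simps)
  show ?thesis
  proof (rule edge_boxI[OF s r(1), where w = w and lo = "\<lambda>j. - w" and hi = "\<lambda>j. w"])
   show "real CARD('n) * w \<le> r / 4" using E0(3) r(1) by (simp add: n_def)
   show "- w \<le> - w \<and> w \<le> w \<and> - w + 1 / (16 * q * (n + L)) * r \<le> w" for j :: 'n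
    unfolding kw using E0(1) by simp
   fix z :: "real^'n" assume z: "\<And>j. j \<noteq> i \<Longrightarrow> - w < z $ j \<and> z $ j < w"
   have zj: "\<bar>z $ j\<bar> \<le> w" if "j \<noteq> i" for j using z[OF that] by (auto simp: abs_le_iff)
   {
    assume "- r / 2 < s * z $ i" "s * z $ i < - r / 4"
    then have "(norm ((x - cc) + z))\<^sup>2 < (sqrt 2 - L * w)\<^sup>2" by (intro E(1)) (auto simp: zj)
    also have "\<dots> \<le> (sqrt 2)\<^sup>2" using Lw E0 r by (intro power_mono) auto
    finally have "(norm ((x - cc) + z))\<^sup>2 < 2" by simp
    then show "x + z \<in> W" unfolding cusp_domain_eq bm[symmetric] by blast
   }
   {
    assume zi: "r / 2 \<le> s * z $ i" "s * z $ i < r"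
    then have "(sqrt 2)\<^sup>2 + 7 * (sqrt 2 / q * r) / 8 \<le> (norm ((x - cc) + z))\<^sup>2" by (intro E(2)) (auto simp: zj)
    moreover have "0 < sqrt 2 / q * r" using q r by simp
    ultimately have "(sqrt 2)\<^sup>2 < (norm ((x - cc) + z))\<^sup>2" by (rule aux)
    then have "x + z \<notin> ball cc (sqrt 2)" unfolding bm by simp
    moreover have "x + z \<notin> cusp_part k \<gamma>"
    proof
     assume "x + z \<in> cusp_part k \<gamma>"
     then have "step m \<le> norm z" using 3(3) by (force simp: dist_norm)
     also have "norm z \<le> (\<Sum>j\<in>UNIV. \<bar>z $ j\<bar>)" by (rule norm_le_l1_cart)
     also have "\<dots> \<le> (\<Sum>j\<in>UNIV. (if j = i then r else 0) + w)"
     proof (rule sum_mono)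
      fix j have "\<bar>z $ i\<bar> < r" using s zi r by auto
      then show "\<bar>z $ j\<bar> \<le> (if j = i then r else 0) + w" using zj[of j] E0(1) by (cases "j = i") auto
     qed
     also have "\<dots> = r + n * w" by (simp add: sum.distrib n_def)
     also have "\<dots> \<le> 2 * r" using E0 r by simp
     finally have "step m \<le> 2 * r" .
     moreover have "2 * r * q < step m" using r(2) q by (simp add: pos_less_divide_eq algebra_simps)
     moreover have "2 * r * 1 \<le> 2 * r * q" using q r by (intro mult_left_mono) auto
     ultimately show False by linarith
    qed
    ultimately show "x + z \<notin> W" by (simp add: cusp_domain_eq)
   }
  qed
 qed
qed


text \<open>Sums the layer estimate over the 2n signed axes, n being the dimension. On each piece
  the weight is at most q (x - cc) . e with q the square root of n, and 3 bounds (x - cc) . e on the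
  domain. K depends on k and \<gamma> but neither on p nor on v.\<close>

lemma weighted_boundary_bound:
 obtains K where "0 \<le> K" "\<And>p v G. 1 < p \<Longrightarrow> C1_fun v G \<Longrightarrow>
  bdry_int k \<gamma> p v \<le> ennreal K * (\<integral>\<^sup>+x. ennreal (2 * \<bar>v x\<bar> powr p + p * 3 * (\<bar>v x\<bar> powr (p - 1) * norm (G x))) * indicator W x \<partial>lborel)"
proof -
 let ?q = "sqrt (real CARD('n))"
 obtain t1 where t1: "0 < t1" "t1 < 1" "\<And>x::real^'n. x $ k < 1 \<Longrightarrow> t1 < x $ k \<Longrightarrow> norm (xprime k x) = \<gamma> (x $ k) \<Longrightarrow> x \<in> W"
  by (rule ex_corner) (rule that)
 obtain L where L: "1 \<le> L" "\<And>a b. 0 \<le> a \<Longrightarrow> a \<le> b \<Longrightarrow> b \<le> t1 \<Longrightarrow> \<gamma> b - \<gamma> a \<le> L * (b - a)"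
  by (rule ex_Lipschitz[OF t1(1,2)]) (rule that)
 define Q where "Q = 1 / (16 * ?q * (real CARD('n) + L))"
 have Q: "0 < Q" unfolding Q_def using L(1) by (intro divide_pos_pos mult_pos_pos add_nonneg_pos) auto
 define K0 where "K0 = 4 * (unit_ball_vol (real CARD('n) - 1) * (2 / Q) ^ (CARD('n) - 1))"
 have K0: "0 \<le> K0" unfolding K0_def using Q by (intro mult_nonneg_nonneg) auto
 define J where "J p v G = (\<integral>\<^sup>+x. ennreal (2 * \<bar>v x\<bar> powr p + p * 3 * (\<bar>v x\<bar> powr (p - 1) * norm (G x))) * indicator W x \<partial>lborel)"
  for p and v :: "real^'n \<Rightarrow> real" and G :: "real^'n \<Rightarrow> real^'n"
 define I where "I = (UNIV :: 'n set) \<times> {1, -1 :: real}"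
 have I: "finite I" by (simp add: I_def)
 define e where "e s = (snd s *\<^sub>R axis (fst s) 1 :: real^'n)" for s :: "'n \<times> real"
 have edot: "(x - cc) \<bullet> e s = snd s * (x - cc) $ fst s" for x s by (simp add: e_def inner_axis)
 define PP where "PP s = (\<Union>m. piece t1 (fst s) (snd s) m)" for s
 have PPm[measurable]: "PP s \<in> sets (boundary_measure k \<gamma>)" for s unfolding PP_def using piece_measurable by auto
 have main: "bdry_int k \<gamma> p v \<le> ennreal (?q * K0 * real (card I)) * J p v G" if p: "1 < p" and C: "C1_fun v G" for p v G
 proof -
  define F where "F s x = max 0 ((x - cc) \<bullet> e s) * \<bar>v x\<bar> powr p" for s x
  have Fc: "continuous_on UNIV (F s)" for s
   unfolding F_def using p by (intro continuous_intros continuous_on_powr' C1_fun_continuous(1)[OF C]) auto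
  have F0: "0 \<le> F s x" for s x by (simp add: F_def)
  have Fm[measurable]: "F s \<in> borel_measurable (boundary_measure k \<gamma>)" for s
   by (intro continuous_imp_bm_measurable borel_measurable_continuous_onI Fc)
  have one: "(\<integral>\<^sup>+x. ennreal (F s x) * indicator (PP s) x \<partial>boundary_measure k \<gamma>) \<le> ennreal K0 * J p v G" if s: "s \<in> I" for s
  proof -
   have S: "snd s = 1 \<or> snd s = -1" using s by (auto simp: I_def)
   have ne: "norm (e s) = 1" using S by (auto simp: e_def)
   have a: "(\<integral>\<^sup>+x. ennreal (F s x) * indicator (PP s) x \<partial>boundary_measure k \<gamma>) \<le> ennreal K0 *
     liminf (\<lambda>j. \<integral>\<^sup>+x. ennreal (1 / step j) * (ennreal (F s x) * indicator (edge_layer W (snd s *\<^sub>R axis (fst s) 1) (step j)) x) \<partial>lborel)"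
    unfolding PP_def K0_def
   proof (rule nn_integral_piece_le_layers[OF dom_open dom_bounded S Q emeasure_boundary_measure_le sets_boundary_measure piece_measurable piece_incseq _ Fc F0])
    fix m
    show "\<exists>r0>0. \<forall>x\<in>piece t1 (fst s) (snd s) m. \<forall>r. 0 < r \<longrightarrow> r < r0 \<longrightarrow> edge_box W (fst s) (snd s) Q r x"
    proof (intro exI[of _ "step m / (2 * ?q)"] conjI ballI allI impI)
     show "0 < step m / (2 * ?q)" by (simp add: step_def)
     fix x r assume x: "x \<in> piece t1 (fst s) (snd s) m" "0 < r" "r < step m / (2 * ?q)"
     show "edge_box W (fst s) (snd s) Q r x" unfolding Q_def by (rule piece_edge_box[OF t1(1,2) L S x])
    qed
   qed
   have b: "liminf (\<lambda>j. \<integral>\<^sup>+x. ennreal (1 / step j) * (ennreal (max 0 ((x - cc) \<bullet> e s) * \<bar>v x\<bar> powr p) * indicator (edge_layer W (e s) (step j)) x) \<partial>lborel) \<le> J p v G"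
    unfolding J_def
   proof (rule edge_layer_integral_le[OF dom_open dom_bounded p ne _ _ _ C])
    show "y - s' *\<^sub>R e s \<in> W" if "y \<in> W" "0 < s'" "0 < (y - s' *\<^sub>R e s - cc) \<bullet> e s" for y s'
     using dom_retract[OF S that(1,2), of "fst s"] that(3) unfolding e_def by blast
    show "(y - cc) \<bullet> e s \<le> 3" if "y \<in> W" for y
     using norm_cauchy_schwarz[of "y - cc" "e s"] cusp_domain_bound[OF that] unfolding ne by linarith
   qed simp
   show ?thesis using order_trans[OF a[folded e_def] mult_left_mono[OF b[folded F_def]]] by simp
  qed
  have pw: "ennreal (\<bar>v x\<bar> powr p * cusp_weight k \<gamma> x) \<le> (\<Sum>s\<in>I. ennreal ?q * (ennreal (F s x) * indicator (PP s) x))"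
   if x: "x \<in> space (boundary_measure k \<gamma>)" for x
  proof (cases "cusp_weight k \<gamma> x = 0")
   case False
   then have "0 < cusp_weight k \<gamma> x" using cusp_weight_bounds(1)[of x] by simp
   moreover have "x \<in> frontier W" using x by (simp add: space_boundary_measure)
   ultimately obtain i S m where i: "S = 1 \<or> S = -1" "x \<in> piece t1 i S m" using pieces_cover[OF t1(3)] by blast
   let ?s = "(i, S)"
   have s: "?s \<in> I" "x \<in> PP ?s" using i by (auto simp: I_def PP_def)
   have "cusp_weight k \<gamma> x \<le> ?q * ((x - cc) \<bullet> e ?s)" unfolding edot using piece_weight[OF i(2)] by simp
   also have "\<dots> \<le> ?q * max 0 ((x - cc) \<bullet> e ?s)" by (intro mult_left_mono) auto
   finally have "\<bar>v x\<bar> powr p * cusp_weight k \<gamma> x \<le> \<bar>v x\<bar> powr p * (?q * max 0 ((x - cc) \<bullet> e ?s))" by (intro mult_left_mono) auto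
   then have "ennreal (\<bar>v x\<bar> powr p * cusp_weight k \<gamma> x) \<le> ennreal (?q * F ?s x)"
    unfolding F_def by (intro ennreal_leI) (simp add: mult_ac)
   also have "\<dots> = ennreal ?q * (ennreal (F ?s x) * indicator (PP ?s) x)" using s by (simp add: ennreal_mult F0)
   also have "\<dots> \<le> (\<Sum>s\<in>I. ennreal ?q * (ennreal (F s x) * indicator (PP s) x))"
    by (rule member_le_sum[OF s(1) _ I]) simp
   finally show ?thesis .
  qed simp
  have "bdry_int k \<gamma> p v \<le> (\<integral>\<^sup>+x. (\<Sum>s\<in>I. ennreal ?q * (ennreal (F s x) * indicator (PP s) x)) \<partial>boundary_measure k \<gamma>)"
   unfolding bdry_int_def by (rule nn_integral_mono) (rule pw)
  also have "\<dots> = (\<Sum>s\<in>I. ennreal ?q * (\<integral>\<^sup>+x. ennreal (F s x) * indicator (PP s) x \<partial>boundary_measure k \<gamma>))"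
   by (subst nn_integral_sum) (auto intro!: sum.cong nn_integral_cmult)
  also have "\<dots> \<le> (\<Sum>s\<in>I. ennreal ?q * (ennreal K0 * J p v G))" by (intro sum_mono mult_left_mono one) auto
  also have "\<dots> = ennreal (?q * K0 * real (card I)) * J p v G"
   using K0 by (simp add: ennreal_mult ennreal_of_nat_eq_real_of_nat mult_ac)
  finally show ?thesis .
 qed
 show ?thesis
  by (rule that[of "?q * K0 * real (card I)"]) (use K0 main in \<open>auto simp: J_def\<close>)
qed

text \<open>Only the mixed term |v|^(p-1) |G| involves the gradient, and Young's inequality makes
  its gradient part as small as desired at the expense of C.\<close>

theorem trace_inequality_C1:
 assumes p: "1 < p" and e: "0 < e"
 obtains C where "0 \<le> C" "\<And>v G. C1_fun v G \<Longrightarrow> bdry_int k \<gamma> p v \<le> ennreal (e * Lp_int p MW G + C * Lp_int p MW v)"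
proof -
 obtain K where K: "0 \<le> K" "\<And>p v G. 1 < p \<Longrightarrow> C1_fun v G \<Longrightarrow>
  bdry_int k \<gamma> p v \<le> ennreal K * (\<integral>\<^sup>+x. ennreal (2 * \<bar>v x\<bar> powr p + p * 3 * (\<bar>v x\<bar> powr (p - 1) * norm (G x))) * indicator W x \<partial>lborel)"
  by (rule weighted_boundary_bound) (rule that)
 define d where "d = e / (K + 1)"
 have d: "0 < d" "K * d \<le> e" using e K(1) by (auto simp: d_def field_simps)
 obtain C where C: "0 \<le> C" "\<And>a b. 0 \<le> a \<Longrightarrow> 0 \<le> b \<Longrightarrow> p * 3 * (a powr (p - 1) * b) \<le> d * b powr p + C * a powr p"
  by (rule Young_powr[OF p d(1), of "p * 3"]) (use p that in auto)
 show ?thesis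
 proof (rule that[of "K * (2 + C)"])
  show "0 \<le> K * (2 + C)" using K(1) C(1) by simp
  fix v :: "real^'n \<Rightarrow> real" and G assume vG: "C1_fun v G"
  have L: "Lp_vec p MW v" "Lp_vec p MW G" using W1p_pair_C1[OF dom_open dom_bounded vG, of p] p by (auto simp: W1p_pair_def)
  note [measurable] = C1_fun_measurable[OF vG]
  have C2: "0 \<le> 2 + C" using C(1) by simp
  have [measurable]: "W \<in> sets borel" using dom_open by simp
  have "(\<integral>\<^sup>+x. ennreal (2 * \<bar>v x\<bar> powr p + p * 3 * (\<bar>v x\<bar> powr (p - 1) * norm (G x))) * indicator W x \<partial>lborel)
    \<le> (\<integral>\<^sup>+x. ennreal d * (ennreal (norm (G x) powr p) * indicator W x) + ennreal (2 + C) * (ennreal (norm (v x) powr p) * indicator W x) \<partial>lborel)"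
  proof (rule nn_integral_mono)
   fix x
   have "2 * \<bar>v x\<bar> powr p + p * 3 * (\<bar>v x\<bar> powr (p - 1) * norm (G x)) \<le> d * norm (G x) powr p + (2 + C) * norm (v x) powr p"
    using C(2)[of "\<bar>v x\<bar>" "norm (G x)"] by (simp add: distrib_right)
   then have "ennreal (2 * \<bar>v x\<bar> powr p + p * 3 * (\<bar>v x\<bar> powr (p - 1) * norm (G x))) \<le> ennreal d * ennreal (norm (G x) powr p) + ennreal (2 + C) * ennreal (norm (v x) powr p)"
    using d(1) C(1) by (simp add: ennreal_mult[symmetric] ennreal_plus[symmetric] ennreal_leI del: ennreal_plus)
   then show "ennreal (2 * \<bar>v x\<bar> powr p + p * 3 * (\<bar>v x\<bar> powr (p - 1) * norm (G x))) * indicator W x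
    \<le> ennreal d * (ennreal (norm (G x) powr p) * indicator W x) + ennreal (2 + C) * (ennreal (norm (v x) powr p) * indicator W x)"
    by (simp split: split_indicator)
  qed
  also have "\<dots> = ennreal d * ennreal (Lp_int p MW G) + ennreal (2 + C) * ennreal (Lp_int p MW v)"
   by (subst nn_integral_add) (auto simp: nn_integral_cmult ennreal_Lp_int[OF dom_open _ L(1), simplified] ennreal_Lp_int[OF dom_open _ L(2), simplified])
  also have "\<dots> = ennreal (d * Lp_int p MW G + (2 + C) * Lp_int p MW v)"
   using d(1) C2 by (simp add: ennreal_mult[symmetric] ennreal_plus[symmetric] del: ennreal_plus)
  finally have "bdry_int k \<gamma> p v \<le> ennreal K * ennreal (d * Lp_int p MW G + (2 + C) * Lp_int p MW v)"
   using K(2)[OF p vG] by (meson mult_left_mono order_trans zero_le)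
  also have "\<dots> = ennreal (K * d * Lp_int p MW G + K * (2 + C) * Lp_int p MW v)"
  proof -
   have "K * (d * a + (2 + C) * b) = K * d * a + K * (2 + C) * b" for a b :: real by (simp add: algebra_simps)
   moreover have "0 \<le> d * Lp_int p MW G + (2 + C) * Lp_int p MW v" using d(1) C(1) by (intro add_nonneg_nonneg mult_nonneg_nonneg) auto
   ultimately show ?thesis using ennreal_mult[OF K(1)] by metis
  qed
  also have "\<dots> \<le> ennreal (e * Lp_int p MW G + K * (2 + C) * Lp_int p MW v)"
   by (intro ennreal_leI add_right_mono mult_right_mono d(2)) auto
  finally show "bdry_int k \<gamma> p v \<le> ennreal (e * Lp_int p MW G + K * (2 + C) * Lp_int p MW v)" .
 qed
qed

end

section \<open>Traces\<close>

lemma C1_fun_diff: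
 assumes "C1_fun v G" "C1_fun v' G'"
 shows "C1_fun (\<lambda>x. v x - v' x) (\<lambda>x. G x - G' x)"
 using assms by (simp only: C1_fun_def inner_diff_left) (blast intro: has_derivative_diff continuous_on_diff)

lemma C1_fun_const: "C1_fun (\<lambda>x. c) (\<lambda>x. 0)"
 by (simp only: C1_fun_def inner_zero_left) auto

lemma Lp_diff_tendsto:
 assumes p: "1 \<le> p" and L: "\<And>n. Lp_vec p M (f n)" "Lp_vec p M f0" "\<And>n. Lp_vec p M (g n)" "Lp_vec p M g0"
  and lim: "(\<lambda>n. Lp_int p M (\<lambda>x. f n x - f0 x)) \<longlonglongrightarrow> 0" "(\<lambda>n. Lp_int p M (\<lambda>x. g n x - g0 x)) \<longlonglongrightarrow> 0"
 shows "(\<lambda>n. Lp_int p M (\<lambda>x. (f n x - g n x) - (f0 x - g0 x))) \<longlonglongrightarrow> 0"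
proof -
 have "(\<lambda>n. 2 powr (p - 1) * (Lp_int p M (\<lambda>x. f n x - f0 x) + Lp_int p M (\<lambda>x. g n x - g0 x))) \<longlonglongrightarrow> 2 powr (p - 1) * (0 + 0)"
  by (intro tendsto_intros lim)
 then have l: "(\<lambda>n. 2 powr (p - 1) * (Lp_int p M (\<lambda>x. f n x - f0 x) + Lp_int p M (\<lambda>x. g n x - g0 x))) \<longlonglongrightarrow> 0" by simp
 have "Lp_int p M (\<lambda>x. (f n x - g n x) - (f0 x - g0 x)) \<le> 2 powr (p - 1) * (Lp_int p M (\<lambda>x. f n x - f0 x) + Lp_int p M (\<lambda>x. g n x - g0 x))" for n
  using Lp_int_diff_le[OF p Lp_vec_diff[OF p L(1)[of n] L(2)] Lp_vec_diff[OF p L(3)[of n] L(4)]] by (simp add: algebra_simps)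
 then show ?thesis by (intro tendsto_sandwich[OF _ _ tendsto_const l]) auto
qed

lemma Lp_int_zero_AE:
 assumes "Lp_vec p M f" "Lp_int p M f \<le> 0"
 shows "AE x in M. f x = 0"
proof -
 have "Lp_int p M f = 0" using assms(2) Lp_int_nonneg[of p M f] by linarith
 then have "AE x in M. norm (f x) powr p = 0"
  unfolding Lp_int_def using integral_nonneg_eq_0_iff_AE[OF Lp_vec_integrable[OF assms(1)]] by simp
 then show ?thesis by simp
qed

lemma Lp_limit_unique:
 assumes p: "1 \<le> p" and L: "\<And>n. Lp_vec p M (f n)" "Lp_vec p M g" "Lp_vec p M h"
  and lim: "(\<lambda>n. Lp_int p M (\<lambda>x. f n x - g x)) \<longlonglongrightarrow> 0" "(\<lambda>n. Lp_int p M (\<lambda>x. f n x - h x)) \<longlonglongrightarrow> 0"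
 shows "AE x in M. g x = h x"
proof -
 have "(\<lambda>n. Lp_int p M (\<lambda>x. (f n x - f n x) - (g x - h x))) \<longlonglongrightarrow> 0"
  by (rule Lp_diff_tendsto[OF p L(1,2) L(1,3) lim])
 then have "Lp_int p M (\<lambda>x. - (g x - h x)) \<le> 0" by (simp add: tendsto_const_iff)
 then have "Lp_int p M (\<lambda>x. g x - h x) \<le> 0" unfolding Lp_int_uminus .
 from Lp_int_zero_AE[OF Lp_vec_diff[OF p L(2,3)] this] show ?thesis by simp
qed

locale cusp_trace = cusp k \<gamma> for k :: "'n::finite" and \<gamma> :: "real \<Rightarrow> real" +
 fixes p :: real
 assumes p: "1 < p"
begin

lemma p1: "1 \<le> p" using p by simp

abbreviation "bm \<equiv> boundary_measure k \<gamma>"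

text \<open>With the weight absorbed into the measure, the weighted boundary space becomes an
  ordinary L^p space and the general lemmas on \<open>Lp_vec\<close> and \<open>Lp_int\<close>
  apply.\<close>

definition \<mu> :: "(real^'n) measure" where
 "\<mu> = density bm (\<lambda>x. ennreal (cusp_weight k \<gamma> x))"

lemma sets_\<mu> [measurable_cong]: "sets \<mu> = sets bm" by (simp add: \<mu>_def)

lemma measurable_\<mu>: "f \<in> borel_measurable \<mu> \<longleftrightarrow> f \<in> borel_measurable bm"
 by (simp add: \<mu>_def)

lemma bdry_int_eq:
 assumes [measurable]: "T \<in> borel_measurable bm"
 shows "bdry_int k \<gamma> p T = (\<integral>\<^sup>+x. ennreal (norm (T x) powr p) \<partial>\<mu>)"
 unfolding bdry_int_def \<mu>_def
 by (subst nn_integral_density) (auto simp: ennreal_mult cusp_weight_bounds mult.commute)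

lemma Lp_\<mu>_iff: "Lp_vec p \<mu> T \<longleftrightarrow> T \<in> borel_measurable bm \<and> bdry_int k \<gamma> p T < \<infinity>"
proof (cases "T \<in> borel_measurable bm")
 case True
 have m: "(\<lambda>x. norm (T x) powr p) \<in> borel_measurable \<mu>" using True unfolding measurable_\<mu>[symmetric] by measurable
 have "integrable \<mu> (\<lambda>x. norm (T x) powr p) \<longleftrightarrow> (\<integral>\<^sup>+x. ennreal (norm (norm (T x) powr p)) \<partial>\<mu>) < \<infinity>"
  unfolding integrable_iff_bounded using m by simp
 also have "(\<integral>\<^sup>+x. ennreal (norm (norm (T x) powr p)) \<partial>\<mu>) = bdry_int k \<gamma> p T" unfolding bdry_int_eq[OF True] by simp
 finally show ?thesis using True unfolding Lp_vec_def measurable_\<mu> by blast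
qed (simp add: Lp_vec_def measurable_\<mu>)

lemma bdry_int_Lp:
 assumes "Lp_vec p \<mu> T"
 shows "bdry_int k \<gamma> p T = ennreal (Lp_int p \<mu> T)"
proof -
 have T: "T \<in> borel_measurable bm" using assms by (simp add: Lp_\<mu>_iff)
 show ?thesis unfolding bdry_int_eq[OF T] Lp_int_def
  by (rule nn_integral_eq_integral[OF Lp_vec_integrable[OF assms]]) simp
qed

lemma integral_\<mu>:
 fixes f :: "real^'n \<Rightarrow> real"
 assumes "f \<in> borel_measurable bm"
 shows "(\<integral>x. f x \<partial>\<mu>) = (\<integral>x. f x * cusp_weight k \<gamma> x \<partial>bm)"
 unfolding \<mu>_def by (subst integral_density) (use assms in \<open>auto simp: cusp_weight_bounds mult.commute\<close>)

lemma Lp_\<mu>_C1: "C1_fun v G \<Longrightarrow> Lp_vec p \<mu> v"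
proof -
 assume C: "C1_fun v G"
 obtain K where K: "\<And>v G. C1_fun v G \<Longrightarrow> bdry_int k \<gamma> p v \<le> ennreal (1 * Lp_int p MW G + K * Lp_int p MW v)"
  by (rule trace_inequality_C1[OF p zero_less_one]) (rule that)
 have "bdry_int k \<gamma> p v < \<infinity>" by (rule le_less_trans[OF K[OF C]]) simp
 then show ?thesis unfolding Lp_\<mu>_iff using continuous_imp_bm_measurable[OF C1_fun_measurable(1)[OF C]] by simp
qed

text \<open>Naming the constant as a function of \<epsilon> lets all later estimates use the same
  one, independent of the function.\<close>

definition tr_const :: "real \<Rightarrow> real" where
 "tr_const \<epsilon> = (SOME C. 0 \<le> C \<and> (\<forall>v G. C1_fun v G \<longrightarrow> Lp_int p \<mu> v \<le> \<epsilon> * Lp_int p MW G + C * Lp_int p MW v))"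

lemma tr_const:
 assumes e: "0 < e"
 shows "0 \<le> tr_const e" "C1_fun v G \<Longrightarrow> Lp_int p \<mu> v \<le> e * Lp_int p MW G + tr_const e * Lp_int p MW v"
proof -
 obtain C where C: "0 \<le> C" "\<And>v G. C1_fun v G \<Longrightarrow> bdry_int k \<gamma> p v \<le> ennreal (e * Lp_int p MW G + C * Lp_int p MW v)"
  by (rule trace_inequality_C1[OF p e]) (rule that)
 have "Lp_int p \<mu> v \<le> e * Lp_int p MW G + C * Lp_int p MW v" if "C1_fun v G" for v G
 proof -
  have "0 \<le> e * Lp_int p MW G + C * Lp_int p MW v" using e C(1) by simp
  then show ?thesis using C(2)[OF that] unfolding bdry_int_Lp[OF Lp_\<mu>_C1[OF that]] by (simp add: ennreal_le_iff)
 qed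
 then have "\<exists>C. 0 \<le> C \<and> (\<forall>v G. C1_fun v G \<longrightarrow> Lp_int p \<mu> v \<le> e * Lp_int p MW G + C * Lp_int p MW v)" using C(1) by blast
 from someI_ex[OF this, folded tr_const_def]
 show "0 \<le> tr_const e" "C1_fun v G \<Longrightarrow> Lp_int p \<mu> v \<le> e * Lp_int p MW G + tr_const e * Lp_int p MW v" by auto
qed

text \<open>The constant 1 is a C1 function, so the trace inequality already bounds the total
  weighted mass.\<close>

lemma finite_\<mu>: "finite_measure \<mu>"
proof (rule finite_measureI)
 have "bdry_int k \<gamma> p (\<lambda>x. 1) < \<infinity>" using Lp_\<mu>_C1[OF C1_fun_const[of 1]] unfolding Lp_\<mu>_iff by simp
 moreover have "bdry_int k \<gamma> p (\<lambda>x. 1) = (\<integral>\<^sup>+x. ennreal 1 \<partial>\<mu>)" by (subst bdry_int_eq) auto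
 ultimately show "emeasure \<mu> (space \<mu>) \<noteq> \<infinity>" by simp
qed

text \<open>Traces obtained from C1 approximations; by the trace inequality they agree with those defined through functions
  continuous up to the boundary.\<close>

definition tr :: "(real^'n \<Rightarrow> real) \<Rightarrow> (real^'n \<Rightarrow> real^'n) \<Rightarrow> (real^'n \<Rightarrow> real) \<Rightarrow> bool" where
 "tr u g T \<longleftrightarrow> W1p_pair p W u g \<and> Lp_vec p \<mu> T \<and>
   (\<exists>v G. (\<forall>j::nat. C1_fun (v j) (G j)) \<and> (\<lambda>j. Lp_int p MW (\<lambda>x. v j x - u x)) \<longlonglongrightarrow> 0 \<and>
    (\<lambda>j. Lp_int p MW (\<lambda>x. G j x - g x)) \<longlonglongrightarrow> 0 \<and> (\<lambda>j. Lp_int p \<mu> (\<lambda>x. v j x - T x)) \<longlonglongrightarrow> 0)"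

lemma trD:
 assumes "tr u g T"
 shows "W1p_pair p W u g" "Lp_vec p MW u" "Lp_vec p MW g" "Lp_vec p \<mu> T"
 using assms by (auto simp: tr_def W1p_pair_def)

lemma C1_Lp: "C1_fun v G \<Longrightarrow> Lp_vec p MW v" "C1_fun v G \<Longrightarrow> Lp_vec p MW G"
 using W1p_pair_C1[OF dom_open dom_bounded, of v G p] p by (auto simp: W1p_pair_def)

lemma tr_le:
 assumes u: "tr u g T" and e: "0 < e"
 shows "Lp_int p \<mu> T \<le> e * Lp_int p MW g + tr_const e * Lp_int p MW u"
proof -
 obtain v G where v: "\<And>j::nat. C1_fun (v j) (G j)" "(\<lambda>j. Lp_int p MW (\<lambda>x. v j x - u x)) \<longlonglongrightarrow> 0"
  "(\<lambda>j. Lp_int p MW (\<lambda>x. G j x - g x)) \<longlonglongrightarrow> 0" "(\<lambda>j. Lp_int p \<mu> (\<lambda>x. v j x - T x)) \<longlonglongrightarrow> 0"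
  using u unfolding tr_def by blast
 note D = trD[OF u]
 have "(\<lambda>j. Lp_int p \<mu> (v j)) \<longlonglongrightarrow> Lp_int p \<mu> T"
  by (rule Lp_int_tendsto[OF p1 Lp_\<mu>_C1[OF v(1)] D(4) v(4)])
 moreover have "(\<lambda>j. e * Lp_int p MW (G j) + tr_const e * Lp_int p MW (v j)) \<longlonglongrightarrow> e * Lp_int p MW g + tr_const e * Lp_int p MW u"
  by (intro tendsto_intros Lp_int_tendsto[OF p1 C1_Lp(1)[OF v(1)] D(2) v(2)] Lp_int_tendsto[OF p1 C1_Lp(2)[OF v(1)] D(3) v(3)])
 ultimately show ?thesis
  by (rule LIMSEQ_le) (use tr_const(2)[OF e v(1)] in auto)
qed

lemma tr_diff:
 assumes "tr u g T" "tr v h S"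
 shows "tr (\<lambda>x. u x - v x) (\<lambda>x. g x - h x) (\<lambda>x. T x - S x)"
proof -
 obtain a A where a: "\<And>j::nat. C1_fun (a j) (A j)" "(\<lambda>j. Lp_int p MW (\<lambda>x. a j x - u x)) \<longlonglongrightarrow> 0"
  "(\<lambda>j. Lp_int p MW (\<lambda>x. A j x - g x)) \<longlonglongrightarrow> 0" "(\<lambda>j. Lp_int p \<mu> (\<lambda>x. a j x - T x)) \<longlonglongrightarrow> 0"
  using assms(1) unfolding tr_def by blast
 obtain b B where b: "\<And>j::nat. C1_fun (b j) (B j)" "(\<lambda>j. Lp_int p MW (\<lambda>x. b j x - v x)) \<longlonglongrightarrow> 0"
  "(\<lambda>j. Lp_int p MW (\<lambda>x. B j x - h x)) \<longlonglongrightarrow> 0" "(\<lambda>j. Lp_int p \<mu> (\<lambda>x. b j x - S x)) \<longlonglongrightarrow> 0"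
  using assms(2) unfolding tr_def by blast
 note D = trD[OF assms(1)] and F = trD[OF assms(2)]
 show ?thesis
  unfolding tr_def
  by (intro conjI exI[of _ "\<lambda>j x. a j x - b j x"] exI[of _ "\<lambda>j x. A j x - B j x"] allI
    W1p_pair_diff[OF dom_open p1 D(1) F(1)] Lp_vec_diff[OF p1 D(4) F(4)] C1_fun_diff a(1) b(1)
    Lp_diff_tendsto[OF p1 C1_Lp(1)[OF a(1)] D(2) C1_Lp(1)[OF b(1)] F(2) a(2) b(2)]
    Lp_diff_tendsto[OF p1 C1_Lp(2)[OF a(1)] D(3) C1_Lp(2)[OF b(1)] F(3) a(3) b(3)]
    Lp_diff_tendsto[OF p1 Lp_\<mu>_C1[OF a(1)] D(4) Lp_\<mu>_C1[OF b(1)] F(4) a(4) b(4)])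
qed

lemma tr_cmult:
 assumes "tr u g T"
 shows "tr (\<lambda>x. c * u x) (\<lambda>x. c *\<^sub>R g x) (\<lambda>x. c * T x)"
proof -
 obtain v G where v: "\<And>j::nat. C1_fun (v j) (G j)" "(\<lambda>j. Lp_int p MW (\<lambda>x. v j x - u x)) \<longlonglongrightarrow> 0"
  "(\<lambda>j. Lp_int p MW (\<lambda>x. G j x - g x)) \<longlonglongrightarrow> 0" "(\<lambda>j. Lp_int p \<mu> (\<lambda>x. v j x - T x)) \<longlonglongrightarrow> 0"
  using assms unfolding tr_def by blast
 note D = trD[OF assms]
 have C: "C1_fun (\<lambda>x. c * v j x) (\<lambda>x. c *\<^sub>R G j x)" for j
  unfolding C1_fun_def inner_scaleR_left
  by (intro conjI allI has_derivative_mult_right continuous_on_scaleR continuous_on_const)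
   (use v(1)[of j] in \<open>simp_all add: C1_fun_def\<close>)
 have lim: "(\<lambda>j. Lp_int p M (\<lambda>x. c *\<^sub>R F j x - c *\<^sub>R f x)) \<longlonglongrightarrow> 0" if "(\<lambda>j. Lp_int p M (\<lambda>x. F j x - f x)) \<longlonglongrightarrow> 0"
  for M :: "(real^'n) measure" and F :: "nat \<Rightarrow> real^'n \<Rightarrow> 'b::euclidean_space" and f
  using tendsto_mult_left[OF that, of "\<bar>c\<bar> powr p"] unfolding scaleR_diff_right[symmetric] Lp_int_scaleR by simp
 show ?thesis
  unfolding tr_def
  using C W1p_pair_cmult[OF D(1), of c] Lp_vec_scaleR[OF D(4), of c] lim[OF v(2)] lim[OF v(3)] lim[OF v(4)]
  by (intro conjI exI[of _ "\<lambda>j x. c * v j x"] exI[of _ "\<lambda>j x. c *\<^sub>R G j x"]) simp_all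
qed

text \<open>C1 approximations are Cauchy on the boundary by the trace inequality applied to their
  differences. If u is continuous on the closure, the same approximations converge uniformly there,
  and \<mu> is finite, so the limit is u.\<close>

lemma tr_exists:
 assumes u: "W1p_pair p W u g"
 shows "\<exists>T. tr u g T" "continuous_on (closure W) u \<Longrightarrow> tr u g u"
proof -
 obtain v G where v: "\<And>j::nat. C1_fun (v j) (G j)" "(\<lambda>j. Lp_int p MW (\<lambda>x. v j x - u x)) \<longlonglongrightarrow> 0"
  "(\<lambda>j. Lp_int p MW (\<lambda>x. G j x - g x)) \<longlonglongrightarrow> 0"
  "\<And>\<epsilon>. continuous_on (closure W) u \<Longrightarrow> 0 < \<epsilon> \<Longrightarrow> \<exists>N. \<forall>j\<ge>N. \<forall>x\<in>closure W. \<bar>v j x - u x\<bar> \<le> \<epsilon>"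
  by (rule W1p_dense_C1[OF p u]) (rule that)
 have uL: "Lp_vec p MW u" "Lp_vec p MW g" using u by (auto simp: W1p_pair_def)
 have Cauchy: "\<exists>N. \<forall>m\<ge>N. \<forall>n\<ge>N. Lp_int p \<mu> (\<lambda>x. v m x - v n x) < e" if e: "0 < e" for e
 proof -
  \<comment> \<open>Combines the quasi-triangle constant with the trace constant at \<epsilon> = 1,
    so errors below e / (2 K) inside the domain give less than e on the boundary.\<close>
  define K where "K = 2 powr (p - 1) * (1 + tr_const 1)"
  have K: "0 < K" using tr_const(1)[of 1] by (simp add: K_def)
  have "0 < e / (2 * K)" using e K by simp
  then have "\<forall>\<^sub>F j in sequentially. Lp_int p MW (\<lambda>x. v j x - u x) < e / (2 * K) \<and> Lp_int p MW (\<lambda>x. G j x - g x) < e / (2 * K)"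
   by (intro eventually_conj order_tendstoD(2)[OF v(2)] order_tendstoD(2)[OF v(3)])
  then obtain N where N: "\<And>j. N \<le> j \<Longrightarrow> Lp_int p MW (\<lambda>x. v j x - u x) < e / (2 * K)" "\<And>j. N \<le> j \<Longrightarrow> Lp_int p MW (\<lambda>x. G j x - g x) < e / (2 * K)"
   unfolding eventually_sequentially by blast
  have "Lp_int p \<mu> (\<lambda>x. v m x - v n x) < e" if mn: "N \<le> m" "N \<le> n" for m n
  proof -
   let ?q = "2 powr (p - 1)"
   have 1: "Lp_int p MW (\<lambda>x. v m x - v n x) \<le> ?q * (Lp_int p MW (\<lambda>x. v m x - u x) + Lp_int p MW (\<lambda>x. u x - v n x))"
    by (rule Lp_int_triangle[OF p1 C1_Lp(1)[OF v(1)] uL(1) C1_Lp(1)[OF v(1)]])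
   have 2: "Lp_int p MW (\<lambda>x. G m x - G n x) \<le> ?q * (Lp_int p MW (\<lambda>x. G m x - g x) + Lp_int p MW (\<lambda>x. g x - G n x))"
    by (rule Lp_int_triangle[OF p1 C1_Lp(2)[OF v(1)] uL(2) C1_Lp(2)[OF v(1)]])
   have s: "?q * (a + b) < ?q * (e / K)" if "a < e / (2 * K)" "b < e / (2 * K)" for a b
   proof -
    have "e / K = e / (2 * K) + e / (2 * K)" by simp
    then show ?thesis using that by (intro mult_strict_left_mono) auto
   qed
   have 3: "Lp_int p MW (\<lambda>x. v m x - v n x) < ?q * (e / K)" "Lp_int p MW (\<lambda>x. G m x - G n x) < ?q * (e / K)"
    using le_less_trans[OF 1 s] le_less_trans[OF 2 s] N mn Lp_int_minus_commute[of p MW u] Lp_int_minus_commute[of p MW g] by auto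
   have "Lp_int p \<mu> (\<lambda>x. v m x - v n x) \<le> 1 * Lp_int p MW (\<lambda>x. G m x - G n x) + tr_const 1 * Lp_int p MW (\<lambda>x. v m x - v n x)"
    by (rule tr_const(2)[OF zero_less_one C1_fun_diff[OF v(1) v(1)]])
   also have "\<dots> < 1 * (?q * (e / K)) + tr_const 1 * (?q * (e / K))"
    by (intro add_less_le_mono mult_strict_left_mono mult_left_mono 3 less_imp_le[OF 3(1)] tr_const(1)) auto
   also have "\<dots> = K * (e / K)" by (simp only: K_def distrib_left distrib_right mult_1 mult.assoc mult.left_commute mult_1_right)
   finally show ?thesis using K by simp
  qed
  then show ?thesis by blast
 qed
 obtain T where T: "Lp_vec p \<mu> T" "(\<lambda>n. Lp_int p \<mu> (\<lambda>x. v n x - T x)) \<longlonglongrightarrow> 0"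
  by (rule Lp_complete[OF p Lp_\<mu>_C1[OF v(1)] Cauchy]) (use that in auto)
 then show "\<exists>T. tr u g T" unfolding tr_def using u v by blast
 assume c: "continuous_on (closure W) u"
 interpret \<mu>: finite_measure \<mu> by (rule finite_\<mu>)
 have fr: "frontier W \<subseteq> closure W" by (auto simp: frontier_def)
 have sp: "space \<mu> = frontier W" by (simp add: \<mu>_def space_boundary_measure)
 have um: "u \<in> borel_measurable \<mu>"
  unfolding measurable_\<mu> by (subst measurable_cong_sets[OF sets_boundary_measure refl])
   (rule borel_measurable_continuous_on_restrict[OF continuous_on_subset[OF c fr]])
 have "bounded (u ` closure W)" by (intro compact_imp_bounded compact_continuous_image c compact_closure_dom)
 then obtain B where B: "\<And>x. x \<in> closure W \<Longrightarrow> norm (u x) \<le> B" by (auto simp: bounded_iff)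
 have uT: "Lp_vec p \<mu> u" by (rule Lp_vec_const_bounded[OF finite_\<mu> um, of B]) (use B fr sp p in auto)
 have "(\<lambda>j. Lp_int p \<mu> (\<lambda>x. v j x - u x)) \<longlonglongrightarrow> 0"
 proof (rule LIMSEQ_I)
  fix e :: real assume e: "0 < e"
  define m where "m = measure \<mu> (space \<mu>)"
  have m: "0 \<le> m" by (simp add: m_def)
  define d where "d = (e / (m + 1)) powr (1 / p)"
  have d: "0 < d" "d powr p = e / (m + 1)" using e m p by (auto simp: d_def powr_powr)
  obtain N where N: "\<And>j x. N \<le> j \<Longrightarrow> x \<in> closure W \<Longrightarrow> \<bar>v j x - u x\<bar> \<le> d" using v(4)[OF c d(1)] by blast
  have "norm (Lp_int p \<mu> (\<lambda>x. v j x - u x) - 0) < e" if "N \<le> j" for j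
  proof -
   have "Lp_int p \<mu> (\<lambda>x. v j x - u x) \<le> (\<integral>x. d powr p \<partial>\<mu>)"
    unfolding Lp_int_def
    by (rule integral_mono[OF Lp_vec_integrable[OF Lp_vec_diff[OF p1 Lp_\<mu>_C1[OF v(1)] uT]]])
     (use N[OF that] fr sp p in \<open>auto intro!: powr_mono2\<close>)
   also have "\<dots> = m * (e / (m + 1))" by (simp add: d(2) m_def)
   also have "\<dots> < e" using e m by (simp add: field_simps)
   finally show ?thesis by simp
  qed
  then show "\<exists>N. \<forall>j\<ge>N. norm (Lp_int p \<mu> (\<lambda>x. v j x - u x) - 0) < e" by blast
 qed
 then show "tr u g u" unfolding tr_def using u uT v by blast
qed

end

section \<open>Identification of traces, first variation and eigenfunctions\<close>

lemma powr_mult_square: "0 \<le> a \<Longrightarrow> a powr (p - 2) * (a * a) = a powr p" for a p :: real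
proof (cases "a = 0")
 case False
 assume "0 \<le> a"
 then have "a * a = a powr 2" using False by (simp add: powr_numeral power2_eq_square)
 then show ?thesis by (simp add: powr_add[symmetric])
qed simp

text \<open>With f the sum of the midpoint and half the difference, the weighted inequality forces
  the midpoint to carry almost all of the unit mass. The threshold D is uniform in the measure and
  the functions.\<close>

lemma Lp_int_midpoint_lower:
 fixes p H :: real
 assumes p: "1 \<le> p" and H: "0 < H" "H < 1"
 obtains D where "0 < D" "\<And>(M :: 'a measure) f g :: 'a \<Rightarrow> real. Lp_vec p M f \<Longrightarrow> Lp_vec p M g \<Longrightarrow> Lp_int p M f = 1 \<Longrightarrow>
  Lp_int p M (\<lambda>x. f x - g x) < D \<Longrightarrow> 1 - H < Lp_int p M (\<lambda>x. (1/2) *\<^sub>R (f x + g x))"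
proof -
 have "((\<lambda>t. (1 - t) powr (1 - p) * (1 - H)) \<longlongrightarrow> (1 - 0) powr (1 - p) * (1 - H)) (at_right 0)"
  by (intro tendsto_intros) auto
 then have "\<forall>\<^sub>F t in at_right 0. (1 - t) powr (1 - p) * (1 - H) < 1 - H / 2"
  by (rule order_tendstoD(2)) (use H in simp)
 moreover have "\<forall>\<^sub>F t in at_right (0::real). t < 1" by (rule eventually_at_right_real[THEN eventually_mono]) auto
 moreover have "\<forall>\<^sub>F t in at_right (0::real). 0 < t" by (simp add: eventually_at_right_less)
 ultimately have "\<forall>\<^sub>F t in at_right 0. (1 - t) powr (1 - p) * (1 - H) < 1 - H / 2 \<and> t < 1 \<and> 0 < t"
  by (intro eventually_conj)
 then obtain t :: real where t: "(1 - t) powr (1 - p) * (1 - H) < 1 - H / 2" "t < 1" "0 < t"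
  by (metis (mono_tags, lifting) eventually_happens' trivial_limit_at_right_real)
 \<comment> \<open>Calibrated so that the difference contributes at most H/2 after multiplication by
   \<open>t powr (1 - p)\<close>.\<close>
 define D where "D = t powr (p - 1) * (H / 2)"
 have D: "0 < D" "t powr (1 - p) * D = H / 2" using t(3) H by (auto simp: D_def powr_add[symmetric] mult.assoc[symmetric])
 show ?thesis
 proof (rule that[OF D(1)])
  fix M :: "'a measure" and f g :: "'a \<Rightarrow> real"
  assume L: "Lp_vec p M f" "Lp_vec p M g" and 1: "Lp_int p M f = 1" and d: "Lp_int p M (\<lambda>x. f x - g x) < D"
  let ?h = "\<lambda>x. (1/2) *\<^sub>R (f x + g x)" and ?d = "\<lambda>x. (1/2) *\<^sub>R (f x - g x)"
  have Lh: "Lp_vec p M ?h" "Lp_vec p M ?d" by (intro Lp_vec_scaleR Lp_vec_add Lp_vec_diff p L)+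
  have "Lp_int p M (\<lambda>x. ?h x + ?d x) \<le> (1 - t) powr (1 - p) * Lp_int p M ?h + t powr (1 - p) * Lp_int p M ?d"
   by (rule Lp_int_add_le_weighted[OF p Lh t(3,2)])
  moreover have "(\<lambda>x. ?h x + ?d x) = f" by (auto simp: field_simps)
  ultimately have 2: "1 \<le> (1 - t) powr (1 - p) * Lp_int p M ?h + t powr (1 - p) * Lp_int p M ?d" using 1 by simp
  have "(1/2) powr p \<le> (1::real)" using p powr_mono2[of p "1/2" 1] by simp
  then have "Lp_int p M ?d \<le> 1 * Lp_int p M (\<lambda>x. f x - g x)" unfolding Lp_int_scaleR by (intro mult_right_mono) auto
  then have "t powr (1 - p) * Lp_int p M ?d \<le> t powr (1 - p) * D" using d by (intro mult_left_mono) auto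
  then have 3: "1 - H / 2 \<le> (1 - t) powr (1 - p) * Lp_int p M ?h" using 2 D(2) by simp
  show "1 - H < Lp_int p M ?h"
  proof (rule ccontr)
   assume "\<not> 1 - H < Lp_int p M ?h"
   then have "(1 - t) powr (1 - p) * Lp_int p M ?h \<le> (1 - t) powr (1 - p) * (1 - H)" by (intro mult_left_mono) auto
   then show False using 3 t(1) by linarith
  qed
 qed
qed

context cusp_trace
begin

lemma tr_add:
 assumes "tr u g T" "tr v h S"
 shows "tr (\<lambda>x. u x + c * v x) (\<lambda>x. g x + c *\<^sub>R h x) (\<lambda>x. T x + c * S x)"
 using tr_diff[OF assms(1) tr_cmult[OF assms(2), of "- c"]] by simp

lemma tr_imp_is_trace:
 assumes "tr u g T"
 shows "is_trace k \<gamma> p u T"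
proof -
 obtain v G where v: "\<And>j::nat. C1_fun (v j) (G j)" "(\<lambda>j. Lp_int p MW (\<lambda>x. v j x - u x)) \<longlonglongrightarrow> 0"
  "(\<lambda>j. Lp_int p MW (\<lambda>x. G j x - g x)) \<longlonglongrightarrow> 0" "(\<lambda>j. Lp_int p \<mu> (\<lambda>x. v j x - T x)) \<longlonglongrightarrow> 0"
  using assms unfolding tr_def by blast
 note D = trD[OF assms]
 have P: "W1p_pair p W (v j) (G j)" for j using W1p_pair_C1[OF dom_open dom_bounded v(1)] p by simp
 have E: "energy p W (\<lambda>x. v j x - u x) = Lp_int p MW (\<lambda>x. G j x - g x) + Lp_int p MW (\<lambda>x. v j x - u x)" for j
  by (rule energy_eq_pair[OF dom_open W1p_pair_diff[OF dom_open p1 P D(1)]])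
 have B: "bdry_int k \<gamma> p (\<lambda>x. v j x - T x) = ennreal (Lp_int p \<mu> (\<lambda>x. v j x - T x))" for j
  by (rule bdry_int_Lp[OF Lp_vec_diff[OF p1 Lp_\<mu>_C1[OF v(1)] D(4)]])
 have "(\<lambda>j. energy p W (\<lambda>x. v j x - u x)) \<longlonglongrightarrow> 0"
  unfolding E using tendsto_add[OF v(3) v(2)] by simp
 moreover have "(\<lambda>j. bdry_int k \<gamma> p (\<lambda>x. v j x - T x)) \<longlonglongrightarrow> 0"
  unfolding B using tendsto_ennrealI[OF v(4)] by simp
 ultimately show ?thesis
  unfolding is_trace_def using D(4) P C1_fun_continuous(1)[OF v(1)] unfolding Lp_\<mu>_iff W1p_iff_pair by blast
qed

text \<open>The approximants in \<open>is_trace\<close> are merely Sobolev functions continuous up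
  to the boundary. Each is its own trace in the sense of \<open>tr\<close>, so the trace inequality
  applied to v j - u makes them converge to T' as well.\<close>

lemma is_trace_unique:
 assumes T: "is_trace k \<gamma> p u T" and T': "tr u g T'"
 shows "Lp_vec p \<mu> T" "AE x in \<mu>. T x = T' x"
proof -
 obtain v where v: "\<And>j::nat. W1p p W (v j)" "\<And>j. continuous_on (closure W) (v j)"
  "(\<lambda>j. energy p W (\<lambda>x. v j x - u x)) \<longlonglongrightarrow> 0" "(\<lambda>j. bdry_int k \<gamma> p (\<lambda>x. v j x - T x)) \<longlonglongrightarrow> 0"
  using T unfolding is_trace_def by blast
 show TL: "Lp_vec p \<mu> T" unfolding Lp_\<mu>_iff using T by (simp add: is_trace_def)
 have P: "W1p_pair p W (v j) (wgrad W (v j))" for j by (rule W1p_pair_wgrad[OF dom_open v(1)])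
 have tv: "tr (v j) (wgrad W (v j)) (v j)" for j by (rule tr_exists(2)[OF P v(2)])
 have L: "Lp_vec p \<mu> (v j)" for j using trD(4)[OF tv] .
 have td: "tr (\<lambda>x. v j x - u x) (\<lambda>x. wgrad W (v j) x - g x) (\<lambda>x. v j x - T' x)" for j by (rule tr_diff[OF tv T'])
 let ?K = "1 + tr_const 1"
 have le: "Lp_int p \<mu> (\<lambda>x. v j x - T' x) \<le> ?K * energy p W (\<lambda>x. v j x - u x)" for j
 proof -
  have "Lp_int p \<mu> (\<lambda>x. v j x - T' x) \<le> 1 * Lp_int p MW (\<lambda>x. wgrad W (v j) x - g x) + tr_const 1 * Lp_int p MW (\<lambda>x. v j x - u x)"
   by (rule tr_le[OF td]) simp
  also have "\<dots> \<le> ?K * Lp_int p MW (\<lambda>x. wgrad W (v j) x - g x) + ?K * Lp_int p MW (\<lambda>x. v j x - u x)"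
   using tr_const(1)[of 1] by (intro add_mono mult_right_mono) auto
  also have "\<dots> = ?K * energy p W (\<lambda>x. v j x - u x)"
   unfolding energy_eq_pair[OF dom_open trD(1)[OF td]] by (simp only: distrib_left)
  finally show ?thesis .
 qed
 have b: "(\<lambda>j. ?K * energy p W (\<lambda>x. v j x - u x)) \<longlonglongrightarrow> 0" by (rule tendsto_mult_right_zero[OF v(3)])
 have l1: "(\<lambda>j. Lp_int p \<mu> (\<lambda>x. v j x - T' x)) \<longlonglongrightarrow> 0"
  by (rule tendsto_sandwich[OF always_eventually[OF allI] always_eventually[OF allI] tendsto_const b]) (rule Lp_int_nonneg, rule le)
 have "(\<lambda>j. ennreal (Lp_int p \<mu> (\<lambda>x. v j x - T x))) \<longlonglongrightarrow> ennreal 0"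
  using v(4) unfolding bdry_int_Lp[OF Lp_vec_diff[OF p1 L TL]] by simp
 then have l2: "(\<lambda>j. Lp_int p \<mu> (\<lambda>x. v j x - T x)) \<longlonglongrightarrow> 0" by (subst (asm) tendsto_ennreal_iff) auto
 show "AE x in \<mu>. T x = T' x" by (rule Lp_limit_unique[OF p1 L TL trD(4)[OF T'] l2 l1])
qed

text \<open>The function chosen by SOME agrees a.e. with any T related by \<open>tr\<close>, so it
  may replace T wherever an integral is taken.\<close>

lemma tr_trace:
 assumes "tr u g T"
 shows "tr u g (trace k \<gamma> p u)" "AE x in \<mu>. trace k \<gamma> p u x = T x" "Lpw_norm k \<gamma> p u = Lp_int p \<mu> T powr (1 / p)" "W1p_Lpw k \<gamma> p u"
proof -
 have it: "is_trace k \<gamma> p u T" by (rule tr_imp_is_trace[OF assms])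
 then have "is_trace k \<gamma> p u (trace k \<gamma> p u)" unfolding trace_def by (rule someI[of "is_trace k \<gamma> p u"])
 note U = is_trace_unique[OF this assms]
 show ae: "AE x in \<mu>. trace k \<gamma> p u x = T x" by (rule U(2))
 note D = trD[OF assms]
 obtain v G where v: "\<And>j::nat. C1_fun (v j) (G j)" "(\<lambda>j. Lp_int p MW (\<lambda>x. v j x - u x)) \<longlonglongrightarrow> 0"
  "(\<lambda>j. Lp_int p MW (\<lambda>x. G j x - g x)) \<longlonglongrightarrow> 0" "(\<lambda>j. Lp_int p \<mu> (\<lambda>x. v j x - T x)) \<longlonglongrightarrow> 0"
  using assms unfolding tr_def by blast
 note [measurable] = Lp_vec_measurable[OF D(4)] Lp_vec_measurable[OF U(1)] Lp_vec_measurable[OF Lp_\<mu>_C1[OF v(1)]]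
 have "Lp_int p \<mu> (\<lambda>x. v j x - trace k \<gamma> p u x) = Lp_int p \<mu> (\<lambda>x. v j x - T x)" for j
  by (rule Lp_int_cong_AE) (use ae in auto)
 then show "tr u g (trace k \<gamma> p u)" unfolding tr_def using D(1) U(1) v by (auto intro!: exI[of _ v] exI[of _ G])
 have "Lp_int p \<mu> (trace k \<gamma> p u) = Lp_int p \<mu> T" by (rule Lp_int_cong_AE[OF _ _ ae]) auto
 then show "Lpw_norm k \<gamma> p u = Lp_int p \<mu> T powr (1 / p)"
  unfolding Lpw_norm_def bdry_int_Lp[OF U(1)] by simp
 show "W1p_Lpw k \<gamma> p u" unfolding W1p_Lpw_def W1p_iff_pair using D(1) it by blast
qed

lemma tr_W1p:
 assumes "W1p p W u"
 shows "tr u (wgrad W u) (trace k \<gamma> p u)"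
 using tr_exists(1)[OF W1p_pair_wgrad[OF dom_open assms]] tr_trace(1) by blast

lemma Lpw_norm_eq_1_iff:
 assumes "tr u g T"
 shows "Lpw_norm k \<gamma> p u = 1 \<longleftrightarrow> Lp_int p \<mu> T = 1"
proof
 assume "Lpw_norm k \<gamma> p u = 1"
 then have "(Lp_int p \<mu> T powr (1 / p)) powr p = 1" unfolding tr_trace(3)[OF assms] by simp
 then show "Lp_int p \<mu> T = 1" using p by (simp add: powr_powr)
qed (simp add: tr_trace(3)[OF assms])

abbreviation "lam \<equiv> lambda_p k \<gamma> p"

lemma tr_normalize:
 assumes u: "tr u g T" and N: "0 < Lp_int p \<mu> T"
 defines "c \<equiv> Lp_int p \<mu> T powr (- 1 / p)"
 shows "0 < c" "Lpw_norm k \<gamma> p (\<lambda>x. c * u x) = 1" "W1p_Lpw k \<gamma> p (\<lambda>x. c * u x)"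
  "energy p W (\<lambda>x. c * u x) = (Lp_int p MW g + Lp_int p MW u) / Lp_int p \<mu> T"
proof -
 show c: "0 < c" using N by (simp add: c_def)
 have "c powr p = Lp_int p \<mu> T powr ((- 1 / p) * p)" unfolding c_def powr_powr ..
 also have "(- 1 / p) * p = - 1" using p by simp
 finally have cp: "\<bar>c\<bar> powr p = 1 / Lp_int p \<mu> T" using c N by (simp add: powr_minus_divide)
 note t = tr_cmult[OF u, of c]
 have s: "Lp_int p M (\<lambda>x. c * f x) = \<bar>c\<bar> powr p * Lp_int p M f" for M and f :: "real^'n \<Rightarrow> real"
  using Lp_int_scaleR[of p M c f] by simp
 show "Lpw_norm k \<gamma> p (\<lambda>x. c * u x) = 1" unfolding Lpw_norm_eq_1_iff[OF t] s cp using N by simp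
 show "W1p_Lpw k \<gamma> p (\<lambda>x. c * u x)" by (rule tr_trace(4)[OF t])
 show "energy p W (\<lambda>x. c * u x) = (Lp_int p MW g + Lp_int p MW u) / Lp_int p \<mu> T"
  unfolding energy_eq_pair[OF dom_open trD(1)[OF t]] s Lp_int_scaleR cp by (simp add: add_divide_distrib)
qed

text \<open>The homogeneous form of the infimum: both sides scale with the p-th power, and a
  vanishing boundary norm leaves only the nonnegativity of the energy. In this form it applies to
  midpoints and to u + t v without normalization.\<close>

lemma lambda_le:
 assumes u: "tr u g T"
 shows "lam * Lp_int p \<mu> T \<le> Lp_int p MW g + Lp_int p MW u"
proof (cases "0 < Lp_int p \<mu> T")
 case True
 note t = tr_normalize[OF u True]
 have "lam \<le> (Lp_int p MW g + Lp_int p MW u) / Lp_int p \<mu> T"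
  unfolding lambda_p_def
 proof (rule cInf_lower)
  show "(Lp_int p MW g + Lp_int p MW u) / Lp_int p \<mu> T \<in> {energy p W u |u. W1p_Lpw k \<gamma> p u \<and> Lpw_norm k \<gamma> p u = 1}"
   unfolding t(4)[symmetric] using t(2,3) by blast
  show "bdd_below {energy p W u |u. W1p_Lpw k \<gamma> p u \<and> Lpw_norm k \<gamma> p u = 1}"
   by (rule bdd_belowI[of _ 0]) (use energy_nonneg in auto)
 qed
 then show ?thesis using True by (simp add: pos_le_divide_eq)
next
 case False
 then have "Lp_int p \<mu> T = 0" using Lp_int_nonneg[of p \<mu> T] by linarith
 then show ?thesis by simp
qed

lemma first_variation:
 assumes u: "tr u g T" and eq: "Lp_int p MW g + Lp_int p MW u = lam * Lp_int p \<mu> T" and v: "tr v h S"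
 shows "(\<integral>x. norm (g x) powr (p - 2) * (g x \<bullet> h x) \<partial>MW) + (\<integral>x. norm (u x) powr (p - 2) * (u x \<bullet> v x) \<partial>MW)
  = lam * (\<integral>x. norm (T x) powr (p - 2) * (T x \<bullet> S x) \<partial>\<mu>)" (is "?A + ?B = lam * ?D")
proof -
 define \<Phi> where "\<Phi> t = (Lp_int p MW (\<lambda>x. g x + t *\<^sub>R h x) + Lp_int p MW (\<lambda>x. u x + t *\<^sub>R v x)) - lam * Lp_int p \<mu> (\<lambda>x. T x + t *\<^sub>R S x)" for t
 note D = trD[OF u] and F = trD[OF v]
 have d: "(\<Phi> has_real_derivative ((p * ?A + p * ?B) - lam * (p * ?D))) (at 0)"
  unfolding \<Phi>_def
  by (intro DERIV_diff DERIV_add DERIV_cmult Lp_int_has_derivative_line[OF p] D F)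
 have "\<Phi> 0 \<le> \<Phi> t" for t
 proof -
  have "0 \<le> \<Phi> t" unfolding \<Phi>_def using lambda_le[OF tr_add[OF u v, of t]] by simp
  moreover have "\<Phi> 0 = 0" unfolding \<Phi>_def using eq by simp
  ultimately show ?thesis by simp
 qed
 then have "(p * ?A + p * ?B) - lam * (p * ?D) = 0" using DERIV_local_min[OF d, of 1] by simp
 then have "p * (?A + ?B) = p * (lam * ?D)" by (simp add: algebra_simps)
 then show ?thesis using p by simp
qed

lemma integral_trace_eq:
 assumes u: "tr u g T" and v: "tr v h S"
 shows "(\<integral>x. norm (T x) powr (p - 2) * (T x \<bullet> S x) \<partial>\<mu>) = (\<integral>x. \<bar>T x\<bar> powr (p - 2) * T x * S x * cusp_weight k \<gamma> x \<partial>bm)"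
proof -
 have [measurable]: "T \<in> borel_measurable bm" "S \<in> borel_measurable bm"
  using trD(4)[OF u] trD(4)[OF v] by (auto simp: Lp_\<mu>_iff)
 show ?thesis by (subst integral_\<mu>) (auto simp: mult.assoc)
qed

text \<open>A function vanishing a.e. has a.e. zero weak gradient, so the trace inequality kills its
  trace; a minimizer with boundary norm 1 is thus a nontrivial eigenfunction.\<close>

lemma tr_AE_zero:
 assumes u: "tr u g T" and z: "AE x in MW. u x = 0"
 shows "Lp_int p \<mu> T = 0"
proof -
 note D = trD[OF u]
 have w: "weak_grad W u g" using D(1) by (simp add: W1p_pair_def)
 have "weak_grad W (\<lambda>x. 0) g" by (rule weak_grad_cong_AE[OF dom_open w]) (use z Lp_vec_measurable[OF D(3)] in auto)
 moreover have "weak_grad W (\<lambda>x. 0) (\<lambda>x. 0)" using weak_grad_cmult[OF w, of 0] by simp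
 ultimately have "AE x in MW. g x = 0" by (rule weak_grad_unique[OF dom_open])
 then have "Lp_int p MW g = Lp_int p MW (\<lambda>x. 0 :: real^'n)" by (intro Lp_int_cong_AE Lp_vec_measurable[OF D(3)]) auto
 moreover have "Lp_int p MW u = Lp_int p MW (\<lambda>x. 0 :: real)" using z by (intro Lp_int_cong_AE Lp_vec_measurable[OF D(2)]) auto
 ultimately have "Lp_int p MW g = 0" "Lp_int p MW u = 0" by (simp_all add: Lp_int_def)
 then show ?thesis using tr_le[OF u zero_less_one] Lp_int_nonneg[of p \<mu> T] by simp
qed

lemma minimizer_eigenpair:
 assumes u: "tr u g T" and N: "Lp_int p \<mu> T = 1" and E: "Lp_int p MW g + Lp_int p MW u = lam"
 shows "is_eigenpair k \<gamma> p lam u"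
 unfolding is_eigenpair_def
proof (intro conjI allI impI)
 show "W1p_Lpw k \<gamma> p u" by (rule tr_trace(4)[OF u])
 then have uW: "W1p p W u" by (simp add: W1p_Lpw_def)
 show "\<not> (AE x in MW. u x = 0)" using tr_AE_zero[OF u] N by auto
 fix v assume v: "W1p p W v"
 note tu = tr_W1p[OF uW] and tv = tr_W1p[OF v]
 have "Lp_int p MW (wgrad W u) + Lp_int p MW u = lam"
  using E energy_eq_pair[OF dom_open trD(1)[OF u]] energy_eq_pair[OF dom_open trD(1)[OF tu]] by simp
 moreover have "Lp_int p \<mu> (trace k \<gamma> p u) = 1"
  using N Lpw_norm_eq_1_iff[OF u] Lpw_norm_eq_1_iff[OF tu] by simp
 ultimately have eq: "Lp_int p MW (wgrad W u) + Lp_int p MW u = lam * Lp_int p \<mu> (trace k \<gamma> p u)" by simp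
 show "(\<integral>x. norm (wgrad W u x) powr (p - 2) * (wgrad W u x \<bullet> wgrad W v x) \<partial>MW) + (\<integral>x. \<bar>u x\<bar> powr (p - 2) * u x * v x \<partial>MW)
  = lam * (\<integral>x. \<bar>trace k \<gamma> p u x\<bar> powr (p - 2) * trace k \<gamma> p u x * trace k \<gamma> p v x * cusp_weight k \<gamma> x \<partial>bm)"
  using first_variation[OF tu eq tv] unfolding integral_trace_eq[OF tu tv] by (simp add: mult.assoc)
qed

lemma eigenfunction_normalize:
 assumes v: "is_eigenpair k \<gamma> p lam v"
 shows "\<exists>c w. W1p_Lpw k \<gamma> p w \<and> Lpw_norm k \<gamma> p w = 1 \<and> energy p W w = lam \<and> (\<forall>x\<in>W. v x = c * w x)"
proof -
 have vW: "W1p p W v" and nz: "\<not> (AE x in MW. v x = 0)" using v by (auto simp: is_eigenpair_def W1p_Lpw_def)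
 note t = tr_W1p[OF vW]
 have "(\<integral>x. norm (wgrad W v x) powr (p - 2) * (wgrad W v x \<bullet> wgrad W v x) \<partial>MW) + (\<integral>x. \<bar>v x\<bar> powr (p - 2) * v x * v x \<partial>MW)
  = lam * (\<integral>x. \<bar>trace k \<gamma> p v x\<bar> powr (p - 2) * trace k \<gamma> p v x * trace k \<gamma> p v x * cusp_weight k \<gamma> x \<partial>bm)"
  using v vW unfolding is_eigenpair_def by blast
 then have "(\<integral>x. norm (wgrad W v x) powr (p - 2) * (wgrad W v x \<bullet> wgrad W v x) \<partial>MW) + (\<integral>x. norm (v x) powr (p - 2) * (v x \<bullet> v x) \<partial>MW)
  = lam * (\<integral>x. norm (trace k \<gamma> p v x) powr (p - 2) * (trace k \<gamma> p v x \<bullet> trace k \<gamma> p v x) \<partial>\<mu>)"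
  unfolding integral_trace_eq[OF t t] by (simp add: mult.assoc)
 moreover have pw: "norm z powr (p - 2) * (z \<bullet> z) = norm z powr p" for z :: "'b::euclidean_space"
  using powr_mult_square[of "norm z" p] by (simp add: power2_norm_eq_inner[symmetric] power2_eq_square)
 ultimately have E: "Lp_int p MW (wgrad W v) + Lp_int p MW v = lam * Lp_int p \<mu> (trace k \<gamma> p v)"
  unfolding pw Lp_int_def by simp
 \<comment> \<open>If the boundary norm vanished, the equation tested with v itself would give zero
   energy and hence v = 0 a.e., against nontriviality. This makes the normalization
   possible.\<close>
 have N: "0 < Lp_int p \<mu> (trace k \<gamma> p v)"
 proof (rule ccontr)
  assume "\<not> 0 < Lp_int p \<mu> (trace k \<gamma> p v)"
  then have "Lp_int p \<mu> (trace k \<gamma> p v) = 0" using Lp_int_nonneg[of p \<mu>] by (metis antisym_conv1)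
  then have "Lp_int p MW (wgrad W v) + Lp_int p MW v = 0" using E by simp
  then have "Lp_int p MW v \<le> 0" using Lp_int_nonneg[of p MW "wgrad W v"] by linarith
  then show False using nz Lp_int_zero_AE[OF trD(2)[OF t]] by blast
 qed
 define c where "c = Lp_int p \<mu> (trace k \<gamma> p v) powr (- 1 / p)"
 note n = tr_normalize[OF t N, folded c_def]
 have "energy p W (\<lambda>x. c * v x) = lam" unfolding n(4) E using N by simp
 then show ?thesis using n(1-3) by (intro exI[of _ "1 / c"] exI[of _ "\<lambda>x. c * v x"]) simp
qed

end

section \<open>Minimizing sequences\<close>

lemma Lp_int_midpoint_le:
 assumes "1 \<le> p" "Lp_vec p M f" "Lp_vec p M g"
 shows "Lp_int p M (\<lambda>x. (1/2) *\<^sub>R (f x + g x)) \<le> (Lp_int p M f + Lp_int p M g) / 2"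
proof -
 have "Lp_int p M (\<lambda>x. (1/2) *\<^sub>R (f x + g x)) \<le> (1/2) powr p * (2 powr (p - 1) * (Lp_int p M f + Lp_int p M g))"
  unfolding Lp_int_scaleR using Lp_int_add_le[OF assms] by (intro mult_mono) auto
 also have "(1/2) powr p * (2 powr (p - 1) * s) = s / 2" for s :: real
  by (simp add: powr_divide powr_diff)
 finally show ?thesis .
qed

context cusp_trace
begin

text \<open>The traces are close, so midpoints have boundary mass above 1 - h and energy at least
  lam (1 - h). As both endpoints have energy below lam + h, the total midpoint defect is at most h
  (lam + 1), and uniform convexity bounds the differences.\<close>

lemma minimizing_sequence_Cauchy:
 assumes t: "\<And>n::nat. tr (u n) (g n) (T n)" and N: "\<And>n. Lp_int p \<mu> (T n) = 1"
  and E: "(\<lambda>n. Lp_int p MW (g n) + Lp_int p MW (u n)) \<longlonglongrightarrow> lam"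
  and Tc: "\<And>e. 0 < e \<Longrightarrow> \<exists>N. \<forall>m\<ge>N. \<forall>n\<ge>N. Lp_int p \<mu> (\<lambda>x. T m x - T n x) < e"
  and e: "0 < e"
 shows "\<exists>N. \<forall>m\<ge>N. \<forall>n\<ge>N. Lp_int p MW (\<lambda>x. g m x - g n x) + Lp_int p MW (\<lambda>x. u m x - u n x) < e"
proof -
 define EE where "EE n = Lp_int p MW (g n) + Lp_int p MW (u n)" for n
 have lam0: "0 \<le> lam" by (rule LIMSEQ_le_const[OF E]) simp
 note L = trD(2-4)[OF t]
 \<comment> \<open>Late energies are below lam + 1, so the first term of the uniform convexity bound
   stays under e/2.\<close>
 define a where "a = e / (4 * (lam + 1))"
 have a: "0 < a" using e lam0 by (simp add: a_def)
 obtain C1 where C1: "0 \<le> C1" "\<And>(M::(real^'n) measure) f g::real^'n \<Rightarrow> real^'n. Lp_vec p M f \<Longrightarrow> Lp_vec p M g \<Longrightarrow>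
   Lp_int p M (\<lambda>x. f x - g x) \<le> a * (Lp_int p M f + Lp_int p M g) + C1 * ((Lp_int p M f + Lp_int p M g) / 2 - Lp_int p M (\<lambda>x. (1/2) *\<^sub>R (f x + g x)))"
  by (rule Lp_int_uniform_convexity[OF p a]) (rule that)
 obtain C2 where C2: "0 \<le> C2" "\<And>(M::(real^'n) measure) f g::real^'n \<Rightarrow> real. Lp_vec p M f \<Longrightarrow> Lp_vec p M g \<Longrightarrow>
   Lp_int p M (\<lambda>x. f x - g x) \<le> a * (Lp_int p M f + Lp_int p M g) + C2 * ((Lp_int p M f + Lp_int p M g) / 2 - Lp_int p M (\<lambda>x. (1/2) *\<^sub>R (f x + g x)))"
  by (rule Lp_int_uniform_convexity[OF p a]) (rule that)
 define C where "C = C1 + C2"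
 have C: "0 \<le> C" "C1 \<le> C" "C2 \<le> C" using C1(1) C2(1) by (auto simp: C_def)
 \<comment> \<open>Makes the constant C times the defect bound h (lam + 1) at most e/4; the minimum
   with 1/2 keeps h below 1.\<close>
 define h where "h = min (1/2) (e / (4 * (C + 1) * (lam + 1)))"
 have h: "0 < h" "h < 1" using e C lam0 by (auto simp: h_def)
 have "h * (4 * (C + 1) * (lam + 1)) \<le> e"
  using C lam0 by (subst pos_le_divide_eq[symmetric]) (auto simp: h_def)
 moreover have "0 \<le> h * (lam + 1)" using h lam0 by simp
 moreover have "h * (4 * (C + 1) * (lam + 1)) = 4 * (C * (h * (lam + 1))) + 4 * (h * (lam + 1))" by (simp add: algebra_simps)
 ultimately have hC: "4 * (C * (h * (lam + 1))) \<le> e" by linarith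
 obtain d where d: "0 < d" "\<And>(M :: (real^'n) measure) f g :: real^'n \<Rightarrow> real. Lp_vec p M f \<Longrightarrow> Lp_vec p M g \<Longrightarrow> Lp_int p M f = 1 \<Longrightarrow>
  Lp_int p M (\<lambda>x. f x - g x) < d \<Longrightarrow> 1 - h < Lp_int p M (\<lambda>x. (1/2) *\<^sub>R (f x + g x))"
  by (rule Lp_int_midpoint_lower[OF p1 h]) (rule that)
 obtain N1 where N1: "\<And>m n. N1 \<le> m \<Longrightarrow> N1 \<le> n \<Longrightarrow> Lp_int p \<mu> (\<lambda>x. T m x - T n x) < d" using Tc[OF d(1)] by blast
 have "\<forall>\<^sub>F n in sequentially. EE n < lam + h" unfolding EE_def by (rule order_tendstoD(2)[OF E]) (use h in simp)
 then obtain N2 where N2: "\<And>n. N2 \<le> n \<Longrightarrow> EE n < lam + h" unfolding eventually_sequentially by blast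
 have "Lp_int p MW (\<lambda>x. g m x - g n x) + Lp_int p MW (\<lambda>x. u m x - u n x) < e" if mn: "max N1 N2 \<le> m" "max N1 N2 \<le> n" for m n
 proof -
  define X where "X = (Lp_int p MW (g m) + Lp_int p MW (g n)) / 2 - Lp_int p MW (\<lambda>x. (1/2) *\<^sub>R (g m x + g n x))"
  define Y where "Y = (Lp_int p MW (u m) + Lp_int p MW (u n)) / 2 - Lp_int p MW (\<lambda>x. (1/2) *\<^sub>R (u m x + u n x))"
  have X0: "0 \<le> X" and Y0: "0 \<le> Y"
   using Lp_int_midpoint_le[OF p1 L(2)[of m] L(2)[of n]] Lp_int_midpoint_le[OF p1 L(1)[of m] L(1)[of n]] by (auto simp: X_def Y_def)
  have mid: "tr (\<lambda>x. (1/2) *\<^sub>R (u m x + u n x)) (\<lambda>x. (1/2) *\<^sub>R (g m x + g n x)) (\<lambda>x. (1/2) *\<^sub>R (T m x + T n x))"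
   using tr_cmult[OF tr_add[OF t[of m] t[of n], of 1], of "1/2"] by simp
  have "1 - h < Lp_int p \<mu> (\<lambda>x. (1/2) *\<^sub>R (T m x + T n x))" by (rule d(2)[OF L(3) L(3) N N1]) (use mn in auto)
  then have "lam * (1 - h) \<le> lam * Lp_int p \<mu> (\<lambda>x. (1/2) *\<^sub>R (T m x + T n x))" using lam0 by (intro mult_left_mono) auto
  also note lambda_le[OF mid]
  finally have "X + Y \<le> (EE m + EE n) / 2 - lam * (1 - h)" unfolding X_def Y_def EE_def by (simp add: field_simps)
  also have EE: "EE m < lam + h" "EE n < lam + h" using N2 mn by auto
  then have "(EE m + EE n) / 2 - lam * (1 - h) \<le> (lam + h) - lam * (1 - h)" by simp
  also have "\<dots> = h * (lam + 1)" by (simp add: algebra_simps)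
  finally have XY: "X + Y \<le> h * (lam + 1)" .
  have "Lp_int p MW (\<lambda>x. g m x - g n x) \<le> a * (Lp_int p MW (g m) + Lp_int p MW (g n)) + C1 * X"
   unfolding X_def by (rule C1(2)[OF L(2) L(2)])
  also have "C1 * X \<le> C * X" by (rule mult_right_mono[OF C(2) X0])
  finally have 1: "Lp_int p MW (\<lambda>x. g m x - g n x) \<le> a * (Lp_int p MW (g m) + Lp_int p MW (g n)) + C * X" by simp
  have "Lp_int p MW (\<lambda>x. u m x - u n x) \<le> a * (Lp_int p MW (u m) + Lp_int p MW (u n)) + C2 * Y"
   unfolding Y_def by (rule C2(2)[OF L(1) L(1)])
  also have "C2 * Y \<le> C * Y" by (rule mult_right_mono[OF C(3) Y0])
  finally have "Lp_int p MW (\<lambda>x. u m x - u n x) \<le> a * (Lp_int p MW (u m) + Lp_int p MW (u n)) + C * Y" by simp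
  with 1 have 2: "Lp_int p MW (\<lambda>x. g m x - g n x) + Lp_int p MW (\<lambda>x. u m x - u n x) \<le> a * (EE m + EE n) + C * (X + Y)"
   unfolding EE_def by (simp add: algebra_simps)
  have "a * (EE m + EE n) < a * (2 * (lam + 1))" using EE h a by (intro mult_strict_left_mono) auto
  also have "\<dots> = e / 2" using lam0 by (simp add: a_def field_simps)
  finally have 3: "a * (EE m + EE n) < e / 2" .
  have "C * (X + Y) \<le> C * (h * (lam + 1))" by (rule mult_left_mono[OF XY C(1)])
  then show ?thesis using 2 3 hC e by linarith
 qed
 then show ?thesis by blast
qed

theorem minimizing_sequence:
 assumes uW: "\<And>n. W1p_Lpw k \<gamma> p (u n)" and uN: "\<And>n. Lpw_norm k \<gamma> p (u n) = 1"
  and lim: "(\<lambda>n. W1p_norm p W (u n) powr p) \<longlonglongrightarrow> lam"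
 obtains r u0 where "strict_mono (r :: nat \<Rightarrow> nat)" "W1p_Lpw k \<gamma> p u0" "Lpw_norm k \<gamma> p u0 = 1"
  "(\<lambda>j. W1p_norm p W (\<lambda>x. u (r j) x - u0 x)) \<longlonglongrightarrow> 0" "energy p W u0 = lam" "is_eigenpair k \<gamma> p lam u0"
proof -
 define g where "g n = wgrad W (u n)" for n
 define T where "T n = trace k \<gamma> p (u n)" for n
 have t: "tr (u n) (g n) (T n)" for n using uW[of n] unfolding W1p_Lpw_def g_def T_def by (intro tr_W1p) simp
 note L = trD(2-4)[OF t]
 have N: "Lp_int p \<mu> (T n) = 1" for n using uN Lpw_norm_eq_1_iff[OF t] by simp
 define EE where "EE n = Lp_int p MW (g n) + Lp_int p MW (u n)" for n
 have "W1p_norm p W (u n) powr p = EE n" for n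
  unfolding W1p_norm_def EE_def using p energy_nonneg[of p W "u n"] energy_eq_pair[OF dom_open trD(1)[OF t[of n]]] by (simp add: powr_powr)
 then have E: "EE \<longlonglongrightarrow> lam" using lim by simp
 have "bounded (range EE)" using E convergent_imp_bounded by blast
 then obtain B where B: "\<And>n. \<bar>EE n\<bar> \<le> B" by (auto simp: bounded_iff)
 have gB: "Lp_int p MW (g n) \<le> B" and uB: "Lp_int p MW (u n) \<le> B" for n
  using B[of n] Lp_int_nonneg[of p MW "g n"] Lp_int_nonneg[of p MW "u n"] unfolding EE_def by linarith+
 obtain r :: "nat \<Rightarrow> nat" where r: "strict_mono r" "\<And>e. 0 < e \<Longrightarrow> \<exists>N. \<forall>m\<ge>N. \<forall>n\<ge>N. Lp_int p MW (\<lambda>x. u (r m) x - u (r n) x) < e"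
  by (rule Rellich[where u = u and g = g and B = B, OF p trD(1)[OF t] uB gB]) (rule that)
 \<comment> \<open>Gradient differences are only bounded, by D. The factor a in front of them is
   fixed first so that a D is at most e/2; the trace constant for this a is then beaten by the L^p
   Cauchy property from \<open>Rellich\<close>.\<close>
 have Tc: "\<exists>N. \<forall>m\<ge>N. \<forall>n\<ge>N. Lp_int p \<mu> (\<lambda>x. T (r m) x - T (r n) x) < e" if e: "0 < e" for e
 proof -
  define D where "D = 2 powr (p - 1) * (B + B)"
  have D: "Lp_int p MW (\<lambda>x. g m x - g n x) \<le> D" for m n
   unfolding D_def by (rule order_trans[OF Lp_int_diff_le[OF p1 L(2) L(2)]]) (intro mult_left_mono add_mono gB, simp)
  have D0: "0 \<le> D" using order_trans[OF Lp_int_nonneg D] .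
  define a where "a = e / (2 * (D + 1))"
  have a: "0 < a" "a * D \<le> e / 2" using e D0 by (auto simp: a_def field_simps)
  define K where "K = tr_const a"
  have K: "0 \<le> K" using tr_const(1)[OF a(1)] by (simp add: K_def)
  have "0 < e / (2 * (K + 1))" using e K by simp
  from r(2)[OF this] obtain N where N: "\<And>m n. N \<le> m \<Longrightarrow> N \<le> n \<Longrightarrow> Lp_int p MW (\<lambda>x. u (r m) x - u (r n) x) < e / (2 * (K + 1))" by blast
  have "Lp_int p \<mu> (\<lambda>x. T (r m) x - T (r n) x) < e" if "N \<le> m" "N \<le> n" for m n
  proof -
   have "Lp_int p \<mu> (\<lambda>x. T (r m) x - T (r n) x) \<le> a * Lp_int p MW (\<lambda>x. g (r m) x - g (r n) x) + K * Lp_int p MW (\<lambda>x. u (r m) x - u (r n) x)"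
    unfolding K_def by (rule tr_le[OF tr_diff[OF t t] a(1)])
   also have "\<dots> \<le> a * D + K * (e / (2 * (K + 1)))"
    using a(1) K by (intro add_mono mult_left_mono D less_imp_le[OF N[OF that]]) auto
   also have "K * (e / (2 * (K + 1))) < e / 2" using e K by (simp add: field_simps)
   finally show ?thesis using a(2) by linarith
  qed
  then show ?thesis by blast
 qed
 have Er: "(\<lambda>j. Lp_int p MW (g (r j)) + Lp_int p MW (u (r j))) \<longlonglongrightarrow> lam"
  using LIMSEQ_subseq_LIMSEQ[OF E r(1)] by (simp add: EE_def o_def)
 have Ec: "\<exists>N. \<forall>m\<ge>N. \<forall>n\<ge>N. Lp_int p MW (\<lambda>x. g (r m) x - g (r n) x) + Lp_int p MW (\<lambda>x. u (r m) x - u (r n) x) < e" if "0 < e" for e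
  by (rule minimizing_sequence_Cauchy[where u = "\<lambda>j. u (r j)" and g = "\<lambda>j. g (r j)" and T = "\<lambda>j. T (r j)", OF t N Er Tc that])
 have gc: "\<exists>N. \<forall>m\<ge>N. \<forall>n\<ge>N. Lp_int p MW (\<lambda>x. g (r m) x - g (r n) x) < e" if "0 < e" for e
  using Ec[OF that] by (meson Lp_int_nonneg add_increasing2 le_less_trans order_refl)
 obtain u0 g0 where u0: "W1p_pair p W u0 g0" "(\<lambda>n. Lp_int p MW (\<lambda>x. u (r n) x - u0 x)) \<longlonglongrightarrow> 0"
  "(\<lambda>n. Lp_int p MW (\<lambda>x. g (r n) x - g0 x)) \<longlonglongrightarrow> 0"
  by (rule W1p_pair_complete[where u = "\<lambda>j. u (r j)" and g = "\<lambda>j. g (r j)", OF dom_open dom_bounded p trD(1)[OF t] r(2) gc]) (assumption, assumption, rule that)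
 obtain T0 where t0: "tr u0 g0 T0" using tr_exists(1)[OF u0(1)] by blast
 note L0 = trD(2-4)[OF t0]
 have "(\<lambda>j. 1 * Lp_int p MW (\<lambda>x. g (r j) x - g0 x) + tr_const 1 * Lp_int p MW (\<lambda>x. u (r j) x - u0 x)) \<longlonglongrightarrow> 1 * 0 + tr_const 1 * 0"
  by (intro tendsto_intros u0)
 then have b: "(\<lambda>j. 1 * Lp_int p MW (\<lambda>x. g (r j) x - g0 x) + tr_const 1 * Lp_int p MW (\<lambda>x. u (r j) x - u0 x)) \<longlonglongrightarrow> 0" by simp
 have "(\<lambda>j. Lp_int p \<mu> (\<lambda>x. T (r j) x - T0 x)) \<longlonglongrightarrow> 0"
  by (rule tendsto_sandwich[OF always_eventually[OF allI] always_eventually[OF allI] tendsto_const b])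
   (rule Lp_int_nonneg, rule tr_le[OF tr_diff[OF t t0] zero_less_one])
 then have "(\<lambda>j. Lp_int p \<mu> (T (r j))) \<longlonglongrightarrow> Lp_int p \<mu> T0" by (rule Lp_int_tendsto[OF p1 L(3) L0(3)])
 \<comment> \<open>The constraint survives the limit because the traces converge in L^p of \<mu>, by
   the trace inequality for u (r j) - u0.\<close>
 then have N0: "Lp_int p \<mu> T0 = 1" unfolding N by (simp add: tendsto_const_iff)
 have "(\<lambda>j. Lp_int p MW (g (r j)) + Lp_int p MW (u (r j))) \<longlonglongrightarrow> Lp_int p MW g0 + Lp_int p MW u0"
  by (intro tendsto_add Lp_int_tendsto[OF p1 L(2) L0(2) u0(3)] Lp_int_tendsto[OF p1 L(1) L0(1) u0(2)])
 then have E0: "Lp_int p MW g0 + Lp_int p MW u0 = lam" using Er LIMSEQ_unique by blast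
 have "energy p W (\<lambda>x. u (r j) x - u0 x) = Lp_int p MW (\<lambda>x. g (r j) x - g0 x) + Lp_int p MW (\<lambda>x. u (r j) x - u0 x)" for j
  by (rule energy_eq_pair[OF dom_open W1p_pair_diff[OF dom_open p1 trD(1)[OF t] u0(1)]])
 then have e0: "(\<lambda>j. energy p W (\<lambda>x. u (r j) x - u0 x)) \<longlonglongrightarrow> 0" using tendsto_add[OF u0(3) u0(2)] by simp
 show ?thesis
 proof (rule that[OF r(1) tr_trace(4)[OF t0]])
  show "Lpw_norm k \<gamma> p u0 = 1" using N0 Lpw_norm_eq_1_iff[OF t0] by simp
  show "(\<lambda>j. W1p_norm p W (\<lambda>x. u (r j) x - u0 x)) \<longlonglongrightarrow> 0"
   unfolding W1p_norm_def by (rule tendsto_zero_powrI[OF e0 tendsto_const]) (use p in \<open>simp_all add: energy_nonneg\<close>)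
  show "energy p W u0 = lam" using E0 energy_eq_pair[OF dom_open u0(1)] by simp
  show "is_eigenpair k \<gamma> p lam u0" by (rule minimizer_eigenpair[OF t0 N0 E0])
 qed
qed

end

theorem theorem5p2:
 fixes k :: "'n::finite" and \<gamma> :: "real \<Rightarrow> real" and p :: real
  and u :: "nat \<Rightarrow> real^'n \<Rightarrow> real"
 assumes dim: "CARD('n) \<ge> 2"
  and g_cont: "continuous_on {0..1} \<gamma>"
  and g_nonneg: "\<forall>t\<in>{0..1}. \<gamma> t \<ge> 0"
  and g_mono: "mono_on {0..1} \<gamma>"
  and g_diff: "\<forall>t\<in>{0<..<1}. \<gamma> differentiable (at t)"
  and g0: "\<gamma> 0 = 0" and g1: "\<gamma> 1 = 1"
  and g_deriv_mono: "mono_on {0<..<1} (deriv \<gamma>)"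
  and g_deriv_lim: "(deriv \<gamma> \<longlongrightarrow> 0) (at_right 0)"
  and p: "1 < p"
  and u_space: "\<forall>n. W1p_Lpw k \<gamma> p (u n)"
  and u_norm: "\<forall>n. Lpw_norm k \<gamma> p (u n) = 1"
  and u_lim: "(\<lambda>n. W1p_norm p (cusp_domain k \<gamma>) (u n) powr p) \<longlonglongrightarrow> lambda_p k \<gamma> p"
 shows "\<exists>r u0. strict_mono r \<and> W1p_Lpw k \<gamma> p u0 \<and> Lpw_norm k \<gamma> p u0 = 1
      \<and> (\<lambda>j. W1p_norm p (cusp_domain k \<gamma>) (\<lambda>x. u (r j) x - u0 x)) \<longlonglongrightarrow> 0
      \<and> lambda_p k \<gamma> p =
        integral\<^sup>L (lebesgue_on (cusp_domain k \<gamma>)) (\<lambda>x. norm (wgrad (cusp_domain k \<gamma>) u0 x) powr p)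
       + integral\<^sup>L (lebesgue_on (cusp_domain k \<gamma>)) (\<lambda>x. \<bar>u0 x\<bar> powr p)
      \<and> is_eigenpair k \<gamma> p (lambda_p k \<gamma> p) u0
      \<and> (\<forall>v. is_eigenpair k \<gamma> p (lambda_p k \<gamma> p) v \<longrightarrow>
        (\<exists>c w. W1p_Lpw k \<gamma> p w \<and> Lpw_norm k \<gamma> p w = 1
            \<and> energy p (cusp_domain k \<gamma>) w = lambda_p k \<gamma> p
            \<and> (\<forall>x\<in>cusp_domain k \<gamma>. v x = c * w x)))"
proof -
 interpret cusp_trace k \<gamma> p
  by unfold_locales (use g_cont g_nonneg g_mono g_diff g0 g1 g_deriv_mono g_deriv_lim p in auto)
 obtain r u0 where r: "strict_mono (r :: nat \<Rightarrow> nat)" "W1p_Lpw k \<gamma> p u0" "Lpw_norm k \<gamma> p u0 = 1"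
  "(\<lambda>j. W1p_norm p W (\<lambda>x. u (r j) x - u0 x)) \<longlonglongrightarrow> 0" "energy p W u0 = lam" "is_eigenpair k \<gamma> p lam u0"
  by (rule minimizing_sequence[of u]) (use u_space u_norm u_lim in auto)
 show ?thesis
  using r eigenfunction_normalize unfolding energy_def[of p W u0]
  by (intro exI[of _ r] exI[of _ u0] conjI allI impI) auto
qed

end
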